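(* Let $d\ge1$, $N\ge2$, $p\in(2,2^* )$, and let $g:\mathbb{C}^N\to\mathbb{R}$ be twice continuously differentiable (as a function on $\mathbb{R}^{2N}$) with $g(rz)=r^p g(z)$ for all $z\in\mathbb{C}^N$, $r\ge0$. Let $\mathbf{n}=(n_1,\dots,n_N)$ be a vector of positive integers such that $g(e^{in_1\theta}z_1,\dots,e^{in_N\theta}z_N)=g(z_1,\dots,z_N)$ for all $z\in\mathbb{C}^N$, $\theta\in\mathbb{R}$. Let $F_j=\frac2p\partial_{\overline{z_j}}g$, let $\omega>0$, and let $\mathcal{A}_\omega$ be the set of nonzero $\Phi=(\phi_1,\dots,\phi_N)\in(H^1(\mathbb{R}^d))^N$ solving $-\Delta\phi_j+\omega\phi_j=-F_j(\Phi)$ for $j=1,\dots,N$. If $\Phi\in\mathcal{A}_\omega$ then $$(e^{in_1\omega t}\phi_1,e^{in_2\omega t}\phi_2,\dots,e^{in_N\omega t}\phi_N)$$ is a global $H^1$-solution of the system $(i\partial_t+n_j\Delta)u_j=n_jF_j(u_1,\dots,u_N)$, $j=1,\dots,N$ (with initial data $\Phi$).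
   Context: $2^*=\infty$ for $d=1,2$ and $2^*=2d/(d-2)$ for $d\ge3$. With $z=x+iy$, $\partial_{\overline z}=\frac12(\partial_x+i\partial_y)$. An $H^1$-solution on an interval $I\subset\mathbb{R}$ with $0\in\overline I$ and data $(u_{1,0},\dots,u_{N,0})\in(H^1(\mathbb{R}^d))^N$ is $\mathbf{u}=(u_1,\dots,u_N)\in(C(I,H^1(\mathbb{R}^d))\cap L^{q_d}_{\mathrm{loc}}(I,W^{1,r_d}(\mathbb{R}^d)))^N$ satisfying $$u_j(t)=e^{itn_j\Delta}u_{j,0}-i\int_0^te^{i(t-s)n_j\Delta}n_jF_j(\mathbf{u}(s))ds\qquad(j=1,\dots,N)$$ on $I$, where $(q_1,r_1)=(4,\infty)$, $(q_2,r_2)=(\frac{2p}{p-2},p)$, and $(q_d,r_d)=(2,2^* )$ for $d\ge3$. It is global if its maximal lifespan is $\mathbb{R}$. *)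

theory Defs
  imports "HOL-Analysis.Analysis" "HOL-Probability.Essential_Supremum"
begin

text \<open>Elements of function spaces on \<open>\<real>\<^sup>d\<close> are represented by functions rather than by almost
  everywhere classes; all notions below are invariant under modification on null sets (in space,
  and, for measurability and integration in time, in time).\<close>

subsection \<open>Differentiable functions and test functions\<close>

definition partial_deriv ::
    "'a \<Rightarrow> ('a::real_normed_vector \<Rightarrow> 'b::real_normed_vector) \<Rightarrow> 'a \<Rightarrow> 'b" where
  "partial_deriv b f x = frechet_derivative f (at x) b"

primrec Ck :: "nat \<Rightarrow> ('a::euclidean_space \<Rightarrow> 'b::real_normed_vector) \<Rightarrow> bool" where
  "Ck 0 f \<longleftrightarrow> continuous_on UNIV f"
| "Ck (Suc k) f \<longleftrightarrow> (\<forall>x. f differentiable (at x)) \<and> (\<forall>b\<in>Basis. Ck k (partial_deriv b f))"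

definition test_function :: "('a::euclidean_space \<Rightarrow> complex) \<Rightarrow> bool" where
  "test_function \<psi> \<longleftrightarrow> (\<forall>k. Ck k \<psi>) \<and> compact (closure {x. \<psi> x \<noteq> 0})"

definition laplacian :: "('a::euclidean_space \<Rightarrow> complex) \<Rightarrow> 'a \<Rightarrow> complex" where
  "laplacian \<psi> x = (\<Sum>b\<in>Basis. partial_deriv b (partial_deriv b \<psi>) x)"

subsection \<open>Lebesgue and Sobolev spaces\<close>

definition epowr :: "ennreal \<Rightarrow> real \<Rightarrow> ennreal" where
  "epowr x r = (if x = \<infinity> then \<infinity> else ennreal (enn2real x powr r))"

definition Lp_norm :: "ereal \<Rightarrow> ('a::euclidean_space \<Rightarrow> complex) \<Rightarrow> ennreal" where
  "Lp_norm r f =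
     (if r = \<infinity> then esssup lebesgue (\<lambda>x. ennreal (norm (f x)))
      else epowr (\<integral>\<^sup>+x. ennreal (norm (f x) powr real_of_ereal r) \<partial>lebesgue)
                 (1 / real_of_ereal r))"

definition Lp :: "ereal \<Rightarrow> ('a::euclidean_space \<Rightarrow> complex) set" where
  "Lp r = {f. f \<in> borel_measurable lebesgue \<and> Lp_norm r f < \<infinity>}"

definition locally_integrable :: "('a::euclidean_space \<Rightarrow> complex) \<Rightarrow> bool" where
  "locally_integrable f \<longleftrightarrow> (\<forall>K. compact K \<longrightarrow> set_integrable lebesgue K f)"

definition is_weak_deriv ::
    "'a::euclidean_space \<Rightarrow> ('a \<Rightarrow> complex) \<Rightarrow> ('a \<Rightarrow> complex) \<Rightarrow> bool" where
  "is_weak_deriv b f h \<longleftrightarrow>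
     locally_integrable f \<and> locally_integrable h \<and>
     (\<forall>\<psi>. test_function \<psi> \<longrightarrow>
        (LINT x|lebesgue. f x * partial_deriv b \<psi> x) = - (LINT x|lebesgue. h x * \<psi> x))"

text \<open>Weak derivatives are unique up to null sets, so the choice is immaterial in norms.\<close>

definition weak_deriv :: "'a::euclidean_space \<Rightarrow> ('a \<Rightarrow> complex) \<Rightarrow> 'a \<Rightarrow> complex" where
  "weak_deriv b f = (SOME h. is_weak_deriv b f h)"

definition W1 :: "ereal \<Rightarrow> ('a::euclidean_space \<Rightarrow> complex) set" where
  "W1 r = {f \<in> Lp r. \<forall>b\<in>Basis. \<exists>h\<in>Lp r. is_weak_deriv b f h}"

text \<open>To be used on members of \<open>W1 r\<close> only.\<close>

definition W1_norm :: "ereal \<Rightarrow> ('a::euclidean_space \<Rightarrow> complex) \<Rightarrow> ennreal" where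
  "W1_norm r f = Lp_norm r f + (\<Sum>b\<in>Basis. Lp_norm r (weak_deriv b f))"

abbreviation H1 :: "('a::euclidean_space \<Rightarrow> complex) set" where
  "H1 \<equiv> W1 2"

subsection \<open>Functions of time with values in a function space\<close>

text \<open>\<open>X\<close> is a space of functions with seminorm \<open>nrm\<close>.  A simple function \<open>\<real> \<rightarrow> X\<close> is given by
  the list of its pieces \<open>(A, c)\<close>, meaning the sum of the functions \<open>1\<^sub>A c\<close>.  The notions below are
  strong (Bochner) measurability, the space \<open>L\<^sup>q\<^sub>l\<^sub>o\<^sub>c(I, X)\<close> and the Bochner integral over \<open>I\<close>,
  the last one following the library's \<open>has_bochner_integral\<close>.\<close>

definition simple_pieces :: "('a \<Rightarrow> complex) set \<Rightarrow> (real set \<times> ('a \<Rightarrow> complex)) list \<Rightarrow> bool" where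
  "simple_pieces X S \<longleftrightarrow> (\<forall>(A, c)\<in>set S. A \<in> lmeasurable \<and> c \<in> X)"

definition simple_eval :: "(real set \<times> ('a \<Rightarrow> complex)) list \<Rightarrow> real \<Rightarrow> 'a \<Rightarrow> complex" where
  "simple_eval S t x = (\<Sum>(A, c)\<leftarrow>S. indicator A t * c x)"

definition simple_integral ::
    "real set \<Rightarrow> (real set \<times> ('a \<Rightarrow> complex)) list \<Rightarrow> 'a \<Rightarrow> complex" where
  "simple_integral I S x = (\<Sum>(A, c)\<leftarrow>S. complex_of_real (measure lebesgue (A \<inter> I)) * c x)"

definition strongly_measurable_on ::
    "real set \<Rightarrow> ('a \<Rightarrow> complex) set \<Rightarrow> (('a \<Rightarrow> complex) \<Rightarrow> ennreal) \<Rightarrow>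
     (real \<Rightarrow> 'a \<Rightarrow> complex) \<Rightarrow> bool" where
  "strongly_measurable_on I X nrm w \<longleftrightarrow>
     (\<exists>S. (\<forall>k::nat. simple_pieces X (S k)) \<and>
          (AE t in lebesgue. t \<in> I \<longrightarrow>
             w t \<in> X \<and> (\<lambda>k. nrm (\<lambda>x. w t x - simple_eval (S k) t x)) \<longlonglongrightarrow> 0))"

definition Lq_loc ::
    "real \<Rightarrow> real set \<Rightarrow> ('a \<Rightarrow> complex) set \<Rightarrow> (('a \<Rightarrow> complex) \<Rightarrow> ennreal) \<Rightarrow>
     (real \<Rightarrow> 'a \<Rightarrow> complex) set" where
  "Lq_loc q I X nrm =
     {w. strongly_measurable_on I X nrm w \<and>
         (\<forall>K. compact K \<and> K \<subseteq> I \<longrightarrow> (\<integral>\<^sup>+t\<in>K. epowr (nrm (w t)) q \<partial>lebesgue) < \<infinity>)}"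

definition has_bochner_integral_on ::
    "real set \<Rightarrow> ('a \<Rightarrow> complex) set \<Rightarrow> (('a \<Rightarrow> complex) \<Rightarrow> ennreal) \<Rightarrow>
     (real \<Rightarrow> 'a \<Rightarrow> complex) \<Rightarrow> ('a \<Rightarrow> complex) \<Rightarrow> bool" where
  "has_bochner_integral_on I X nrm w J \<longleftrightarrow>
     J \<in> X \<and> strongly_measurable_on I X nrm w \<and>
     (\<exists>S. (\<forall>k::nat. simple_pieces X (S k)) \<and>
          (\<lambda>k. \<integral>\<^sup>+t\<in>I. nrm (\<lambda>x. w t x - simple_eval (S k) t x) \<partial>lebesgue) \<longlonglongrightarrow> 0 \<and>
          (\<lambda>k. nrm (\<lambda>x. simple_integral I (S k) x - J x)) \<longlonglongrightarrow> 0)"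

text \<open>\<open>J\<close> is the \<open>L\<^sup>2\<close>-valued integral of \<open>w\<close> from \<open>a\<close> to \<open>b\<close>, oriented if \<open>b < a\<close>.\<close>

definition has_L2_integral_from_to ::
    "real \<Rightarrow> real \<Rightarrow> (real \<Rightarrow> 'a::euclidean_space \<Rightarrow> complex) \<Rightarrow> ('a \<Rightarrow> complex) \<Rightarrow> bool" where
  "has_L2_integral_from_to a b w J \<longleftrightarrow>
     (if a \<le> b then has_bochner_integral_on {a..b} (Lp 2) (Lp_norm 2) w J
      else has_bochner_integral_on {b..a} (Lp 2) (Lp_norm 2) w (\<lambda>x. - J x))"

definition continuous_into_H1 :: "real set \<Rightarrow> (real \<Rightarrow> 'a::euclidean_space \<Rightarrow> complex) \<Rightarrow> bool" where
  "continuous_into_H1 I w \<longleftrightarrow>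
     (\<forall>t\<in>I. w t \<in> H1 \<and> ((\<lambda>s. W1_norm 2 (\<lambda>x. w s x - w t x)) \<longlongrightarrow> 0) (at t within I))"

subsection \<open>The free Schroedinger group\<close>

definition fourier_integral :: "('a::euclidean_space \<Rightarrow> complex) \<Rightarrow> 'a \<Rightarrow> complex" where
  "fourier_integral f \<xi> =
     complex_of_real ((2 * pi) powr (- real DIM('a) / 2)) *
       (LINT x|lebesgue. exp (- \<i> * complex_of_real (x \<bullet> \<xi>)) * f x)"

text \<open>The Fourier transform on \<open>L\<^sup>2\<close>: the \<open>L\<^sup>2\<close>-limit of the truncated Fourier integrals.\<close>

definition is_fourier_L2 ::
    "('a::euclidean_space \<Rightarrow> complex) \<Rightarrow> ('a \<Rightarrow> complex) \<Rightarrow> bool" where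
  "is_fourier_L2 f h \<longleftrightarrow>
     f \<in> Lp 2 \<and> h \<in> Lp 2 \<and>
     ((\<lambda>R. Lp_norm 2 (\<lambda>\<xi>. h \<xi> - fourier_integral (\<lambda>x. indicator (ball 0 R) x * f x) \<xi>)) \<longlongrightarrow> 0)
       at_top"

definition fourier_L2 :: "('a::euclidean_space \<Rightarrow> complex) \<Rightarrow> 'a \<Rightarrow> complex" where
  "fourier_L2 f = (SOME h. is_fourier_L2 f h)"

text \<open>\<open>schroedinger \<tau> f\<close> is \<open>e\<^sup>i\<^sup>\<tau>\<^sup>\<Delta> f\<close> for \<open>f\<close> in \<open>L\<^sup>2\<close>: the function whose Fourier transform is
  \<open>e\<^sup>-\<^sup>i\<^sup>\<tau>\<^sup>|\<^sup>\<xi>\<^sup>|\<^sup>2\<close> times that of \<open>f\<close>.\<close>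

definition schroedinger :: "real \<Rightarrow> ('a::euclidean_space \<Rightarrow> complex) \<Rightarrow> 'a \<Rightarrow> complex" where
  "schroedinger \<tau> f =
     (SOME v. is_fourier_L2 v
        (\<lambda>\<xi>. exp (- \<i> * complex_of_real (\<tau> * (norm \<xi>)\<^sup>2)) * fourier_L2 f \<xi>))"

subsection \<open>The system\<close>

definition two_star :: "nat \<Rightarrow> ereal" where
  "two_star d = (if d \<le> 2 then \<infinity> else ereal (2 * real d / (real d - 2)))"

definition q_exp :: "real \<Rightarrow> nat \<Rightarrow> real" where
  "q_exp p d = (if d = 1 then 4 else if d = 2 then 2 * p / (p - 2) else 2)"

definition r_exp :: "real \<Rightarrow> nat \<Rightarrow> ereal" where
  "r_exp p d = (if d = 1 then \<infinity> else if d = 2 then ereal p else two_star d)"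

definition dbar :: "'n::finite \<Rightarrow> (complex^'n \<Rightarrow> real) \<Rightarrow> complex^'n \<Rightarrow> complex" where
  "dbar j g z = (1 / 2) * (complex_of_real (partial_deriv (axis j 1) g z) +
                           \<i> * complex_of_real (partial_deriv (axis j \<i>) g z))"

definition nonlinearity :: "real \<Rightarrow> (complex^'n::finite \<Rightarrow> real) \<Rightarrow> 'n \<Rightarrow> complex^'n \<Rightarrow> complex" where
  "nonlinearity p g j z = complex_of_real (2 / p) * dbar j g z"

text \<open>The set \<open>\<A>\<^sub>\<omega>\<close>; the equations hold in the sense of distributions.\<close>

definition standing_waves ::
    "('n::finite \<Rightarrow> complex^'n \<Rightarrow> complex) \<Rightarrow> real \<Rightarrow>
     ('n \<Rightarrow> 'a::euclidean_space \<Rightarrow> complex) set" where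
  "standing_waves F \<omega> =
     {\<Phi>. (\<forall>j. \<Phi> j \<in> H1) \<and>
         \<not> (\<forall>j. AE x in lebesgue. \<Phi> j x = 0) \<and>
         (\<forall>j \<psi>. test_function \<psi> \<longrightarrow>
            (LINT x|lebesgue. \<Phi> j x * (- laplacian \<psi> x + complex_of_real \<omega> * \<psi> x)) =
            - (LINT x|lebesgue. F j (\<chi> k. \<Phi> k x) * \<psi> x))}"

text \<open>In Duhamel's formula the group acts on \<open>L\<^sup>2\<close> and the integral is \<open>L\<^sup>2\<close>-valued.  Since
  \<open>schroedinger\<close> is meaningful on \<open>L\<^sup>2\<close> only, \<open>F\<^sub>j(u(s)) \<in> L\<^sup>2\<close> for almost every \<open>s\<close> is recorded
  explicitly; for the nonlinearities considered here (of growth \<open>p - 1\<close>, \<open>p < 2\<^sup>*\<close>) it follows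
  from \<open>C(I, H\<^sup>1)\<close> and \<open>L\<^sup>q\<^sub>l\<^sub>o\<^sub>c(I, W\<^sup>1\<^sup>,\<^sup>r)\<close>.\<close>

definition H1_solution ::
    "real \<Rightarrow> ('n::finite \<Rightarrow> nat) \<Rightarrow> ('n \<Rightarrow> complex^'n \<Rightarrow> complex) \<Rightarrow> real set \<Rightarrow>
     ('n \<Rightarrow> 'a::euclidean_space \<Rightarrow> complex) \<Rightarrow> ('n \<Rightarrow> real \<Rightarrow> 'a \<Rightarrow> complex) \<Rightarrow> bool" where
  "H1_solution p n F I u0 u \<longleftrightarrow>
     is_interval I \<and> 0 \<in> closure I \<and> (\<forall>j. u0 j \<in> H1) \<and>
     (\<forall>j. continuous_into_H1 I (u j)) \<and>
     (\<forall>j. u j \<in> Lq_loc (q_exp p DIM('a)) I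
                  (W1 (r_exp p DIM('a))) (W1_norm (r_exp p DIM('a)))) \<and>
     (\<forall>j. AE s in lebesgue. s \<in> I \<longrightarrow> (\<lambda>x. F j (\<chi> k. u k s x)) \<in> Lp 2) \<and>
     (\<forall>j. \<forall>t\<in>I. \<exists>J.
        has_L2_integral_from_to 0 t
          (\<lambda>s. schroedinger ((t - s) * real (n j)) (\<lambda>x. of_nat (n j) * F j (\<chi> k. u k s x))) J \<and>
        (AE x in lebesgue. u j t x = schroedinger (t * real (n j)) (u0 j) x - \<i> * J x))"

text \<open>Global: the maximal lifespan is \<open>\<real>\<close>, i.e. the solution exists on all of \<open>\<real>\<close>
  (where no further extension is possible).\<close>

definition global_H1_solution ::
    "real \<Rightarrow> ('n::finite \<Rightarrow> nat) \<Rightarrow> ('n \<Rightarrow> complex^'n \<Rightarrow> complex) \<Rightarrow>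
     ('n \<Rightarrow> 'a::euclidean_space \<Rightarrow> complex) \<Rightarrow> ('n \<Rightarrow> real \<Rightarrow> 'a \<Rightarrow> complex) \<Rightarrow> bool" where
  "global_H1_solution p n F u0 u \<longleftrightarrow> H1_solution p n F UNIV u0 u"

end

theory Submission
  imports Defs "HOL-Probability.Probability"
begin

text \<open>Write \<open>h\<^sub>t\<close> for the heat kernel.  Since \<open>h\<^sub>\<epsilon> * u \<rightarrow> u\<close>, every \<open>u \<in> L\<^sup>2\<close> is
  \<open>h\<^sub>1 * u - \<integral>\<^sub>0\<^sup>1 (\<partial>\<^sub>t h\<^sub>t) * u dt\<close>, and \<open>\<partial>\<^sub>t h\<^sub>t = \<Delta> h\<^sub>t\<close> can be moved onto the standing wave: the weak gradient gives
  \<open>(\<partial>\<^sub>t h\<^sub>t) * \<Phi>\<^sub>j = \<Sum>\<^sub>b \<partial>\<^sub>b h\<^sub>t * \<partial>\<^sub>b \<Phi>\<^sub>j\<close>, the equation gives \<open>(\<partial>\<^sub>t h\<^sub>t) * \<Phi>\<^sub>j = h\<^sub>t * (\<omega> \<Phi>\<^sub>j + F\<^sub>j(\<Phi>))\<close>.  With the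
  \<open>L\<^sup>m\<close>-\<open>L\<^sup>q\<close> bounds of the heat semigroup, the first formula is the Sobolev embedding, and the second one starts a
  bootstrap that, because of \<open>p < 2\<^sup>*\<close>, ends with \<open>\<Phi>\<close> and \<open>\<nabla>\<Phi>\<close> in \<open>L\<^sup>2 \<inter> L\<^sup>\<infinity>\<close>.  Hence
  \<open>\<Phi>\<^sub>j\<close> lies in all Sobolev spaces required of a solution, and \<open>F\<^sub>j(\<Phi>) \<in> L\<^sup>2\<close>.

  On the Fourier side the equation reads \<open>F\<^sub>j(\<Phi>)\<^sup>^ = - (|\<xi>|\<^sup>2 + \<omega>) \<Phi>\<^sub>j\<^sup>^\<close>.  By gauge covariance
  \<open>F\<^sub>j(u(s)) = e\<^sup>i\<^sup>n\<^sup>\<omega>\<^sup>s F\<^sub>j(\<Phi>)\<close> with \<open>n = n\<^sub>j\<close>, so the transform of the Duhamel integrand is the \<open>s\<close>-derivative of an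
  explicit exponential times \<open>\<Phi>\<^sub>j\<^sup>^\<close>, and its Riemann sums converge in \<open>L\<^sup>2\<close> by dominated
  convergence.\<close>

section \<open>Square integrable functions\<close>

text \<open>The equation holds only in the sense of distributions, and at the outset F_j(Phi) is not
  known to be square integrable, so it has no L2 Fourier transform yet; regularity therefore
  precedes any use of the Fourier transform. The heat kernel carries all of the analysis. It
  approximates the identity in L2; it is the transform of a Gaussian, so it regularises Fourier
  inversion and yields Plancherel's theorem; and its derivatives are polynomials times Gaussians,
  dominated by the kernel at twice the time. Since only finiteness of norms matters, constants such
  as powers of 2 are never optimised. Boundedness of Phi and of its gradient is the target because
  \<open>r_exp\<close> is infinite for d = 1 and at least 2 otherwise: together with membership in
  L2 it settles every dimension at once. Fourier transforms, weak derivatives and the group are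
  choices up to null sets, and the definitions integrate over \<open>lebesgue\<close>; the work is
  done with Borel representatives over \<open>lborel\<close>, where Fubini's theorem applies, and is
  transferred at the end.\<close>

lemma lborel_distr_reflect:
  fixes x :: "'a::euclidean_space"
  shows "distr lborel borel (\<lambda>y. x - y) = lborel"
  using lborel_affine[of "-1" x] by (simp add: density_1)

lemma lborel_distr_translate:
  fixes x :: "'a::euclidean_space"
  shows "distr lborel borel (\<lambda>y. y - x) = lborel"
  using lborel_affine[of "1" "-x"] by (simp add: density_1)

lemma nn_integral_lborel_reflect:
  fixes f :: "'a::euclidean_space \<Rightarrow> ennreal"
  assumes [measurable]: "f \<in> borel_measurable borel"
  shows "(\<integral>\<^sup>+y. f (x - y) \<partial>lborel) = (\<integral>\<^sup>+y. f y \<partial>lborel)"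
  by (subst (2) lborel_distr_reflect[of x, symmetric]) (simp add: nn_integral_distr)

lemma nn_integral_lborel_translate:
  fixes f :: "'a::euclidean_space \<Rightarrow> ennreal"
  assumes [measurable]: "f \<in> borel_measurable borel"
  shows "(\<integral>\<^sup>+y. f (y - x) \<partial>lborel) = (\<integral>\<^sup>+y. f y \<partial>lborel)"
  by (subst (2) lborel_distr_translate[of x, symmetric]) (simp add: nn_integral_distr)

lemma integrable_lborel_reflect:
  fixes f :: "'a::euclidean_space \<Rightarrow> 'b::{banach,second_countable_topology}"
  assumes "integrable lborel f"
  shows "integrable lborel (\<lambda>y. f (x - y))"
proof -
  have "integrable (distr lborel borel (\<lambda>y. x - y)) f"
    using assms by (simp only: lborel_distr_reflect)
  then show ?thesis
    using assms by (subst (asm) integrable_distr_eq) auto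
qed

lemma AE_lebesgue_iff_lborel: "(AE x in lebesgue. P x) \<longleftrightarrow> (AE x in lborel. P x)"
  by (simp add: AE_completion_iff)

text \<open>Real and imaginary parts are replaced separately, since the result on completions
  concerns real functions.\<close>

lemma lebesgue_ex_borel:
  fixes f :: "'a::euclidean_space \<Rightarrow> complex"
  assumes "f \<in> borel_measurable lebesgue"
  shows "\<exists>f'\<in>borel_measurable borel. AE x in lborel. f x = f' x"
proof -
  have "(\<lambda>x. Re (f x)) \<in> borel_measurable lebesgue" "(\<lambda>x. Im (f x)) \<in> borel_measurable lebesgue"
    using assms by measurable
  from this[THEN completion_ex_borel_measurable_real] obtain u v where
    [measurable]: "u \<in> borel_measurable borel" "v \<in> borel_measurable borel"
    and uv: "AE x in lborel. Re (f x) = u x" "AE x in lborel. Im (f x) = v x"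
    by (auto simp: measurable_lborel1)
  have "AE x in lborel. f x = Complex (u x) (v x)"
    using uv by eventually_elim (auto simp: complex_eq_iff)
  moreover have "(\<lambda>x. Complex (u x) (v x)) \<in> borel_measurable borel"
    unfolding Complex_eq by measurable
  ultimately show ?thesis by (intro bexI[of _ "\<lambda>x. Complex (u x) (v x)"])
qed

section \<open>The space L2 of Borel functions and its squared norm\<close>

definition L2 :: "('a::euclidean_space \<Rightarrow> complex) set" where
  "L2 = {f \<in> borel_measurable borel. integrable lborel (\<lambda>x. (norm (f x))\<^sup>2)}"

text \<open>Outside L2 the integral takes its default value 0, so estimates of \<open>sq\<close>
  travel with membership in L2. Working with squares avoids roots at the price of a factor 2 in the
  triangle inequality (\<open>sq_add_le\<close>).\<close>

definition sq :: "('a::euclidean_space \<Rightarrow> complex) \<Rightarrow> real" where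
  "sq f = (\<integral>x. (norm (f x))\<^sup>2 \<partial>lborel)"

lemma L2_measurable [measurable_dest, dest]: "f \<in> L2 \<Longrightarrow> f \<in> borel_measurable borel"
  by (simp add: L2_def)

lemma L2_integrable: "f \<in> L2 \<Longrightarrow> integrable lborel (\<lambda>x. (norm (f x))\<^sup>2)"
  by (simp add: L2_def)

lemma sq_nonneg [simp]: "0 \<le> sq f"
  by (simp add: sq_def)

lemma norm_add_sq_le: "(norm (a + b :: 'a::real_normed_vector))\<^sup>2 \<le> 2 * (norm a)\<^sup>2 + 2 * (norm b)\<^sup>2"
proof -
  have "(norm (a + b))\<^sup>2 \<le> (norm a + norm b)\<^sup>2"
    by (intro power_mono norm_triangle_ineq) auto
  also have "\<dots> \<le> 2 * (norm a)\<^sup>2 + 2 * (norm b)\<^sup>2"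
    using sum_squares_bound[of "norm a" "norm b"] by (simp add: power2_sum)
  finally show ?thesis .
qed

lemma L2_bound:
  assumes "f \<in> borel_measurable borel" "integrable lborel w" "\<And>x. (norm (f x))\<^sup>2 \<le> w x"
  shows "f \<in> L2"
proof -
  have "0 \<le> w x" for x using assms(3)[of x] zero_le_power2[of "norm (f x)"] by linarith
  then show ?thesis
    using assms unfolding L2_def
    by (auto intro!: Bochner_Integration.integrable_bound[OF assms(2)])
qed

lemma L2_add:
  assumes "f \<in> L2" "g \<in> L2"
  shows "(\<lambda>x. f x + g x) \<in> L2"
proof (rule L2_bound)
  show "(\<lambda>x. f x + g x) \<in> borel_measurable borel" using assms by measurable
  show "integrable lborel (\<lambda>x. 2 * (norm (f x))\<^sup>2 + 2 * (norm (g x))\<^sup>2)"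
    using assms[THEN L2_integrable] by simp
qed (rule norm_add_sq_le)

lemma L2_mult_bounded:
  assumes "f \<in> L2" "g \<in> borel_measurable borel" "\<And>x. norm (g x) \<le> C"
  shows "(\<lambda>x. g x * f x) \<in> L2"
proof (rule L2_bound)
  show "(\<lambda>x. g x * f x) \<in> borel_measurable borel" using assms by measurable
  show "integrable lborel (\<lambda>x. C\<^sup>2 * (norm (f x))\<^sup>2)"
    using assms(1)[THEN L2_integrable] by simp
  show "(norm (g x * f x))\<^sup>2 \<le> C\<^sup>2 * (norm (f x))\<^sup>2" for x
    using assms(3)[of x] by (auto simp: norm_mult power_mult_distrib intro!: mult_right_mono power_mono)
qed

lemma L2_cmult: "f \<in> L2 \<Longrightarrow> (\<lambda>x. c * f x) \<in> L2"
  by (rule L2_mult_bounded[where C="norm c"]) auto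

lemma L2_uminus: "f \<in> L2 \<Longrightarrow> (\<lambda>x. - f x) \<in> L2"
  using L2_cmult[of f "-1"] by simp

lemma L2_diff: "f \<in> L2 \<Longrightarrow> g \<in> L2 \<Longrightarrow> (\<lambda>x. f x - g x) \<in> L2"
  using L2_add[of f "\<lambda>x. - g x"] L2_uminus[of g] by simp

lemma L2_cnj: "f \<in> L2 \<Longrightarrow> (\<lambda>x. cnj (f x)) \<in> L2"
  unfolding L2_def
  using measurable_compose[of f borel borel cnj borel] borel_measurable_continuous_onI[OF continuous_on_cnj[OF continuous_on_id]]
  by simp

lemma L2_zero [simp]: "(\<lambda>x. 0) \<in> L2"
  by (simp add: L2_def)

lemma sq_cnj [simp]: "sq (\<lambda>x. cnj (f x)) = sq f"
  by (simp add: sq_def)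

lemma sq_cmult: "sq (\<lambda>x. c * f x) = (norm c)\<^sup>2 * sq f"
  by (simp add: sq_def norm_mult power_mult_distrib)

lemma sq_minus_commute: "sq (\<lambda>x. f x - g x) = sq (\<lambda>x. g x - f x)"
  by (simp add: sq_def norm_minus_commute)

lemma sq_mono:
  assumes "f \<in> borel_measurable borel" "g \<in> L2" "\<And>x. norm (f x) \<le> norm (g x)"
  shows "f \<in> L2" "sq f \<le> sq g"
proof -
  have le: "(norm (f x))\<^sup>2 \<le> (norm (g x))\<^sup>2" for x
    using assms(3) by (simp add: power_mono)
  show 1: "f \<in> L2"
    by (rule L2_bound[OF assms(1) L2_integrable[OF assms(2)] le])
  show "sq f \<le> sq g"
    unfolding sq_def using 1 assms(2) le by (intro integral_mono L2_integrable) auto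
qed

lemma sq_cong_AE:
  assumes [measurable]: "f \<in> borel_measurable borel" "g \<in> borel_measurable borel"
    and "AE x in lborel. f x = g x"
  shows "sq f = sq g"
  unfolding sq_def using assms(3) by (intro integral_cong_AE) auto

lemma sq_eq_0_iff:
  assumes "f \<in> L2"
  shows "sq f = 0 \<longleftrightarrow> (AE x in lborel. f x = 0)"
  unfolding sq_def using L2_integrable[OF assms]
  by (subst integral_nonneg_eq_0_iff_AE) auto

lemma sq_add_le:
  assumes "f \<in> L2" "g \<in> L2"
  shows "sq (\<lambda>x. f x + g x) \<le> 2 * sq f + 2 * sq g"
proof -
  have "sq (\<lambda>x. f x + g x) \<le> (\<integral>x. 2 * (norm (f x))\<^sup>2 + 2 * (norm (g x))\<^sup>2 \<partial>lborel)"
    unfolding sq_def using assms[THEN L2_integrable] L2_integrable[OF L2_add[OF assms]]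
    by (intro integral_mono) (auto simp: norm_add_sq_le)
  also have "\<dots> = 2 * sq f + 2 * sq g"
    using assms[THEN L2_integrable] by (simp add: sq_def)
  finally show ?thesis .
qed

lemma sq_diff_triangle:
  assumes "f \<in> L2" "g \<in> L2" "h \<in> L2"
  shows "sq (\<lambda>x. f x - g x) \<le> 2 * sq (\<lambda>x. f x - h x) + 2 * sq (\<lambda>x. h x - g x)"
  using sq_add_le[OF L2_diff[OF assms(1,3)] L2_diff[OF assms(3,2)]] by simp

lemma L2_mult_integrable:
  assumes "f \<in> L2" "g \<in> L2"
  shows "integrable lborel (\<lambda>x. f x * g x)"
proof (rule Bochner_Integration.integrable_bound)
  show "integrable lborel (\<lambda>x. (norm (f x))\<^sup>2 + (norm (g x))\<^sup>2)"
    using assms[THEN L2_integrable] by simp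
  show "(\<lambda>x. f x * g x) \<in> borel_measurable lborel" using assms by measurable
  have "norm (f x * g x) \<le> norm ((norm (f x))\<^sup>2 + (norm (g x))\<^sup>2)" for x
  proof -
    have "2 * norm (f x) * norm (g x) \<le> (norm (f x))\<^sup>2 + (norm (g x))\<^sup>2"
      by (rule sum_squares_bound)
    moreover have "0 \<le> norm (f x) * norm (g x)" by simp
    ultimately have "norm (f x) * norm (g x) \<le> (norm (f x))\<^sup>2 + (norm (g x))\<^sup>2" by linarith
    then show ?thesis by (simp add: norm_mult)
  qed
  then show "AE x in lborel. norm (f x * g x) \<le> norm ((norm (f x))\<^sup>2 + (norm (g x))\<^sup>2)" by simp
qed

text \<open>The squared norm of l|f| - |g| is a nonnegative quadratic polynomial in l, evaluated at
  its minimiser a / \<open>sq f\<close>. If \<open>sq f\<close> = 0 the polynomial is affine and can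
  stay nonnegative for all l only when a = 0.\<close>

lemma L2_Cauchy_Schwarz:
  assumes "f \<in> L2" "g \<in> L2"
  shows "(\<integral>x. norm (f x) * norm (g x) \<partial>lborel)\<^sup>2 \<le> sq f * sq g"
proof -
  define a where "a = (\<integral>x. norm (f x) * norm (g x) \<partial>lborel)"
  have int: "integrable lborel (\<lambda>x. norm (f x) * norm (g x))"
    using integrable_norm[OF L2_mult_integrable[OF assms]] by (simp add: norm_mult)
  have a0: "0 \<le> a" unfolding a_def by simp
  have q: "0 \<le> l\<^sup>2 * sq f - 2 * l * a + sq g" for l
  proof -
    have "0 \<le> (\<integral>x. (l * norm (f x) - norm (g x))\<^sup>2 \<partial>lborel)" by simp
    also have "(\<lambda>x. (l * norm (f x) - norm (g x))\<^sup>2) =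
      (\<lambda>x. l\<^sup>2 * (norm (f x))\<^sup>2 - (2 * l) * (norm (f x) * norm (g x)) + (norm (g x))\<^sup>2)"
      by (auto simp: fun_eq_iff power2_eq_square algebra_simps)
    also have "(\<integral>x. \<dots> x \<partial>lborel) = l\<^sup>2 * sq f - (2 * l) * a + sq g"
      unfolding sq_def a_def using assms[THEN L2_integrable] int by simp
    finally show ?thesis by simp
  qed
  show ?thesis
  proof (cases "sq f = 0")
    case True
    have "a = 0"
    proof (rule ccontr)
      assume "a \<noteq> 0"
      then have "a > 0" using a0 by simp
      then show False using q[of "(sq g + 1) / a"] True sq_nonneg[of g] by simp
    qed
    then show ?thesis using True a_def by simp
  next
    case False
    then have "sq f > 0" using sq_nonneg[of f] by linarith
    then show ?thesis using q[of "a / sq f"] unfolding a_def[symmetric]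
      by (simp add: field_simps power2_eq_square)
  qed
qed

lemma L2_integral_mult_le:
  assumes "f \<in> L2" "g \<in> L2"
  shows "norm (\<integral>x. f x * g x \<partial>lborel) \<le> sqrt (sq f) * sqrt (sq g)"
proof -
  have "norm (\<integral>x. f x * g x \<partial>lborel) \<le> (\<integral>x. norm (f x) * norm (g x) \<partial>lborel)"
    using integral_norm_bound[of lborel "\<lambda>x. f x * g x"] by (simp add: norm_mult)
  also have "\<dots> \<le> sqrt (sq f * sq g)"
    by (rule real_le_rsqrt[OF L2_Cauchy_Schwarz[OF assms]])
  finally show ?thesis by (simp add: real_sqrt_mult)
qed

text \<open>Minkowski's inequality with the sharp constant. The factor 2 of \<open>sq_add_le\<close>
  is harmless for limits equal to 0, but not for the continuity of \<open>sq\<close> in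
  \<open>sq_tendsto\<close>.\<close>

lemma sqrt_sq_triangle:
  assumes "f \<in> L2" "g \<in> L2"
  shows "sqrt (sq (\<lambda>x. f x + g x)) \<le> sqrt (sq f) + sqrt (sq g)"
proof (rule real_le_lsqrt)
  have int: "integrable lborel (\<lambda>x. norm (f x) * norm (g x))"
    using integrable_norm[OF L2_mult_integrable[OF assms]] by (simp add: norm_mult)
  have "sq (\<lambda>x. f x + g x) \<le> (\<integral>x. (norm (f x))\<^sup>2 + 2 * (norm (f x) * norm (g x)) + (norm (g x))\<^sup>2 \<partial>lborel)"
    unfolding sq_def
  proof (rule integral_mono)
    show "(norm (f x + g x))\<^sup>2 \<le> (norm (f x))\<^sup>2 + 2 * (norm (f x) * norm (g x)) + (norm (g x))\<^sup>2" for x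
      using power_mono[OF norm_triangle_ineq[of "f x" "g x"] norm_ge_zero, of 2]
      by (simp add: power2_sum algebra_simps)
  qed (use assms[THEN L2_integrable] L2_integrable[OF L2_add[OF assms]] int in auto)
  also have "\<dots> = sq f + 2 * (\<integral>x. norm (f x) * norm (g x) \<partial>lborel) + sq g"
    unfolding sq_def using assms[THEN L2_integrable] int by simp
  also have "\<dots> \<le> sq f + 2 * (sqrt (sq f) * sqrt (sq g)) + sq g"
    using real_le_rsqrt[OF L2_Cauchy_Schwarz[OF assms]] by (simp add: real_sqrt_mult)
  also have "\<dots> = (sqrt (sq f) + sqrt (sq g))\<^sup>2"
    by (simp add: power2_sum algebra_simps)
  finally show "sq (\<lambda>x. f x + g x) \<le> (sqrt (sq f) + sqrt (sq g))\<^sup>2" .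
qed auto

lemma sqrt_sq_diff_le:
  assumes "f \<in> L2" "g \<in> L2"
  shows "\<bar>sqrt (sq f) - sqrt (sq g)\<bar> \<le> sqrt (sq (\<lambda>x. f x - g x))"
  using sqrt_sq_triangle[OF L2_diff[OF assms] assms(2)] sqrt_sq_triangle[OF L2_diff[OF assms(2,1)] assms(1)]
    sq_minus_commute[of f g] by simp

lemma sq_tendsto:
  assumes f: "\<And>k. f k \<in> L2" and g: "g \<in> L2" and lim: "((\<lambda>k. sq (\<lambda>x. f k x - g x)) \<longlongrightarrow> 0) F"
  shows "((\<lambda>k. sq (f k)) \<longlongrightarrow> sq g) F"
proof -
  have l: "((\<lambda>k. sqrt (sq (\<lambda>x. f k x - g x))) \<longlongrightarrow> 0) F"
    using tendsto_real_sqrt[OF lim] by simp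
  have "((\<lambda>k. sqrt (sq (f k)) - sqrt (sq g)) \<longlongrightarrow> 0) F"
    by (rule Lim_null_comparison[OF _ l]) (simp add: sqrt_sq_diff_le[OF f g])
  then have "((\<lambda>k. (sqrt (sq (f k)))\<^sup>2) \<longlongrightarrow> (sqrt (sq g))\<^sup>2) F"
    by (intro tendsto_power) (simp add: LIM_zero_iff)
  then show ?thesis by simp
qed

lemma L2_integral_mult_tendsto:
  assumes f: "\<And>k. f k \<in> L2" and g: "g \<in> L2" and lim: "((\<lambda>k. sq (\<lambda>x. f k x - g x)) \<longlongrightarrow> 0) F"
    and h: "\<And>k. h k \<in> L2" and u: "u \<in> L2" and lim2: "((\<lambda>k. sq (\<lambda>x. h k x - u x)) \<longlongrightarrow> 0) F"
  shows "((\<lambda>k. \<integral>x. f k x * h k x \<partial>lborel) \<longlongrightarrow> (\<integral>x. g x * u x \<partial>lborel)) F"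
proof -
  have l: "((\<lambda>k. sqrt (sq (\<lambda>x. f k x - g x)) * sqrt (sq (h k)) + sqrt (sq g) * sqrt (sq (\<lambda>x. h k x - u x)))
     \<longlongrightarrow> sqrt 0 * sqrt (sq u) + sqrt (sq g) * sqrt 0) F"
    by (intro tendsto_intros lim lim2 sq_tendsto[OF h u])
  have "((\<lambda>k. (\<integral>x. f k x * h k x \<partial>lborel) - (\<integral>x. g x * u x \<partial>lborel)) \<longlongrightarrow> 0) F"
  proof (rule Lim_null_comparison[OF always_eventually])
    show "\<forall>k. norm ((\<integral>x. f k x * h k x \<partial>lborel) - (\<integral>x. g x * u x \<partial>lborel)) \<le>
      sqrt (sq (\<lambda>x. f k x - g x)) * sqrt (sq (h k)) + sqrt (sq g) * sqrt (sq (\<lambda>x. h k x - u x))"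
    proof
      fix k
      have "(\<integral>x. f k x * h k x \<partial>lborel) - (\<integral>x. g x * u x \<partial>lborel) =
        (\<integral>x. (f k x - g x) * h k x \<partial>lborel) + (\<integral>x. g x * (h k x - u x) \<partial>lborel)"
        using L2_mult_integrable[OF f h] L2_mult_integrable[OF g h] L2_mult_integrable[OF g u]
        by (simp add: algebra_simps)
      then show "norm ((\<integral>x. f k x * h k x \<partial>lborel) - (\<integral>x. g x * u x \<partial>lborel)) \<le>
      sqrt (sq (\<lambda>x. f k x - g x)) * sqrt (sq (h k)) + sqrt (sq g) * sqrt (sq (\<lambda>x. h k x - u x))"
        using L2_integral_mult_le[OF L2_diff[OF f g] h, of k] L2_integral_mult_le[OF g L2_diff[OF h u], of k]
        by (simp only:) (rule norm_triangle_mono)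
    qed
  qed (use l in simp)
  then show ?thesis by (simp add: LIM_zero_iff)
qed

lemma sq_dominated_tendsto:
  fixes f :: "nat \<Rightarrow> 'a::euclidean_space \<Rightarrow> complex"
  assumes [measurable]: "\<And>k. f k \<in> borel_measurable borel" and w: "w \<in> L2"
    and le: "\<And>k x. norm (f k x) \<le> norm (w x)" and lim: "AE x in lborel. (\<lambda>k. f k x) \<longlonglongrightarrow> 0"
  shows "(\<lambda>k. sq (f k)) \<longlonglongrightarrow> 0"
proof -
  have "(\<lambda>k. \<integral>x. (norm (f k x))\<^sup>2 \<partial>lborel) \<longlonglongrightarrow> (\<integral>x. 0 \<partial>(lborel :: 'a measure))"
  proof (rule integral_dominated_convergence[where w="\<lambda>x. (norm (w x))\<^sup>2"])
    show "integrable lborel (\<lambda>x. (norm (w x))\<^sup>2)" by (rule L2_integrable[OF w])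
    show "AE x in lborel. (\<lambda>k. (norm (f k x))\<^sup>2) \<longlonglongrightarrow> 0"
      using lim by eventually_elim (auto intro!: tendsto_eq_intros)
    show "AE x in lborel. norm ((norm (f k x))\<^sup>2) \<le> (norm (w x))\<^sup>2" for k
      using le by (auto intro!: power_mono)
  qed auto
  then show ?thesis by (simp add: sq_def)
qed

section \<open>Completeness of L2 and almost everywhere convergence\<close>

lemma nn_integral_sq: "f \<in> L2 \<Longrightarrow> (\<integral>\<^sup>+x. ennreal ((norm (f x))\<^sup>2) \<partial>lborel) = ennreal (sq f)"
  unfolding sq_def by (rule nn_integral_eq_integral[OF L2_integrable]) auto

lemma L2_iff_nn_integral:
  "f \<in> L2 \<longleftrightarrow> f \<in> borel_measurable borel \<and> (\<integral>\<^sup>+x. ennreal ((norm (f x))\<^sup>2) \<partial>lborel) < \<infinity>"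
  unfolding L2_def by (auto simp: integrable_iff_bounded)

text \<open>Along a subsequence with squared distances below 4^-k, the sum of 2^k |f_(k+1) - f_k|^2
  has finite integral. It is therefore finite almost everywhere, which forces the increments to be
  summable and the subsequence to converge pointwise.\<close>

theorem Riesz_Fischer_L2:
  fixes f :: "nat \<Rightarrow> 'a::euclidean_space \<Rightarrow> complex"
  assumes f: "\<And>k. f k \<in> L2"
    and C: "\<And>e. e > 0 \<Longrightarrow> \<exists>N. \<forall>m\<ge>N. \<forall>n\<ge>N. sq (\<lambda>x. f m x - f n x) < e"
  shows "\<exists>g\<in>L2. (\<lambda>k. sq (\<lambda>x. f k x - g x)) \<longlonglongrightarrow> 0"
proof -
  have [measurable]: "f k \<in> borel_measurable borel" for k using f by auto
  have "\<forall>k::nat. \<exists>N. \<forall>m\<ge>N. \<forall>n\<ge>N. sq (\<lambda>x. f m x - f n x) < (1/4)^k"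
    using C by simp
  then obtain N where N: "\<And>k m n. m \<ge> N k \<Longrightarrow> n \<ge> N k \<Longrightarrow> sq (\<lambda>x. f m x - f n x) < (1/4)^k"
    by metis
  \<comment> \<open>Adding up the thresholds makes \<open>r j\<close> at least \<open>N k\<close>
    for every k \<le> j.\<close>
  define r where "r k = (\<Sum>i\<le>k. N i) + k" for k
  have rN: "N k \<le> r j" if "k \<le> j" for k j
  proof -
    have "N k \<le> (\<Sum>i\<le>j. N i)" using that by (intro member_le_sum) auto
    then show ?thesis by (simp add: r_def)
  qed
  define a where "a k x = norm (f (r (Suc k)) x - f (r k) x)" for k x
  have [measurable]: "a k \<in> borel_measurable borel" for k unfolding a_def by measurable
  have "(\<integral>\<^sup>+x. (\<Sum>k. ennreal (2^k * (a k x)\<^sup>2)) \<partial>lborel) = (\<Sum>k. \<integral>\<^sup>+x. ennreal (2^k * (a k x)\<^sup>2) \<partial>lborel)"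
    by (rule nn_integral_suminf) auto
  also have "\<dots> \<le> (\<Sum>k. ennreal ((1/2)^k))"
  proof (intro suminf_le)
    fix k
    have "(\<integral>\<^sup>+x. ennreal (2^k * (a k x)\<^sup>2) \<partial>lborel) = ennreal (2^k) * ennreal (sq (\<lambda>x. f (r (Suc k)) x - f (r k) x))"
      unfolding a_def by (simp add: nn_integral_sq[OF L2_diff[OF f f], symmetric] ennreal_mult nn_integral_cmult)
    also have "\<dots> \<le> ennreal (2^k) * ennreal ((1/4)^k)"
      by (intro mult_left_mono ennreal_leI less_imp_le[OF N] rN) auto
    also have "\<dots> = ennreal ((1/2)^k)"
      by (subst ennreal_mult[symmetric]) (auto simp: power_mult_distrib[symmetric])
    finally show "(\<integral>\<^sup>+x. ennreal (2^k * (a k x)\<^sup>2) \<partial>lborel) \<le> ennreal ((1/2)^k)" .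
  qed auto
  also have "\<dots> < \<infinity>"
    by (subst suminf_ennreal2) (auto intro: summable_geometric)
  finally have "AE x in lborel. (\<Sum>k. ennreal (2^k * (a k x)\<^sup>2)) \<noteq> \<infinity>"
    by (intro nn_integral_PInf_AE) auto
  then have conv: "AE x in lborel. convergent (\<lambda>k. f (r k) x)"
  proof eventually_elim
    fix x assume "(\<Sum>k. ennreal (2^k * (a k x)\<^sup>2)) \<noteq> \<infinity>"
    then have s1: "summable (\<lambda>k. 2^k * (a k x)\<^sup>2)"
      by (intro summable_suminf_not_top) auto
    have s2: "summable (\<lambda>k. (1/2::real)^k)" by (rule summable_geometric) auto
    have "summable (\<lambda>k. a k x)"
    proof (rule summable_comparison_test'[OF summable_add[OF s1 s2]])
      fix k :: nat assume "k \<ge> 0"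
      define b :: real where "b = 2^k"
      have b: "b > 0" by (simp add: b_def)
      have "0 \<le> a k x" by (simp add: a_def)
      \<comment> \<open>The inequality v \<le> v^2 + 1 for v = 2^k a_k, divided by 2^k, bounds a_k
        by the sum of two summable sequences.\<close>
      have "a k x * b \<le> (a k x * b)\<^sup>2 + 1"
        using sum_squares_bound[of "a k x * b" 1] \<open>0 \<le> a k x\<close> b by (smt (verit) mult_nonneg_nonneg one_power2)
      then have "a k x \<le> b * (a k x)\<^sup>2 + 1 / b"
        using b by (simp add: field_simps power2_eq_square)
      then show "norm (a k x) \<le> 2^k * (a k x)\<^sup>2 + (1/2)^k"
        using \<open>0 \<le> a k x\<close> by (simp only: b_def power_one_over real_norm_def abs_of_nonneg)
    qed
    then have "summable (\<lambda>k. f (r (Suc k)) x - f (r k) x)"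
      unfolding a_def by (rule summable_norm_cancel)
    then have "convergent (\<lambda>n. (\<Sum>k<n. f (r (Suc k)) x - f (r k) x) + f (r 0) x)"
      by (intro convergent_add convergent_const) (simp add: summable_iff_convergent)
    then show "convergent (\<lambda>k. f (r k) x)"
      by (simp add: sum_lessThan_telescope[of "\<lambda>k. f (r k) x"])
  qed
  define g where "g x = lim (\<lambda>k. f (r k) x)" for x
  have [measurable]: "g \<in> borel_measurable borel" unfolding g_def by measurable
  have glim: "AE x in lborel. (\<lambda>k. f (r k) x) \<longlonglongrightarrow> g x"
    using conv by eventually_elim (auto simp: g_def convergent_LIMSEQ_iff)
  \<comment> \<open>Fatou's lemma along the subsequence carries the Cauchy estimate over to the
    limit, for every m beyond \<open>N k\<close> and not only for members of the
    subsequence.\<close>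
  have key: "(\<integral>\<^sup>+x. ennreal ((norm (f m x - g x))\<^sup>2) \<partial>lborel) \<le> ennreal ((1/4)^k)" if m: "m \<ge> N k" for m k
  proof -
    have "(\<integral>\<^sup>+x. ennreal ((norm (f m x - g x))\<^sup>2) \<partial>lborel) =
      (\<integral>\<^sup>+x. liminf (\<lambda>j. ennreal ((norm (f m x - f (r j) x))\<^sup>2)) \<partial>lborel)"
    proof (rule nn_integral_cong_AE)
      show "AE x in lborel. ennreal ((norm (f m x - g x))\<^sup>2) = liminf (\<lambda>j. ennreal ((norm (f m x - f (r j) x))\<^sup>2))"
        using glim
      proof eventually_elim
        fix x assume "(\<lambda>k. f (r k) x) \<longlonglongrightarrow> g x"
        then have "(\<lambda>j. ennreal ((norm (f m x - f (r j) x))\<^sup>2)) \<longlonglongrightarrow> ennreal ((norm (f m x - g x))\<^sup>2)"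
          by (intro tendsto_intros)
        then show "ennreal ((norm (f m x - g x))\<^sup>2) = liminf (\<lambda>j. ennreal ((norm (f m x - f (r j) x))\<^sup>2))"
          by (intro lim_imp_Liminf[symmetric]) auto
      qed
    qed
    also have "\<dots> \<le> liminf (\<lambda>j. \<integral>\<^sup>+x. ennreal ((norm (f m x - f (r j) x))\<^sup>2) \<partial>lborel)"
      by (rule nn_integral_liminf) auto
    also have "\<dots> \<le> liminf (\<lambda>j. ennreal ((1/4)^k))"
    proof (rule Liminf_mono, rule eventually_sequentiallyI[of k])
      fix j assume "k \<le> j"
      have "(\<integral>\<^sup>+x. ennreal ((norm (f m x - f (r j) x))\<^sup>2) \<partial>lborel) = ennreal (sq (\<lambda>x. f m x - f (r j) x))"
        by (rule nn_integral_sq[OF L2_diff[OF f f]])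
      also have "\<dots> \<le> ennreal ((1/4)^k)"
        by (intro ennreal_leI less_imp_le[OF N] m rN \<open>k \<le> j\<close>)
      finally show "(\<integral>\<^sup>+x. ennreal ((norm (f m x - f (r j) x))\<^sup>2) \<partial>lborel) \<le> ennreal ((1/4)^k)" .
    qed
    also have "\<dots> = ennreal ((1/4)^k)" by (simp add: Liminf_const)
    finally show ?thesis .
  qed
  have d: "(\<lambda>x. f m x - g x) \<in> L2" if "m \<ge> N 0" for m
    unfolding L2_iff_nn_integral using key[OF that] by (auto intro: le_less_trans)
  have g: "g \<in> L2"
    using L2_diff[OF f[of "N 0"] d[of "N 0"]] by simp
  show ?thesis
  proof (intro bexI[OF _ g] LIMSEQ_I)
    fix e :: real assume "e > 0"
    then obtain k where k: "(1/4)^k < e" using real_arch_pow_inv[of e "1/4"] by auto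
    have "norm (sq (\<lambda>x. f m x - g x) - 0) < e" if "m \<ge> N k" for m
    proof -
      have "ennreal (sq (\<lambda>x. f m x - g x)) \<le> ennreal ((1/4)^k)"
        using key[OF that] nn_integral_sq[OF L2_diff[OF f g]] by simp
      then have "sq (\<lambda>x. f m x - g x) \<le> (1/4)^k" by (subst (asm) ennreal_le_iff) auto
      then show ?thesis using k by simp
    qed
    then show "\<exists>n0. \<forall>m\<ge>n0. norm (sq (\<lambda>x. f m x - g x) - 0) < e" by blast
  qed
qed

lemma sq_tendsto_0_AE_subseq:
  fixes f :: "nat \<Rightarrow> 'a::euclidean_space \<Rightarrow> complex"
  assumes "\<And>k. f k \<in> L2" "(\<lambda>k. sq (f k)) \<longlonglongrightarrow> 0"
  shows "\<exists>r::nat\<Rightarrow>nat. strict_mono r \<and> (AE x in lborel. (\<lambda>n. f (r n) x) \<longlonglongrightarrow> 0)"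
proof -
  obtain r :: "nat \<Rightarrow> nat" where r: "strict_mono r" "AE x in lborel. (\<lambda>n. (norm (f (r n) x))\<^sup>2) \<longlonglongrightarrow> 0"
    using tendsto_L1_AE_subseq[of lborel "\<lambda>k x. (norm (f k x))\<^sup>2"] assms L2_integrable
    by (auto simp: sq_def)
  from r(2) have "AE x in lborel. (\<lambda>n. f (r n) x) \<longlonglongrightarrow> 0"
  proof eventually_elim
    fix x assume "(\<lambda>n. (norm (f (r n) x))\<^sup>2) \<longlonglongrightarrow> 0"
    from tendsto_real_sqrt[OF this] show "(\<lambda>n. f (r n) x) \<longlonglongrightarrow> 0"
      by (simp add: tendsto_norm_zero_iff)
  qed
  with r(1) show ?thesis by blast
qed

section \<open>Smooth functions\<close>

text \<open>For m = 0 this is the standard flat function. The negative powers of s are included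
  because differentiation produces them: the family over all m is closed under derivatives up to
  linear combinations.\<close>

definition flat_exp :: "nat \<Rightarrow> real \<Rightarrow> real" where
  "flat_exp m s = (if s > 0 then exp (- 1 / s) / s ^ m else 0)"

lemma flat_exp_nonneg: "0 \<le> flat_exp m s"
  by (simp add: flat_exp_def)

text \<open>exp(1/s) dominates every power of 1/s through exp v \<ge> (1 + v/n)^n with n = m + 1.
  One power more than s^m is gained, and the resulting linear bound gives continuity at 0.\<close>

lemma flat_exp_bound: "flat_exp m s \<le> real (Suc m) ^ Suc m * \<bar>s\<bar>"
proof (cases "s > 0")
  case True
  have "(1 / (s * real (Suc m))) ^ Suc m \<le> (1 + (1 / s) / real (Suc m)) ^ Suc m"
    using True by (intro power_mono) (auto simp: divide_simps)
  also have "\<dots> \<le> exp (1 / s)"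
    using True by (intro exp_ge_one_plus_x_over_n_power_n) (auto intro: order_trans[of _ 0])
  finally have "1 \<le> exp (1 / s) * (s * real (Suc m)) ^ Suc m"
    using True by (simp add: power_one_over field_simps del: power_Suc of_nat_Suc)
  then have "exp (- 1 / s) \<le> (s * real (Suc m)) ^ Suc m"
    using mult_left_mono[of 1 "exp (1 / s) * (s * real (Suc m)) ^ Suc m" "exp (- (1 / s))"]
    by (simp add: exp_minus mult.assoc[symmetric] del: power_Suc of_nat_Suc)
  then have "exp (- 1 / s) / s ^ m \<le> (s * real (Suc m)) ^ Suc m / s ^ m"
    using True by (intro divide_right_mono) auto
  also have "\<dots> = real (Suc m) ^ Suc m * s"
    using True by (simp add: power_mult_distrib)
  finally show ?thesis using True by (simp add: flat_exp_def)
next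
  case False
  have "0 \<le> real (Suc m) ^ Suc m * \<bar>s\<bar>" by (intro mult_nonneg_nonneg) auto
  then show ?thesis using False by (simp add: flat_exp_def del: power_Suc of_nat_Suc)
qed

lemma flat_exp_has_deriv:
  "(flat_exp m has_real_derivative (flat_exp (m + 2) s - real m * flat_exp (m + 1) s)) (at s)"
proof -
  consider "s > 0" | "s < 0" | "s = 0" by linarith
  then show ?thesis
  proof cases
    case 1
    have "((\<lambda>s. exp (- 1 / s) / s ^ m) has_real_derivative (flat_exp (m + 2) s - real m * flat_exp (m + 1) s)) (at s)"
      using 1 by (auto intro!: derivative_eq_intros simp: flat_exp_def field_simps power2_eq_square power_add
          power_eq_if[of s m])
    then show ?thesis
      by (rule has_field_derivative_transform_within_open[where S="{0<..}"]) (use 1 in \<open>auto simp: flat_exp_def\<close>)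
  next
    case 2
    have "((\<lambda>s. 0) has_real_derivative 0) (at s)" by simp
    then have "(flat_exp m has_real_derivative 0) (at s)"
      by (rule has_field_derivative_transform_within_open[where S="{..<0}"]) (use 2 in \<open>auto simp: flat_exp_def\<close>)
    then show ?thesis using 2 by (simp add: flat_exp_def)
  next
    case 3
    have "((\<lambda>h. flat_exp (Suc m) h) \<longlongrightarrow> 0) (at 0)"
    proof (rule Lim_null_comparison)
      show "\<forall>\<^sub>F h in at 0. norm (flat_exp (Suc m) h) \<le> real (Suc (Suc m)) ^ Suc (Suc m) * \<bar>h\<bar>"
        using flat_exp_bound flat_exp_nonneg by (auto simp del: power_Suc of_nat_Suc intro!: always_eventually)
      show "((\<lambda>h. real (Suc (Suc m)) ^ Suc (Suc m) * \<bar>h\<bar>) \<longlongrightarrow> 0) (at 0)"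
        by (auto intro!: tendsto_eq_intros)
    qed
    \<comment> \<open>At 0 the difference quotient of \<open>flat_exp m\<close> is exactly
      \<open>flat_exp (Suc m)\<close>, which the linear bound sends to 0.\<close>
    moreover have "(flat_exp m (0 + h) - flat_exp m 0) / h = flat_exp (Suc m) h" for h
      by (auto simp: flat_exp_def)
    ultimately show ?thesis using 3 by (simp add: DERIV_def flat_exp_def)
  qed
qed

text \<open>A class of generators closed under partial derivatives, so that its members are smooth of all orders.\<close>

inductive smooth_gen :: "('a::euclidean_space \<Rightarrow> complex) \<Rightarrow> bool" where
  smooth_gen_const: "smooth_gen (\<lambda>x. c)"
| smooth_gen_lin: "smooth_gen (\<lambda>x. of_real (x \<bullet> b))"
| smooth_gen_flat_exp: "smooth_gen (\<lambda>x. of_real (flat_exp m (c * (x \<bullet> b) + d)))"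
| smooth_gen_gauss: "smooth_gen (\<lambda>x. of_real (exp (- a * (norm (x - z))\<^sup>2)))"
| smooth_gen_add: "smooth_gen f \<Longrightarrow> smooth_gen g \<Longrightarrow> smooth_gen (\<lambda>x. f x + g x)"
| smooth_gen_mult: "smooth_gen f \<Longrightarrow> smooth_gen g \<Longrightarrow> smooth_gen (\<lambda>x. f x * g x)"

lemma smooth_gen_diff: "smooth_gen f \<Longrightarrow> smooth_gen g \<Longrightarrow> smooth_gen (\<lambda>x. f x - g x)"
  using smooth_gen_add[OF _ smooth_gen_mult[OF smooth_gen_const[of "-1"]], of f g] by simp

lemma smooth_gen_sum: "(\<And>i. i \<in> I \<Longrightarrow> smooth_gen (f i)) \<Longrightarrow> smooth_gen (\<lambda>x. \<Sum>i\<in>I. f i x)"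
  by (induct I rule: infinite_finite_induct) (auto intro: smooth_gen_add smooth_gen_const)

lemma smooth_gen_prod: "(\<And>i. i \<in> I \<Longrightarrow> smooth_gen (f i)) \<Longrightarrow> smooth_gen (\<lambda>x. \<Prod>i\<in>I. f i x)"
  by (induct I rule: infinite_finite_induct) (auto intro: smooth_gen_mult smooth_gen_const)

lemma gauss_has_derivative:
  "((\<lambda>x::'a::euclidean_space. complex_of_real (exp (- a * (norm (x - z))\<^sup>2))) has_derivative
    (\<lambda>h. of_real (- 2 * a * ((x - z) \<bullet> h)) * of_real (exp (- a * (norm (x - z))\<^sup>2)))) (at x)"
  unfolding power2_norm_eq_inner
  by (rule has_derivative_eq_rhs, (rule derivative_intros)+) (auto simp: fun_eq_iff inner_commute)

lemma smooth_gen_deriv: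
  "smooth_gen f \<Longrightarrow> \<exists>f'. (\<forall>x. (f has_derivative f' x) (at x)) \<and> (\<forall>b. smooth_gen (\<lambda>x. f' x b))"
proof (induction rule: smooth_gen.induct)
  case (smooth_gen_const c)
  show ?case by (rule exI[of _ "\<lambda>x h. 0"]) (auto intro: smooth_gen.intros)
next
  case (smooth_gen_lin b)
  show ?case
    by (rule exI[of _ "\<lambda>x h. of_real (h \<bullet> b)"]) (auto intro!: smooth_gen.intros derivative_eq_intros)
next
  case (smooth_gen_flat_exp m c b d)
  let ?f = "\<lambda>x h. of_real (c * (h \<bullet> b)) * (of_real (flat_exp (m + 2) (c * (x \<bullet> b) + d)) +
     (- of_nat m) * of_real (flat_exp (m + 1) (c * (x \<bullet> b) + d)))"
  have "((\<lambda>x. complex_of_real (flat_exp m (c * (x \<bullet> b) + d))) has_derivative ?f x) (at x)" for x :: 'a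
  proof -
    have 1: "((\<lambda>x. c * (x \<bullet> b) + d) has_derivative (\<lambda>h. c * (h \<bullet> b))) (at x)"
      by (auto intro!: derivative_eq_intros)
    from has_derivative_compose[OF this flat_exp_has_deriv[unfolded has_field_derivative_def]]
    have "((\<lambda>x. flat_exp m (c * (x \<bullet> b) + d)) has_derivative
      (\<lambda>h. (flat_exp (m + 2) (c * (x \<bullet> b) + d) - real m * flat_exp (m + 1) (c * (x \<bullet> b) + d)) * (c * (h \<bullet> b)))) (at x)" .
    from has_derivative_of_real[OF this] show ?thesis
      by (rule has_derivative_eq_rhs) (auto simp: fun_eq_iff algebra_simps)
  qed
  moreover have "smooth_gen (\<lambda>x. ?f x h)" for h :: 'a
    by (intro smooth_gen.intros)
  ultimately show ?case by (intro exI[of _ ?f] conjI allI)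
next
  case (smooth_gen_gauss a z)
  have "smooth_gen (\<lambda>x. of_real (- 2 * a * ((x - z) \<bullet> h)) * of_real (exp (- a * (norm (x - z))\<^sup>2)))" for h
  proof -
    have "smooth_gen (\<lambda>x. (of_real (- 2 * a) * (of_real (x \<bullet> h) - of_real (z \<bullet> h))) * of_real (exp (- a * (norm (x - z))\<^sup>2)))"
      by (intro smooth_gen.intros smooth_gen_diff)
    then show ?thesis by (simp add: inner_diff_left)
  qed
  then show ?case
    by (intro exI[of _ "\<lambda>x h. of_real (- 2 * a * ((x - z) \<bullet> h)) * of_real (exp (- a * (norm (x - z))\<^sup>2))"]
        conjI allI gauss_has_derivative)
next
  case (smooth_gen_add f g)
  then obtain f' g' where d: "\<And>x. (f has_derivative f' x) (at x)" "\<And>x. (g has_derivative g' x) (at x)"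
    and s: "\<And>b. smooth_gen (\<lambda>x. f' x b)" "\<And>b. smooth_gen (\<lambda>x. g' x b)" by blast
  show ?case
    by (rule exI[of _ "\<lambda>x h. f' x h + g' x h"]) (auto intro: smooth_gen.smooth_gen_add s has_derivative_add d)
next
  case (smooth_gen_mult f g)
  then obtain f' g' where d: "\<And>x. (f has_derivative f' x) (at x)" "\<And>x. (g has_derivative g' x) (at x)"
    and s: "\<And>b. smooth_gen (\<lambda>x. f' x b)" "\<And>b. smooth_gen (\<lambda>x. g' x b)" by blast
  show ?case
    by (rule exI[of _ "\<lambda>x h. f x * g' x h + f' x h * g x"])
      (auto intro!: smooth_gen.smooth_gen_add smooth_gen.smooth_gen_mult s has_derivative_mult d smooth_gen_mult.hyps)
qed

lemma smooth_gen_has_derivative: "smooth_gen f \<Longrightarrow> (f has_derivative frechet_derivative f (at x)) (at x)"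
  using smooth_gen_deriv[of f] differentiableI frechet_derivative_works by blast

lemma smooth_gen_partial: "smooth_gen f \<Longrightarrow> smooth_gen (partial_deriv b f)"
proof -
  assume "smooth_gen f"
  then obtain f' where d: "\<And>x. (f has_derivative f' x) (at x)" and s: "\<And>b. smooth_gen (\<lambda>x. f' x b)"
    using smooth_gen_deriv by blast
  have "partial_deriv b f = (\<lambda>x. f' x b)"
    unfolding partial_deriv_def fun_eq_iff using frechet_derivative_at[OF d] by simp
  then show ?thesis using s by simp
qed

lemma smooth_gen_Ck: "smooth_gen f \<Longrightarrow> Ck k f"
proof (induction k arbitrary: f)
  case 0
  then have "f differentiable (at x)" for x
    using smooth_gen_has_derivative differentiableI by blast
  then show ?case
    by (simp add: continuous_at_imp_continuous_on differentiable_imp_continuous_within)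
next
  case (Suc k)
  then show ?case using smooth_gen_partial smooth_gen_has_derivative differentiableI by (auto, blast)
qed

lemma smooth_gen_continuous: "smooth_gen f \<Longrightarrow> continuous_on UNIV f"
  using smooth_gen_Ck[of f 0] by simp

lemma smooth_gen_measurable: "smooth_gen f \<Longrightarrow> f \<in> borel_measurable borel"
  by (rule borel_measurable_continuous_onI[OF smooth_gen_continuous])

lemma has_derivative_partial: "(f has_derivative D) (at x) \<Longrightarrow> partial_deriv b f x = D b"
  unfolding partial_deriv_def using frechet_derivative_at by metis

lemma partial_deriv_add:
  assumes "smooth_gen f" "smooth_gen g"
  shows "partial_deriv b (\<lambda>x. f x + g x) = (\<lambda>x. partial_deriv b f x + partial_deriv b g x)"
  unfolding fun_eq_iff
  using has_derivative_partial[OF has_derivative_add[OF smooth_gen_has_derivative[OF assms(1)] smooth_gen_has_derivative[OF assms(2)]]]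
  by (simp add: partial_deriv_def)

lemma partial_deriv_mult:
  assumes "smooth_gen f" "smooth_gen g"
  shows "partial_deriv b (\<lambda>x. f x * g x) = (\<lambda>x. f x * partial_deriv b g x + partial_deriv b f x * g x)"
  unfolding fun_eq_iff
  using has_derivative_partial[OF has_derivative_mult[OF smooth_gen_has_derivative[OF assms(1)] smooth_gen_has_derivative[OF assms(2)]]]
  by (simp add: partial_deriv_def)

lemma partial_deriv_const: "partial_deriv b (\<lambda>x::'a::euclidean_space. c::complex) = (\<lambda>x. 0)"
  unfolding fun_eq_iff using has_derivative_partial[OF has_derivative_const] by blast

lemma partial_deriv_cmult:
  assumes "smooth_gen f"
  shows "partial_deriv b (\<lambda>x. c * f x) = (\<lambda>x. c * partial_deriv b f x)"
  using partial_deriv_mult[OF smooth_gen_const assms, of b c] by (simp add: partial_deriv_const)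

lemma partial_deriv_scale:
  fixes f :: "'a::euclidean_space \<Rightarrow> complex"
  assumes "smooth_gen f"
  shows "partial_deriv b (\<lambda>x. f (s *\<^sub>R x)) = (\<lambda>x. of_real s * partial_deriv b f (s *\<^sub>R x))"
proof
  fix x :: 'a
  have "((\<lambda>x. s *\<^sub>R x) has_derivative (\<lambda>h. s *\<^sub>R h)) (at x)"
    by (auto intro!: derivative_eq_intros)
  from has_derivative_compose[OF this smooth_gen_has_derivative[OF assms]]
  have "partial_deriv b (\<lambda>x. f (s *\<^sub>R x)) x = frechet_derivative f (at (s *\<^sub>R x)) (s *\<^sub>R b)"
    by (rule has_derivative_partial)
  also have "\<dots> = of_real s * partial_deriv b f (s *\<^sub>R x)"
    using linear_scale[OF has_derivative_linear[OF smooth_gen_has_derivative[OF assms]]]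
    by (simp add: partial_deriv_def scaleR_conv_of_real)
  finally show "partial_deriv b (\<lambda>x. f (s *\<^sub>R x)) x = of_real s * partial_deriv b f (s *\<^sub>R x)" .
qed

lemma smooth_gen_scale:
  assumes "smooth_gen f" "s \<noteq> 0"
  shows "smooth_gen (\<lambda>x. f (s *\<^sub>R x))"
  using assms(1)
proof induction
  case (smooth_gen_lin b)
  show ?case using smooth_gen_mult[OF smooth_gen_const[of "of_real s"] smooth_gen.smooth_gen_lin[of b]] by simp
next
  case (smooth_gen_flat_exp m c b d)
  show ?case using smooth_gen.smooth_gen_flat_exp[of m "c * s" b d] by (simp add: mult.assoc)
next
  case (smooth_gen_gauss a z)
  \<comment> \<open>The centre of a dilated Gaussian is z / s; this is where s must not
    vanish.\<close>
  have "norm (s *\<^sub>R x - z) = \<bar>s\<bar> * norm (x - z /\<^sub>R s)" for x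
    using assms(2) by (simp add: scaleR_diff_right flip: norm_scaleR)
  then show ?case
    using smooth_gen.smooth_gen_gauss[of "a * s\<^sup>2" "z /\<^sub>R s"] by (simp add: power_mult_distrib mult.assoc)
qed (auto intro: smooth_gen.intros)

text \<open>A product over the coordinates of bumps on (-1, 1), divided by its value at 0 so that
  its dilations tend to 1. The factors 1 and -1 in front of the coordinates match the shape of the
  rule \<open>smooth_gen_flat_exp\<close>.\<close>

definition cutoff :: "'a::euclidean_space \<Rightarrow> complex" where
  "cutoff x = (\<Prod>b\<in>Basis. of_real (flat_exp 0 (1 * (x \<bullet> b) + 1)) * of_real (flat_exp 0 (- 1 * (x \<bullet> b) + 1))) /
     (\<Prod>b\<in>(Basis::'a set). of_real (flat_exp 0 1) * of_real (flat_exp 0 1))"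

lemma cutoff_smooth_gen: "smooth_gen cutoff"
proof -
  have "smooth_gen (\<lambda>x::'a. inverse (\<Prod>b\<in>(Basis::'a set). of_real (flat_exp 0 1) * of_real (flat_exp 0 1)) *
     (\<Prod>b\<in>Basis. of_real (flat_exp 0 (1 * (x \<bullet> b) + 1)) * of_real (flat_exp 0 (- 1 * (x \<bullet> b) + 1))))"
    by (intro smooth_gen_mult smooth_gen_const smooth_gen_prod smooth_gen_flat_exp)
  then show ?thesis unfolding cutoff_def[abs_def] by (simp add: divide_inverse mult.commute)
qed

lemma cutoff_0 [simp]: "cutoff 0 = 1"
  by (simp add: cutoff_def flat_exp_def)

lemma cutoff_neq_0_iff: "cutoff x \<noteq> 0 \<longleftrightarrow> x \<in> box (- One) (One)"
  by (auto simp: cutoff_def flat_exp_def box_def prod_zero_iff)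

lemma support_closed_partial:
  assumes "closed K" "\<And>x. x \<notin> K \<Longrightarrow> f x = (0::complex)" "x \<notin> K"
  shows "partial_deriv b f x = 0"
proof -
  have "((\<lambda>x. 0::complex) has_derivative (\<lambda>h. 0)) (at x)" by simp
  then have "(f has_derivative (\<lambda>h. 0)) (at x)"
    by (rule has_derivative_transform_within_open[OF _ open_Compl[OF assms(1)]]) (use assms in auto)
  from has_derivative_partial[OF this] show ?thesis by simp
qed

lemma continuous_support_bounded:
  fixes f :: "'a::euclidean_space \<Rightarrow> complex"
  assumes "compact K" "\<And>x. x \<notin> K \<Longrightarrow> f x = 0" "continuous_on UNIV f"
  shows "\<exists>C. \<forall>x. norm (f x) \<le> C"
proof -
  have "bounded (f ` K)"
    using assms by (intro compact_imp_bounded compact_continuous_image) (auto intro: continuous_on_subset)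
  then obtain C where "\<And>x. x \<in> K \<Longrightarrow> norm (f x) \<le> C" "C > 0"
    by (auto simp: bounded_pos)
  then show ?thesis using assms(2) by (metis less_imp_le norm_zero)
qed

lemma cutoff_bounds:
  "\<exists>C. \<forall>x::'a::euclidean_space. norm (cutoff x) \<le> C"
  "\<exists>C. \<forall>x::'a. norm (partial_deriv b cutoff x) \<le> C"
  "\<exists>C. \<forall>x::'a. norm (partial_deriv b (partial_deriv b cutoff) x) \<le> C"
proof -
  let ?K = "cbox (- One) (One :: 'a)"
  have K: "compact ?K" "closed ?K" by (auto simp: closed_cbox)
  have 0: "cutoff x = 0" if "x \<notin> ?K" for x :: 'a
    using that cutoff_neq_0_iff[of x] box_subset_cbox[of "-One" "One :: 'a"] by auto
  have 1: "partial_deriv b cutoff x = 0" if "x \<notin> ?K" for x :: 'a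
    by (rule support_closed_partial[OF K(2) _ that]) (rule 0)
  have 2: "partial_deriv b (partial_deriv b cutoff) x = 0" if "x \<notin> ?K" for x :: 'a
    by (rule support_closed_partial[OF K(2) _ that]) (rule 1)
  show "\<exists>C. \<forall>x::'a. norm (cutoff x) \<le> C"
    by (rule continuous_support_bounded[OF K(1) 0]) (auto intro: smooth_gen_continuous cutoff_smooth_gen)
  show "\<exists>C. \<forall>x::'a. norm (partial_deriv b cutoff x) \<le> C"
    by (rule continuous_support_bounded[OF K(1) 1]) (auto intro: smooth_gen_continuous smooth_gen_partial cutoff_smooth_gen)
  show "\<exists>C. \<forall>x::'a. norm (partial_deriv b (partial_deriv b cutoff) x) \<le> C"
    by (rule continuous_support_bounded[OF K(1) 2]) (auto intro: smooth_gen_continuous smooth_gen_partial cutoff_smooth_gen)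
qed

lemma test_function_cutoff:
  fixes f :: "'a::euclidean_space \<Rightarrow> complex"
  assumes "smooth_gen f" "s > 0"
  shows "test_function (\<lambda>x. cutoff (s *\<^sub>R x) * f x)"
proof -
  have "{x. cutoff (s *\<^sub>R x) * f x \<noteq> 0} \<subseteq> cbox (- (One /\<^sub>R s)) (One /\<^sub>R s)"
    using assms(2) by (auto simp: cutoff_neq_0_iff mem_box field_simps less_imp_le)
  then have "bounded {x. cutoff (s *\<^sub>R x) * f x \<noteq> 0}"
    using bounded_cbox bounded_subset by blast
  then show ?thesis
    unfolding test_function_def
    using smooth_gen_Ck[OF smooth_gen_mult[OF smooth_gen_scale[OF cutoff_smooth_gen] assms(1)], of s] assms(2) by (auto simp: compact_closure)
qed

text \<open>Polynomials times Gaussians contain the heat kernel and its derivatives; they are no test functions, but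
  distributional identities between functions of moderate growth extend to them by cutting off.\<close>

inductive poly_gauss :: "'a::euclidean_space \<Rightarrow> ('a \<Rightarrow> complex) \<Rightarrow> bool" for z where
  poly_gauss_gauss: "a > 0 \<Longrightarrow> poly_gauss z (\<lambda>x. of_real (exp (- a * (norm (x - z))\<^sup>2)))"
| poly_gauss_lin: "poly_gauss z f \<Longrightarrow> poly_gauss z (\<lambda>x. of_real ((x - z) \<bullet> b) * f x)"
| poly_gauss_cmult: "poly_gauss z f \<Longrightarrow> poly_gauss z (\<lambda>x. c * f x)"
| poly_gauss_add: "poly_gauss z f \<Longrightarrow> poly_gauss z g \<Longrightarrow> poly_gauss z (\<lambda>x. f x + g x)"

section \<open>Polynomials times Gaussians as test functions\<close>

lemma smooth_gen_lin': "smooth_gen (\<lambda>x. of_real ((x - z) \<bullet> b))"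
  using smooth_gen_diff[OF smooth_gen_lin smooth_gen_const, of b "of_real (z \<bullet> b)"] by (simp add: inner_diff_left)

lemma poly_gauss_smooth_gen: "poly_gauss z f \<Longrightarrow> smooth_gen f"
  by (induction rule: poly_gauss.induct) (blast intro: smooth_gen_gauss, (intro smooth_gen_mult smooth_gen_add smooth_gen_lin' smooth_gen_const; assumption)+)

lemma partial_deriv_lin: "partial_deriv b' (\<lambda>x::'a::euclidean_space. complex_of_real ((x - z) \<bullet> b)) = (\<lambda>x. of_real (b' \<bullet> b))"
proof
  fix x :: 'a
  have "((\<lambda>x. complex_of_real ((x - z) \<bullet> b)) has_derivative (\<lambda>h. of_real (h \<bullet> b))) (at x)"
    by (auto intro!: derivative_eq_intros)
  then show "partial_deriv b' (\<lambda>x. complex_of_real ((x - z) \<bullet> b)) x = of_real (b' \<bullet> b)"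
    by (rule has_derivative_partial)
qed

lemma partial_deriv_gauss:
  "partial_deriv b (\<lambda>x::'a::euclidean_space. complex_of_real (exp (- a * (norm (x - z))\<^sup>2))) =
   (\<lambda>x. of_real (- 2 * a) * (of_real ((x - z) \<bullet> b) * of_real (exp (- a * (norm (x - z))\<^sup>2))))"
  by (rule ext, subst has_derivative_partial[OF gauss_has_derivative]) simp

lemma poly_gauss_partial: "poly_gauss z f \<Longrightarrow> poly_gauss z (partial_deriv b f)"
proof (induction rule: poly_gauss.induct)
  case (poly_gauss_gauss a)
  then show ?case unfolding partial_deriv_gauss by (intro poly_gauss_cmult poly_gauss_lin poly_gauss.poly_gauss_gauss)
next
  case (poly_gauss_lin f b')
  show ?case
    unfolding partial_deriv_mult[OF smooth_gen_lin' poly_gauss_smooth_gen[OF poly_gauss_lin.hyps]] partial_deriv_lin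
    by (intro poly_gauss_add poly_gauss.poly_gauss_lin poly_gauss_cmult poly_gauss_lin)
next
  case (poly_gauss_cmult f c)
  then show ?case by (simp add: partial_deriv_cmult poly_gauss_smooth_gen poly_gauss.poly_gauss_cmult)
next
  case (poly_gauss_add f g)
  then show ?case by (simp add: partial_deriv_add poly_gauss_smooth_gen poly_gauss.poly_gauss_add)
qed

text \<open>A linear factor costs half of the decay rate and a sum takes the smaller of two rates,
  so a Gaussian majorant survives each construction rule.\<close>

lemma poly_gauss_bound: "poly_gauss z f \<Longrightarrow> \<exists>C a. a > 0 \<and> C \<ge> 0 \<and> (\<forall>x. norm (f x) \<le> C * exp (- a * (norm (x - z))\<^sup>2))"
proof (induction rule: poly_gauss.induct)
  case (poly_gauss_gauss a)
  then show ?case by (intro exI[of _ 1] exI[of _ a]) auto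
next
  case (poly_gauss_lin f b)
  then obtain C a where *: "a > 0" "C \<ge> 0" "\<And>x. norm (f x) \<le> C * exp (- a * (norm (x - z))\<^sup>2)" by blast
  have "norm (of_real ((x - z) \<bullet> b) * f x) \<le> (norm b * (1 + 2 / a) * C) * exp (- (a / 2) * (norm (x - z))\<^sup>2)" for x
  proof -
    define s where "s = norm (x - z)"
    have "2 * s * 1 \<le> s\<^sup>2 + 1\<^sup>2" "0 \<le> s" using sum_squares_bound[of s 1] by (auto simp: s_def)
    then have "s \<le> 1 + s\<^sup>2" by simp
    also have "\<dots> \<le> (1 + 2 / a) * (1 + a / 2 * s\<^sup>2)"
      using *(1) by (simp add: field_simps)
    also have "\<dots> \<le> (1 + 2 / a) * exp (a / 2 * s\<^sup>2)"
      using *(1) by (intro mult_left_mono exp_ge_add_one_self) auto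
    finally have s: "s \<le> (1 + 2 / a) * exp (a / 2 * s\<^sup>2)" .
    have "norm (of_real ((x - z) \<bullet> b) * f x) \<le> (s * norm b) * (C * exp (- a * s\<^sup>2))"
      unfolding norm_mult s_def using Cauchy_Schwarz_ineq2[of "x - z" b] *(2,3) by (intro mult_mono) auto
    also have "\<dots> \<le> ((1 + 2 / a) * exp (a / 2 * s\<^sup>2) * norm b) * (C * exp (- a * s\<^sup>2))"
      using s *(2) by (intro mult_right_mono) auto
    also have "\<dots> = (norm b * (1 + 2 / a) * C) * (exp (a / 2 * s\<^sup>2) * exp (- a * s\<^sup>2))" by simp
    also have "exp (a / 2 * s\<^sup>2) * exp (- a * s\<^sup>2) = exp (- (a / 2) * s\<^sup>2)"
      by (simp flip: exp_add)
    finally show ?thesis by (simp add: s_def)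
  qed
  then show ?case using * by (intro exI[of _ "norm b * (1 + 2 / a) * C"] exI[of _ "a/2"]) auto
next
  case (poly_gauss_cmult f c)
  then obtain C a where *: "a > 0" "C \<ge> 0" "\<And>x. norm (f x) \<le> C * exp (- a * (norm (x - z))\<^sup>2)" by blast
  have "norm (c * f x) \<le> (norm c * C) * exp (- a * (norm (x - z))\<^sup>2)" for x
    using mult_left_mono[OF *(3), of "norm c" x] by (simp add: norm_mult mult.assoc)
  then show ?case using * by (intro exI[of _ "norm c * C"] exI[of _ a]) auto
next
  case (poly_gauss_add f g)
  then obtain C a C' a' where *: "a > 0" "C \<ge> 0" "\<And>x. norm (f x) \<le> C * exp (- a * (norm (x - z))\<^sup>2)"
    "a' > 0" "C' \<ge> 0" "\<And>x. norm (g x) \<le> C' * exp (- a' * (norm (x - z))\<^sup>2)" by metis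
  let ?m = "min a a'"
  have "norm (f x + g x) \<le> (C + C') * exp (- ?m * (norm (x - z))\<^sup>2)" for x
  proof -
    have "norm (f x + g x) \<le> C * exp (- a * (norm (x - z))\<^sup>2) + C' * exp (- a' * (norm (x - z))\<^sup>2)"
      by (rule order_trans[OF norm_triangle_ineq add_mono[OF *(3) *(6)]])
    also have "\<dots> \<le> C * exp (- ?m * (norm (x - z))\<^sup>2) + C' * exp (- ?m * (norm (x - z))\<^sup>2)"
      using * by (intro add_mono mult_left_mono) (auto intro!: mult_right_mono)
    finally show ?thesis by (simp add: algebra_simps)
  qed
  then show ?case using * by (intro exI[of _ "C + C'"] exI[of _ "min a a'"]) auto
qed

text \<open>Integrability against every Gaussian, which is exactly what pairing with
  \<open>poly_gauss\<close> functions requires. It is weaker than the growth condition behind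
  tempered distributions.\<close>

definition tempered :: "('a::euclidean_space \<Rightarrow> complex) \<Rightarrow> bool" where
  "tempered f \<longleftrightarrow> f \<in> borel_measurable borel \<and>
     (\<forall>a>0. \<forall>z. integrable lborel (\<lambda>x. norm (f x) * exp (- a * (norm (x - z))\<^sup>2)))"

lemma tempered_measurable [measurable_dest]: "tempered f \<Longrightarrow> f \<in> borel_measurable borel"
  by (simp add: tempered_def)

lemma tempered_mult_integrable:
  assumes "tempered f" "poly_gauss z \<psi>"
  shows "integrable lborel (\<lambda>x. f x * \<psi> x)"
proof -
  obtain C a where *: "a > 0" "C \<ge> 0" "\<And>x. norm (\<psi> x) \<le> C * exp (- a * (norm (x - z))\<^sup>2)"
    using poly_gauss_bound[OF assms(2)] by blast
  have [measurable]: "f \<in> borel_measurable borel" "\<psi> \<in> borel_measurable borel"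
    using assms by (auto intro: tempered_measurable smooth_gen_measurable poly_gauss_smooth_gen)
  show ?thesis
  proof (rule Bochner_Integration.integrable_bound)
    show "integrable lborel (\<lambda>x. C * (norm (f x) * exp (- a * (norm (x - z))\<^sup>2)))"
      using assms(1) *(1) unfolding tempered_def by (intro integrable_mult_right) blast
    show "AE x in lborel. norm (f x * \<psi> x) \<le> norm (C * (norm (f x) * exp (- a * (norm (x - z))\<^sup>2)))"
      using mult_left_mono[OF *(3), of "norm (f _)"] *(2) by (auto simp: norm_mult abs_mult algebra_simps)
  qed measurable
qed

text \<open>Applied with l = 1 to the dilated cutoff and with l = 0 to its derivatives.\<close>

lemma tempered_cutoff_tendsto:
  fixes c :: "nat \<Rightarrow> 'a::euclidean_space \<Rightarrow> complex"
  assumes "tempered f" "poly_gauss z \<psi>" and [measurable]: "\<And>k. c k \<in> borel_measurable borel"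
    and le: "\<And>k x. norm (c k x) \<le> C" and lim: "\<And>x. (\<lambda>k. c k x) \<longlonglongrightarrow> l"
  shows "(\<lambda>k. \<integral>x. f x * (c k x * \<psi> x) \<partial>lborel) \<longlonglongrightarrow> (\<integral>x. f x * (l * \<psi> x) \<partial>lborel)"
    "integrable lborel (\<lambda>x. f x * (c k x * \<psi> x))"
proof -
  have [measurable]: "f \<in> borel_measurable borel" "\<psi> \<in> borel_measurable borel"
    using assms by (auto intro: tempered_measurable smooth_gen_measurable poly_gauss_smooth_gen)
  have int: "integrable lborel (\<lambda>x. C * norm (f x * \<psi> x))"
    by (intro integrable_mult_right integrable_norm tempered_mult_integrable[OF assms(1,2)])
  have le': "norm (f x * (c k x * \<psi> x)) \<le> C * norm (f x * \<psi> x)" for k x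
    using mult_right_mono[OF le, of "norm (f x * \<psi> x)" k x] by (simp add: norm_mult algebra_simps)
  show "(\<lambda>k. \<integral>x. f x * (c k x * \<psi> x) \<partial>lborel) \<longlonglongrightarrow> (\<integral>x. f x * (l * \<psi> x) \<partial>lborel)"
  proof (rule integral_dominated_convergence[OF _ _ int])
    show "AE x in lborel. (\<lambda>k. f x * (c k x * \<psi> x)) \<longlonglongrightarrow> f x * (l * \<psi> x)"
      by (intro AE_I2 tendsto_intros lim)
  qed (use le' in auto)
  show "integrable lborel (\<lambda>x. f x * (c k x * \<psi> x))"
    by (rule Bochner_Integration.integrable_bound[OF int]) (use le' in \<open>auto intro: order_trans[OF _ abs_ge_self]\<close>)
qed

text \<open>The chain rule puts the factor 1 / (k + 1) in front of each derivative of the dilated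
  cutoff; boundedness of the derivative does the rest.\<close>

lemma cutoff_scaled_tendsto:
  assumes g: "smooth_gen g" and C: "\<And>x. norm (g x) \<le> C"
  shows "(\<lambda>k. of_real (1 / real (Suc k)) * g ((1 / real (Suc k)) *\<^sub>R x)) \<longlonglongrightarrow> 0"
    "norm (of_real (1 / real (Suc k)) * g ((1 / real (Suc k)) *\<^sub>R x)) \<le> C"
proof -
  have C0: "0 \<le> C" using C norm_ge_zero order_trans by blast
  have le: "norm (of_real (1 / real (Suc k)) * g ((1 / real (Suc k)) *\<^sub>R x)) \<le> 1 / real (Suc k) * C" for k
    unfolding norm_mult norm_of_real using C by (intro mult_mono) (auto simp del: of_nat_Suc)
  have l: "(\<lambda>k. 1 / real (Suc k) * C) \<longlonglongrightarrow> 0 * C"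
    by (intro tendsto_intros LIMSEQ_inverse_real_of_nat[unfolded inverse_eq_divide])
  show "(\<lambda>k. of_real (1 / real (Suc k)) * g ((1 / real (Suc k)) *\<^sub>R x)) \<longlonglongrightarrow> 0"
    by (rule Lim_null_comparison[OF always_eventually]) (use le l in auto)
  show "norm (of_real (1 / real (Suc k)) * g ((1 / real (Suc k)) *\<^sub>R x)) \<le> C"
    using le[of k] mult_right_mono[OF _ C0, of "1 / real (Suc k)" 1] by simp
qed

lemma cutoff_one_tendsto:
  fixes x :: "'a::euclidean_space"
  shows "(\<lambda>k. cutoff ((1 / real (Suc k)) *\<^sub>R x)) \<longlonglongrightarrow> 1"
proof -
  have "(\<lambda>k. (1 / real (Suc k)) *\<^sub>R x) \<longlonglongrightarrow> 0 *\<^sub>R x"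
    by (intro tendsto_intros LIMSEQ_inverse_real_of_nat[unfolded inverse_eq_divide])
  moreover have "continuous_on UNIV (cutoff :: 'a \<Rightarrow> complex)"
    by (rule smooth_gen_continuous[OF cutoff_smooth_gen])
  then have "isCont cutoff (0 *\<^sub>R x)"
    by (simp add: continuous_on_eq_continuous_at)
  ultimately have "(\<lambda>k. cutoff ((1 / real (Suc k)) *\<^sub>R x)) \<longlonglongrightarrow> cutoff (0 *\<^sub>R x)"
    by (rule isCont_tendsto_compose[rotated])
  then show ?thesis by simp
qed

text \<open>The identity is tested with the dilated cutoff times \<psi>. The product rule yields one
  additional term, in which the derivative falls on the cutoff, and this term disappears in the
  limit.\<close>

lemma weak_deriv_poly_gauss:
  fixes f h :: "'a::euclidean_space \<Rightarrow> complex"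
  assumes f: "tempered f" and h: "tempered h"
    and W: "\<And>\<psi>. test_function \<psi> \<Longrightarrow> (\<integral>x. f x * partial_deriv b \<psi> x \<partial>lborel) = - (\<integral>x. h x * \<psi> x \<partial>lborel)"
    and poly_gauss: "poly_gauss z \<psi>"
  shows "(\<integral>x. f x * partial_deriv b \<psi> x \<partial>lborel) = - (\<integral>x. h x * \<psi> x \<partial>lborel)"
proof -
  note smooth_gen = poly_gauss_smooth_gen[OF poly_gauss]
  define s where "s k = 1 / real (Suc k)" for k
  have s0: "s k > 0" "s k \<noteq> 0" for k by (auto simp: s_def)
  define c where "c k x = cutoff (s k *\<^sub>R x)" for k and x :: 'a
  define d where "d k x = of_real (s k) * partial_deriv b cutoff (s k *\<^sub>R x)" for k and x :: 'a
  obtain C D where C: "\<And>x::'a. norm (cutoff x) \<le> C" and D: "\<And>x::'a. norm (partial_deriv b cutoff x) \<le> D"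
    using cutoff_bounds(1) cutoff_bounds(2)[of b] by metis
  have smc: "smooth_gen (c k)" for k
    unfolding c_def[abs_def] by (rule smooth_gen_scale[OF cutoff_smooth_gen s0(2)])
  have smd: "smooth_gen (d k)" for k
    unfolding d_def[abs_def] by (intro smooth_gen_mult smooth_gen_const smooth_gen_scale[OF smooth_gen_partial[OF cutoff_smooth_gen] s0(2)])
  have pc: "partial_deriv b (c k) = d k" for k
    unfolding c_def[abs_def] d_def[abs_def] by (rule partial_deriv_scale[OF cutoff_smooth_gen])
  have mc: "c k \<in> borel_measurable borel" "d k \<in> borel_measurable borel" for k
    using smc smd by (auto intro: smooth_gen_measurable)
  have lc: "(\<lambda>k. c k x) \<longlonglongrightarrow> 1" "norm (c k x) \<le> C" for k x
    using cutoff_one_tendsto C by (auto simp: c_def s_def)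
  have ld: "(\<lambda>k. d k x) \<longlonglongrightarrow> 0" "norm (d k x) \<le> D" for k x
    using cutoff_scaled_tendsto[OF smooth_gen_partial[OF cutoff_smooth_gen] D] by (auto simp: d_def s_def)
  note L1 = tempered_cutoff_tendsto[OF f poly_gauss_partial[OF poly_gauss, of b] mc(1) lc(2,1)]
  note L2 = tempered_cutoff_tendsto[OF f poly_gauss mc(2) ld(2,1)]
  note L3 = tempered_cutoff_tendsto[OF h poly_gauss mc(1) lc(2,1)]
  have eq: "(\<integral>x. f x * (c k x * partial_deriv b \<psi> x) \<partial>lborel) + (\<integral>x. f x * (d k x * \<psi> x) \<partial>lborel) =
    - (\<integral>x. h x * (c k x * \<psi> x) \<partial>lborel)" for k
  proof -
    have "test_function (\<lambda>x. c k x * \<psi> x)"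
      unfolding c_def by (rule test_function_cutoff[OF smooth_gen s0(1)])
    from W[OF this] show ?thesis
      unfolding partial_deriv_mult[OF smc smooth_gen] pc using L1(2)[of k] L2(2)[of k] by (simp add: distrib_left)
  qed
  have "(\<lambda>k. - (\<integral>x. h x * (c k x * \<psi> x) \<partial>lborel)) \<longlonglongrightarrow> (\<integral>x. f x * (1 * partial_deriv b \<psi> x) \<partial>lborel) + (\<integral>x. f x * (0 * \<psi> x) \<partial>lborel)"
    unfolding eq[symmetric] by (intro tendsto_add L1(1) L2(1))
  moreover have "(\<lambda>k. - (\<integral>x. h x * (c k x * \<psi> x) \<partial>lborel)) \<longlonglongrightarrow> - (\<integral>x. h x * (1 * \<psi> x) \<partial>lborel)"
    by (intro tendsto_minus L3(1))
  ultimately show ?thesis using LIMSEQ_unique by fastforce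
qed

text \<open>The same cutting off as in \<open>weak_deriv_poly_gauss\<close>. The two error terms
  contain a first derivative \<open>d\<close> and a second derivative \<open>e\<close> of the
  dilated cutoff, with one and two factors 1 / (k + 1).\<close>

lemma laplacian_poly_gauss:
  fixes f h :: "'a::euclidean_space \<Rightarrow> complex"
  assumes f: "tempered f" and h: "tempered h"
    and W: "\<And>\<psi>. test_function \<psi> \<Longrightarrow> (\<integral>x. f x * laplacian \<psi> x \<partial>lborel) = (\<integral>x. h x * \<psi> x \<partial>lborel)"
    and poly_gauss: "poly_gauss z \<psi>"
  shows "(\<integral>x. f x * laplacian \<psi> x \<partial>lborel) = (\<integral>x. h x * \<psi> x \<partial>lborel)"
proof -
  note smooth_gen = poly_gauss_smooth_gen[OF poly_gauss]
  define s where "s k = 1 / real (Suc k)" for k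
  have s0: "s k > 0" "s k \<noteq> 0" for k by (auto simp: s_def)
  define c where "c k x = cutoff (s k *\<^sub>R x)" for k and x :: 'a
  define d where "d b k x = of_real (s k) * partial_deriv b cutoff (s k *\<^sub>R x)" for b k and x :: 'a
  define e where "e b k x = of_real (s k) * (of_real (s k) * partial_deriv b (partial_deriv b cutoff) (s k *\<^sub>R x))" for b k and x :: 'a
  obtain C where C: "\<And>x::'a. norm (cutoff x) \<le> C" using cutoff_bounds(1) by metis
  have smc: "smooth_gen (c k)" for k
    unfolding c_def[abs_def] by (rule smooth_gen_scale[OF cutoff_smooth_gen s0(2)])
  have smd: "smooth_gen (d b k)" for b k
    unfolding d_def[abs_def] by (intro smooth_gen_mult smooth_gen_const smooth_gen_scale[OF smooth_gen_partial[OF cutoff_smooth_gen] s0(2)])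
  have sme: "smooth_gen (e b k)" for b k
    unfolding e_def[abs_def] by (intro smooth_gen_mult smooth_gen_const smooth_gen_scale[OF smooth_gen_partial[OF smooth_gen_partial[OF cutoff_smooth_gen]] s0(2)])
  have pc: "partial_deriv b (c k) = d b k" for b k
    unfolding c_def[abs_def] d_def[abs_def] by (rule partial_deriv_scale[OF cutoff_smooth_gen])
  have pd: "partial_deriv b (d b k) = e b k" for b k
    unfolding d_def[abs_def] e_def[abs_def]
    by (subst partial_deriv_cmult[OF smooth_gen_scale[OF smooth_gen_partial[OF cutoff_smooth_gen] s0(2)]])
      (simp add: partial_deriv_scale[OF smooth_gen_partial[OF cutoff_smooth_gen]])
  have mc: "c k \<in> borel_measurable borel" "d b k \<in> borel_measurable borel" "e b k \<in> borel_measurable borel" for b k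
    using smc smd sme by (auto intro: smooth_gen_measurable)
  have lc: "(\<lambda>k. c k x) \<longlonglongrightarrow> 1" "norm (c k x) \<le> C" for k x
    using cutoff_one_tendsto C by (auto simp: c_def s_def)
  \<comment> \<open>Integrability and limits are bundled for each direction b, since the bounds on
    the derivatives of the cutoff are obtained for b separately.\<close>
  have B: "\<forall>k. (integrable lborel (\<lambda>x. f x * (c k x * partial_deriv b (partial_deriv b \<psi>) x)) \<and>
      integrable lborel (\<lambda>x. f x * (d b k x * partial_deriv b \<psi> x)) \<and>
      integrable lborel (\<lambda>x. f x * (e b k x * \<psi> x))) \<and>
      ((\<lambda>k. \<integral>x. f x * (c k x * partial_deriv b (partial_deriv b \<psi>) x) \<partial>lborel) \<longlonglongrightarrow> (\<integral>x. f x * (1 * partial_deriv b (partial_deriv b \<psi>) x) \<partial>lborel) \<and>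
      (\<lambda>k. \<integral>x. f x * (d b k x * partial_deriv b \<psi> x) \<partial>lborel) \<longlonglongrightarrow> (\<integral>x. f x * (0 * partial_deriv b \<psi> x) \<partial>lborel) \<and>
      (\<lambda>k. \<integral>x. f x * (e b k x * \<psi> x) \<partial>lborel) \<longlonglongrightarrow> (\<integral>x. f x * (0 * \<psi> x) \<partial>lborel))" for b
  proof -
    obtain D E where D: "\<And>x::'a. norm (partial_deriv b cutoff x) \<le> D" and E: "\<And>x::'a. norm (partial_deriv b (partial_deriv b cutoff) x) \<le> E"
      using cutoff_bounds(2,3)[of b] by metis
    have ld: "(\<lambda>k. d b k x) \<longlonglongrightarrow> 0" "norm (d b k x) \<le> D" for k x
      using cutoff_scaled_tendsto[OF smooth_gen_partial[OF cutoff_smooth_gen] D] by (auto simp: d_def s_def)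
    note E' = cutoff_scaled_tendsto[OF smooth_gen_partial[OF smooth_gen_partial[OF cutoff_smooth_gen]] E]
    have le: "(\<lambda>k. e b k x) \<longlonglongrightarrow> 0" for x
    proof -
      have "(\<lambda>k. e b k x) \<longlonglongrightarrow> of_real 0 * 0"
        unfolding e_def s_def
        by (intro tendsto_mult tendsto_of_real LIMSEQ_inverse_real_of_nat[unfolded inverse_eq_divide] E'(1))
      then show ?thesis by simp
    qed
    have le2: "norm (e b k x) \<le> E" for k x
    proof -
      have "norm (e b k x) \<le> 1 * E"
        unfolding e_def norm_mult[of "of_real (s k)" "of_real (s k) * _"]
        using E'(2)[folded s_def] unfolding norm_of_real by (intro mult_mono) (auto simp: s_def)
      then show ?thesis by simp
    qed
    show ?thesis
      using tempered_cutoff_tendsto[OF f poly_gauss_partial[OF poly_gauss_partial[OF poly_gauss, of b], of b] mc(1) lc(2,1)]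
       tempered_cutoff_tendsto[OF f poly_gauss_partial[OF poly_gauss, of b] mc(2) ld(2,1)]
       tempered_cutoff_tendsto[OF f poly_gauss mc(3) le2 le] by blast
  qed
  note L4 = tempered_cutoff_tendsto[OF h poly_gauss mc(1) lc(2,1)]
  have I: "integrable lborel (\<lambda>x. f x * (c k x * partial_deriv b (partial_deriv b \<psi>) x))"
    "integrable lborel (\<lambda>x. f x * (d b k x * partial_deriv b \<psi> x))"
    "integrable lborel (\<lambda>x. f x * (e b k x * \<psi> x))" for b k using B[of b] by auto
  have lap: "laplacian (\<lambda>x. c k x * \<psi> x) = (\<lambda>x. \<Sum>b\<in>Basis. c k x * partial_deriv b (partial_deriv b \<psi>) x +
     2 * (d b k x * partial_deriv b \<psi> x) + e b k x * \<psi> x)" for k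
  proof -
    have "partial_deriv b (partial_deriv b (\<lambda>x. c k x * \<psi> x)) = (\<lambda>x. c k x * partial_deriv b (partial_deriv b \<psi>) x +
     2 * (d b k x * partial_deriv b \<psi> x) + e b k x * \<psi> x)" for b
      unfolding partial_deriv_mult[OF smc smooth_gen] pc
        partial_deriv_add[OF smooth_gen_mult[OF smc smooth_gen_partial[OF smooth_gen]] smooth_gen_mult[OF smd smooth_gen]]
        partial_deriv_mult[OF smc smooth_gen_partial[OF smooth_gen]] partial_deriv_mult[OF smd smooth_gen] pd
      by (simp add: fun_eq_iff)
    then show ?thesis by (simp add: laplacian_def[abs_def])
  qed
  have eq: "(\<Sum>b\<in>Basis. (\<integral>x. f x * (c k x * partial_deriv b (partial_deriv b \<psi>) x) \<partial>lborel) +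
      2 * (\<integral>x. f x * (d b k x * partial_deriv b \<psi> x) \<partial>lborel) + (\<integral>x. f x * (e b k x * \<psi> x) \<partial>lborel)) =
    (\<integral>x. h x * (c k x * \<psi> x) \<partial>lborel)" for k
  proof -
    have t: "test_function (\<lambda>x. c k x * \<psi> x)"
      unfolding c_def by (rule test_function_cutoff[OF smooth_gen s0(1)])
    have "(\<integral>x. h x * (c k x * \<psi> x) \<partial>lborel) =
     (\<integral>x. (\<Sum>b\<in>Basis. f x * (c k x * partial_deriv b (partial_deriv b \<psi>) x) +
      2 * (f x * (d b k x * partial_deriv b \<psi> x)) + f x * (e b k x * \<psi> x)) \<partial>lborel)"
      unfolding W[OF t, symmetric] lap by (simp add: sum_distrib_left algebra_simps)
    also have "\<dots> = (\<Sum>b\<in>Basis. \<integral>x. f x * (c k x * partial_deriv b (partial_deriv b \<psi>) x) +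
      2 * (f x * (d b k x * partial_deriv b \<psi> x)) + f x * (e b k x * \<psi> x) \<partial>lborel)"
      by (rule Bochner_Integration.integral_sum) (intro Bochner_Integration.integrable_add integrable_mult_right I)
    also have "\<dots> = (\<Sum>b\<in>Basis. (\<integral>x. f x * (c k x * partial_deriv b (partial_deriv b \<psi>) x) \<partial>lborel) +
      2 * (\<integral>x. f x * (d b k x * partial_deriv b \<psi> x) \<partial>lborel) + (\<integral>x. f x * (e b k x * \<psi> x) \<partial>lborel))"
      by (intro sum.cong refl)
        (subst Bochner_Integration.integral_add, (intro Bochner_Integration.integrable_add integrable_mult_right I)+,
         subst Bochner_Integration.integral_add, (intro Bochner_Integration.integrable_add integrable_mult_right I)+, simp)
    finally show ?thesis by simp
  qed
  have "(\<lambda>k. \<integral>x. h x * (c k x * \<psi> x) \<partial>lborel) \<longlonglongrightarrow> (\<Sum>b\<in>Basis. (\<integral>x. f x * (1 * partial_deriv b (partial_deriv b \<psi>) x) \<partial>lborel) +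
      2 * (\<integral>x. f x * (0 * partial_deriv b \<psi> x) \<partial>lborel) + (\<integral>x. f x * (0 * \<psi> x) \<partial>lborel))"
    unfolding eq[symmetric] using B by (intro tendsto_sum tendsto_add tendsto_mult tendsto_const) auto
  from LIMSEQ_unique[OF this L4(1)]
  have "(\<integral>x. h x * \<psi> x \<partial>lborel) = (\<Sum>b\<in>Basis. (\<integral>x. f x * partial_deriv b (partial_deriv b \<psi>) x \<partial>lborel))"
    by simp
  also have "\<dots> = (\<integral>x. (\<Sum>b\<in>Basis. f x * partial_deriv b (partial_deriv b \<psi>) x) \<partial>lborel)"
    by (rule Bochner_Integration.integral_sum[symmetric]) (rule tempered_mult_integrable[OF f poly_gauss_partial[OF poly_gauss_partial[OF poly_gauss]]])
  finally show ?thesis by (simp add: laplacian_def sum_distrib_left)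
qed

section \<open>The heat kernel\<close>

lemma integral_lborel_prod:
  fixes f :: "'a::euclidean_space \<Rightarrow> real \<Rightarrow> complex"
  assumes f: "\<And>b. b \<in> Basis \<Longrightarrow> integrable lborel (f b)"
  shows "integrable lborel (\<lambda>x. \<Prod>b\<in>Basis. f b (x \<bullet> b))"
    and "(\<integral>x. (\<Prod>b\<in>Basis. f b (x \<bullet> b)) \<partial>lborel) = (\<Prod>b\<in>Basis. \<integral>s. f b s \<partial>lborel)"
proof -
  interpret product_sigma_finite "\<lambda>b::'a. lborel :: real measure" ..
  have [measurable]: "f b \<in> borel_measurable borel" if "b \<in> Basis" for b
    using f[OF that] by (auto dest: borel_measurable_integrable)
  have [measurable]: "(\<lambda>g. \<Sum>b\<in>Basis. g b *\<^sub>R b) \<in> (\<Pi>\<^sub>M b\<in>(Basis::'a set). lborel) \<rightarrow>\<^sub>M (borel :: 'a measure)"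
    by measurable
  have m: "(\<lambda>x. \<Prod>b\<in>Basis. f b (x \<bullet> b)) \<in> borel_measurable borel" by measurable
  have eq: "(\<Prod>b\<in>Basis. f b ((\<Sum>b'\<in>Basis. g b' *\<^sub>R b') \<bullet> b)) = (\<Prod>b\<in>Basis. f b (g b))" for g :: "'a \<Rightarrow> real"
    by (intro prod.cong refl) simp
  have "integrable (distr (\<Pi>\<^sub>M b\<in>(Basis::'a set). lborel) borel (\<lambda>g. \<Sum>b\<in>Basis. g b *\<^sub>R b)) (\<lambda>x. \<Prod>b\<in>Basis. f b (x \<bullet> b))"
    by (subst integrable_distr_eq) (use m product_integrable_prod[OF finite_Basis f] in \<open>auto simp: eq\<close>)
  then show "integrable lborel (\<lambda>x. \<Prod>b\<in>Basis. f b (x \<bullet> b))"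
    by (subst lborel_eq)
  have "(\<integral>x. (\<Prod>b\<in>Basis. f b (x \<bullet> b)) \<partial>distr (\<Pi>\<^sub>M b\<in>(Basis::'a set). lborel) borel (\<lambda>g. \<Sum>b\<in>Basis. g b *\<^sub>R b)) = (\<Prod>b\<in>Basis. \<integral>s. f b s \<partial>lborel)"
    by (subst integral_distr) (use m product_integral_prod[OF finite_Basis f] in \<open>auto simp: eq\<close>)
  then show "(\<integral>x. (\<Prod>b\<in>Basis. f b (x \<bullet> b)) \<partial>lborel) = (\<Prod>b\<in>Basis. \<integral>s. f b s \<partial>lborel)"
    by (subst lborel_eq)
qed

text \<open>The substitution s = c x with c = 1 / sqrt(2 e) turns e s^2 into x^2 / 2, so the
  integral becomes the characteristic function of the standard normal distribution.\<close>

lemma gaussian_fourier_real: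
  assumes e: "e > 0"
  shows "integrable lborel (\<lambda>s. exp (\<i> * complex_of_real (y * s)) * complex_of_real (exp (- e * s\<^sup>2)))" (is "integrable lborel ?f")
    and "(\<integral>s. exp (\<i> * complex_of_real (y * s)) * complex_of_real (exp (- e * s\<^sup>2)) \<partial>lborel) =
      complex_of_real (sqrt (pi / e) * exp (- y\<^sup>2 / (4 * e)))"
proof -
  define c where "c = 1 / sqrt (2 * e)"
  have c: "c \<noteq> 0" "c > 0" and c2: "c\<^sup>2 = 1 / (2 * e)"
    using e by (auto simp: c_def power_divide)
  let ?g = "\<lambda>x. std_normal_density x *\<^sub>R exp (\<i> * complex_of_real (y * c * x))"
  have eq: "?f (0 + c * x) = complex_of_real (sqrt (2 * pi)) * ?g x" for x
  proof -
    have "e * (c * x)\<^sup>2 = x\<^sup>2 / 2" using e by (simp add: power_mult_distrib c2)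
    then show ?thesis by (simp add: std_normal_density_def scaleR_conv_of_real mult.assoc)
  qed
  have ig: "integrable lborel ?g"
  proof (rule Bochner_Integration.integrable_bound[where f=std_normal_density])
    show "integrable lborel std_normal_density" by simp
  qed (auto simp: normal_density_nonneg)
  have "(\<integral>x. ?g x \<partial>lborel) = char std_normal_distribution (y * c)"
    unfolding char_def by (subst integral_density) (auto simp: normal_density_nonneg)
  then have g: "(\<integral>x. ?g x \<partial>lborel) = complex_of_real (exp (- (y * c)\<^sup>2 / 2))"
    by (simp add: char_std_normal_distribution)
  have "integrable lborel (\<lambda>x. ?f (0 + c * x))"
    unfolding eq by (intro integrable_mult_right ig)
  then show "integrable lborel ?f"
    using lborel_integrable_real_affine_iff[OF c(1), of ?f 0] by simp
  have "(\<integral>x. ?f x \<partial>lborel) = c *\<^sub>R (\<integral>x. ?f (0 + c * x) \<partial>lborel)"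
    using lborel_integral_real_affine[OF c(1), of ?f 0] c(2) by simp
  also have "\<dots> = c *\<^sub>R (complex_of_real (sqrt (2 * pi)) * complex_of_real (exp (- (y * c)\<^sup>2 / 2)))"
    unfolding eq by (simp only: integral_mult_right_zero g)
  also have "\<dots> = complex_of_real ((c * sqrt (2 * pi)) * exp (- (y * c)\<^sup>2 / 2))"
    by (simp add: scaleR_conv_of_real)
  also have "c * sqrt (2 * pi) = sqrt (pi / e)"
    using e by (simp add: c_def real_sqrt_divide real_sqrt_mult)
  also have "- (y * c)\<^sup>2 / 2 = - y\<^sup>2 / (4 * e)"
    by (simp add: power_mult_distrib c2)
  finally show "(\<integral>x. ?f x \<partial>lborel) = complex_of_real (sqrt (pi / e) * exp (- y\<^sup>2 / (4 * e)))" .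
qed

definition heat_kernel :: "real \<Rightarrow> 'a::euclidean_space \<Rightarrow> real" where
  "heat_kernel t x = (4 * pi * t) powr (- real DIM('a) / 2) * exp (- (norm x)\<^sup>2 / (4 * t))"

lemma exp_prod_Basis:
  fixes x z :: "'a::euclidean_space"
  shows "(\<Prod>b\<in>Basis. exp (\<i> * complex_of_real ((z \<bullet> b) * (x \<bullet> b))) * complex_of_real (exp (- e * (x \<bullet> b)\<^sup>2))) =
    exp (\<i> * complex_of_real (z \<bullet> x)) * complex_of_real (exp (- e * (norm x)\<^sup>2))"
proof -
  have "(norm x)\<^sup>2 = (\<Sum>b\<in>Basis. (x \<bullet> b)\<^sup>2)"
    unfolding power2_norm_eq_inner by (subst euclidean_inner) (simp add: power2_eq_square)
  then show ?thesis
    by (simp add: prod.distrib exp_sum[symmetric] euclidean_inner[of z x] sum_distrib_left of_real_exp[symmetric]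
      flip: of_real_prod)
qed

text \<open>The parameter e of the Gaussian reappears as the time of the heat kernel. This identity
  links Gaussian regularisation in frequency with the heat flow in space.\<close>

lemma gaussian_fourier:
  fixes z :: "'a::euclidean_space"
  assumes e: "e > 0"
  shows "integrable lborel (\<lambda>x::'a. exp (\<i> * complex_of_real (z \<bullet> x)) * complex_of_real (exp (- e * (norm x)\<^sup>2)))"
    and "(\<integral>x. exp (\<i> * complex_of_real (z \<bullet> x)) * complex_of_real (exp (- e * (norm x)\<^sup>2)) \<partial>lborel) =
      complex_of_real ((2 * pi) ^ DIM('a) * heat_kernel e z)"
proof -
  note 1 = integral_lborel_prod[of "\<lambda>b s. exp (\<i> * complex_of_real ((z \<bullet> b) * s)) * complex_of_real (exp (- e * s\<^sup>2))",
    OF gaussian_fourier_real(1)[OF e]]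
  show "integrable lborel (\<lambda>x::'a. exp (\<i> * complex_of_real (z \<bullet> x)) * complex_of_real (exp (- e * (norm x)\<^sup>2)))"
    using 1(1) unfolding exp_prod_Basis .
  have n: "(norm z)\<^sup>2 = (\<Sum>b\<in>Basis. (z \<bullet> b)\<^sup>2)"
    unfolding power2_norm_eq_inner by (subst euclidean_inner) (simp add: power2_eq_square)
  have "sqrt (pi / e) ^ DIM('a) = (pi / e) powr (real DIM('a) / 2)"
    using e by (simp add: powr_half_sqrt[symmetric] powr_powr flip: powr_realpow)
  also have "(pi / e) powr (real DIM('a) / 2) = ((2 * pi)\<^sup>2 / (4 * pi * e)) powr (real DIM('a) / 2)"
    using e by (simp add: power2_eq_square field_simps)
  also have "\<dots> = ((2 * pi)\<^sup>2) powr (real DIM('a) / 2) / (4 * pi * e) powr (real DIM('a) / 2)"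
    by (rule powr_divide)
  also have "((2 * pi)\<^sup>2) powr (real DIM('a) / 2) = (2 * pi) powr (real DIM('a))"
  proof -
    have "((2 * pi)\<^sup>2) powr (real DIM('a) / 2) = ((2 * pi) powr 2) powr (real DIM('a) / 2)"
      by (subst powr_numeral) auto
    then show ?thesis by (simp only: powr_powr) simp
  qed
  also have "\<dots> = (2 * pi) ^ DIM('a)" by (simp add: powr_realpow)
  also have "(2 * pi) ^ DIM('a) / (4 * pi * e) powr (real DIM('a) / 2) = (2 * pi) ^ DIM('a) * (4 * pi * e) powr (- real DIM('a) / 2)"
    by (simp only: minus_divide_left[symmetric] powr_minus divide_inverse[of "_ ^ _"])
  finally have c: "sqrt (pi / e) ^ DIM('a) = (2 * pi) ^ DIM('a) * (4 * pi * e) powr (- real DIM('a) / 2)" .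
  have "(\<integral>x. exp (\<i> * complex_of_real (z \<bullet> x)) * complex_of_real (exp (- e * (norm x)\<^sup>2)) \<partial>lborel) =
    (\<Prod>b\<in>(Basis::'a set). complex_of_real (sqrt (pi / e) * exp (- (z \<bullet> b)\<^sup>2 / (4 * e))))"
    using 1(2) unfolding exp_prod_Basis gaussian_fourier_real(2)[OF e] .
  also have "\<dots> = complex_of_real (sqrt (pi / e) ^ DIM('a) * (\<Prod>b\<in>(Basis::'a set). exp (- (z \<bullet> b)\<^sup>2 / (4 * e))))"
    by (simp add: prod.distrib flip: of_real_prod)
  also have "(\<Prod>b\<in>(Basis::'a set). exp (- (z \<bullet> b)\<^sup>2 / (4 * e))) = exp (- (norm z)\<^sup>2 / (4 * e))"
    by (simp add: n exp_sum[symmetric] sum_divide_distrib sum_negf)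
  finally show "(\<integral>x. exp (\<i> * complex_of_real (z \<bullet> x)) * complex_of_real (exp (- e * (norm x)\<^sup>2)) \<partial>lborel) =
      complex_of_real ((2 * pi) ^ DIM('a) * heat_kernel e z)"
    unfolding c heat_kernel_def by (simp add: mult.assoc)
qed

lemma heat_kernel_nonneg [simp]: "0 \<le> heat_kernel t x"
  by (simp add: heat_kernel_def)

lemma heat_kernel_measurable [measurable]: "heat_kernel t \<in> borel_measurable borel"
  unfolding heat_kernel_def by measurable

lemma heat_kernel_measurable2 [measurable (raw)]:
  assumes [measurable]: "f \<in> borel_measurable M" "g \<in> M \<rightarrow>\<^sub>M borel"
  shows "(\<lambda>p. heat_kernel (f p) (g p)) \<in> borel_measurable M"
  unfolding heat_kernel_def by measurable

lemma heat_kernel_le: "heat_kernel t (x :: 'a::euclidean_space) \<le> (4 * pi * t) powr (- real DIM('a) / 2)" if "t > 0"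
  using that by (simp add: heat_kernel_def mult_le_cancel_left1)

lemma heat_kernel_integral:
  assumes t: "t > 0"
  shows "integrable lborel (heat_kernel t :: 'a::euclidean_space \<Rightarrow> real)" "(\<integral>x. heat_kernel t (x::'a) \<partial>lborel) = 1"
    "(\<integral>\<^sup>+x. ennreal (heat_kernel t (x::'a)) \<partial>lborel) = 1"
proof -
  let ?c = "(4 * pi * t) powr (- real DIM('a) / 2)"
  \<comment> \<open>The kernel is a multiple of the Gaussian with parameter 1 / (4 t), whose
    integral is its Fourier integral at frequency 0.\<close>
  note g = gaussian_fourier[of "1 / (4 * t)" "0::'a"]
  have eq: "complex_of_real (heat_kernel t x) = complex_of_real ?c *
    (exp (\<i> * complex_of_real (0 \<bullet> x)) * complex_of_real (exp (- (1 / (4 * t)) * (norm x)\<^sup>2)))" for x :: 'a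
    by (simp add: heat_kernel_def)
  have "integrable lborel (\<lambda>x. complex_of_real (heat_kernel t (x::'a)))"
    unfolding eq using t g(1) by (intro integrable_mult_right) auto
  then show i: "integrable lborel (heat_kernel t :: 'a \<Rightarrow> real)"
    by (simp add: complex_of_real_integrable_eq)
  have "complex_of_real (\<integral>x. heat_kernel t (x::'a) \<partial>lborel) = (\<integral>x. complex_of_real (heat_kernel t (x::'a)) \<partial>lborel)"
    by simp
  also have "\<dots> = complex_of_real ?c * complex_of_real ((2 * pi) ^ DIM('a) * heat_kernel (1 / (4 * t)) (0::'a))"
    unfolding eq using t g(2) by (subst integral_mult_right_zero) simp
  also have "\<dots> = complex_of_real (?c * ((2 * pi) ^ DIM('a) * (pi / t) powr (- real DIM('a) / 2)))"
    by (simp add: heat_kernel_def)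
  also have "?c * ((2 * pi) ^ DIM('a) * (pi / t) powr (- real DIM('a) / 2)) = 1"
  proof -
    have "?c * (pi / t) powr (- real DIM('a) / 2) = ((4 * pi * t) * (pi / t)) powr (- real DIM('a) / 2)"
      by (rule powr_mult[symmetric])
    also have "(4 * pi * t) * (pi / t) = (2 * pi) powr 2" using t by (simp add: power2_eq_square)
    also have "\<dots> powr (- real DIM('a) / 2) = (2 * pi) powr (- real DIM('a))" by (simp add: powr_powr del: powr_numeral)
    also have "\<dots> = 1 / (2 * pi) ^ DIM('a)" by (simp add: powr_minus powr_realpow divide_inverse)
    finally show ?thesis by (simp add: field_simps)
  qed
  finally show r: "(\<integral>x. heat_kernel t (x::'a) \<partial>lborel) = 1" by (simp only: of_real_eq_iff)
  show "(\<integral>\<^sup>+x. ennreal (heat_kernel t (x::'a)) \<partial>lborel) = 1"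
    using nn_integral_eq_integral[OF i] r by simp
qed

section \<open>Convolution with the heat kernel on L1 and L2\<close>

lemma nn_integral_heat_kernel_diff:
  fixes x :: "'a::euclidean_space"
  assumes t: "t > 0"
  shows "(\<integral>\<^sup>+y. ennreal (heat_kernel t (x - y)) \<partial>lborel) = 1" "(\<integral>\<^sup>+y. ennreal (heat_kernel t (y - x)) \<partial>lborel) = 1"
  using nn_integral_lborel_reflect[of "\<lambda>y. ennreal (heat_kernel t y)" x]
    nn_integral_lborel_translate[of "\<lambda>y. ennreal (heat_kernel t y)" x] heat_kernel_integral(3)[OF t, where 'a='a] by simp_all

lemma heat_kernel_diff_L2: "t > 0 \<Longrightarrow> (\<lambda>y. complex_of_real (heat_kernel t (x - y))) \<in> L2"
proof (rule L2_bound)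
  assume t: "t > 0"
  show "integrable lborel (\<lambda>y. (4 * pi * t) powr (- real DIM('a) / 2) * heat_kernel t (x - y))"
    by (intro integrable_mult_right integrable_lborel_reflect heat_kernel_integral t)
  show "(norm (complex_of_real (heat_kernel t (x - y))))\<^sup>2 \<le> (4 * pi * t) powr (- real DIM('a) / 2) * heat_kernel t (x - y)" for y
    using heat_kernel_le[OF t, of "x - y"] by (simp add: power2_eq_square mult_right_mono)
qed measurable

text \<open>The convolution for functions with values in the extended nonnegative numbers. It needs
  no integrability, and all estimates of \<open>heat_conv\<close> pass through it.\<close>

definition heat_nn :: "real \<Rightarrow> ('a::euclidean_space \<Rightarrow> ennreal) \<Rightarrow> 'a \<Rightarrow> ennreal" where
  "heat_nn t w x = (\<integral>\<^sup>+y. ennreal (heat_kernel t (x - y)) * w y \<partial>lborel)"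

definition heat_conv :: "real \<Rightarrow> ('a::euclidean_space \<Rightarrow> complex) \<Rightarrow> 'a \<Rightarrow> complex" where
  "heat_conv t f x = (\<integral>y. complex_of_real (heat_kernel t (x - y)) * f y \<partial>lborel)"

lemma heat_nn_measurable [measurable]:
  assumes [measurable]: "w \<in> borel_measurable borel"
  shows "heat_nn t w \<in> borel_measurable borel"
  unfolding heat_nn_def by measurable

lemma heat_conv_measurable [measurable]:
  assumes [measurable]: "f \<in> borel_measurable borel"
  shows "heat_conv t f \<in> borel_measurable borel"
  unfolding heat_conv_def by measurable

lemma heat_nn_mono: "(\<And>y. w y \<le> v y) \<Longrightarrow> heat_nn t w x \<le> heat_nn t v x"
  unfolding heat_nn_def by (intro nn_integral_mono mult_left_mono) auto

lemma nn_integral_heat_nn: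
  assumes [measurable]: "w \<in> borel_measurable borel" and t: "t > 0"
  shows "(\<integral>\<^sup>+x. heat_nn t w x \<partial>lborel) = (\<integral>\<^sup>+x. w x \<partial>lborel)"
proof -
  have "(\<integral>\<^sup>+x. heat_nn t w x \<partial>lborel) = (\<integral>\<^sup>+y. \<integral>\<^sup>+x. ennreal (heat_kernel t (x - y)) * w y \<partial>lborel \<partial>lborel)"
    unfolding heat_nn_def by (rule lborel_pair.Fubini') measurable
  also have "\<dots> = (\<integral>\<^sup>+y. w y \<partial>lborel)"
    by (simp add: nn_integral_multc nn_integral_heat_kernel_diff[OF t])
  finally show ?thesis .
qed

lemma norm_integral_le_nn_integral:
  fixes f :: "'b \<Rightarrow> 'c::{banach, second_countable_topology}"
  shows "ennreal (norm (\<integral>x. f x \<partial>M)) \<le> (\<integral>\<^sup>+x. ennreal (norm (f x)) \<partial>M)"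
  by (cases "integrable M f") (auto intro: integral_norm_bound_ennreal simp: not_integrable_integral_eq)

lemma norm_heat_conv_le: "ennreal (norm (heat_conv t f x)) \<le> heat_nn t (\<lambda>y. ennreal (norm (f y))) x"
  unfolding heat_conv_def heat_nn_def
  using norm_integral_le_nn_integral[of lborel "\<lambda>y. complex_of_real (heat_kernel t (x - y)) * f y"]
  by (simp add: norm_mult ennreal_mult)

lemma heat_conv_integrable_L1:
  assumes f: "integrable lborel f" and t: "t > 0"
  shows "integrable lborel (\<lambda>y. complex_of_real (heat_kernel t (x - y)) * f y)"
proof (rule Bochner_Integration.integrable_bound)
  show "integrable lborel (\<lambda>y. (4 * pi * t) powr (- real DIM('a) / 2) * norm (f y))"
    using f by simp
  show "AE y in lborel. norm (complex_of_real (heat_kernel t (x - y)) * f y) \<le> norm ((4 * pi * t) powr (- real DIM('a) / 2) * norm (f y))"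
    using heat_kernel_le[OF t, of "x - _"] by (auto simp: norm_mult intro!: mult_right_mono)
qed (use f in measurable)

lemma heat_conv_integrable_L2:
  assumes f: "f \<in> L2" and t: "t > 0"
  shows "integrable lborel (\<lambda>y. complex_of_real (heat_kernel t (x - y)) * f y)"
  by (rule L2_mult_integrable[OF heat_kernel_diff_L2[OF t] f])

lemma heat_conv_L1:
  assumes f: "integrable lborel f" and t: "t > 0"
  shows "integrable lborel (heat_conv t f)" "(\<integral>x. norm (heat_conv t f x) \<partial>lborel) \<le> (\<integral>x. norm (f x) \<partial>lborel)"
proof -
  have [measurable]: "f \<in> borel_measurable borel" using f by (auto dest: borel_measurable_integrable)
  have "(\<integral>\<^sup>+x. ennreal (norm (heat_conv t f x)) \<partial>lborel) \<le> (\<integral>\<^sup>+x. heat_nn t (\<lambda>y. ennreal (norm (f y))) x \<partial>lborel)"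
    by (intro nn_integral_mono norm_heat_conv_le)
  also have "\<dots> = (\<integral>\<^sup>+x. ennreal (norm (f x)) \<partial>lborel)"
    using t by (intro nn_integral_heat_nn) auto
  also have "\<dots> = ennreal (\<integral>x. norm (f x) \<partial>lborel)"
    using f by (intro nn_integral_eq_integral) auto
  finally have le: "(\<integral>\<^sup>+x. ennreal (norm (heat_conv t f x)) \<partial>lborel) \<le> ennreal (\<integral>x. norm (f x) \<partial>lborel)" .
  then show i: "integrable lborel (heat_conv t f)"
    unfolding integrable_iff_bounded by (auto intro: le_less_trans)
  have "(\<integral>\<^sup>+x. ennreal (norm (heat_conv t f x)) \<partial>lborel) = ennreal (\<integral>x. norm (heat_conv t f x) \<partial>lborel)"
    using i by (intro nn_integral_eq_integral) auto
  then show "(\<integral>x. norm (heat_conv t f x) \<partial>lborel) \<le> (\<integral>x. norm (f x) \<partial>lborel)"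
    using le by (simp add: ennreal_le_iff)
qed

text \<open>Jensen's inequality for the square, obtained from the Cauchy-Schwarz inequality by
  splitting the kernel, a probability density in y, into two square roots.\<close>

lemma heat_conv_sq_le:
  assumes f: "f \<in> L2" and t: "t > 0"
  shows "ennreal ((norm (heat_conv t f x))\<^sup>2) \<le> heat_nn t (\<lambda>y. ennreal ((norm (f y))\<^sup>2)) x"
proof -
  have [measurable]: "f \<in> borel_measurable borel" using f by auto
  define u where "u y = complex_of_real (sqrt (heat_kernel t (x - y)))" for y
  have um [measurable]: "u \<in> borel_measurable borel" unfolding u_def by measurable
  have iu: "integrable lborel (\<lambda>y. heat_kernel t (x - y))"
    by (intro integrable_lborel_reflect heat_kernel_integral t)
  have u: "u \<in> L2"
    by (rule L2_bound[OF um iu]) (simp add: u_def)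
  have su: "sq u = 1"
    using nn_integral_eq_integral[OF iu] nn_integral_heat_kernel_diff(1)[OF t, of x] by (simp add: sq_def u_def)
  have iv: "integrable lborel (\<lambda>y. heat_kernel t (x - y) * (norm (f y))\<^sup>2)"
    using heat_conv_integrable_L1[of "\<lambda>y. complex_of_real ((norm (f y))\<^sup>2)" t x] L2_integrable[OF f] t
    by (simp add: complex_of_real_integrable_eq flip: of_real_mult of_real_power)
  have v: "(\<lambda>y. u y * f y) \<in> L2"
    by (rule L2_bound[OF _ iv]) (auto simp: u_def norm_mult power_mult_distrib)
  have "norm (heat_conv t f x) = norm (\<integral>y. u y * (u y * f y) \<partial>lborel)"
    unfolding heat_conv_def u_def by (simp add: mult.assoc[symmetric] flip: of_real_mult)
  also have "\<dots> \<le> sqrt (sq u) * sqrt (sq (\<lambda>y. u y * f y))"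
    by (rule L2_integral_mult_le[OF u v])
  also have "sq (\<lambda>y. u y * f y) = (\<integral>y. heat_kernel t (x - y) * (norm (f y))\<^sup>2 \<partial>lborel)"
    by (simp add: sq_def u_def norm_mult power_mult_distrib)
  finally have "norm (heat_conv t f x) \<le> sqrt (\<integral>y. heat_kernel t (x - y) * (norm (f y))\<^sup>2 \<partial>lborel)"
    by (simp add: su)
  then have "(norm (heat_conv t f x))\<^sup>2 \<le> (\<integral>y. heat_kernel t (x - y) * (norm (f y))\<^sup>2 \<partial>lborel)"
    using power_mono[OF _ norm_ge_zero, of "heat_conv t f x" "sqrt (\<integral>y. heat_kernel t (x - y) * (norm (f y))\<^sup>2 \<partial>lborel)" 2] by simp
  then have "ennreal ((norm (heat_conv t f x))\<^sup>2) \<le> ennreal (\<integral>y. heat_kernel t (x - y) * (norm (f y))\<^sup>2 \<partial>lborel)"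
    by (rule ennreal_leI)
  also have "\<dots> = heat_nn t (\<lambda>y. ennreal ((norm (f y))\<^sup>2)) x"
    unfolding heat_nn_def using nn_integral_eq_integral[OF iv] by (simp add: ennreal_mult)
  finally show ?thesis .
qed

lemma heat_conv_L2:
  assumes f: "f \<in> L2" and t: "t > 0"
  shows "heat_conv t f \<in> L2" "sq (heat_conv t f) \<le> sq f"
proof -
  have [measurable]: "f \<in> borel_measurable borel" using f by auto
  have "(\<integral>\<^sup>+x. ennreal ((norm (heat_conv t f x))\<^sup>2) \<partial>lborel) \<le> (\<integral>\<^sup>+x. heat_nn t (\<lambda>y. ennreal ((norm (f y))\<^sup>2)) x \<partial>lborel)"
    by (intro nn_integral_mono heat_conv_sq_le f t)
  also have "\<dots> = (\<integral>\<^sup>+x. ennreal ((norm (f x))\<^sup>2) \<partial>lborel)"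
    using t by (intro nn_integral_heat_nn) auto
  also have "\<dots> = ennreal (sq f)" by (rule nn_integral_sq[OF f])
  finally have le: "(\<integral>\<^sup>+x. ennreal ((norm (heat_conv t f x))\<^sup>2) \<partial>lborel) \<le> ennreal (sq f)" .
  then show i: "heat_conv t f \<in> L2"
    unfolding L2_iff_nn_integral by (auto intro: le_less_trans)
  show "sq (heat_conv t f) \<le> sq f"
    using le unfolding nn_integral_sq[OF i] by (simp add: ennreal_le_iff)
qed

lemma heat_conv_diff_L1:
  assumes "integrable lborel f" "integrable lborel g" "t > 0"
  shows "heat_conv t (\<lambda>x. f x - g x) x = heat_conv t f x - heat_conv t g x"
  using heat_conv_integrable_L1[OF assms(1,3)] heat_conv_integrable_L1[OF assms(2,3)]
  by (simp add: heat_conv_def right_diff_distrib)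

lemma heat_conv_diff_L2:
  assumes "f \<in> L2" "g \<in> L2" "t > 0"
  shows "heat_conv t (\<lambda>x. f x - g x) x = heat_conv t f x - heat_conv t g x"
  using heat_conv_integrable_L2[OF assms(1,3)] heat_conv_integrable_L2[OF assms(2,3)]
  by (simp add: heat_conv_def right_diff_distrib)

section \<open>The heat semigroup as an approximate identity\<close>

lemma powr_double_half:
  assumes "t > 0"
  shows "(4 * pi * t) powr (- real d / 2) = 2 powr (real d / 2) * (4 * pi * (2 * t)) powr (- real d / 2)"
proof -
  have "(4 * pi * (2 * t)) powr (- real d / 2) = (2 * (4 * pi * t)) powr (- real d / 2)"
    by (simp add: algebra_simps)
  also have "\<dots> = 2 powr (- real d / 2) * (4 * pi * t) powr (- real d / 2)"
    using assms by (subst powr_mult) auto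
  finally have 1: "(4 * pi * (2 * t)) powr (- real d / 2) = 2 powr (- real d / 2) * (4 * pi * t) powr (- real d / 2)" .
  have 2: "2 powr (real d / 2) * 2 powr (- real d / 2) = (1::real)"
    by (subst powr_add[symmetric]) simp
  have "X = a * (b * X)" if "a * b = 1" for a b X :: real
    using that by (simp add: mult.assoc[symmetric])
  from this[OF 2] show ?thesis unfolding 1 .
qed

text \<open>Half of the exponent provides the small factor. The other half is the exponent of the
  kernel at time 2t, which has integral 1; the power of 2 compensates the change of
  normalisation.\<close>

lemma heat_kernel_tail:
  fixes x :: "'a::euclidean_space"
  assumes t: "t > 0" and x: "norm x \<ge> r" "r \<ge> 0"
  shows "heat_kernel t x \<le> 2 powr (real DIM('a) / 2) * exp (- r\<^sup>2 / (8 * t)) * heat_kernel (2 * t) x"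
proof -
  let ?c = "2 powr (real DIM('a) / 2) * (4 * pi * (2 * t)) powr (- real DIM('a) / 2)"
  have "exp (- (norm x)\<^sup>2 / (4 * t)) = exp (- (norm x)\<^sup>2 / (8 * t)) * exp (- (norm x)\<^sup>2 / (4 * (2 * t)))"
    using t by (simp flip: exp_add add: field_simps)
  also have "\<dots> \<le> exp (- r\<^sup>2 / (8 * t)) * exp (- (norm x)\<^sup>2 / (4 * (2 * t)))"
    using t x by (intro mult_right_mono) (auto simp: divide_right_mono power_mono)
  finally have e: "exp (- (norm x)\<^sup>2 / (4 * t)) \<le> exp (- r\<^sup>2 / (8 * t)) * exp (- (norm x)\<^sup>2 / (4 * (2 * t)))" .
  have "heat_kernel t x = ?c * exp (- (norm x)\<^sup>2 / (4 * t))"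
    by (simp only: heat_kernel_def powr_double_half[OF t, of "DIM('a)"])
  also have "\<dots> \<le> ?c * (exp (- r\<^sup>2 / (8 * t)) * exp (- (norm x)\<^sup>2 / (4 * (2 * t))))"
    by (intro mult_left_mono e) auto
  finally show ?thesis by (simp only: heat_kernel_def mult_ac)
qed

definition inv_Suc :: "nat \<Rightarrow> real" where "inv_Suc k = 1 / real (Suc k)"

lemma inv_Suc_pos [simp]: "inv_Suc k > 0" by (simp add: inv_Suc_def)

lemma inv_Suc_tendsto: "inv_Suc \<longlonglongrightarrow> 0"
  using LIMSEQ_inverse_real_of_nat by (simp add: inv_Suc_def[abs_def] inverse_eq_divide)

lemma exp_inv_Suc_tendsto:
  assumes "r > 0"
  shows "(\<lambda>k. exp (- r\<^sup>2 / (8 * inv_Suc k))) \<longlonglongrightarrow> 0"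
proof (rule tendsto_sandwich[OF _ _ tendsto_const])
  have "exp (- r\<^sup>2 / (8 * inv_Suc k)) \<le> 8 / r\<^sup>2 * inv_Suc k" for k
  proof -
    define y where "y = r\<^sup>2 / (8 * inv_Suc k)"
    have y: "y > 0" using assms by (simp add: y_def)
    have "y \<le> exp y" using exp_ge_add_one_self[of y] by linarith
    then have "inverse (exp y) \<le> inverse y" using y by (intro le_imp_inverse_le)
    then show ?thesis by (simp add: y_def exp_minus)
  qed
  then show "\<forall>\<^sub>F k in sequentially. exp (- r\<^sup>2 / (8 * inv_Suc k)) \<le> 8 / r\<^sup>2 * inv_Suc k" by simp
  show "(\<lambda>k. 8 / r\<^sup>2 * inv_Suc k) \<longlonglongrightarrow> 0"
    using tendsto_mult[OF tendsto_const inv_Suc_tendsto, of "8 / r\<^sup>2"] by simp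
qed auto

text \<open>Only points at distance at least r from x contribute. There the tail bound applies, and
  after integration only a constant times exp(-r^2 / (8 t)) remains.\<close>

lemma heat_conv_indicator_open_tendsto:
  assumes U: "open U" "x \<in> U"
  shows "(\<lambda>k. heat_nn (inv_Suc k) (indicator (- U)) x) \<longlonglongrightarrow> 0"
proof -
  obtain r where r: "r > 0" "ball x r \<subseteq> U" using U by (auto simp: open_contains_ball)
  let ?C = "2 powr (real DIM('a) / 2)"
  have le: "heat_nn (inv_Suc k) (indicator (- U)) x \<le> ennreal (?C * exp (- r\<^sup>2 / (8 * inv_Suc k)))" for k
  proof -
    have "heat_nn (inv_Suc k) (indicator (- U)) x \<le> (\<integral>\<^sup>+y. ennreal (?C * exp (- r\<^sup>2 / (8 * inv_Suc k))) * ennreal (heat_kernel (2 * inv_Suc k) (x - y)) \<partial>lborel)"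
      unfolding heat_nn_def
    proof (rule nn_integral_mono)
      fix y
      show "ennreal (heat_kernel (inv_Suc k) (x - y)) * indicator (- U) y \<le> ennreal (?C * exp (- r\<^sup>2 / (8 * inv_Suc k))) * ennreal (heat_kernel (2 * inv_Suc k) (x - y))"
      proof (cases "y \<in> U")
        case False
        then have "norm (x - y) \<ge> r" using r(2) by (auto simp: dist_norm subset_eq not_less)
        from heat_kernel_tail[OF inv_Suc_pos this] r(1) show ?thesis
          using False by (simp add: ennreal_leI flip: ennreal_mult)
      qed simp
    qed
    also have "\<dots> = ennreal (?C * exp (- r\<^sup>2 / (8 * inv_Suc k)))"
      by (subst nn_integral_cmult) (auto simp: nn_integral_heat_kernel_diff)
    finally show ?thesis .
  qed
  have "(\<lambda>k. ennreal (?C * exp (- r\<^sup>2 / (8 * inv_Suc k)))) \<longlonglongrightarrow> ennreal (?C * 0)"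
    by (intro tendsto_ennrealI tendsto_mult tendsto_const exp_inv_Suc_tendsto r(1))
  then have l: "(\<lambda>k. ennreal (?C * exp (- r\<^sup>2 / (8 * inv_Suc k)))) \<longlonglongrightarrow> 0" by simp
  show ?thesis
    by (rule tendsto_sandwich[OF always_eventually always_eventually tendsto_const l]) (simp_all only: le zero_le simp_thms)
qed

definition norm_L1 :: "('a::euclidean_space \<Rightarrow> complex) \<Rightarrow> real" where
  "norm_L1 f = (\<integral>x. norm (f x) \<partial>lborel)"

lemma integrable_indicator_complex:
  assumes "A \<in> sets M" "emeasure M A < \<infinity>"
  shows "integrable M (indicator A :: 'b \<Rightarrow> complex)"
proof -
  have "integrable M (\<lambda>x. complex_of_real (indicator A x))"
    using assms by (intro integrable_of_real integrable_real_indicator)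
  moreover have "(\<lambda>x. complex_of_real (indicator A x)) = indicator A"
    by (auto simp: indicator_def)
  ultimately show ?thesis by simp
qed

lemma norm_L1_nonneg: "0 \<le> norm_L1 f" by (simp add: norm_L1_def)

lemma norm_L1_triangle:
  assumes "integrable lborel f" "integrable lborel g" "integrable lborel h"
  shows "norm_L1 (\<lambda>x. f x - g x) \<le> norm_L1 (\<lambda>x. f x - h x) + norm_L1 (\<lambda>x. h x - g x)"
proof -
  have "norm_L1 (\<lambda>x. f x - g x) \<le> (\<integral>x. norm (f x - h x) + norm (h x - g x) \<partial>lborel)"
    unfolding norm_L1_def
  proof (rule integral_mono)
    show "norm (f x - g x) \<le> norm (f x - h x) + norm (h x - g x)" for x
      using norm_triangle_ineq[of "f x - h x" "h x - g x"] by simp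
  qed (use assms in auto)
  also have "\<dots> = norm_L1 (\<lambda>x. f x - h x) + norm_L1 (\<lambda>x. h x - g x)"
    unfolding norm_L1_def using assms by simp
  finally show ?thesis .
qed

lemma norm_L1_commute: "norm_L1 (\<lambda>x. f x - g x) = norm_L1 (\<lambda>x. g x - f x)"
  by (simp add: norm_L1_def norm_minus_commute)

text \<open>Because the heat semigroup contracts L1, replacing f by g costs twice their distance.
  This transfers convergence from a dense class.\<close>

lemma norm_L1_heat_conv_approx:
  assumes f: "integrable lborel f" and g: "integrable lborel g" and t: "t > 0"
  shows "norm_L1 (\<lambda>x. heat_conv t f x - f x) \<le> 2 * norm_L1 (\<lambda>x. f x - g x) + norm_L1 (\<lambda>x. heat_conv t g x - g x)"
proof -
  have 1: "norm_L1 (\<lambda>x. heat_conv t f x - heat_conv t g x) \<le> norm_L1 (\<lambda>x. f x - g x)"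
    unfolding norm_L1_def heat_conv_diff_L1[OF f g t, symmetric] by (intro heat_conv_L1(2) t) (use f g in simp)
  have 2: "norm_L1 (\<lambda>x. heat_conv t f x - f x) \<le> norm_L1 (\<lambda>x. heat_conv t f x - heat_conv t g x) + norm_L1 (\<lambda>x. heat_conv t g x - f x)"
    by (intro norm_L1_triangle heat_conv_L1 f g t)
  have 3: "norm_L1 (\<lambda>x. heat_conv t g x - f x) \<le> norm_L1 (\<lambda>x. heat_conv t g x - g x) + norm_L1 (\<lambda>x. g x - f x)"
    by (intro norm_L1_triangle heat_conv_L1 f g t)
  show ?thesis using 1 2 3 norm_L1_commute[of f g] by linarith
qed

text \<open>Since the heat kernel preserves the integral, only the loss of mass inside \<open>U\<close> has to be estimated.\<close>

lemma heat_conv_open_L1_tendsto: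
  fixes U :: "'a::euclidean_space set"
  assumes U: "open U" "emeasure lborel U < \<infinity>"
  shows "(\<lambda>k. norm_L1 (\<lambda>x. heat_conv (inv_Suc k) (indicator U) x - indicator U x)) \<longlonglongrightarrow> 0"
proof -
  have [measurable]: "U \<in> sets borel" using U(1) by simp
  have iU: "integrable lborel (indicator U :: 'a \<Rightarrow> complex)" using U by (intro integrable_indicator_complex) auto
  define w where "w k x = heat_nn (inv_Suc k) (indicator (- U)) x" for k x
  have [measurable]: "w k \<in> borel_measurable borel" for k unfolding w_def by measurable
  have sum1: "heat_nn (inv_Suc k) (indicator U) x + w k x = 1" for k x
  proof -
    have "heat_nn (inv_Suc k) (indicator U) x + w k x = (\<integral>\<^sup>+y. ennreal (heat_kernel (inv_Suc k) (x - y)) \<partial>lborel)"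
      unfolding w_def heat_nn_def
      by (subst nn_integral_add[symmetric]) (auto intro!: nn_integral_cong simp: indicator_def)
    then show ?thesis by (simp only: nn_integral_heat_kernel_diff[OF inv_Suc_pos])
  qed
  have hcr: "heat_conv (inv_Suc k) (indicator U) x = complex_of_real (enn2real (heat_nn (inv_Suc k) (indicator U) x))" for k x
  proof -
    have "integrable lborel (\<lambda>y. heat_kernel (inv_Suc k) (x - y) * indicator U y)"
      using heat_conv_integrable_L1[OF iU inv_Suc_pos, of k x]
      by (subst complex_of_real_integrable_eq[symmetric]) (auto simp: indicator_def of_bool_def if_distrib cong: if_cong)
    from nn_integral_eq_integral[OF this]
    have "heat_nn (inv_Suc k) (indicator U) x = ennreal (\<integral>y. heat_kernel (inv_Suc k) (x - y) * indicator U y \<partial>lborel)"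
      unfolding heat_nn_def by (simp add: ennreal_mult ennreal_indicator)
    moreover have "heat_conv (inv_Suc k) (indicator U) x = complex_of_real (\<integral>y. heat_kernel (inv_Suc k) (x - y) * indicator U y \<partial>lborel)"
      unfolding heat_conv_def by (subst integral_complex_of_real[symmetric]) (auto simp: indicator_def of_bool_def intro!: Bochner_Integration.integral_cong)
    ultimately show ?thesis by simp
  qed
  define v where "v k x = (if x \<in> U then w k x else 0)" for k x
  have [measurable]: "v k \<in> borel_measurable borel" for k unfolding v_def by measurable
  \<comment> \<open>With a the value of the convolution at x, this is (1 - a) + 1 = 2 (1 - a) + a on
    U and a \<le> a elsewhere. After integration the indicator and its convolution both contribute
    the finite measure of U and cancel, leaving the mass lost inside U.\<close>
  have pt: "ennreal (norm (heat_conv (inv_Suc k) (indicator U) x - indicator U x)) + indicator U x \<le> 2 * v k x + heat_nn (inv_Suc k) (indicator U) x" for k x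
  proof -
    define a where "a = enn2real (heat_nn (inv_Suc k) (indicator U) x)"
    have "heat_nn (inv_Suc k) (indicator U) x \<le> heat_nn (inv_Suc k) (indicator U) x + w k x" by simp
    then have "heat_nn (inv_Suc k) (indicator U) x \<le> 1" unfolding sum1 .
    then have a: "heat_nn (inv_Suc k) (indicator U) x = ennreal a" "0 \<le> a" "a \<le> 1"
      unfolding a_def by (cases "heat_nn (inv_Suc k) (indicator U) x"; auto simp: top_unique)+
    have w: "w k x = ennreal (1 - a)"
    proof -
      have "w k x \<le> heat_nn (inv_Suc k) (indicator U) x + w k x" by simp
      then have "w k x \<le> 1" unfolding sum1 .
      then obtain b where b: "w k x = ennreal b" "b \<ge> 0" by (cases "w k x") (auto simp: top_unique)
      have "ennreal (a + b) = ennreal 1" using sum1[of k x] a b by (simp add: ennreal_plus)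
      then have "a + b = 1" using a b by (subst (asm) ennreal_inj) auto
      then show ?thesis using b by (simp add: algebra_simps)
    qed
    have n: "norm (complex_of_real a - 1) = 1 - a"
    proof -
      have "complex_of_real a - 1 = complex_of_real (a - 1)" by simp
      then show ?thesis using a(3) by (simp only: norm_of_real)
    qed
    show ?thesis
    proof (cases "x \<in> U")
      case True
      then have "ennreal (norm (heat_conv (inv_Suc k) (indicator U) x - indicator U x)) + indicator U x = ennreal ((1 - a) + 1)"
        using a n by (subst ennreal_plus) (auto simp: hcr a_def[symmetric])
      also have "\<dots> = ennreal (2 * (1 - a) + a)" by simp
      also have "\<dots> = ennreal (2 * (1 - a)) + ennreal a"
        using a by (intro ennreal_plus) auto
      also have "ennreal (2 * (1 - a)) = 2 * ennreal (1 - a)"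
        using a by (subst ennreal_mult) auto
      also have "2 * ennreal (1 - a) + ennreal a = 2 * v k x + heat_nn (inv_Suc k) (indicator U) x"
        using True a by (simp add: v_def w)
      finally show ?thesis by simp
    next
      case False
      then show ?thesis using a by (simp add: hcr a_def[symmetric] v_def)
    qed
  qed
  have le: "ennreal (norm_L1 (\<lambda>x. heat_conv (inv_Suc k) (indicator U) x - indicator U x)) \<le> 2 * (\<integral>\<^sup>+x. v k x \<partial>lborel)" for k
  proof -
    have "ennreal (norm_L1 (\<lambda>x. heat_conv (inv_Suc k) (indicator U) x - indicator U x)) + emeasure lborel U =
      (\<integral>\<^sup>+x. ennreal (norm (heat_conv (inv_Suc k) (indicator U) x - indicator U x)) + indicator U x \<partial>lborel)"
      unfolding norm_L1_def
      using heat_conv_L1(1)[OF iU inv_Suc_pos] iU by (subst nn_integral_eq_integral[symmetric]) (auto simp: nn_integral_add)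
    also have "\<dots> \<le> (\<integral>\<^sup>+x. 2 * v k x + heat_nn (inv_Suc k) (indicator U) x \<partial>lborel)"
      by (intro nn_integral_mono pt)
    also have "\<dots> = 2 * (\<integral>\<^sup>+x. v k x \<partial>lborel) + emeasure lborel U"
      by (subst nn_integral_add) (auto simp: nn_integral_cmult nn_integral_heat_nn)
    finally show ?thesis using U(2) by (auto simp add: ennreal_add_left_cancel_le add.commute[of _ "emeasure lborel U"])
  qed
  have "(\<lambda>k. \<integral>\<^sup>+x. v k x \<partial>lborel) \<longlonglongrightarrow> (\<integral>\<^sup>+x. 0 \<partial>(lborel :: 'a measure))"
  proof (rule nn_integral_dominated_convergence[where w="indicator U"])
    show "AE x in lborel. (\<lambda>k. v k x) \<longlonglongrightarrow> 0"
    proof (rule AE_I2)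
      fix x
      show "(\<lambda>k. v k x) \<longlonglongrightarrow> 0"
        using heat_conv_indicator_open_tendsto[OF U(1), of x] by (cases "x \<in> U") (simp_all add: v_def w_def)
    qed
    have "w k x \<le> 1" for k x
    proof -
      have "w k x \<le> heat_nn (inv_Suc k) (indicator U) x + w k x" by simp
      then show ?thesis unfolding sum1 .
    qed
    then show "AE x in lborel. v k x \<le> indicator U x" for k by (auto simp: v_def)
  qed (use U in auto)
  then have "(\<lambda>k. 2 * (\<integral>\<^sup>+x. v k x \<partial>lborel)) \<longlonglongrightarrow> 2 * 0"
    by (intro ennreal_tendsto_cmult) auto
  then have l: "(\<lambda>k. 2 * (\<integral>\<^sup>+x. v k x \<partial>lborel)) \<longlonglongrightarrow> 0" by simp
  have "(\<lambda>k. ennreal (norm_L1 (\<lambda>x. heat_conv (inv_Suc k) (indicator U) x - indicator U x))) \<longlonglongrightarrow> 0"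
    by (rule tendsto_sandwich[OF always_eventually always_eventually tendsto_const l]) (simp_all only: le zero_le simp_thms)
  then have "(\<lambda>k. ennreal (norm_L1 (\<lambda>x. heat_conv (inv_Suc k) (indicator U) x - indicator U x))) \<longlonglongrightarrow> ennreal 0"
    by simp
  then show ?thesis
    by (subst (asm) tendsto_ennreal_iff) (auto simp: norm_L1_nonneg)
qed

text \<open>Induction over integrable functions. For the indicator of a measurable set, outer
  regularity supplies an open set of almost the same measure.\<close>

lemma heat_conv_L1_tendsto:
  fixes f :: "'a::euclidean_space \<Rightarrow> complex"
  assumes "integrable lborel f"
  shows "(\<lambda>k. norm_L1 (\<lambda>x. heat_conv (inv_Suc k) f x - f x)) \<longlonglongrightarrow> 0"
  using assms
proof induct
  case (base A c)
  have [measurable]: "A \<in> sets borel" using base by simp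
  have iA: "integrable lborel (\<lambda>x. indicator A x * c)" using base by (intro integrable_mult_left integrable_indicator_complex) auto
  have "(\<lambda>k. norm_L1 (\<lambda>x. heat_conv (inv_Suc k) (\<lambda>x. indicator A x * c) x - indicator A x * c)) \<longlonglongrightarrow> 0"
  proof (rule LIMSEQ_I)
    fix e :: real assume e: "e > 0"
    \<comment> \<open>Chosen so that twice \<open>norm c * d\<close> is at most e / 2; adding 1
      keeps the denominator positive when c = 0.\<close>
    define d where "d = e / (4 * (norm c + 1))"
    have d: "d > 0" unfolding d_def using e by (intro divide_pos_pos mult_pos_pos) (auto intro: add_nonneg_pos)
    have "A \<in> sets lebesgue" using base by simp
    then obtain U where U: "open U" "A \<subseteq> U" "U - A \<in> lmeasurable" "emeasure lebesgue (U - A) < ennreal d"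
      using sets_lebesgue_outer_open d by metis
    have [measurable]: "U \<in> sets borel" using U(1) by simp
    have UA: "emeasure lborel (U - A) < ennreal d" using U(4) by simp
    have "emeasure lborel U \<le> emeasure lborel (U - A) + emeasure lborel A"
      using U(2) emeasure_subadditive[of "U - A" lborel A] by (simp add: Un_absorb2)
    also have "\<dots> < \<infinity>" using UA base(2) by (auto simp: less_top[symmetric] dest: less_trans)
    finally have Uf: "emeasure lborel U < \<infinity>" .
    have iU: "integrable lborel (\<lambda>x. indicator U x * c)" using Uf by (intro integrable_mult_left integrable_indicator_complex) auto
    have "norm_L1 (\<lambda>x. indicator A x * c - indicator U x * c) \<le> norm c * d"
    proof -
      have "norm_L1 (\<lambda>x. indicator A x * c - indicator U x * c) = (\<integral>x. norm c * indicator (U - A) x \<partial>lborel)"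
        unfolding norm_L1_def using U(2) by (intro Bochner_Integration.integral_cong) (auto simp: indicator_def)
      also have "\<dots> = norm c * measure lborel (U - A)" by simp
      also have "measure lborel (U - A) \<le> d"
        using UA d by (auto simp: measure_def intro!: enn2real_leI)
      finally show ?thesis by (simp add: mult_left_mono)
    qed
    then have "2 * norm_L1 (\<lambda>x. indicator A x * c - indicator U x * c) \<le> 2 * (norm c * d)" by simp
    also have "\<dots> \<le> e / 2"
      using e unfolding d_def by (simp add: field_simps add_pos_nonneg)
    finally have 2: "2 * norm_L1 (\<lambda>x. indicator A x * c - indicator U x * c) \<le> e / 2" .
    have "(\<lambda>k. norm c * norm_L1 (\<lambda>x. heat_conv (inv_Suc k) (indicator U) x - indicator U x)) \<longlonglongrightarrow> norm c * 0"
      by (intro tendsto_mult tendsto_const heat_conv_open_L1_tendsto U(1) Uf)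
    moreover have "norm_L1 (\<lambda>x. heat_conv (inv_Suc k) (\<lambda>x. indicator U x * c) x - indicator U x * c) =
      norm c * norm_L1 (\<lambda>x. heat_conv (inv_Suc k) (indicator U) x - indicator U x)" for k
    proof -
      have "heat_conv (inv_Suc k) (\<lambda>x. indicator U x * c) x = heat_conv (inv_Suc k) (indicator U) x * c" for x
        unfolding heat_conv_def mult.assoc[symmetric] by simp
      then show ?thesis
        by (simp add: norm_L1_def norm_mult mult.commute[of "norm c"] flip: left_diff_distrib)
    qed
    ultimately have "\<forall>\<^sub>F k in sequentially. norm_L1 (\<lambda>x. heat_conv (inv_Suc k) (\<lambda>x. indicator U x * c) x - indicator U x * c) < e / 2"
      using e by (intro order_tendstoD(2)[where y=0]) auto
    then obtain n0 where n0: "\<And>k. k \<ge> n0 \<Longrightarrow> norm_L1 (\<lambda>x. heat_conv (inv_Suc k) (\<lambda>x. indicator U x * c) x - indicator U x * c) < e / 2"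
      by (auto simp: eventually_sequentially)
    have "norm_L1 (\<lambda>x. heat_conv (inv_Suc k) (\<lambda>x. indicator A x * c) x - indicator A x * c) < e" if "k \<ge> n0" for k
      using norm_L1_heat_conv_approx[OF iA iU inv_Suc_pos, of k] n0[OF that] 2 by linarith
    then show "\<exists>n0. \<forall>k\<ge>n0. norm (norm_L1 (\<lambda>x. heat_conv (inv_Suc k) (\<lambda>x. indicator A x * c) x - indicator A x * c) - 0) < e"
      by (intro exI[of _ n0]) (simp add: norm_L1_nonneg)
  qed
  moreover have "(indicator A x *\<^sub>R c) = indicator A x * c" for x :: 'a by (simp add: indicator_def)
  ultimately show ?case by simp
next
  case (add f g)
  have "norm_L1 (\<lambda>x. heat_conv (inv_Suc k) (\<lambda>x. f x + g x) x - (f x + g x)) \<le> norm_L1 (\<lambda>x. heat_conv (inv_Suc k) f x - f x) + norm_L1 (\<lambda>x. heat_conv (inv_Suc k) g x - g x)" for k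
  proof -
    have "heat_conv (inv_Suc k) (\<lambda>x. f x + g x) x = heat_conv (inv_Suc k) f x + heat_conv (inv_Suc k) g x" for x
      using heat_conv_integrable_L1[OF add(1) inv_Suc_pos, of k x] heat_conv_integrable_L1[OF add(3) inv_Suc_pos, of k x]
      unfolding heat_conv_def by (simp add: distrib_left)
    then have "norm_L1 (\<lambda>x. heat_conv (inv_Suc k) (\<lambda>x. f x + g x) x - (f x + g x)) = norm_L1 (\<lambda>x. (heat_conv (inv_Suc k) f x - f x) - (g x - heat_conv (inv_Suc k) g x))"
      by (simp add: algebra_simps)
    also have "\<dots> \<le> norm_L1 (\<lambda>x. (heat_conv (inv_Suc k) f x - f x) - 0) + norm_L1 (\<lambda>x. 0 - (g x - heat_conv (inv_Suc k) g x))"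
      by (rule norm_L1_triangle) (use heat_conv_L1(1)[OF add(1) inv_Suc_pos] heat_conv_L1(1)[OF add(3) inv_Suc_pos] add in auto)
    finally show ?thesis by simp
  qed
  note le = this
  have "(\<lambda>k. norm_L1 (\<lambda>x. heat_conv (inv_Suc k) f x - f x) + norm_L1 (\<lambda>x. heat_conv (inv_Suc k) g x - g x)) \<longlonglongrightarrow> 0 + 0"
    by (intro tendsto_add add(2) add(4))
  then have l: "(\<lambda>k. norm_L1 (\<lambda>x. heat_conv (inv_Suc k) f x - f x) + norm_L1 (\<lambda>x. heat_conv (inv_Suc k) g x - g x)) \<longlonglongrightarrow> 0" by simp
  show ?case
    by (rule tendsto_sandwich[OF always_eventually always_eventually tendsto_const l]) (simp_all only: le norm_L1_nonneg simp_thms)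
next
  case (lim f s)
  have "(\<lambda>i. \<integral>x. norm (f x - s i x) \<partial>lborel) \<longlonglongrightarrow> (\<integral>x. 0 \<partial>(lborel :: 'a measure))"
  \<comment> \<open>The approximating simple functions satisfy |s_i| \<le> 2 |f|, hence |f - s_i|
    \<le> 3 |f|.\<close>
  proof (rule integral_dominated_convergence[where w="\<lambda>x. 3 * norm (f x)"])
    show "AE x in lborel. (\<lambda>i. norm (f x - s i x)) \<longlonglongrightarrow> 0"
    proof (rule AE_I2)
      fix x :: 'a
      have "(\<lambda>i. norm (f x - s i x)) \<longlonglongrightarrow> norm (f x - f x)"
        by (intro tendsto_intros lim) auto
      then show "(\<lambda>i. norm (f x - s i x)) \<longlonglongrightarrow> 0" by simp
    qed
    show "AE x in lborel. norm (norm (f x - s i x)) \<le> 3 * norm (f x)" for i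
    proof (rule AE_I2)
      fix x :: 'a
      show "norm (norm (f x - s i x)) \<le> 3 * norm (f x)"
        using norm_triangle_ineq4[of "f x" "s i x"] lim(4)[of x i] by simp
    qed
    have [measurable]: "f \<in> borel_measurable borel" "s i \<in> borel_measurable borel" for i
      using borel_measurable_integrable[OF lim(5)] borel_measurable_integrable[OF lim(1)] by auto
    show "(\<lambda>x. norm (f x - s i x)) \<in> borel_measurable lborel" for i by measurable
    show "integrable lborel (\<lambda>x. 3 * norm (f x))" using lim(5) by simp
  qed simp
  then have l: "(\<lambda>i. norm_L1 (\<lambda>x. f x - s i x)) \<longlonglongrightarrow> 0" by (simp add: norm_L1_def)
  show ?case
  proof (rule LIMSEQ_I)
    fix e :: real assume e: "e > 0"
    then obtain i where i: "norm_L1 (\<lambda>x. f x - s i x) < e / 4"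
      using order_tendstoD(2)[OF l, of "e/4"] by (auto simp: eventually_sequentially)
    have "\<forall>\<^sub>F k in sequentially. norm_L1 (\<lambda>x. heat_conv (inv_Suc k) (s i) x - s i x) < e / 2"
      using lim(2) e by (intro order_tendstoD(2)[where y=0]) auto
    then obtain n0 where n0: "\<And>k. k \<ge> n0 \<Longrightarrow> norm_L1 (\<lambda>x. heat_conv (inv_Suc k) (s i) x - s i x) < e / 2"
      by (auto simp: eventually_sequentially)
    have "norm_L1 (\<lambda>x. heat_conv (inv_Suc k) f x - f x) < e" if "k \<ge> n0" for k
      using norm_L1_heat_conv_approx[OF lim(5) lim(1) inv_Suc_pos, of k i] n0[OF that] i by linarith
    then show "\<exists>n0. \<forall>k\<ge>n0. norm (norm_L1 (\<lambda>x. heat_conv (inv_Suc k) f x - f x) - 0) < e"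
      by (intro exI[of _ n0]) (simp add: norm_L1_nonneg)
  qed
qed

text \<open>For a truncation g bounded by m, the difference between g and its convolution is at most
  2 m, so its squared L2 norm is at most 2 m times its L1 norm and L1 convergence suffices. The
  truncation error is controlled by the L2 contraction, uniformly in time.\<close>

lemma heat_conv_L2_tendsto:
  fixes f :: "'a::euclidean_space \<Rightarrow> complex"
  assumes f: "f \<in> L2"
  shows "(\<lambda>k. sq (\<lambda>x. heat_conv (inv_Suc k) f x - f x)) \<longlonglongrightarrow> 0"
proof -
  have fm [measurable]: "f \<in> borel_measurable borel" using f by auto
  define g where "g m x = (if norm (f x) \<le> real m \<and> norm x \<le> real m then f x else 0)" for m :: nat and x
  have gm [measurable]: "g m \<in> borel_measurable borel" for m unfolding g_def by measurable
  have gf: "norm (g m x) \<le> norm (f x)" and gb: "norm (g m x) \<le> real m" for m x by (auto simp: g_def)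
  have gL2: "g m \<in> L2" for m by (rule sq_mono(1)[OF gm f gf])
  have gL1: "integrable lborel (g m)" for m
  proof (rule Bochner_Integration.integrable_bound[where f="\<lambda>x. real m * indicator (cball 0 (real m)) x"])
    show "integrable lborel (\<lambda>x. real m * indicator (cball (0::'a) (real m)) x)"
      by (intro integrable_mult_right integrable_real_indicator emeasure_bounded_finite bounded_cball) auto
    show "AE x in lborel. norm (g m x) \<le> norm (real m * indicator (cball 0 (real m)) x)"
      by (auto simp: g_def indicator_def)
  qed auto
  have l: "(\<lambda>m. sq (\<lambda>x. g m x - f x)) \<longlonglongrightarrow> 0"
  proof (rule sq_dominated_tendsto[OF _ f])
    show "norm (g m x - f x) \<le> norm (f x)" for m x by (auto simp: g_def)
    show "AE x in lborel. (\<lambda>m. g m x - f x) \<longlonglongrightarrow> 0"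
    proof (rule AE_I2, rule tendsto_eventually)
      fix x
      obtain N where N: "max (norm (f x)) (norm x) \<le> real N" using real_arch_simple by blast
      show "\<forall>\<^sub>F m in sequentially. g m x - f x = 0"
        using eventually_ge_at_top[of N] by eventually_elim (use N in \<open>auto simp: g_def\<close>)
    qed
  qed measurable
  have main: "sqrt (sq (\<lambda>x. heat_conv (inv_Suc k) f x - f x)) \<le> 2 * sqrt (sq (\<lambda>x. g m x - f x)) + sqrt (2 * real m * norm_L1 (\<lambda>x. heat_conv (inv_Suc k) (g m) x - g m x))" for k m
  proof -
    note h = heat_conv_L2[OF f inv_Suc_pos, of k] heat_conv_L2[OF gL2 inv_Suc_pos, of k m]
    have A: "sqrt (sq (\<lambda>x. heat_conv (inv_Suc k) f x - f x)) \<le>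
      sqrt (sq (\<lambda>x. heat_conv (inv_Suc k) f x - heat_conv (inv_Suc k) (g m) x)) + sqrt (sq (\<lambda>x. heat_conv (inv_Suc k) (g m) x - f x))"
      using sqrt_sq_triangle[OF L2_diff[OF h(1,3)] L2_diff[OF h(3) f]] by simp
    have B: "sq (\<lambda>x. heat_conv (inv_Suc k) f x - heat_conv (inv_Suc k) (g m) x) \<le> sq (\<lambda>x. g m x - f x)"
      unfolding heat_conv_diff_L2[OF f gL2 inv_Suc_pos, symmetric] sq_minus_commute[of "g m" f]
      by (rule heat_conv_L2(2)[OF L2_diff[OF f gL2] inv_Suc_pos])
    have C: "sqrt (sq (\<lambda>x. heat_conv (inv_Suc k) (g m) x - f x)) \<le>
      sqrt (sq (\<lambda>x. heat_conv (inv_Suc k) (g m) x - g m x)) + sqrt (sq (\<lambda>x. g m x - f x))"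
      using sqrt_sq_triangle[OF L2_diff[OF h(3) gL2[of m]] L2_diff[OF gL2[of m] f]] by simp
    have D: "sq (\<lambda>x. heat_conv (inv_Suc k) (g m) x - g m x) \<le> 2 * real m * norm_L1 (\<lambda>x. heat_conv (inv_Suc k) (g m) x - g m x)"
    proof -
      have hb: "norm (heat_conv (inv_Suc k) (g m) x) \<le> real m" for x
      proof -
        have "ennreal (norm (heat_conv (inv_Suc k) (g m) x)) \<le> heat_nn (inv_Suc k) (\<lambda>y. ennreal (norm (g m y))) x"
          by (rule norm_heat_conv_le)
        also have "\<dots> \<le> heat_nn (inv_Suc k) (\<lambda>y. ennreal (real m)) x"
          by (intro heat_nn_mono ennreal_leI gb)
        also have "\<dots> = ennreal (real m)"
          unfolding heat_nn_def by (subst nn_integral_multc) (auto simp: nn_integral_heat_kernel_diff)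
        finally show ?thesis by (simp add: ennreal_le_iff)
      qed
      have "sq (\<lambda>x. heat_conv (inv_Suc k) (g m) x - g m x) \<le> (\<integral>x. 2 * real m * norm (heat_conv (inv_Suc k) (g m) x - g m x) \<partial>lborel)"
        unfolding sq_def
      proof (rule integral_mono)
        fix x
        have "norm (heat_conv (inv_Suc k) (g m) x - g m x) \<le> 2 * real m"
          using norm_triangle_ineq4[of "heat_conv (inv_Suc k) (g m) x" "g m x"] hb[of x] gb[of m x] by linarith
        then show "(norm (heat_conv (inv_Suc k) (g m) x - g m x))\<^sup>2 \<le> 2 * real m * norm (heat_conv (inv_Suc k) (g m) x - g m x)"
          by (simp add: power2_eq_square mult_right_mono)
      next
        show "integrable lborel (\<lambda>x. (norm (heat_conv (inv_Suc k) (g m) x - g m x))\<^sup>2)"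
          by (intro L2_integrable L2_diff h gL2)
        show "integrable lborel (\<lambda>x. 2 * real m * norm (heat_conv (inv_Suc k) (g m) x - g m x))"
          using heat_conv_L1(1)[OF gL1 inv_Suc_pos] gL1 by (intro integrable_mult_right integrable_norm Bochner_Integration.integrable_diff)
      qed
      then show ?thesis by (simp add: norm_L1_def)
    qed
    show ?thesis
      using A C real_sqrt_le_mono[OF B] real_sqrt_le_mono[OF D] by linarith
  qed
  have "(\<lambda>k. sqrt (sq (\<lambda>x. heat_conv (inv_Suc k) f x - f x))) \<longlonglongrightarrow> 0"
  proof (rule LIMSEQ_I)
    fix e :: real assume e: "e > 0"
    have l0: "(\<lambda>m. sqrt (sq (\<lambda>x. g m x - f x))) \<longlonglongrightarrow> sqrt 0" by (intro tendsto_real_sqrt l)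
    obtain m where m: "sqrt (sq (\<lambda>x. g m x - f x)) < e / 4"
      using order_tendstoD(2)[OF l0, of "e/4"] e by (auto simp: eventually_sequentially)
    have "(\<lambda>k. sqrt (2 * real m * norm_L1 (\<lambda>x. heat_conv (inv_Suc k) (g m) x - g m x))) \<longlonglongrightarrow> sqrt (2 * real m * 0)"
      by (intro tendsto_real_sqrt tendsto_mult tendsto_const heat_conv_L1_tendsto gL1)
    then have "\<forall>\<^sub>F k in sequentially. sqrt (2 * real m * norm_L1 (\<lambda>x. heat_conv (inv_Suc k) (g m) x - g m x)) < e / 2"
      using e by (intro order_tendstoD(2)[where y="sqrt (2 * real m * 0)"]) auto
    then obtain n0 where n0: "\<And>k. k \<ge> n0 \<Longrightarrow> sqrt (2 * real m * norm_L1 (\<lambda>x. heat_conv (inv_Suc k) (g m) x - g m x)) < e / 2"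
      by (auto simp: eventually_sequentially)
    have "sqrt (sq (\<lambda>x. heat_conv (inv_Suc k) f x - f x)) < e" if "k \<ge> n0" for k
      using main[of k m] n0[OF that] m by linarith
    then show "\<exists>n0. \<forall>k\<ge>n0. norm (sqrt (sq (\<lambda>x. heat_conv (inv_Suc k) f x - f x)) - 0) < e"
      by (intro exI[of _ n0]) simp
  qed
  from tendsto_power[OF this, of 2] show ?thesis by simp
qed

section \<open>The Fourier transform on square integrable functions\<close>

text \<open>The kernel stays abstract because exponentials of both signs occur: one in the
  multiplication formula, the other in the regularised Plancherel identity.\<close>

lemma Fubini_bounded_kernel:
  fixes a b :: "'a::euclidean_space \<Rightarrow> complex" and k :: "'a \<Rightarrow> 'a \<Rightarrow> complex"
  assumes a: "integrable lborel a" and b: "integrable lborel b"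
    and k [measurable]: "(\<lambda>(x, y). k x y) \<in> borel_measurable (borel \<Otimes>\<^sub>M borel)"
    and le: "\<And>x y. norm (k x y) \<le> 1"
  shows "(\<integral>x. a x * (\<integral>y. k x y * b y \<partial>lborel) \<partial>lborel) = (\<integral>y. b y * (\<integral>x. k x y * a x \<partial>lborel) \<partial>lborel)"
proof -
  have [measurable]: "a \<in> borel_measurable borel" "b \<in> borel_measurable borel"
    using a b by (auto dest: borel_measurable_integrable)
  let ?f = "\<lambda>(x, y). a x * (k x y * b y)"
  have "integrable (lborel \<Otimes>\<^sub>M lborel) ?f"
    unfolding integrable_iff_bounded
  proof
    show "?f \<in> borel_measurable (lborel \<Otimes>\<^sub>M lborel)" by measurable
    have "(\<integral>\<^sup>+p. ennreal (norm (?f p)) \<partial>(lborel \<Otimes>\<^sub>M lborel)) \<le>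
      (\<integral>\<^sup>+p. (case p of (x, y) \<Rightarrow> ennreal (norm (a x)) * ennreal (norm (b y))) \<partial>(lborel \<Otimes>\<^sub>M lborel))"
    proof (rule nn_integral_mono, clarify)
      fix x y
      have "norm (a x * (k x y * b y)) \<le> norm (a x) * norm (b y)"
        using mult_left_mono[OF mult_right_mono[OF le, of "norm (b y)" x y], of "norm (a x)"] by (simp add: norm_mult)
      then show "ennreal (norm (a x * (k x y * b y))) \<le> ennreal (norm (a x)) * ennreal (norm (b y))"
        by (simp add: ennreal_leI flip: ennreal_mult)
    qed
    also have "\<dots> = (\<integral>\<^sup>+x. \<integral>\<^sup>+y. ennreal (norm (a x)) * ennreal (norm (b y)) \<partial>lborel \<partial>lborel)"
      by (subst lborel.nn_integral_fst[symmetric]) auto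
    also have "\<dots> = (\<integral>\<^sup>+x. ennreal (norm (a x)) \<partial>lborel) * (\<integral>\<^sup>+y. ennreal (norm (b y)) \<partial>lborel)"
      by (simp add: nn_integral_cmult nn_integral_multc)
    also have "\<dots> < \<infinity>"
      using a b unfolding integrable_iff_bounded by (simp add: ennreal_mult_less_top)
    finally show "(\<integral>\<^sup>+p. ennreal (norm (?f p)) \<partial>(lborel \<Otimes>\<^sub>M lborel)) < \<infinity>" .
  qed
  from lborel_pair.Fubini_integral[OF this]
  have "(\<integral>x. (\<integral>y. a x * (k x y * b y) \<partial>lborel) \<partial>lborel) = (\<integral>y. (\<integral>x. a x * (k x y * b y) \<partial>lborel) \<partial>lborel)" ..
  moreover have "(\<integral>x. a x * (k x y * b y) \<partial>lborel) = b y * (\<integral>x. k x y * a x \<partial>lborel)" for y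
    by (subst integral_mult_right_zero[symmetric]) (intro Bochner_Integration.integral_cong refl, simp)
  ultimately show ?thesis by simp
qed

section \<open>The Fourier transform on L1 and Plancherel's identity\<close>

definition fourier_L1 :: "('a::euclidean_space \<Rightarrow> complex) \<Rightarrow> 'a \<Rightarrow> complex" where
  "fourier_L1 f \<xi> = complex_of_real ((2 * pi) powr (- real DIM('a) / 2)) *
     (\<integral>x. exp (- \<i> * complex_of_real (x \<bullet> \<xi>)) * f x \<partial>lborel)"

lemma fourier_L1_measurable [measurable]:
  assumes [measurable]: "f \<in> borel_measurable borel"
  shows "fourier_L1 f \<in> borel_measurable borel"
  unfolding fourier_L1_def by measurable

lemma exp_mult_integrable:
  assumes "integrable lborel f"
  shows "integrable lborel (\<lambda>x. exp (- \<i> * complex_of_real (x \<bullet> \<xi>)) * f x)"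
proof (rule Bochner_Integration.integrable_bound[OF assms])
  have [measurable]: "f \<in> borel_measurable borel"
    using assms by (auto dest: borel_measurable_integrable)
  show "(\<lambda>x. exp (- \<i> * complex_of_real (x \<bullet> \<xi>)) * f x) \<in> borel_measurable lborel" by measurable
qed (simp add: norm_mult del: mult_minus_left)

lemma fourier_L1_diff:
  assumes "integrable lborel f" "integrable lborel g"
  shows "fourier_L1 (\<lambda>x. f x - g x) = (\<lambda>x. fourier_L1 f x - fourier_L1 g x)"
  unfolding fourier_L1_def fun_eq_iff
  using exp_mult_integrable[OF assms(1)] exp_mult_integrable[OF assms(2)] by (simp add: right_diff_distrib)

lemma fourier_L1_add:
  assumes "integrable lborel f" "integrable lborel g"
  shows "fourier_L1 (\<lambda>x. f x + g x) = (\<lambda>x. fourier_L1 f x + fourier_L1 g x)"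
  unfolding fourier_L1_def fun_eq_iff
  using exp_mult_integrable[OF assms(1)] exp_mult_integrable[OF assms(2)] by (simp add: distrib_left)

lemma fourier_L1_cmult: "fourier_L1 (\<lambda>x. c * f x) = (\<lambda>x. c * fourier_L1 f x)"
proof
  fix \<xi>
  have "(\<lambda>x. exp (- \<i> * complex_of_real (x \<bullet> \<xi>)) * (c * f x)) = (\<lambda>x. c * (exp (- \<i> * complex_of_real (x \<bullet> \<xi>)) * f x))"
    by (simp add: mult_ac)
  then show "fourier_L1 (\<lambda>x. c * f x) \<xi> = c * fourier_L1 f \<xi>"
    unfolding fourier_L1_def by (simp only: integral_mult_right_zero mult_ac)
qed

lemma fourier_L1_mult_formula:
  assumes f: "integrable lborel f" and g: "integrable lborel g"
  shows "(\<integral>x. fourier_L1 f x * g x \<partial>lborel) = (\<integral>x. f x * fourier_L1 g x \<partial>lborel)"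
proof -
  let ?c = "complex_of_real ((2 * pi) powr (- real DIM('a) / 2))"
  have "(\<integral>x. g x * (\<integral>y. exp (- \<i> * complex_of_real (y \<bullet> x)) * f y \<partial>lborel) \<partial>lborel) =
    (\<integral>y. f y * (\<integral>x. exp (- \<i> * complex_of_real (y \<bullet> x)) * g x \<partial>lborel) \<partial>lborel)"
    by (rule Fubini_bounded_kernel[OF g f]) (simp_all del: mult_minus_left)
  then have eq: "(\<integral>x. g x * (\<integral>y. exp (- \<i> * complex_of_real (y \<bullet> x)) * f y \<partial>lborel) \<partial>lborel) =
    (\<integral>y. f y * (\<integral>x. exp (- \<i> * complex_of_real (x \<bullet> y)) * g x \<partial>lborel) \<partial>lborel)"
    by (simp add: inner_commute)
  have 1: "fourier_L1 f x * g x = ?c * (g x * (\<integral>y. exp (- \<i> * complex_of_real (y \<bullet> x)) * f y \<partial>lborel))"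
    and 2: "f x * fourier_L1 g x = ?c * (f x * (\<integral>y. exp (- \<i> * complex_of_real (y \<bullet> x)) * g y \<partial>lborel))" for x
    unfolding fourier_L1_def by (simp_all only: mult_ac)
  show ?thesis unfolding 1 2 integral_mult_right_zero eq ..
qed

lemma gauss_mult_integrable:
  fixes x :: "'a::euclidean_space"
  assumes e: "e > 0"
  shows "integrable lborel (\<lambda>y::'a. complex_of_real (exp (- e * (norm y)\<^sup>2)))"
    "(\<lambda>\<xi>. exp (\<i> * complex_of_real (x \<bullet> \<xi>)) * complex_of_real (exp (- e * (norm \<xi>)\<^sup>2))) \<in> L2"
    "integrable lborel (\<lambda>\<xi>. exp (\<i> * complex_of_real (x \<bullet> \<xi>)) * complex_of_real (exp (- e * (norm \<xi>)\<^sup>2)))"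
proof -
  show 1: "integrable lborel (\<lambda>y::'a. complex_of_real (exp (- e * (norm y)\<^sup>2)))"
    using gaussian_fourier(1)[OF e, of 0] by simp
  show "integrable lborel (\<lambda>\<xi>. exp (\<i> * complex_of_real (x \<bullet> \<xi>)) * complex_of_real (exp (- e * (norm \<xi>)\<^sup>2)))"
    by (rule gaussian_fourier(1)[OF e])
  show "(\<lambda>\<xi>. exp (\<i> * complex_of_real (x \<bullet> \<xi>)) * complex_of_real (exp (- e * (norm \<xi>)\<^sup>2))) \<in> L2"
  proof (rule L2_bound)
    show "integrable lborel (\<lambda>y::'a. exp (- e * (norm y)\<^sup>2))"
      using 1 by (simp only: complex_of_real_integrable_eq)
    show "(norm (exp (\<i> * complex_of_real (x \<bullet> \<xi>)) * complex_of_real (exp (- e * (norm \<xi>)\<^sup>2))))\<^sup>2 \<le> exp (- e * (norm \<xi>)\<^sup>2)" for \<xi>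
    proof -
      have "exp (- e * (norm \<xi>)\<^sup>2) \<le> 1" using e by simp
      then have "(exp (- e * (norm \<xi>)\<^sup>2))\<^sup>2 \<le> exp (- e * (norm \<xi>)\<^sup>2)"
        unfolding power2_eq_square[of "exp _"] by (intro mult_left_le) auto
      then show ?thesis by (simp add: norm_mult)
    qed
  qed measurable
qed

text \<open>A character times a Gaussian transforms into a heat kernel centred at x. Inserted into
  the multiplication formula, this makes Gaussian-regularised Fourier inversion equal to heat
  convolution.\<close>

lemma fourier_L1_modulated_gauss:
  fixes x :: "'a::euclidean_space"
  assumes e: "e > 0"
  shows "fourier_L1 (\<lambda>\<xi>. exp (\<i> * complex_of_real (x \<bullet> \<xi>)) * complex_of_real (exp (- e * (norm \<xi>)\<^sup>2))) y =
    complex_of_real ((2 * pi) powr (real DIM('a) / 2) * heat_kernel e (x - y))"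
proof -
  have "exp (- \<i> * complex_of_real (\<xi> \<bullet> y)) * (exp (\<i> * complex_of_real (x \<bullet> \<xi>)) * complex_of_real (exp (- e * (norm \<xi>)\<^sup>2)))
    = exp (\<i> * complex_of_real ((x - y) \<bullet> \<xi>)) * complex_of_real (exp (- e * (norm \<xi>)\<^sup>2))" for \<xi>
    unfolding mult.assoc[symmetric] exp_add[symmetric] by (simp add: inner_diff_left inner_commute algebra_simps)
  then have "fourier_L1 (\<lambda>\<xi>. exp (\<i> * complex_of_real (x \<bullet> \<xi>)) * complex_of_real (exp (- e * (norm \<xi>)\<^sup>2))) y =
    complex_of_real ((2 * pi) powr (- real DIM('a) / 2)) * complex_of_real ((2 * pi) ^ DIM('a) * heat_kernel e (x - y))"
    unfolding fourier_L1_def by (simp only: gaussian_fourier(2)[OF e])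
  also have "\<dots> = complex_of_real (((2 * pi) powr (- real DIM('a) / 2) * (2 * pi) powr real DIM('a)) * heat_kernel e (x - y))"
    by (simp add: powr_realpow)
  also have "(2 * pi) powr (- real DIM('a) / 2) * (2 * pi) powr real DIM('a) = (2 * pi) powr (real DIM('a) / 2)"
    by (subst powr_add[symmetric]) simp
  finally show ?thesis .
qed

text \<open>The Gaussian weight makes every integral absolutely convergent. One factor, the
  conjugate transform, is written out as an integral over y; after exchanging the integrals, the
  inner one over \<xi> is the regularised inversion of f, that is, \<open>heat_conv\<close>.\<close>

lemma Plancherel_gauss:
  fixes f :: "'a::euclidean_space \<Rightarrow> complex"
  assumes f: "integrable lborel f" and e: "e > 0"
  shows "(\<integral>\<xi>. (norm (fourier_L1 f \<xi>))\<^sup>2 * exp (- e * (norm \<xi>)\<^sup>2) \<partial>lborel) = Re (\<integral>x. cnj (f x) * heat_conv e f x \<partial>lborel)"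
    "integrable lborel (\<lambda>\<xi>. (norm (fourier_L1 f \<xi>))\<^sup>2 * exp (- e * (norm \<xi>)\<^sup>2))"
proof -
  have [measurable]: "f \<in> borel_measurable borel"
    using f by (auto dest: borel_measurable_integrable)
  let ?c = "complex_of_real ((2 * pi) powr (- real DIM('a) / 2))"
  let ?g = "\<lambda>\<xi>::'a. complex_of_real (exp (- e * (norm \<xi>)\<^sup>2))"
  have ig: "integrable lborel ?g" by (rule gauss_mult_integrable(1)[OF e])
  have FIb: "norm (fourier_L1 f \<xi>) \<le> norm ?c * (\<integral>x. norm (f x) \<partial>lborel)" for \<xi>
  proof -
    have "norm (\<integral>x. exp (- \<i> * complex_of_real (x \<bullet> \<xi>)) * f x \<partial>lborel) \<le> (\<integral>x. norm (f x) \<partial>lborel)"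
      using integral_norm_bound[of lborel "\<lambda>x. exp (- \<i> * complex_of_real (x \<bullet> \<xi>)) * f x"]
      by (simp add: norm_mult del: mult_minus_left)
    then show ?thesis unfolding fourier_L1_def norm_mult by (rule mult_left_mono) simp
  qed
  have igF: "integrable lborel (\<lambda>\<xi>. ?g \<xi> * fourier_L1 f \<xi>)"
  proof (rule Bochner_Integration.integrable_bound[OF integrable_mult_right[OF ig]])
    show "AE \<xi> in lborel. norm (?g \<xi> * fourier_L1 f \<xi>) \<le> norm (complex_of_real (norm ?c * (\<integral>x. norm (f x) \<partial>lborel)) * ?g \<xi>)"
    proof (rule AE_I2)
      fix \<xi>
      have "norm (?g \<xi> * fourier_L1 f \<xi>) \<le> norm (?g \<xi>) * (norm ?c * (\<integral>x. norm (f x) \<partial>lborel))"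
        unfolding norm_mult[of "?g \<xi>"] by (intro mult_left_mono FIb) simp
      also have "\<dots> = norm (complex_of_real (norm ?c * (\<integral>x. norm (f x) \<partial>lborel)) * ?g \<xi>)"
        unfolding norm_mult norm_of_real by (simp add: mult.commute)
      finally show "norm (?g \<xi> * fourier_L1 f \<xi>) \<le> norm (complex_of_real (norm ?c * (\<integral>x. norm (f x) \<partial>lborel)) * ?g \<xi>)" .
    qed
  qed measurable
  have cF: "cnj (fourier_L1 f \<xi>) = ?c * (\<integral>y. exp (\<i> * complex_of_real (y \<bullet> \<xi>)) * cnj (f y) \<partial>lborel)" for \<xi>
  proof -
    have "cnj (\<integral>x. exp (- \<i> * complex_of_real (x \<bullet> \<xi>)) * f x \<partial>lborel) = (\<integral>x. cnj (exp (- \<i> * complex_of_real (x \<bullet> \<xi>)) * f x) \<partial>lborel)"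
      by (simp only: Bochner_Integration.integral_cnj)
    also have "\<dots> = (\<integral>y. exp (\<i> * complex_of_real (y \<bullet> \<xi>)) * cnj (f y) \<partial>lborel)"
      by (simp add: exp_cnj)
    finally show ?thesis unfolding fourier_L1_def by simp
  qed
  have step2: "(\<integral>\<xi>. ?g \<xi> * (exp (\<i> * complex_of_real (y \<bullet> \<xi>)) * fourier_L1 f \<xi>) \<partial>lborel) =
    complex_of_real ((2 * pi) powr (real DIM('a) / 2)) * heat_conv e f y" for y
  proof -
    have "(\<integral>\<xi>. ?g \<xi> * (exp (\<i> * complex_of_real (y \<bullet> \<xi>)) * fourier_L1 f \<xi>) \<partial>lborel) =
       (\<integral>\<xi>. fourier_L1 f \<xi> * (exp (\<i> * complex_of_real (y \<bullet> \<xi>)) * ?g \<xi>) \<partial>lborel)"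
      by (simp add: mult_ac)
    also have "\<dots> = (\<integral>x. f x * complex_of_real ((2 * pi) powr (real DIM('a) / 2) * heat_kernel e (y - x)) \<partial>lborel)"
      by (subst fourier_L1_mult_formula[OF f gauss_mult_integrable(3)[OF e]]) (simp only: fourier_L1_modulated_gauss[OF e])
    also have "\<dots> = complex_of_real ((2 * pi) powr (real DIM('a) / 2)) * heat_conv e f y"
      unfolding heat_conv_def integral_mult_right_zero[symmetric]
      by (intro Bochner_Integration.integral_cong refl) simp
    finally show ?thesis .
  qed
  have eq: "complex_of_real ((norm (fourier_L1 f \<xi>))\<^sup>2 * exp (- e * (norm \<xi>)\<^sup>2)) = (?g \<xi> * fourier_L1 f \<xi>) * cnj (fourier_L1 f \<xi>)" for \<xi>
    by (simp add: complex_norm_square mult_ac del: of_real_power)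
  have "integrable lborel (\<lambda>\<xi>. (?g \<xi> * fourier_L1 f \<xi>) * cnj (fourier_L1 f \<xi>))"
  proof (rule Bochner_Integration.integrable_bound[OF integrable_mult_right[OF igF]])
    show "AE \<xi> in lborel. norm ((?g \<xi> * fourier_L1 f \<xi>) * cnj (fourier_L1 f \<xi>)) \<le> norm (complex_of_real (norm ?c * (\<integral>x. norm (f x) \<partial>lborel)) * (?g \<xi> * fourier_L1 f \<xi>))"
    proof (rule AE_I2)
      fix \<xi>
      have "norm ((?g \<xi> * fourier_L1 f \<xi>) * cnj (fourier_L1 f \<xi>)) \<le> norm (?g \<xi> * fourier_L1 f \<xi>) * (norm ?c * (\<integral>x. norm (f x) \<partial>lborel))"
        unfolding norm_mult[of "?g \<xi> * fourier_L1 f \<xi>"] complex_mod_cnj by (intro mult_left_mono FIb) simp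
      also have "\<dots> = norm (complex_of_real (norm ?c * (\<integral>x. norm (f x) \<partial>lborel)) * (?g \<xi> * fourier_L1 f \<xi>))"
        unfolding norm_mult norm_of_real by (simp add: mult.commute)
      finally show "norm ((?g \<xi> * fourier_L1 f \<xi>) * cnj (fourier_L1 f \<xi>)) \<le> norm (complex_of_real (norm ?c * (\<integral>x. norm (f x) \<partial>lborel)) * (?g \<xi> * fourier_L1 f \<xi>))" .
    qed
    have [measurable]: "cnj \<in> borel_measurable borel"
      by (rule borel_measurable_continuous_onI) (intro continuous_intros)
    show "(\<lambda>\<xi>. (?g \<xi> * fourier_L1 f \<xi>) * cnj (fourier_L1 f \<xi>)) \<in> borel_measurable lborel" by measurable
  qed
  then have "integrable lborel (\<lambda>\<xi>. complex_of_real ((norm (fourier_L1 f \<xi>))\<^sup>2 * exp (- e * (norm \<xi>)\<^sup>2)))"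
    unfolding eq .
  then show "integrable lborel (\<lambda>\<xi>. (norm (fourier_L1 f \<xi>))\<^sup>2 * exp (- e * (norm \<xi>)\<^sup>2))"
    by (simp only: complex_of_real_integrable_eq)
  have "complex_of_real (\<integral>\<xi>. (norm (fourier_L1 f \<xi>))\<^sup>2 * exp (- e * (norm \<xi>)\<^sup>2) \<partial>lborel) =
    (\<integral>\<xi>. (?g \<xi> * fourier_L1 f \<xi>) * cnj (fourier_L1 f \<xi>) \<partial>lborel)"
    unfolding eq[symmetric] by (rule integral_complex_of_real[symmetric])
  also have "\<dots> = ?c * (\<integral>\<xi>. (?g \<xi> * fourier_L1 f \<xi>) * (\<integral>y. exp (\<i> * complex_of_real (y \<bullet> \<xi>)) * cnj (f y) \<partial>lborel) \<partial>lborel)"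
    unfolding cF integral_mult_right_zero[symmetric] by (intro Bochner_Integration.integral_cong refl) (simp add: mult_ac)
  also have "(\<integral>\<xi>. (?g \<xi> * fourier_L1 f \<xi>) * (\<integral>y. exp (\<i> * complex_of_real (y \<bullet> \<xi>)) * cnj (f y) \<partial>lborel) \<partial>lborel) =
    (\<integral>y. cnj (f y) * (\<integral>\<xi>. exp (\<i> * complex_of_real (y \<bullet> \<xi>)) * (?g \<xi> * fourier_L1 f \<xi>) \<partial>lborel) \<partial>lborel)"
    using f by (intro Fubini_bounded_kernel igF) auto
  also have "\<dots> = (\<integral>y. cnj (f y) * (complex_of_real ((2 * pi) powr (real DIM('a) / 2)) * heat_conv e f y) \<partial>lborel)"
    unfolding step2[symmetric] by (simp add: mult_ac)
  also have "?c * \<dots> = (complex_of_real ((2 * pi) powr (- real DIM('a) / 2) * (2 * pi) powr (real DIM('a) / 2))) * (\<integral>y. cnj (f y) * heat_conv e f y \<partial>lborel)"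
    by (simp add: mult.left_commute[of "cnj _"])
  also have "(2 * pi) powr (- real DIM('a) / 2) * (2 * pi) powr (real DIM('a) / 2) = 1"
    by (subst powr_add[symmetric]) simp
  finally have "complex_of_real (\<integral>\<xi>. (norm (fourier_L1 f \<xi>))\<^sup>2 * exp (- e * (norm \<xi>)\<^sup>2) \<partial>lborel) = complex_of_real 1 * (\<integral>x. cnj (f x) * heat_conv e f x \<partial>lborel)" .
  then have "Re (complex_of_real (\<integral>\<xi>. (norm (fourier_L1 f \<xi>))\<^sup>2 * exp (- e * (norm \<xi>)\<^sup>2) \<partial>lborel)) = Re (complex_of_real 1 * (\<integral>x. cnj (f x) * heat_conv e f x \<partial>lborel))"
    by (rule arg_cong)
  then show "(\<integral>\<xi>. (norm (fourier_L1 f \<xi>))\<^sup>2 * exp (- e * (norm \<xi>)\<^sup>2) \<partial>lborel) = Re (\<integral>x. cnj (f x) * heat_conv e f x \<partial>lborel)"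
    by (simp only: Re_complex_of_real of_real_1 mult_1_left)
qed

text \<open>The parameter e tends to 0 in \<open>Plancherel_gauss\<close>: the left side converges
  monotonically, the right side because \<open>heat_conv\<close> tends to f in L2.\<close>

theorem Plancherel_L1_L2:
  fixes f :: "'a::euclidean_space \<Rightarrow> complex"
  assumes f1: "integrable lborel f" and f2: "f \<in> L2"
  shows "fourier_L1 f \<in> L2" "sq (fourier_L1 f) = sq f"
proof -
  have [measurable]: "f \<in> borel_measurable borel" using f2 by auto
  have "(\<lambda>k. \<integral>x. cnj (f x) * heat_conv (inv_Suc k) f x \<partial>lborel) \<longlonglongrightarrow> (\<integral>x. cnj (f x) * f x \<partial>lborel)"
    by (rule L2_integral_mult_tendsto[OF L2_cnj[OF f2] L2_cnj[OF f2] _ heat_conv_L2(1)[OF f2 inv_Suc_pos] f2 heat_conv_L2_tendsto[OF f2]])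
      (simp add: sq_def)
  from tendsto_Re[OF this] have l: "(\<lambda>k. Re (\<integral>x. cnj (f x) * heat_conv (inv_Suc k) f x \<partial>lborel)) \<longlonglongrightarrow> Re (\<integral>x. cnj (f x) * f x \<partial>lborel)" .
  have "(\<integral>x. cnj (f x) * f x \<partial>lborel) = (\<integral>x. complex_of_real ((norm (f x))\<^sup>2) \<partial>lborel)"
    by (intro Bochner_Integration.integral_cong refl) (simp add: complex_norm_square mult.commute del: of_real_power)
  also have "\<dots> = complex_of_real (sq f)" by (simp add: sq_def del: of_real_power)
  finally have r: "Re (\<integral>x. cnj (f x) * f x \<partial>lborel) = sq f" by simp
  have "(\<lambda>k. \<integral>\<^sup>+\<xi>. ennreal ((norm (fourier_L1 f \<xi>))\<^sup>2 * exp (- inv_Suc k * (norm \<xi>)\<^sup>2)) \<partial>lborel) \<longlonglongrightarrow>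
    (\<integral>\<^sup>+\<xi>. ennreal ((norm (fourier_L1 f \<xi>))\<^sup>2) \<partial>lborel)"
  proof (rule nn_integral_LIMSEQ)
    show "incseq (\<lambda>k \<xi>. ennreal ((norm (fourier_L1 f \<xi>))\<^sup>2 * exp (- inv_Suc k * (norm \<xi>)\<^sup>2)))"
    proof (intro incseq_SucI le_funI ennreal_leI mult_left_mono)
      fix k \<xi>
      have "inv_Suc (Suc k) \<le> inv_Suc k" by (simp add: inv_Suc_def frac_le)
      then show "exp (- inv_Suc k * (norm \<xi>)\<^sup>2) \<le> exp (- inv_Suc (Suc k) * (norm (\<xi>::'a))\<^sup>2)" by (simp add: mult_right_mono)
    qed simp
    show "(\<lambda>k. ennreal ((norm (fourier_L1 f \<xi>))\<^sup>2 * exp (- inv_Suc k * (norm \<xi>)\<^sup>2))) \<longlonglongrightarrow> ennreal ((norm (fourier_L1 f \<xi>))\<^sup>2)" for \<xi>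
    proof -
      have "(\<lambda>k. (norm (fourier_L1 f \<xi>))\<^sup>2 * exp (- inv_Suc k * (norm \<xi>)\<^sup>2)) \<longlonglongrightarrow> (norm (fourier_L1 f \<xi>))\<^sup>2 * exp (- 0 * (norm \<xi>)\<^sup>2)"
        by (intro tendsto_intros inv_Suc_tendsto)
      then show ?thesis by (intro tendsto_ennrealI) simp
    qed
  qed measurable
  moreover have "(\<integral>\<^sup>+\<xi>. ennreal ((norm (fourier_L1 f \<xi>))\<^sup>2 * exp (- inv_Suc k * (norm \<xi>)\<^sup>2)) \<partial>lborel) =
    ennreal (Re (\<integral>x. cnj (f x) * heat_conv (inv_Suc k) f x \<partial>lborel))" for k
    using nn_integral_eq_integral[OF Plancherel_gauss(2)[OF f1 inv_Suc_pos[of k]]] Plancherel_gauss(1)[OF f1 inv_Suc_pos[of k]] by simp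
  moreover have "(\<lambda>k. ennreal (Re (\<integral>x. cnj (f x) * heat_conv (inv_Suc k) f x \<partial>lborel))) \<longlonglongrightarrow> ennreal (sq f)"
    using l unfolding r by (rule tendsto_ennrealI)
  ultimately have eq: "(\<integral>\<^sup>+\<xi>. ennreal ((norm (fourier_L1 f \<xi>))\<^sup>2) \<partial>lborel) = ennreal (sq f)"
    using LIMSEQ_unique by simp
  then show F: "fourier_L1 f \<in> L2" by (simp add: L2_iff_nn_integral)
  show "sq (fourier_L1 f) = sq f" using eq unfolding nn_integral_sq[OF F] by simp
qed

section \<open>Extension of the Fourier transform to L2\<close>

definition trunc :: "real \<Rightarrow> ('a::euclidean_space \<Rightarrow> complex) \<Rightarrow> 'a \<Rightarrow> complex" where
  "trunc R f x = indicator (ball 0 R) x * f x"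

text \<open>Counterpart of \<open>is_fourier_L2\<close> for Borel functions, with real-valued
  distances. As a relation it needs no choice of a transform; \<open>is_fourier_L2_iff\<close>
  relates the two.\<close>

definition FT :: "('a::euclidean_space \<Rightarrow> complex) \<Rightarrow> ('a \<Rightarrow> complex) \<Rightarrow> bool" where
  "FT f h \<longleftrightarrow> f \<in> L2 \<and> h \<in> L2 \<and> ((\<lambda>R. sq (\<lambda>\<xi>. h \<xi> - fourier_L1 (trunc R f) \<xi>)) \<longlongrightarrow> 0) at_top"

lemma trunc_L2: "f \<in> L2 \<Longrightarrow> trunc R f \<in> L2"
  unfolding trunc_def[abs_def] by (rule L2_mult_bounded[where C=1]) (auto simp: indicator_def)

lemma trunc_L1:
  fixes f :: "'a::euclidean_space \<Rightarrow> complex"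
  assumes "f \<in> L2"
  shows "integrable lborel (trunc R f)"
proof -
  have "integrable lborel (\<lambda>x. (norm (indicator (ball 0 R) (x::'a) :: complex))\<^sup>2)"
  proof (rule Bochner_Integration.integrable_bound)
    show "integrable lborel (indicator (ball (0::'a) R) :: 'a \<Rightarrow> complex)"
      by (intro integrable_indicator_complex emeasure_bounded_finite bounded_ball) auto
  qed (auto simp: indicator_def)
  then have "(indicator (ball 0 R) :: 'a \<Rightarrow> complex) \<in> L2" unfolding L2_def by (auto intro: borel_measurable_indicator)
  from L2_mult_integrable[OF this assms] show ?thesis unfolding trunc_def[abs_def] .
qed

lemma trunc_tendsto:
  fixes f :: "'a::euclidean_space \<Rightarrow> complex"
  assumes f: "f \<in> L2"
  shows "((\<lambda>R. sq (\<lambda>x. f x - trunc R f x)) \<longlongrightarrow> 0) at_top"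
proof -
  have [measurable]: "f \<in> borel_measurable borel" "trunc R f \<in> borel_measurable borel" for R
    using f trunc_L2[OF f] by auto
  have "((\<lambda>R. \<integral>x. (norm (f x - trunc R f x))\<^sup>2 \<partial>lborel) \<longlongrightarrow> (\<integral>x. 0 \<partial>(lborel :: 'a measure))) at_top"
  proof (rule integral_dominated_convergence_at_top[where w="\<lambda>x. (norm (f x))\<^sup>2"])
    show "AE x in lborel. ((\<lambda>R. (norm (f x - trunc R f x))\<^sup>2) \<longlongrightarrow> 0) at_top"
    proof (rule AE_I2, rule tendsto_eventually)
      fix x :: 'a
      show "\<forall>\<^sub>F R in at_top. (norm (f x - trunc R f x))\<^sup>2 = 0"
        using eventually_gt_at_top[of "norm x"] by eventually_elim (auto simp: trunc_def)
    qed
    show "\<forall>\<^sub>F R in at_top. AE x in lborel. norm ((norm (f x - trunc R f x))\<^sup>2) \<le> (norm (f x))\<^sup>2"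
      by (intro always_eventually allI AE_I2) (auto simp: trunc_def indicator_def)
  qed (use L2_integrable[OF f] in measurable)
  then show ?thesis by (simp add: sq_def)
qed

lemma fourier_L1_trunc_diff:
  assumes "f \<in> L2"
  shows "sq (\<lambda>\<xi>. fourier_L1 (trunc R f) \<xi> - fourier_L1 (trunc S f) \<xi>) = sq (\<lambda>x. trunc R f x - trunc S f x)"
  unfolding fourier_L1_diff[OF trunc_L1[OF assms] trunc_L1[OF assms], symmetric]
  by (intro Plancherel_L1_L2 L2_diff trunc_L2 assms Bochner_Integration.integrable_diff trunc_L1)

lemma fourier_L1_trunc_L2: "f \<in> L2 \<Longrightarrow> fourier_L1 (trunc R f) \<in> L2"
  by (intro Plancherel_L1_L2 trunc_L1 trunc_L2)

text \<open>By Plancherel the transforms of truncations at integer radii are Cauchy, and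
  completeness gives a limit. The same isometry extends the convergence to real radii, as the
  definition demands.\<close>

lemma FT_exists:
  fixes f :: "'a::euclidean_space \<Rightarrow> complex"
  assumes f: "f \<in> L2"
  shows "\<exists>h. FT f h"
proof -
  have ev: "\<exists>N. \<forall>R\<ge>N. sq (\<lambda>x. f x - trunc R f x) < e" if "e > 0" for e
    using order_tendstoD(2)[OF trunc_tendsto[OF f] that] by (auto simp: eventually_at_top_linorder)
  have tri: "sq (\<lambda>x. trunc R f x - trunc S f x) \<le> 2 * sq (\<lambda>x. f x - trunc R f x) + 2 * sq (\<lambda>x. f x - trunc S f x)" for R S
    using sq_diff_triangle[OF trunc_L2[OF f] trunc_L2[OF f] f, of R S] sq_minus_commute[of "trunc R f" f] by simp
  have "\<exists>h\<in>L2. (\<lambda>k. sq (\<lambda>\<xi>. fourier_L1 (trunc (real k) f) \<xi> - h \<xi>)) \<longlonglongrightarrow> 0"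
  proof (rule Riesz_Fischer_L2[OF fourier_L1_trunc_L2[OF f]])
    fix e :: real assume "e > 0"
    then obtain N where N: "\<And>R. R \<ge> N \<Longrightarrow> sq (\<lambda>x. f x - trunc R f x) < e / 4" using ev[of "e/4"] by auto
    obtain M :: nat where M: "N \<le> real M" using real_arch_simple by blast
    show "\<exists>N. \<forall>m\<ge>N. \<forall>n\<ge>N. sq (\<lambda>x. fourier_L1 (trunc (real m) f) x - fourier_L1 (trunc (real n) f) x) < e"
    proof (intro exI[of _ M] allI impI)
      fix m n assume "M \<le> m" "M \<le> n"
      then have "real m \<ge> N" "real n \<ge> N" using M by linarith+
      then show "sq (\<lambda>x. fourier_L1 (trunc (real m) f) x - fourier_L1 (trunc (real n) f) x) < e"
        unfolding fourier_L1_trunc_diff[OF f] using tri[of "real m" "real n"] N[of "real m"] N[of "real n"] by linarith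
    qed
  qed
  then obtain h where h: "h \<in> L2" and l: "(\<lambda>k. sq (\<lambda>\<xi>. fourier_L1 (trunc (real k) f) \<xi> - h \<xi>)) \<longlonglongrightarrow> 0" by blast
  have "((\<lambda>R. sq (\<lambda>\<xi>. h \<xi> - fourier_L1 (trunc R f) \<xi>)) \<longlongrightarrow> 0) at_top"
  proof (rule tendstoI)
    fix e :: real assume e: "e > 0"
    \<comment> \<open>With k fixed, two triangle inequalities with factor 2 give 2 (e/4) + 2 (2
      (e/16) + 2 (e/16)) = e.\<close>
    obtain N where N: "\<And>R. R \<ge> N \<Longrightarrow> sq (\<lambda>x. f x - trunc R f x) < e / 16" using ev[of "e/16"] e by auto
    obtain K where K: "\<And>k. k \<ge> K \<Longrightarrow> sq (\<lambda>\<xi>. fourier_L1 (trunc (real k) f) \<xi> - h \<xi>) < e / 4"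
      using order_tendstoD(2)[OF l, of "e/4"] e by (auto simp: eventually_sequentially)
    obtain M :: nat where M: "N \<le> real M" using real_arch_simple by blast
    define k where "k = max M K"
    have k: "real k \<ge> N" "k \<ge> K" using M by (auto simp: k_def)
    have "sq (\<lambda>\<xi>. h \<xi> - fourier_L1 (trunc R f) \<xi>) < e" if "R \<ge> N" for R
      using sq_diff_triangle[OF h fourier_L1_trunc_L2[OF f, of R] fourier_L1_trunc_L2[OF f, of "real k"]]
        K[OF k(2)] N[OF k(1)] N[OF that] tri[of "real k" R]
      unfolding fourier_L1_trunc_diff[OF f] sq_minus_commute[of h] by linarith
    then show "\<forall>\<^sub>F R in at_top. dist (sq (\<lambda>\<xi>. h \<xi> - fourier_L1 (trunc R f) \<xi>)) 0 < e"
      by (auto simp: dist_real_def eventually_at_top_linorder)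
  qed
  then show ?thesis using f h by (auto simp: FT_def)
qed

lemma FT_L2: "FT f h \<Longrightarrow> f \<in> L2" "FT f h \<Longrightarrow> h \<in> L2"
  by (auto simp: FT_def)

lemma FT_lim: "FT f h \<Longrightarrow> ((\<lambda>R. sq (\<lambda>\<xi>. fourier_L1 (trunc R f) \<xi> - h \<xi>)) \<longlongrightarrow> 0) at_top"
  unfolding sq_minus_commute[of _ h] by (simp add: FT_def)

lemma FT_sq:
  assumes "FT f h"
  shows "sq h = sq f"
proof -
  note L = FT_L2[OF assms]
  have "((\<lambda>R. sq (fourier_L1 (trunc R f))) \<longlongrightarrow> sq h) at_top"
    by (rule sq_tendsto[OF fourier_L1_trunc_L2[OF L(1)] L(2) FT_lim[OF assms]])
  moreover have "((\<lambda>R. sq (trunc R f)) \<longlongrightarrow> sq f) at_top"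
    using trunc_tendsto[OF L(1)] unfolding sq_minus_commute[of f] by (intro sq_tendsto trunc_L2 L(1))
  moreover have "sq (fourier_L1 (trunc R f)) = sq (trunc R f)" for R
    by (intro Plancherel_L1_L2 trunc_L1 trunc_L2 L(1))
  ultimately show ?thesis using tendsto_unique[OF trivial_limit_at_top_linorder] by simp
qed

lemma FT_cong_AE:
  fixes f :: "'a::euclidean_space \<Rightarrow> complex"
  assumes "FT f h" "f' \<in> borel_measurable borel" "h' \<in> borel_measurable borel"
    "AE x in lborel. f' x = f x" "AE x in lborel. h' x = h x"
  shows "FT f' h'"
proof -
  have [measurable]: "f' \<in> borel_measurable borel" "h' \<in> borel_measurable borel"
    "f \<in> borel_measurable borel" "h \<in> borel_measurable borel"
    using assms(2,3) FT_L2[OF assms(1)] by auto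
  have [measurable]: "ball (0::'a) R \<in> sets borel" for R by simp
  have f': "f' \<in> L2"
  proof -
    have "integrable lborel (\<lambda>x. (norm (f' x))\<^sup>2) \<longleftrightarrow> integrable lborel (\<lambda>x. (norm (f x))\<^sup>2)"
      using assms(4) by (intro integrable_cong_AE) auto
    then show ?thesis using FT_L2(1)[OF assms(1)] by (simp add: L2_def)
  qed
  have h': "h' \<in> L2"
  proof -
    have "integrable lborel (\<lambda>x. (norm (h' x))\<^sup>2) \<longleftrightarrow> integrable lborel (\<lambda>x. (norm (h x))\<^sup>2)"
      using assms(5) by (intro integrable_cong_AE) auto
    then show ?thesis using FT_L2(2)[OF assms(1)] by (simp add: L2_def)
  qed
  have "fourier_L1 (trunc R f') = fourier_L1 (trunc R f)" for R
  proof
    fix \<xi>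
    have "(\<integral>x. exp (- \<i> * complex_of_real (x \<bullet> \<xi>)) * (indicator (ball 0 R) x * f' x) \<partial>lborel) =
      (\<integral>x. exp (- \<i> * complex_of_real (x \<bullet> \<xi>)) * (indicator (ball 0 R) x * f x) \<partial>lborel)"
    proof (rule integral_cong_AE)
      show "AE x in lborel. exp (- \<i> * complex_of_real (x \<bullet> \<xi>)) * (indicator (ball 0 R) x * f' x) =
        exp (- \<i> * complex_of_real (x \<bullet> \<xi>)) * (indicator (ball 0 R) x * f x)"
        using assms(4) by eventually_elim simp
      show "(\<lambda>x. exp (- \<i> * complex_of_real (x \<bullet> \<xi>)) * (indicator (ball 0 R) x * f' x)) \<in> borel_measurable lborel"
        by measurable
      show "(\<lambda>x. exp (- \<i> * complex_of_real (x \<bullet> \<xi>)) * (indicator (ball 0 R) x * f x)) \<in> borel_measurable lborel"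
        by measurable
    qed
    then show "fourier_L1 (trunc R f') \<xi> = fourier_L1 (trunc R f) \<xi>" by (simp only: fourier_L1_def trunc_def)
  qed
  moreover have "sq (\<lambda>\<xi>. h' \<xi> - fourier_L1 (trunc R f) \<xi>) = sq (\<lambda>\<xi>. h \<xi> - fourier_L1 (trunc R f) \<xi>)" for R
  proof (rule sq_cong_AE)
    have [measurable]: "trunc R f \<in> borel_measurable borel" unfolding trunc_def[abs_def] by measurable
    show "(\<lambda>\<xi>. h' \<xi> - fourier_L1 (trunc R f) \<xi>) \<in> borel_measurable borel" "(\<lambda>\<xi>. h \<xi> - fourier_L1 (trunc R f) \<xi>) \<in> borel_measurable borel" by measurable
  qed (use assms(5) in auto)
  ultimately show ?thesis using assms(1) f' h' by (simp add: FT_def)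
qed

lemma FT_add:
  assumes "FT f h" "FT g k"
  shows "FT (\<lambda>x. f x + g x) (\<lambda>x. h x + k x)"
proof -
  note L = FT_L2[OF assms(1)] FT_L2[OF assms(2)]
  have eq: "fourier_L1 (trunc R (\<lambda>x. f x + g x)) = (\<lambda>\<xi>. fourier_L1 (trunc R f) \<xi> + fourier_L1 (trunc R g) \<xi>)" for R
  proof -
    have "trunc R (\<lambda>x. f x + g x) = (\<lambda>x. trunc R f x + trunc R g x)" by (auto simp: trunc_def algebra_simps)
    then show ?thesis using fourier_L1_add[OF trunc_L1[OF L(1)] trunc_L1[OF L(3)]] by simp
  qed
  have "sq (\<lambda>\<xi>. (h \<xi> + k \<xi>) - (fourier_L1 (trunc R f) \<xi> + fourier_L1 (trunc R g) \<xi>)) \<le>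
     2 * sq (\<lambda>\<xi>. h \<xi> - fourier_L1 (trunc R f) \<xi>) + 2 * sq (\<lambda>\<xi>. k \<xi> - fourier_L1 (trunc R g) \<xi>)" for R
    using sq_add_le[OF L2_diff[OF L(2) fourier_L1_trunc_L2[OF L(1)]] L2_diff[OF L(4) fourier_L1_trunc_L2[OF L(3)]], of R R]
    by (simp add: algebra_simps)
  note le = this
  have "((\<lambda>R. 2 * sq (\<lambda>\<xi>. h \<xi> - fourier_L1 (trunc R f) \<xi>) + 2 * sq (\<lambda>\<xi>. k \<xi> - fourier_L1 (trunc R g) \<xi>)) \<longlongrightarrow> 2 * 0 + 2 * 0) at_top"
    using assms by (intro tendsto_intros) (auto simp: FT_def)
  then have l: "((\<lambda>R. 2 * sq (\<lambda>\<xi>. h \<xi> - fourier_L1 (trunc R f) \<xi>) + 2 * sq (\<lambda>\<xi>. k \<xi> - fourier_L1 (trunc R g) \<xi>)) \<longlongrightarrow> 0) at_top" by simp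
  have "((\<lambda>R. sq (\<lambda>\<xi>. (h \<xi> + k \<xi>) - (fourier_L1 (trunc R f) \<xi> + fourier_L1 (trunc R g) \<xi>))) \<longlongrightarrow> 0) at_top"
    by (rule tendsto_sandwich[OF always_eventually always_eventually tendsto_const l]) (simp_all only: le sq_nonneg simp_thms)
  then show ?thesis unfolding FT_def eq using L by (auto intro: L2_add)
qed

lemma FT_cmult:
  assumes "FT f h"
  shows "FT (\<lambda>x. c * f x) (\<lambda>x. c * h x)"
proof -
  note L = FT_L2[OF assms(1)]
  have "fourier_L1 (trunc R (\<lambda>x. c * f x)) = (\<lambda>\<xi>. c * fourier_L1 (trunc R f) \<xi>)" for R
  proof -
    have "trunc R (\<lambda>x. c * f x) = (\<lambda>x. c * trunc R f x)" by (auto simp: trunc_def algebra_simps)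
    then show ?thesis by (simp only: fourier_L1_cmult)
  qed
  moreover have "((\<lambda>R. (norm c)\<^sup>2 * sq (\<lambda>\<xi>. h \<xi> - fourier_L1 (trunc R f) \<xi>)) \<longlongrightarrow> (norm c)\<^sup>2 * 0) at_top"
    using assms by (intro tendsto_intros) (auto simp: FT_def)
  ultimately show ?thesis unfolding FT_def using L
    by (auto intro: L2_cmult simp: sq_cmult[symmetric] right_diff_distrib)
qed

lemma FT_diff:
  assumes "FT f h" "FT g k"
  shows "FT (\<lambda>x. f x - g x) (\<lambda>x. h x - k x)"
  using FT_add[OF assms(1) FT_cmult[OF assms(2), of "-1"]] by simp

lemma FT_zero: "FT (\<lambda>x. 0) (\<lambda>x. 0)"
  by (simp add: FT_def trunc_def fourier_L1_def sq_def)

lemma FT_sum: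
  "(\<And>i. i \<in> I \<Longrightarrow> FT (f i) (h i)) \<Longrightarrow> FT (\<lambda>x. \<Sum>i\<in>I. f i x) (\<lambda>x. \<Sum>i\<in>I. h i x)"
  by (induct I rule: infinite_finite_induct) (auto intro: FT_add FT_zero)

text \<open>The difference of two transforms of f is a transform of 0, hence of norm 0 by
  isometry.\<close>

lemma FT_unique:
  assumes "FT f h" "FT f k"
  shows "AE x in lborel. h x = k x"
proof -
  have "sq (\<lambda>x. h x - k x) = 0"
    using FT_sq[OF FT_diff[OF assms]] by (simp add: sq_def)
  then show ?thesis
    using sq_eq_0_iff[OF L2_diff[OF FT_L2(2)[OF assms(1)] FT_L2(2)[OF assms(2)]]] by simp
qed

lemma FT_mult_formula:
  assumes "FT f h" "FT g k"
  shows "(\<integral>x. h x * g x \<partial>lborel) = (\<integral>x. f x * k x \<partial>lborel)"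
proof -
  note L = FT_L2[OF assms(1)] FT_L2[OF assms(2)]
  have t: "((\<lambda>R. sq (\<lambda>x. trunc R f x - f x)) \<longlongrightarrow> 0) at_top" if "f \<in> L2" for f :: "'a \<Rightarrow> complex"
    using trunc_tendsto[OF that] unfolding sq_minus_commute[of f] .
  have "((\<lambda>R. \<integral>x. fourier_L1 (trunc R f) x * trunc R g x \<partial>lborel) \<longlongrightarrow> (\<integral>x. h x * g x \<partial>lborel)) at_top"
    by (rule L2_integral_mult_tendsto[OF fourier_L1_trunc_L2[OF L(1)] L(2) FT_lim[OF assms(1)] trunc_L2[OF L(3)] L(3) t[OF L(3)]])
  moreover have "((\<lambda>R. \<integral>x. trunc R f x * fourier_L1 (trunc R g) x \<partial>lborel) \<longlongrightarrow> (\<integral>x. f x * k x \<partial>lborel)) at_top"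
    by (rule L2_integral_mult_tendsto[OF trunc_L2[OF L(1)] L(1) t[OF L(1)] fourier_L1_trunc_L2[OF L(3)] L(4) FT_lim[OF assms(2)]])
  moreover have "(\<integral>x. fourier_L1 (trunc R f) x * trunc R g x \<partial>lborel) = (\<integral>x. trunc R f x * fourier_L1 (trunc R g) x \<partial>lborel)" for R
    by (rule fourier_L1_mult_formula[OF trunc_L1[OF L(1)] trunc_L1[OF L(3)]])
  ultimately show ?thesis using tendsto_unique[OF trivial_limit_at_top_linorder] by simp
qed

text \<open>By the multiplication formula, \<open>g \<mapsto> cnj (T (cnj g))\<close> is the adjoint of the isometry \<open>T\<close>; being
  an isometry as well, it is a right inverse.\<close>

lemma FT_surj:
  assumes g: "g \<in> L2"
  shows "\<exists>f. FT f g"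
proof -
  obtain k where k: "FT (\<lambda>x. cnj (g x)) k" using FT_exists[OF L2_cnj[OF g]] by blast
  have kL: "k \<in> L2" by (rule FT_L2(2)[OF k])
  obtain h where h: "FT (\<lambda>x. cnj (k x)) h" using FT_exists[OF L2_cnj[OF kL]] by blast
  have hL: "h \<in> L2" by (rule FT_L2(2)[OF h])
  have sqk: "sq k = sq g" and sqh: "sq h = sq g" using FT_sq[OF k] FT_sq[OF h] by auto
  have ip: "(\<integral>x. cnj (f x) * f x \<partial>lborel) = complex_of_real (sq f)" for f :: "'a \<Rightarrow> complex"
  proof -
    have "(\<integral>x. cnj (f x) * f x \<partial>lborel) = (\<integral>x. complex_of_real ((norm (f x))\<^sup>2) \<partial>lborel)"
      by (intro Bochner_Integration.integral_cong refl) (simp add: complex_norm_square mult.commute del: of_real_power)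
    then show ?thesis by (simp add: sq_def del: of_real_power)
  qed
  have "(\<integral>x. h x * cnj (g x) \<partial>lborel) = (\<integral>x. cnj (k x) * k x \<partial>lborel)"
    by (rule FT_mult_formula[OF h k])
  then have hg: "(\<integral>x. h x * cnj (g x) \<partial>lborel) = complex_of_real (sq g)" by (simp add: ip sqk)
  note i1 = L2_mult_integrable[OF L2_cnj[OF hL] hL] and i2 = L2_mult_integrable[OF hL L2_cnj[OF g]]
    and i3 = L2_mult_integrable[OF L2_cnj[OF g] g]
  \<comment> \<open>The square |h - g|^2 is expanded; the two norms and the inner product of h and g
    all equal \<open>sq g\<close>, so everything cancels.\<close>
  have "complex_of_real (sq (\<lambda>x. h x - g x)) = (\<integral>x. cnj (h x - g x) * (h x - g x) \<partial>lborel)"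
    by (rule ip[symmetric])
  also have "\<dots> = (\<integral>x. (cnj (h x) * h x - cnj (h x * cnj (g x))) - (h x * cnj (g x) - cnj (g x) * g x) \<partial>lborel)"
    by (intro Bochner_Integration.integral_cong refl) (simp add: algebra_simps)
  also have "\<dots> = ((\<integral>x. cnj (h x) * h x \<partial>lborel) - cnj (\<integral>x. h x * cnj (g x) \<partial>lborel)) -
     ((\<integral>x. h x * cnj (g x) \<partial>lborel) - (\<integral>x. cnj (g x) * g x \<partial>lborel))"
    by (simp only: Bochner_Integration.integral_diff[OF Bochner_Integration.integrable_diff[OF i1 integrable_cnj[OF i2]] Bochner_Integration.integrable_diff[OF i2 i3]]
        Bochner_Integration.integral_diff[OF i1 integrable_cnj[OF i2]] Bochner_Integration.integral_diff[OF i2 i3] Bochner_Integration.integral_cnj)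
  also have "\<dots> = 0" by (simp add: ip hg sqh)
  finally have "sq (\<lambda>x. h x - g x) = 0" by simp
  then have "AE x in lborel. h x = g x" using sq_eq_0_iff[OF L2_diff[OF hL g]] by simp
  then have gh: "AE x in lborel. g x = h x" by eventually_elim simp
  have "FT (\<lambda>x. cnj (k x)) g"
    by (rule FT_cong_AE[OF h _ _ _ gh]) (use g FT_L2(1)[OF h] in auto)
  then show ?thesis by blast
qed

lemma FT_L1_L2:
  assumes g1: "integrable lborel g" and g2: "g \<in> L2"
  shows "FT g (fourier_L1 g)"
proof -
  have "sq (\<lambda>\<xi>. fourier_L1 g \<xi> - fourier_L1 (trunc R g) \<xi>) = sq (\<lambda>x. g x - trunc R g x)" for R
    unfolding fourier_L1_diff[OF g1 trunc_L1[OF g2], symmetric]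
    by (intro Plancherel_L1_L2 L2_diff trunc_L2 g2 Bochner_Integration.integrable_diff trunc_L1 g1)
  then show ?thesis
    unfolding FT_def using g2 Plancherel_L1_L2(1)[OF g1 g2] trunc_tendsto[OF g2] by simp
qed

text \<open>The multiplication formula against a modulated Gaussian. It holds at every x, not merely
  almost everywhere, since the Gaussian makes the frequency integral absolutely convergent.\<close>

lemma heat_conv_FT:
  fixes f :: "'a::euclidean_space \<Rightarrow> complex"
  assumes "FT f h" and t: "t > 0"
  shows "complex_of_real ((2 * pi) powr (real DIM('a) / 2)) * heat_conv t f x =
    (\<integral>\<xi>. exp (\<i> * complex_of_real (x \<bullet> \<xi>)) * (complex_of_real (exp (- t * (norm \<xi>)\<^sup>2)) * h \<xi>) \<partial>lborel)"
proof -
  have "(\<integral>\<xi>. h \<xi> * (exp (\<i> * complex_of_real (x \<bullet> \<xi>)) * complex_of_real (exp (- t * (norm \<xi>)\<^sup>2))) \<partial>lborel) =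
    (\<integral>y. f y * complex_of_real ((2 * pi) powr (real DIM('a) / 2) * heat_kernel t (x - y)) \<partial>lborel)"
    using FT_mult_formula[OF assms(1) FT_L1_L2[OF gauss_mult_integrable(3,2)[OF t]]]
    unfolding fourier_L1_modulated_gauss[OF t] .
  also have "\<dots> = complex_of_real ((2 * pi) powr (real DIM('a) / 2)) * heat_conv t f x"
    unfolding heat_conv_def integral_mult_right_zero[symmetric]
    by (intro Bochner_Integration.integral_cong refl) simp
  finally show ?thesis by (simp add: mult_ac)
qed

lemma fourier_injective:
  fixes w :: "'a::euclidean_space \<Rightarrow> complex"
  assumes "integrable lborel w" "w \<in> L2"
    and "\<And>x. (\<integral>\<xi>. exp (\<i> * complex_of_real (x \<bullet> \<xi>)) * w \<xi> \<partial>lborel) = 0"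
  shows "AE \<xi> in lborel. w \<xi> = 0"
proof -
  have "fourier_L1 w x = 0" for x
    using assms(3)[of "- x"] unfolding fourier_L1_def by (simp add: inner_commute)
  then have "sq w = 0" using Plancherel_L1_L2(2)[OF assms(1,2)] by (simp add: sq_def)
  then show ?thesis using sq_eq_0_iff[OF assms(2)] by simp
qed

section \<open>Borel representatives\<close>

text \<open>The bridge between the Lebesgue measurable functions of the definitions and the Borel
  functions of the proofs.\<close>

definition borel_rep :: "('a::euclidean_space \<Rightarrow> complex) \<Rightarrow> ('a \<Rightarrow> complex) \<Rightarrow> bool" where
  "borel_rep f f' \<longleftrightarrow> f \<in> borel_measurable lebesgue \<and> f' \<in> borel_measurable borel \<and> (AE x in lborel. f x = f' x)"

lemma borel_repD:
  assumes "borel_rep f f'"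
  shows "f \<in> borel_measurable lebesgue" "f' \<in> borel_measurable borel" "AE x in lborel. f x = f' x" "AE x in lebesgue. f x = f' x"
    "f' \<in> borel_measurable lebesgue"
  using assms by (auto simp: borel_rep_def AE_lebesgue_iff_lborel intro: measurable_completion)

lemma borel_rep_ex: "f \<in> borel_measurable lebesgue \<Longrightarrow> \<exists>f'. borel_rep f f'"
  using lebesgue_ex_borel unfolding borel_rep_def by blast

lemma borel_rep_self: "f \<in> borel_measurable borel \<Longrightarrow> borel_rep f f"
  by (auto simp: borel_rep_def intro: measurable_completion)

lemma borel_rep_cong:
  assumes "borel_rep f f'" "g \<in> borel_measurable borel" "AE x in lborel. f' x = g x"
  shows "borel_rep f g"
  unfolding borel_rep_def using assms(2) borel_repD(1)[OF assms(1)] borel_repD(3)[OF assms(1)] assms(3)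
  by (auto elim: eventually_elim2)

lemma borel_rep_mult:
  assumes "borel_rep f f'" "borel_rep g g'" shows "borel_rep (\<lambda>x. f x * g x) (\<lambda>x. f' x * g' x)"
  unfolding borel_rep_def using borel_repD[OF assms(1)] borel_repD[OF assms(2)]
  by (auto elim: eventually_elim2 intro: borel_measurable_times)

lemma borel_rep_add:
  assumes "borel_rep f f'" "borel_rep g g'" shows "borel_rep (\<lambda>x. f x + g x) (\<lambda>x. f' x + g' x)"
  unfolding borel_rep_def using borel_repD[OF assms(1)] borel_repD[OF assms(2)]
  by (auto elim: eventually_elim2 intro: borel_measurable_add)

lemma borel_rep_diff:
  assumes "borel_rep f f'" "borel_rep g g'" shows "borel_rep (\<lambda>x. f x - g x) (\<lambda>x. f' x - g' x)"
  unfolding borel_rep_def using borel_repD[OF assms(1)] borel_repD[OF assms(2)]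
  by (auto elim: eventually_elim2 intro: borel_measurable_diff)

lemma borel_rep_cmult:
  assumes "borel_rep f f'" shows "borel_rep (\<lambda>x. c * f x) (\<lambda>x. c * f' x)"
  by (rule borel_rep_mult[OF borel_rep_self assms]) simp

lemma borel_rep_sum:
  "(\<And>i. i \<in> I \<Longrightarrow> borel_rep (f i) (f' i)) \<Longrightarrow> borel_rep (\<lambda>x. \<Sum>i\<in>I. f i x) (\<lambda>x. \<Sum>i\<in>I. f' i x)"
  by (induct I rule: infinite_finite_induct) (auto intro: borel_rep_add borel_rep_self)

lemma borel_rep_integral:
  assumes "borel_rep f f'"
  shows "(\<integral>x. f x \<partial>lebesgue) = (\<integral>x. f' x \<partial>lborel)" "integrable lebesgue f \<longleftrightarrow> integrable lborel f'"
proof -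
  note r = borel_repD[OF assms]
  have "(\<integral>x. f x \<partial>lebesgue) = (\<integral>x. f' x \<partial>lebesgue)"
    by (rule integral_cong_AE[OF r(1,5,4)])
  also have "\<dots> = (\<integral>x. f' x \<partial>lborel)" using r(2) by (intro integral_completion) simp
  finally show "(\<integral>x. f x \<partial>lebesgue) = (\<integral>x. f' x \<partial>lborel)" .
  have "integrable lebesgue f \<longleftrightarrow> integrable lebesgue f'"
    by (rule integrable_cong_AE[OF r(1,5,4)])
  also have "\<dots> \<longleftrightarrow> integrable lborel f'" using r(2) by (intro integrable_completion) simp
  finally show "integrable lebesgue f \<longleftrightarrow> integrable lborel f'" .
qed

section \<open>Norms and Fourier transforms in terms of representatives\<close>

lemma Lp_norm_2:
  assumes "borel_rep f f'"
  shows "Lp_norm 2 f = epowr (\<integral>\<^sup>+x. ennreal ((norm (f' x))\<^sup>2) \<partial>lborel) (1 / 2)"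
proof -
  have "(\<integral>\<^sup>+x. ennreal (norm (f x) powr 2) \<partial>lebesgue) = (\<integral>\<^sup>+x. ennreal ((norm (f' x))\<^sup>2) \<partial>lebesgue)"
    using borel_repD(4)[OF assms] by (intro nn_integral_cong_AE) (auto simp: powr_numeral)
  then show ?thesis
    by (simp add: Lp_norm_def nn_integral_completion)
qed

lemma epowr_ennreal: "0 \<le> a \<Longrightarrow> epowr (ennreal a) r = ennreal (a powr r)"
  by (simp add: epowr_def)

lemma Lp_norm_2_L2:
  assumes "borel_rep f f'" "f' \<in> L2"
  shows "Lp_norm 2 f = ennreal (sqrt (sq f'))"
  using Lp_norm_2[OF assms(1)] nn_integral_sq[OF assms(2)] by (simp add: epowr_ennreal powr_half_sqrt)

lemma Lp2_iff:
  assumes "borel_rep f f'"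
  shows "f \<in> Lp 2 \<longleftrightarrow> f' \<in> L2"
proof
  assume "f \<in> Lp 2"
  then have "Lp_norm 2 f < \<infinity>" by (simp only: Lp_def mem_Collect_eq)
  then have "epowr (\<integral>\<^sup>+x. ennreal ((norm (f' x))\<^sup>2) \<partial>lborel) (1 / 2) < \<infinity>"
    unfolding Lp_norm_2[OF assms] .
  then have "(\<integral>\<^sup>+x. ennreal ((norm (f' x))\<^sup>2) \<partial>lborel) < \<infinity>"
    by (auto simp: epowr_def less_top split: if_splits)
  then show "f' \<in> L2" using borel_repD(2)[OF assms] by (simp add: L2_iff_nn_integral)
next
  assume "f' \<in> L2"
  then show "f \<in> Lp 2" using Lp_norm_2_L2[OF assms] borel_repD(1)[OF assms] by (simp add: Lp_def)
qed

lemma Lp_measurable: "f \<in> Lp r \<Longrightarrow> f \<in> borel_measurable lebesgue"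
  by (simp add: Lp_def)

lemma Lp2_ex_rep: "f \<in> Lp 2 \<Longrightarrow> \<exists>f'. borel_rep f f' \<and> f' \<in> L2"
  using borel_rep_ex[OF Lp_measurable] Lp2_iff by blast

lemma fourier_integral_eq_fourier_L1:
  fixes f :: "'a::euclidean_space \<Rightarrow> complex"
  assumes "borel_rep f f'"
  shows "fourier_integral (\<lambda>x. indicator (ball 0 R) x * f x) = fourier_L1 (trunc R f')"
proof
  fix \<xi> :: 'a
  have "borel_rep (\<lambda>x. exp (- \<i> * complex_of_real (x \<bullet> \<xi>)) * (indicator (ball 0 R) x * f x))
     (\<lambda>x. exp (- \<i> * complex_of_real (x \<bullet> \<xi>)) * (indicator (ball 0 R) x * f' x))"
  proof (intro borel_rep_mult borel_rep_self assms)
    show "indicator (ball 0 R) \<in> borel_measurable borel" by (intro borel_measurable_indicator) simp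
  qed measurable
  from borel_rep_integral(1)[OF this]
  show "fourier_integral (\<lambda>x. indicator (ball 0 R) x * f x) \<xi> = fourier_L1 (trunc R f') \<xi>"
    unfolding fourier_integral_def fourier_L1_def trunc_def by simp
qed

lemma tendsto_ennreal_sqrt_iff:
  assumes "\<And>x. 0 \<le> f x"
  shows "((\<lambda>x. ennreal (sqrt (f x))) \<longlongrightarrow> 0) F \<longleftrightarrow> (f \<longlongrightarrow> 0) F"
proof
  assume "((\<lambda>x. ennreal (sqrt (f x))) \<longlongrightarrow> 0) F"
  then have "((\<lambda>x. ennreal (sqrt (f x))) \<longlongrightarrow> ennreal 0) F" by simp
  then have "((\<lambda>x. sqrt (f x)) \<longlongrightarrow> 0) F"
    by (subst (asm) tendsto_ennreal_iff) (auto simp: assms)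
  from tendsto_power[OF this, of 2] show "(f \<longlongrightarrow> 0) F" using assms by simp
next
  assume "(f \<longlongrightarrow> 0) F"
  from tendsto_ennrealI[OF tendsto_real_sqrt[OF this]]
  show "((\<lambda>x. ennreal (sqrt (f x))) \<longlongrightarrow> 0) F" by simp
qed

lemma is_fourier_L2_iff:
  assumes f: "borel_rep f f'" and h: "borel_rep h h'"
  shows "is_fourier_L2 f h \<longleftrightarrow> FT f' h'"
proof (cases "f' \<in> L2 \<and> h' \<in> L2")
  case True
  have "Lp_norm 2 (\<lambda>\<xi>. h \<xi> - fourier_integral (\<lambda>x. indicator (ball 0 R) x * f x) \<xi>) =
    ennreal (sqrt (sq (\<lambda>\<xi>. h' \<xi> - fourier_L1 (trunc R f') \<xi>)))" for R
    unfolding fourier_integral_eq_fourier_L1[OF f]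
    using True fourier_L1_trunc_L2[of f' R] by (intro Lp_norm_2_L2 borel_rep_diff h borel_rep_self L2_diff) auto
  then show ?thesis
    using True Lp2_iff[OF f] Lp2_iff[OF h] by (simp add: is_fourier_L2_def FT_def tendsto_ennreal_sqrt_iff)
next
  case False
  then show ?thesis using Lp2_iff[OF f] Lp2_iff[OF h] by (auto simp: is_fourier_L2_def FT_def)
qed

lemma phase_mult_L2: "h \<in> L2 \<Longrightarrow> (\<lambda>\<xi>. exp (- \<i> * complex_of_real (\<tau> * (norm \<xi>)\<^sup>2)) * h \<xi>) \<in> L2"
  by (rule L2_mult_bounded[where C=1]) (simp_all del: mult_minus_left)

text \<open>\<open>fourier_L2\<close> and \<open>schroedinger\<close> are choices.
  \<open>FT_unique\<close> identifies the first with h up to a null set, and \<open>FT_surj\<close>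
  guarantees that the second has something to choose from.\<close>

lemma schroedinger_FT:
  assumes f: "borel_rep f f'" and h: "FT f' h"
  shows "\<exists>v. borel_rep (schroedinger \<tau> f) v \<and> FT v (\<lambda>\<xi>. exp (- \<i> * complex_of_real (\<tau> * (norm \<xi>)\<^sup>2)) * h \<xi>)"
proof -
  let ?m = "\<lambda>\<xi>. exp (- \<i> * complex_of_real (\<tau> * (norm \<xi>)\<^sup>2))"
  have m: "?m \<in> borel_measurable borel" by measurable
  note hL = FT_L2(2)[OF h]
  have "is_fourier_L2 f h" using is_fourier_L2_iff[OF f borel_rep_self[OF L2_measurable[OF hL]]] h by blast
  then have 1: "is_fourier_L2 f (fourier_L2 f)" unfolding fourier_L2_def by (rule someI[of "is_fourier_L2 f" h])
  then have "fourier_L2 f \<in> borel_measurable lebesgue" by (auto simp: is_fourier_L2_def Lp_def)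
  then obtain k where k: "borel_rep (fourier_L2 f) k" using borel_rep_ex by blast
  have "FT f' k" using is_fourier_L2_iff[OF f k] 1 by blast
  from FT_unique[OF this h] have kh: "AE x in lborel. k x = h x" .
  have mh: "borel_rep (\<lambda>\<xi>. ?m \<xi> * fourier_L2 f \<xi>) (\<lambda>\<xi>. ?m \<xi> * h \<xi>)"
    by (intro borel_rep_mult borel_rep_self m borel_rep_cong[OF k L2_measurable[OF hL] kh])
  obtain w where w: "FT w (\<lambda>\<xi>. ?m \<xi> * h \<xi>)" using FT_surj[OF phase_mult_L2[OF hL]] by blast
  have "is_fourier_L2 w (\<lambda>\<xi>. ?m \<xi> * fourier_L2 f \<xi>)"
    using is_fourier_L2_iff[OF borel_rep_self[OF L2_measurable[OF FT_L2(1)[OF w]]] mh] w by blast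
  then have 2: "is_fourier_L2 (schroedinger \<tau> f) (\<lambda>\<xi>. ?m \<xi> * fourier_L2 f \<xi>)"
    unfolding schroedinger_def by (rule someI[of "\<lambda>v. is_fourier_L2 v (\<lambda>\<xi>. ?m \<xi> * fourier_L2 f \<xi>)" w])
  then have "schroedinger \<tau> f \<in> borel_measurable lebesgue" by (auto simp: is_fourier_L2_def Lp_def)
  then obtain v where v: "borel_rep (schroedinger \<tau> f) v" using borel_rep_ex by blast
  have "FT v (\<lambda>\<xi>. ?m \<xi> * h \<xi>)" using is_fourier_L2_iff[OF v mh] 2 by blast
  with v show ?thesis by blast
qed

section \<open>Uniqueness of weak derivatives\<close>

lemma poly_gauss_heat_kernel:
  fixes x :: "'a::euclidean_space"
  assumes "t > 0" shows "poly_gauss x (\<lambda>y. complex_of_real (heat_kernel t (x - y)))"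
proof -
  have "poly_gauss x (\<lambda>y. complex_of_real ((4 * pi * t) powr (- real DIM('a) / 2)) * of_real (exp (- (1 / (4 * t)) * (norm (y - x))\<^sup>2)))"
    using assms by (intro poly_gauss_cmult poly_gauss_gauss) simp
  then show ?thesis by (simp add: heat_kernel_def norm_minus_commute)
qed

lemma test_function_bounded:
  fixes \<psi> :: "'a::euclidean_space \<Rightarrow> complex"
  assumes "test_function \<psi>"
  shows "\<psi> \<in> borel_measurable borel" "\<exists>C. \<forall>x. norm (\<psi> x) \<le> C" "\<exists>K. compact K \<and> (\<forall>x. x \<notin> K \<longrightarrow> \<psi> x = 0)"
proof -
  have c: "continuous_on UNIV \<psi>" using assms unfolding test_function_def by (metis Ck.simps(1))
  then show "\<psi> \<in> borel_measurable borel" by (rule borel_measurable_continuous_onI)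
  have K: "compact (closure {x. \<psi> x \<noteq> 0})" using assms by (simp add: test_function_def)
  have z: "\<psi> x = 0" if "x \<notin> closure {x. \<psi> x \<noteq> 0}" for x
    using that closure_subset[of "{x. \<psi> x \<noteq> 0}"] by auto
  show "\<exists>K. compact K \<and> (\<forall>x. x \<notin> K \<longrightarrow> \<psi> x = 0)" using K z by blast
  show "\<exists>C. \<forall>x. norm (\<psi> x) \<le> C" by (rule continuous_support_bounded[OF K z c])
qed

lemma locally_integrable_measurable:
  fixes f :: "'a::euclidean_space \<Rightarrow> complex"
  assumes "locally_integrable f" shows "f \<in> borel_measurable lebesgue"
proof -
  have m: "(\<lambda>x. indicator (cball 0 (real k)) x *\<^sub>R f x) \<in> borel_measurable lebesgue" for k :: nat
    using assms unfolding locally_integrable_def set_integrable_def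
    by (intro borel_measurable_integrable) auto
  have l: "(\<lambda>k. indicator (cball 0 (real k)) x *\<^sub>R f x) \<longlonglongrightarrow> f x" for x :: 'a
  proof (rule tendsto_eventually)
    obtain N where N: "norm x \<le> real N" using real_arch_simple by blast
    show "\<forall>\<^sub>F k in sequentially. indicator (cball 0 (real k)) x *\<^sub>R f x = f x"
      using eventually_ge_at_top[of N] by eventually_elim (use N in auto)
  qed
  show ?thesis by (rule borel_measurable_LIMSEQ_metric[OF m l])
qed

lemma locally_integrable_mult_test:
  assumes f: "locally_integrable f" and \<psi>: "\<psi> \<in> borel_measurable borel" "\<And>x. norm (\<psi> x) \<le> C" "compact K" "\<And>x. x \<notin> K \<Longrightarrow> \<psi> x = 0"
  shows "integrable lebesgue (\<lambda>x. f x * \<psi> x)"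
proof (rule Bochner_Integration.integrable_bound)
  show "integrable lebesgue (\<lambda>x. C * norm (indicator K x *\<^sub>R f x))"
    using f \<psi>(3) unfolding locally_integrable_def set_integrable_def by (intro integrable_mult_right integrable_norm) blast
  show "(\<lambda>x. f x * \<psi> x) \<in> borel_measurable lebesgue"
    using locally_integrable_measurable[OF f] measurable_completion[of \<psi> lborel borel] \<psi>(1)
    by (intro borel_measurable_times) auto
  show "AE x in lebesgue. norm (f x * \<psi> x) \<le> norm (C * norm (indicator K x *\<^sub>R f x))"
  proof (rule AE_I2)
    fix x
    show "norm (f x * \<psi> x) \<le> norm (C * norm (indicator K x *\<^sub>R f x))"
    proof (cases "x \<in> K")
      case True
      have "0 \<le> C" using \<psi>(2)[of x] norm_ge_zero[of "\<psi> x"] by linarith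
      then show ?thesis using True mult_right_mono[OF \<psi>(2)[of x], of "norm (f x)"] by (simp add: norm_mult mult.commute)
    qed (simp add: \<psi>(4))
  qed
qed

text \<open>Smooth cutoffs of \<open>u\<close> are annihilated by the heat semigroup, which approximates the identity.\<close>

lemma fundamental_lemma:
  fixes u :: "'a::euclidean_space \<Rightarrow> complex"
  assumes u: "locally_integrable u" and z: "\<And>\<psi>. test_function \<psi> \<Longrightarrow> (\<integral>x. u x * \<psi> x \<partial>lebesgue) = 0"
  shows "AE x in lebesgue. u x = 0"
proof -
  obtain v where v: "borel_rep u v" using borel_rep_ex[OF locally_integrable_measurable[OF u]] by blast
  obtain C where C: "\<And>x::'a. norm (cutoff x) \<le> C" using cutoff_bounds(1) by metis
  define w where "w k x = v x * cutoff (inv_Suc k *\<^sub>R x)" for k x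
  have sc: "smooth_gen (\<lambda>x. cutoff (inv_Suc k *\<^sub>R (x::'a)))" for k
    by (intro smooth_gen_scale cutoff_smooth_gen) (simp add: inv_Suc_def)
  have "AE x in lborel. w k x = 0" for k
  proof -
    define K where "K = cbox (- (One /\<^sub>R inv_Suc k)) (One /\<^sub>R inv_Suc k :: 'a)"
    have "integrable lebesgue (\<lambda>x. u x * cutoff (inv_Suc k *\<^sub>R x))"
    proof (rule locally_integrable_mult_test[OF u, where K=K and C=C])
      show "cutoff (inv_Suc k *\<^sub>R x) = 0" if "x \<notin> K" for x
        using that cutoff_neq_0_iff[of "inv_Suc k *\<^sub>R x"] inv_Suc_pos[of k]
        by (auto simp: K_def mem_box field_simps less_imp_le)
    qed (auto simp: K_def C intro: smooth_gen_measurable sc)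
    moreover have "borel_rep (\<lambda>x. u x * cutoff (inv_Suc k *\<^sub>R x)) (w k)"
      unfolding w_def[abs_def] by (intro borel_rep_mult v borel_rep_self smooth_gen_measurable sc)
    ultimately have wi: "integrable lborel (w k)" using borel_rep_integral(2) by blast
    \<comment> \<open>In the variable y the cutoff times the heat kernel is a test function, so the
      hypothesis applies; the cutoff also makes \<open>w k\<close> integrable, as convergence in L1
      requires.\<close>
    have "heat_conv (inv_Suc j) (w k) x = 0" for j x
    proof -
      have sh: "smooth_gen (\<lambda>y. complex_of_real (heat_kernel (inv_Suc j) (x - y)))" by (rule poly_gauss_smooth_gen[OF poly_gauss_heat_kernel[OF inv_Suc_pos]])
      have "borel_rep (\<lambda>y. u y * (cutoff (inv_Suc k *\<^sub>R y) * complex_of_real (heat_kernel (inv_Suc j) (x - y))))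
        (\<lambda>y. v y * (cutoff (inv_Suc k *\<^sub>R y) * complex_of_real (heat_kernel (inv_Suc j) (x - y))))"
        by (intro borel_rep_mult v borel_rep_self smooth_gen_measurable sc sh)
      from borel_rep_integral(1)[OF this] z[OF test_function_cutoff[OF sh inv_Suc_pos[of k]]]
      show ?thesis unfolding heat_conv_def w_def by (simp add: mult_ac)
    qed
    then have "(\<lambda>j. norm_L1 (w k)) \<longlonglongrightarrow> 0" using heat_conv_L1_tendsto[OF wi] by (simp add: norm_L1_def)
    then have "norm_L1 (w k) = 0" by (simp add: LIMSEQ_const_iff)
    then show "AE x in lborel. w k x = 0"
      unfolding norm_L1_def using wi by (subst (asm) integral_nonneg_eq_0_iff_AE) auto
  qed
  then have "AE x in lborel. \<forall>k. w k x = 0" by (simp add: AE_all_countable)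
  moreover have "AE x in lborel. u x = v x" using borel_repD(3)[OF v] .
  ultimately have "AE x in lborel. u x = 0"
  proof eventually_elim
    fix x assume x: "\<forall>k. w k x = 0" "u x = v x"
    have "(\<lambda>k. w k x) \<longlonglongrightarrow> v x * 1"
      unfolding w_def inv_Suc_def by (intro tendsto_mult tendsto_const cutoff_one_tendsto)
    then show "u x = 0" using x by (simp add: LIMSEQ_const_iff)
  qed
  then show ?thesis by (simp add: AE_lebesgue_iff_lborel)
qed

lemma locally_integrable_diff:
  "locally_integrable f \<Longrightarrow> locally_integrable g \<Longrightarrow> locally_integrable (\<lambda>x. f x - g x)"
  by (simp add: locally_integrable_def)

lemma locally_integrable_cmult:
  "locally_integrable f \<Longrightarrow> locally_integrable (\<lambda>x. c * f x)"
  by (simp add: locally_integrable_def)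

text \<open>This makes \<open>W1_norm\<close> independent of the choice inside
  \<open>weak_deriv\<close>.\<close>

lemma weak_deriv_unique:
  assumes "is_weak_deriv b f h" "is_weak_deriv b f k"
  shows "AE x in lebesgue. h x = k x"
proof -
  have l: "locally_integrable h" "locally_integrable k" using assms by (auto simp: is_weak_deriv_def)
  have "AE x in lebesgue. h x - k x = 0"
  proof (rule fundamental_lemma[OF locally_integrable_diff[OF l]])
    fix \<psi> :: "'a \<Rightarrow> complex" assume t: "test_function \<psi>"
    obtain C K where "\<And>x. norm (\<psi> x) \<le> C" "compact K" "\<And>x. x \<notin> K \<Longrightarrow> \<psi> x = 0"
      using test_function_bounded[OF t] by metis
    note i = locally_integrable_mult_test[OF l(1) test_function_bounded(1)[OF t] this]
      locally_integrable_mult_test[OF l(2) test_function_bounded(1)[OF t] this]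
    have "(\<integral>x. h x * \<psi> x \<partial>lebesgue) = (\<integral>x. k x * \<psi> x \<partial>lebesgue)"
      using assms t unfolding is_weak_deriv_def by (metis neg_equal_iff_equal)
    then show "(\<integral>x. (h x - k x) * \<psi> x \<partial>lebesgue) = 0" using i by (simp add: left_diff_distrib)
  qed
  then show ?thesis by simp
qed

lemma weak_deriv_AE: "is_weak_deriv b f h \<Longrightarrow> AE x in lebesgue. weak_deriv b f x = h x"
  using weak_deriv_unique[of b f "weak_deriv b f" h] someI[of "is_weak_deriv b f" h]
  by (auto simp: weak_deriv_def)

lemma is_weak_deriv_cmult:
  assumes "is_weak_deriv b f h" shows "is_weak_deriv b (\<lambda>x. c * f x) (\<lambda>x. c * h x)"
  using assms unfolding is_weak_deriv_def by (auto simp: locally_integrable_cmult mult.assoc)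

lemma is_weak_deriv_weak_deriv: "is_weak_deriv b f h \<Longrightarrow> is_weak_deriv b f (weak_deriv b f)"
  unfolding weak_deriv_def by (rule someI[of "is_weak_deriv b f" h])

section \<open>Scaling of Sobolev norms\<close>

lemma Lp_norm_cong_AE:
  assumes "f \<in> borel_measurable lebesgue" "g \<in> borel_measurable lebesgue" "AE x in lebesgue. f x = g x"
  shows "Lp_norm r f = Lp_norm r g"
proof -
  have "esssup lebesgue (\<lambda>x. ennreal (norm (f x))) = esssup lebesgue (\<lambda>x. ennreal (norm (g x)))"
    using assms by (intro esssup_AE_cong) auto
  moreover have "(\<integral>\<^sup>+x. ennreal (norm (f x) powr s) \<partial>lebesgue) = (\<integral>\<^sup>+x. ennreal (norm (g x) powr s) \<partial>lebesgue)" for s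
    using assms(3) by (intro nn_integral_cong_AE) auto
  ultimately show ?thesis by (simp add: Lp_norm_def)
qed

text \<open>An inequality is enough for the estimates in time, and for the essential supremum this
  direction is immediate.\<close>

lemma Lp_norm_cmult_le:
  assumes f: "f \<in> Lp r" and r: "r = \<infinity> \<or> (\<exists>q>0. r = ereal q)"
  shows "Lp_norm r (\<lambda>x. c * f x) \<le> ennreal (norm c) * Lp_norm r f"
proof -
  have m: "f \<in> borel_measurable lebesgue" by (rule Lp_measurable[OF f])
  consider "r = \<infinity>" | q where "q > 0" "r = ereal q" using r by blast
  then show ?thesis
  proof cases
    case 1
    have "AE x in lebesgue. ennreal (norm (f x)) \<le> esssup lebesgue (\<lambda>x. ennreal (norm (f x)))"
      by (rule esssup_AE)
    then have "AE x in lebesgue. ennreal (norm (c * f x)) \<le> ennreal (norm c) * esssup lebesgue (\<lambda>x. ennreal (norm (f x)))"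
      by eventually_elim (simp add: norm_mult ennreal_mult mult_left_mono)
    then show ?thesis using m 1 by (auto simp: Lp_norm_def intro!: esssup_I)
  next
    case 2
    define I where "I = (\<integral>\<^sup>+x. ennreal (norm (f x) powr q) \<partial>lebesgue)"
    have fin: "epowr I (1 / q) < \<infinity>" using f 2 by (simp add: Lp_def Lp_norm_def I_def)
    then have "I \<noteq> \<infinity>" by (auto simp: epowr_def)
    then obtain a where a: "I = ennreal a" "0 \<le> a" by (cases I) auto
    have "(\<integral>\<^sup>+x. ennreal (norm (c * f x) powr q) \<partial>lebesgue) = (\<integral>\<^sup>+x. ennreal (norm c powr q) * ennreal (norm (f x) powr q) \<partial>lebesgue)"
      by (simp add: norm_mult powr_mult ennreal_mult)
    also have "\<dots> = ennreal (norm c powr q) * I"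
      unfolding I_def using m by (intro nn_integral_cmult) measurable
    finally have "(\<integral>\<^sup>+x. ennreal (norm (c * f x) powr q) \<partial>lebesgue) = ennreal (norm c powr q * a)"
      by (simp add: a ennreal_mult)
    then have "Lp_norm r (\<lambda>x. c * f x) = ennreal ((norm c powr q * a) powr (1 / q))"
      using 2 a by (simp add: Lp_norm_def epowr_ennreal)
    also have "(norm c powr q * a) powr (1 / q) = norm c * a powr (1 / q)"
      using 2 a by (simp add: powr_mult powr_powr)
    also have "ennreal (norm c * a powr (1 / q)) = ennreal (norm c) * Lp_norm r f"
      using 2 a by (simp add: Lp_norm_def I_def[symmetric] epowr_ennreal ennreal_mult)
    finally show ?thesis by simp
  qed
qed

lemma Lp_cmult:
  assumes f: "f \<in> Lp r" and r: "r = \<infinity> \<or> (\<exists>q>0. r = ereal q)"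
  shows "(\<lambda>x. c * f x) \<in> Lp r"
proof -
  have "ennreal (norm c) * Lp_norm r f < \<infinity>"
    using f by (simp add: Lp_def ennreal_mult_less_top)
  then show ?thesis using Lp_norm_cmult_le[OF f r, of c] Lp_measurable[OF f]
    by (auto simp: Lp_def intro: le_less_trans)
qed

lemma W1_cmult:
  assumes f: "f \<in> W1 r" and r: "r = \<infinity> \<or> (\<exists>q>0. r = ereal q)"
  shows "(\<lambda>x. c * f x) \<in> W1 r"
proof -
  have "\<exists>h\<in>Lp r. is_weak_deriv b (\<lambda>x. c * f x) h" if b: "b \<in> Basis" for b
  proof -
    obtain h where "h \<in> Lp r" "is_weak_deriv b f h" using f b by (auto simp: W1_def)
    then show ?thesis using Lp_cmult[OF _ r] is_weak_deriv_cmult by blast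
  qed
  then show ?thesis using f Lp_cmult[OF _ r] by (auto simp: W1_def)
qed

lemma is_weak_deriv_measurable: "is_weak_deriv b f h \<Longrightarrow> h \<in> borel_measurable lebesgue"
  by (simp add: is_weak_deriv_def locally_integrable_measurable)

lemma Lp_norm_weak_deriv: "is_weak_deriv b f h \<Longrightarrow> Lp_norm r (weak_deriv b f) = Lp_norm r h"
  by (intro Lp_norm_cong_AE weak_deriv_AE is_weak_deriv_measurable) (rule is_weak_deriv_weak_deriv)

lemma W1_norm_finite:
  assumes f: "f \<in> W1 r"
  shows "W1_norm r f < \<infinity>"
proof -
  have "Lp_norm r (weak_deriv b f) < \<infinity>" if b: "b \<in> Basis" for b
  proof -
    obtain h where h: "h \<in> Lp r" "is_weak_deriv b f h" using f b by (auto simp: W1_def)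
    have "Lp_norm r (weak_deriv b f) = Lp_norm r h"
      by (rule Lp_norm_weak_deriv[OF h(2)])
    then show ?thesis using h by (simp add: Lp_def)
  qed
  then show ?thesis using f by (simp add: W1_norm_def W1_def Lp_def)
qed

lemma W1_norm_cmult_le:
  assumes f: "f \<in> W1 r" and r: "r = \<infinity> \<or> (\<exists>q>0. r = ereal q)"
  shows "W1_norm r (\<lambda>x. c * f x) \<le> ennreal (norm c) * W1_norm r f"
proof -
  have "Lp_norm r (weak_deriv b (\<lambda>x. c * f x)) \<le> ennreal (norm c) * Lp_norm r (weak_deriv b f)" if b: "b \<in> Basis" for b
  proof -
    obtain h where h: "h \<in> Lp r" "is_weak_deriv b f h" using f b by (auto simp: W1_def)
    note heat_conv = is_weak_deriv_cmult[OF h(2), of c]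
    have "Lp_norm r (weak_deriv b (\<lambda>x. c * f x)) = Lp_norm r (\<lambda>x. c * h x)"
      by (rule Lp_norm_weak_deriv[OF heat_conv])
    also have "\<dots> \<le> ennreal (norm c) * Lp_norm r h" by (rule Lp_norm_cmult_le[OF h(1) r])
    also have "Lp_norm r h = Lp_norm r (weak_deriv b f)"
      by (rule Lp_norm_weak_deriv[OF h(2), symmetric])
    finally show ?thesis .
  qed
  then have "(\<Sum>b\<in>Basis. Lp_norm r (weak_deriv b (\<lambda>x. c * f x))) \<le> ennreal (norm c) * (\<Sum>b\<in>Basis. Lp_norm r (weak_deriv b f))"
    unfolding sum_distrib_left by (intro sum_mono)
  moreover have "Lp_norm r (\<lambda>x. c * f x) \<le> ennreal (norm c) * Lp_norm r f"
    using f by (intro Lp_norm_cmult_le[OF _ r]) (simp add: W1_def)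
  ultimately show ?thesis unfolding W1_norm_def distrib_left by (rule add_mono[rotated])
qed

section \<open>Smoothing estimates for the heat semigroup\<close>

lemma epowr_mono: "x \<le> y \<Longrightarrow> 0 \<le> r \<Longrightarrow> epowr x r \<le> epowr y r"
  by (auto simp: epowr_def top_unique less_top intro!: ennreal_leI powr_mono2 enn2real_mono)

lemma epowr_measurable [measurable]:
  assumes [measurable]: "f \<in> borel_measurable M"
  shows "(\<lambda>x. epowr (f x) r) \<in> borel_measurable M"
  unfolding epowr_def by measurable

lemma epowr_0 [simp]: "epowr 0 r = 0"
  by (simp add: epowr_def)

lemma epowr_top [simp]: "epowr \<top> r = \<top>"
  by (simp add: epowr_def)

lemma epowr_1 [simp]: "epowr x 1 = x"
  by (cases x) (auto simp: epowr_def)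

lemma epowr_cmult: "c > 0 \<Longrightarrow> epowr (ennreal c * x) r = ennreal (c powr r) * epowr x r"
  by (cases x) (auto simp: epowr_ennreal powr_mult ennreal_mult_top simp flip: ennreal_mult)

lemma epowr_epowr: "epowr (epowr x a) b = epowr x (a * b)"
  by (cases x) (auto simp: epowr_ennreal powr_powr)

lemma epowr_add: "epowr x (a + b) = epowr x a * epowr x b"
  by (cases x) (auto simp: epowr_ennreal powr_add simp flip: ennreal_mult)

lemma epowr_add_le:
  assumes r: "r > 0"
  shows "epowr (x + y) r \<le> ennreal (2 powr r) * (epowr x r + epowr y r)"
proof -
  have "epowr (x + y) r \<le> epowr (ennreal 2 * max x y) r"
  proof (rule epowr_mono)
    have "x + y \<le> max x y + max x y" by (intro add_mono) auto
    then show "x + y \<le> ennreal 2 * max x y" by (simp add: mult_2)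
  qed (use r in simp)
  also have "\<dots> = ennreal (2 powr r) * epowr (max x y) r" by (rule epowr_cmult) simp
  also have "\<dots> \<le> ennreal (2 powr r) * (epowr x r + epowr y r)"
    by (intro mult_left_mono) (auto simp: max_def)
  finally show ?thesis .
qed

text \<open>Above the level a one has x = x^(1-q) x^q \<le> a^(1-q) x^q; below it the first summand
  suffices. The free level a is what turns this into an inequality for integrals.\<close>

lemma epowr_Young:
  assumes a: "a > 0" and q: "q \<ge> 1"
  shows "x \<le> ennreal a + ennreal (a powr (1 - q)) * epowr x q"
proof (cases x)
  case (real r)
  show ?thesis
  proof (cases "r \<le> a")
    case True
    then have "x \<le> ennreal a" using real by (simp add: ennreal_leI)
    also have "\<dots> \<le> ennreal a + ennreal (a powr (1 - q)) * epowr x q" by simp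
    finally show ?thesis .
  next
    case False
    have "r = r powr (1 - q) * r powr q" using False a by (simp flip: powr_add)
    also have "\<dots> \<le> a powr (1 - q) * r powr q"
      using False a q by (intro mult_right_mono powr_mono2') auto
    finally have "x \<le> ennreal (a powr (1 - q)) * epowr x q"
      using real by (simp add: epowr_ennreal ennreal_leI flip: ennreal_mult)
    also have "\<dots> \<le> ennreal a + ennreal (a powr (1 - q)) * epowr x q" by simp
    finally show ?thesis .
  qed
qed (use a in \<open>simp add: ennreal_mult_top\<close>)

text \<open>Jensen's inequality for a weight of mass at most W, up to the factor 2^q:
  \<open>epowr_Young\<close> is integrated against the weight and the level a is then
  optimised.\<close>

lemma epowr_nn_integral_le:
  assumes [measurable]: "w \<in> borel_measurable M" "f \<in> borel_measurable M"
    and q: "q \<ge> 1" and W: "W > 0" "(\<integral>\<^sup>+x. w x \<partial>M) \<le> ennreal W"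
  shows "epowr (\<integral>\<^sup>+x. w x * f x \<partial>M) q \<le> ennreal (2 powr q * W powr (q - 1)) * (\<integral>\<^sup>+x. w x * epowr (f x) q \<partial>M)"
proof (cases "(\<integral>\<^sup>+x. w x * epowr (f x) q \<partial>M)")
  case top
  then show ?thesis using W by (simp add: ennreal_mult_top)
next
  case (real i)
  have le: "(\<integral>\<^sup>+x. w x * f x \<partial>M) \<le> ennreal (a * W + a powr (1 - q) * i)" if a: "a > 0" for a
  proof -
    have "(\<integral>\<^sup>+x. w x * f x \<partial>M) \<le> (\<integral>\<^sup>+x. ennreal a * w x + ennreal (a powr (1 - q)) * (w x * epowr (f x) q) \<partial>M)"
    proof (rule nn_integral_mono)
      fix x
      have "w x * f x \<le> w x * (ennreal a + ennreal (a powr (1 - q)) * epowr (f x) q)"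
        by (intro mult_left_mono epowr_Young a q) simp
      then show "w x * f x \<le> ennreal a * w x + ennreal (a powr (1 - q)) * (w x * epowr (f x) q)"
        by (simp add: distrib_left mult_ac)
    qed
    also have "\<dots> = ennreal a * (\<integral>\<^sup>+x. w x \<partial>M) + ennreal (a powr (1 - q)) * ennreal i"
      by (subst nn_integral_add) (auto simp: nn_integral_cmult real)
    also have "\<dots> \<le> ennreal a * ennreal W + ennreal (a powr (1 - q)) * ennreal i"
      by (intro add_right_mono mult_left_mono W) simp
    also have "\<dots> = ennreal (a * W + a powr (1 - q) * i)"
      using a W real by (simp add: ennreal_mult ennreal_plus del: ennreal_plus[symmetric])
    finally show ?thesis .
  qed
  show ?thesis
  proof (cases "i = 0")
    \<comment> \<open>With i = 0 the bound is a W for every a > 0, so a may tend to 0.\<close>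
    case True
    have "(\<integral>\<^sup>+x. w x * f x \<partial>M) \<le> ennreal 0"
    proof (rule ennreal_le_epsilon)
      fix e :: real assume "e > 0"
      then show "(\<integral>\<^sup>+x. w x * f x \<partial>M) \<le> ennreal 0 + ennreal e"
        using le[of "e / W"] W True by simp
    qed
    then show ?thesis by simp
  next
    case False
    then have i: "i > 0" using real by simp
    \<comment> \<open>At this level both terms of the bound coincide, which is the origin of the
      factor 2.\<close>
    define a where "a = (i / W) powr (1 / q)"
    have a: "a > 0" using i W by (simp add: a_def)
    have 1: "a * W = i powr (1 / q) * W powr (1 - 1 / q)"
    proof -
      have "a * W = i powr (1 / q) * (W / W powr (1 / q))"
        using i W by (simp add: a_def powr_divide)
      also have "W / W powr (1 / q) = W powr (1 - 1 / q)" using W by (simp add: powr_diff)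
      finally show ?thesis .
    qed
    have 2: "a powr (1 - q) * i = i powr (1 / q) * W powr (1 - 1 / q)"
    proof -
      have "a powr (1 - q) = (i / W) powr (1 / q - 1)"
        unfolding a_def powr_powr using q by (simp add: field_simps)
      also have "\<dots> = i powr (1 / q - 1) / W powr (1 / q - 1)" using i W by (simp add: powr_divide)
      finally have "a powr (1 - q) * i = (i powr (1 / q - 1) * i) * (1 / W powr (1 / q - 1))" by simp
      also have "i powr (1 / q - 1) * i = i powr (1 / q)" using i by (simp add: powr_diff)
      also have "1 / W powr (1 / q - 1) = W powr (1 - 1 / q)" using W by (simp add: powr_diff)
      finally show ?thesis .
    qed
    have "epowr (\<integral>\<^sup>+x. w x * f x \<partial>M) q \<le> epowr (ennreal (2 * (i powr (1 / q) * W powr (1 - 1 / q)))) q"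
      using le[OF a] q unfolding 1 2 by (intro epowr_mono) auto
    also have "\<dots> = ennreal ((2 * (i powr (1 / q) * W powr (1 - 1 / q))) powr q)"
      using W i by (intro epowr_ennreal) simp
    also have "(2 * (i powr (1 / q) * W powr (1 - 1 / q))) powr q = 2 powr q * W powr (q - 1) * i"
      using W i q by (simp add: powr_mult powr_powr left_diff_distrib)
    also have "ennreal \<dots> = ennreal (2 powr q * W powr (q - 1)) * ennreal i"
      using W i by (intro ennreal_mult) auto
    finally show ?thesis by (simp add: real)
  qed
qed

section \<open>Bounds for the heat semigroup at a fixed time\<close>

lemma heat_kernel_le': "t > 0 \<Longrightarrow> heat_kernel t (x :: 'a::euclidean_space) \<le> t powr (- real DIM('a) / 2)"
proof -
  assume t: "t > 0"
  have "t \<le> 4 * pi * t" using t pi_gt3 by (simp add: mult_le_cancel_right1)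
  then have "(4 * pi * t) powr (- real DIM('a) / 2) \<le> t powr (- real DIM('a) / 2)"
    using t by (intro powr_mono2') auto
  with heat_kernel_le[OF t, of x] show ?thesis by linarith
qed

lemma heat_nn_le_integral:
  fixes x :: "'a::euclidean_space"
  assumes [measurable]: "g \<in> borel_measurable borel" and t: "t > 0"
  shows "heat_nn t g x \<le> ennreal (t powr (- real DIM('a) / 2)) * (\<integral>\<^sup>+y. g y \<partial>lborel)"
proof -
  have "heat_nn t g x \<le> (\<integral>\<^sup>+y. ennreal (t powr (- real DIM('a) / 2)) * g y \<partial>lborel)"
    unfolding heat_nn_def by (intro nn_integral_mono mult_right_mono ennreal_leI heat_kernel_le' t) simp
  then show ?thesis by (simp add: nn_integral_cmult)
qed

lemma heat_nn_Jensen: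
  fixes x :: "'a::euclidean_space"
  assumes [measurable]: "f \<in> borel_measurable borel" and t: "t > 0" and m: "m \<ge> 1"
  shows "epowr (heat_nn t f x) m \<le> ennreal (2 powr m) * heat_nn t (\<lambda>y. epowr (f y) m) x"
proof -
  have "epowr (heat_nn t f x) m \<le> ennreal (2 powr m * 1 powr (m - 1)) * heat_nn t (\<lambda>y. epowr (f y) m) x"
    unfolding heat_nn_def using nn_integral_heat_kernel_diff(1)[OF t, of x]
    by (intro epowr_nn_integral_le m) auto
  then show ?thesis by simp
qed

text \<open>Jensen's inequality followed by the supremum bound of the kernel. The flow is taken at a
  time s \<ge> t while the bound is a power of t, because derivatives of the kernel at time t are
  controlled by the kernel at time 2t.\<close>

lemma heat_nn_pointwise:
  fixes x :: "'a::euclidean_space"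
  assumes f [measurable]: "f \<in> borel_measurable borel" and t: "t > 0" "t \<le> s" and m: "m \<ge> 1"
    and M: "(\<integral>\<^sup>+y. epowr (f y) m \<partial>lborel) = ennreal \<mu>" "\<mu> \<ge> 0"
  shows "epowr (heat_nn s f x) m \<le> ennreal (2 powr m * t powr (- real DIM('a) / 2) * \<mu>)"
proof -
  have s: "s > 0" using t by simp
  have "epowr (heat_nn s f x) m \<le> ennreal (2 powr m) * heat_nn s (\<lambda>y. epowr (f y) m) x"
    by (rule heat_nn_Jensen[OF f s m])
  also have "\<dots> \<le> ennreal (2 powr m) * (ennreal (s powr (- real DIM('a) / 2)) * ennreal \<mu>)"
    using heat_nn_le_integral[of "\<lambda>y. epowr (f y) m" s x] s M by (intro mult_left_mono) auto
  also have "\<dots> \<le> ennreal (2 powr m) * (ennreal (t powr (- real DIM('a) / 2)) * ennreal \<mu>)"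
    using t by (intro mult_left_mono mult_right_mono ennreal_leI powr_mono2') auto
  also have "\<dots> = ennreal (2 powr m * t powr (- real DIM('a) / 2) * \<mu>)"
    using M by (simp add: ennreal_mult mult.assoc)
  finally show ?thesis .
qed

lemma heat_nn_pointwise':
  fixes x :: "'a::euclidean_space"
  assumes f [measurable]: "f \<in> borel_measurable borel" and t: "t > 0" "t \<le> s" and m: "m \<ge> 1"
    and M: "(\<integral>\<^sup>+y. epowr (f y) m \<partial>lborel) = ennreal \<mu>" "\<mu> \<ge> 0"
  shows "heat_nn s f x \<le> ennreal (2 * \<mu> powr (1 / m) * t powr (- (real DIM('a) / (2 * m))))"
proof -
  have "heat_nn s f x = epowr (epowr (heat_nn s f x) m) (1 / m)" using m by (simp add: epowr_epowr)
  also have "\<dots> \<le> epowr (ennreal (2 powr m * t powr (- real DIM('a) / 2) * \<mu>)) (1 / m)"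
    using m by (intro epowr_mono heat_nn_pointwise[OF f t m M]) auto
  also have "\<dots> = ennreal ((2 powr m * t powr (- real DIM('a) / 2) * \<mu>) powr (1 / m))"
    using M t by (intro epowr_ennreal) auto
  also have "(2 powr m * t powr (- real DIM('a) / 2) * \<mu>) powr (1 / m) = 2 * \<mu> powr (1 / m) * t powr (- (real DIM('a) / (2 * m)))"
    using M m t by (simp add: powr_mult powr_powr)
  finally show ?thesis .
qed

text \<open>With v the value of the flow, v^q = (v^m)^(q/m - 1) v^m. The first factor is bounded
  pointwise; the second is integrated by Jensen's inequality and conservation of mass.\<close>

lemma nn_integral_heat_nn_powr:
  fixes f :: "'a::euclidean_space \<Rightarrow> ennreal"
  assumes f [measurable]: "f \<in> borel_measurable borel" and t: "t > 0" "t \<le> s" and m: "m \<ge> 1" and q: "q \<ge> m"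
    and M: "(\<integral>\<^sup>+y. epowr (f y) m \<partial>lborel) = ennreal \<mu>" "\<mu> \<ge> 0"
  shows "(\<integral>\<^sup>+x. epowr (heat_nn s f x) q \<partial>lborel) \<le> ennreal (2 powr q * \<mu> powr (q / m - 1) * \<mu> * t powr (- (real DIM('a) / 2 * (q / m - 1))))"
proof -
  have s: "s > 0" using t by simp
  let ?c = "2 powr m * t powr (- real DIM('a) / 2) * \<mu>"
  have c0: "0 \<le> ?c" using M by simp
  have "epowr (heat_nn s f x) q \<le> ennreal (?c powr (q / m - 1) * 2 powr m) * heat_nn s (\<lambda>y. epowr (f y) m) x" for x
  proof -
    have "epowr (heat_nn s f x) q = epowr (epowr (heat_nn s f x) m) (q / m - 1) * epowr (heat_nn s f x) m"
      unfolding epowr_epowr using m by (simp add: right_diff_distrib flip: epowr_add)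
    also have "\<dots> \<le> epowr (ennreal ?c) (q / m - 1) * (ennreal (2 powr m) * heat_nn s (\<lambda>y. epowr (f y) m) x)"
      using m q by (intro mult_mono epowr_mono heat_nn_pointwise[OF f t m M] heat_nn_Jensen[OF f s m]) auto
    also have "\<dots> = ennreal (?c powr (q / m - 1) * 2 powr m) * heat_nn s (\<lambda>y. epowr (f y) m) x"
      unfolding epowr_ennreal[OF c0] by (simp add: ennreal_mult mult.assoc)
    finally show ?thesis .
  qed
  then have "(\<integral>\<^sup>+x. epowr (heat_nn s f x) q \<partial>lborel) \<le> (\<integral>\<^sup>+x. ennreal (?c powr (q / m - 1) * 2 powr m) * heat_nn s (\<lambda>y. epowr (f y) m) x \<partial>lborel)"
    by (intro nn_integral_mono)
  also have "\<dots> = ennreal (?c powr (q / m - 1) * 2 powr m) * ennreal \<mu>"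
    by (subst nn_integral_cmult) (auto simp: nn_integral_heat_nn s M)
  also have "\<dots> = ennreal (?c powr (q / m - 1) * 2 powr m * \<mu>)"
    using M by (intro ennreal_mult[symmetric]) auto
  also have "?c powr (q / m - 1) * 2 powr m * \<mu> = 2 powr q * \<mu> powr (q / m - 1) * \<mu> * t powr (- (real DIM('a) / 2 * (q / m - 1)))"
  proof -
    have "?c powr (q / m - 1) = 2 powr (q - m) * t powr (- (real DIM('a) / 2 * (q / m - 1))) * \<mu> powr (q / m - 1)"
      using M t m by (simp add: powr_mult powr_powr right_diff_distrib)
    moreover have "2 powr (q - m) * 2 powr m = (2::real) powr q" by (simp flip: powr_add)
    ultimately show ?thesis by (simp add: mult_ac)
  qed
  finally show ?thesis .
qed

section \<open>Integration of the bounds over small times\<close>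

lemma nn_integral_powr_0_1:
  assumes "s < 1"
  shows "\<exists>A>0. (\<integral>\<^sup>+t. indicator {0<..<1} t * ennreal (t powr (- s)) \<partial>lborel) \<le> ennreal A"
proof -
  have "((\<lambda>t. t powr (- s)) has_integral 1 powr (- s + 1) / (- s + 1)) {0..1}"
    using assms by (intro has_integral_powr_from_0) auto
  then have "((\<lambda>t. t powr (- s)) has_integral 1 / (1 - s)) {0..1}" by simp
  then have "(\<integral>\<^sup>+t. ennreal (indicator {0..1} t * t powr (- s)) \<partial>lborel) = ennreal (1 / (1 - s))"
    by (intro nn_integral_has_integral_lebesgue) auto
  moreover have "(\<integral>\<^sup>+t. indicator {0<..<1} t * ennreal (t powr (- s)) \<partial>lborel) \<le> (\<integral>\<^sup>+t. ennreal (indicator {0..1} t * t powr (- s)) \<partial>lborel)"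
    by (intro nn_integral_mono) (auto simp: indicator_def)
  ultimately show ?thesis using assms by (intro exI[of _ "1 / (1 - s)"]) auto
qed

text \<open>The time integral that majorises a function in terms of a source f. The exponent
  \<alpha> is 1/2 when one derivative remains on the kernel and 0 when none does; c = 2 absorbs the
  doubled time of the derivative bounds.\<close>

definition heat_potential :: "real \<Rightarrow> real \<Rightarrow> ('a::euclidean_space \<Rightarrow> ennreal) \<Rightarrow> 'a \<Rightarrow> ennreal" where
  "heat_potential c \<alpha> f x = (\<integral>\<^sup>+t. indicator {0<..<1} t * (ennreal (t powr (- \<alpha>)) * heat_nn (c * t) f x) \<partial>lborel)"

lemma heat_nn_measurable3 [measurable (raw)]:
  assumes [measurable]: "w \<in> borel_measurable borel" "f \<in> borel_measurable M" "g \<in> M \<rightarrow>\<^sub>M borel"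
  shows "(\<lambda>p. heat_nn (f p) w (g p)) \<in> borel_measurable M"
  unfolding heat_nn_def by measurable

lemma heat_potential_measurable [measurable]:
  assumes [measurable]: "f \<in> borel_measurable borel"
  shows "heat_potential c \<alpha> f \<in> borel_measurable borel"
  unfolding heat_potential_def by measurable

text \<open>Jensen's inequality in time against a weight of finite mass, then Tonelli's theorem. The
  condition says that the singularity \<alpha> of the kernel and the loss of the L^m-L^q bound
  together remain integrable at t = 0.\<close>

lemma heat_potential_powr_finite:
  fixes f :: "'a::euclidean_space \<Rightarrow> ennreal"
  assumes f [measurable]: "f \<in> borel_measurable borel" and c: "c \<ge> 1" and m: "m \<ge> 1" and q: "q \<ge> m"
    and M: "(\<integral>\<^sup>+y. epowr (f y) m \<partial>lborel) < \<infinity>"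
    and cond: "\<alpha> + real DIM('a) / 2 * (1 / m - 1 / q) < 1"
  shows "(\<integral>\<^sup>+x. epowr (heat_potential c \<alpha> f x) q \<partial>lborel) < \<infinity>"
proof -
  obtain \<mu> where \<mu>: "(\<integral>\<^sup>+y. epowr (f y) m \<partial>lborel) = ennreal \<mu>" "\<mu> \<ge> 0"
    using M by (cases "(\<integral>\<^sup>+y. epowr (f y) m \<partial>lborel)") auto
  \<comment> \<open>The power of t lost by the L^m-L^q bound. It is moved into the weight, and the
    factor t^\<theta> left behind cancels the loss at each time.\<close>
  define \<theta> where "\<theta> = real DIM('a) / 2 * (1 / m - 1 / q)"
  have q1: "q \<ge> 1" using m q by simp
  have \<theta>q: "\<theta> * q = real DIM('a) / 2 * (q / m - 1)" using q1 m by (simp add: \<theta>_def field_simps)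
  obtain A where A: "A > 0" "(\<integral>\<^sup>+t. indicator {0<..<1} t * ennreal (t powr (- (\<alpha> + \<theta>))) \<partial>lborel) \<le> ennreal A"
    using nn_integral_powr_0_1[of "\<alpha> + \<theta>"] cond by (auto simp: \<theta>_def)
  define C where "C = 2 powr q * \<mu> powr (q / m - 1) * \<mu>"
  have C0: "C \<ge> 0" using \<mu> by (simp add: C_def)
  define w where "w t = indicator {0<..<1} t * ennreal (t powr (- (\<alpha> + \<theta>)))" for t
  have [measurable]: "w \<in> borel_measurable borel" unfolding w_def by measurable
  have HBw: "heat_potential c \<alpha> f x = (\<integral>\<^sup>+t. w t * (ennreal (t powr \<theta>) * heat_nn (c * t) f x) \<partial>lborel)" for x
    unfolding heat_potential_def
  proof (rule nn_integral_cong)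
    fix t :: real
    have "ennreal (t powr (- \<alpha>)) = ennreal (t powr (- (\<alpha> + \<theta>))) * ennreal (t powr \<theta>)"
      by (simp flip: ennreal_mult powr_add)
    then show "indicator {0<..<1} t * (ennreal (t powr - \<alpha>) * heat_nn (c * t) f x) = w t * (ennreal (t powr \<theta>) * heat_nn (c * t) f x)"
      by (simp add: w_def mult.assoc)
  qed
  let ?K = "ennreal (2 powr q * A powr (q - 1))"
  have "(\<integral>\<^sup>+x. epowr (heat_potential c \<alpha> f x) q \<partial>lborel) \<le> (\<integral>\<^sup>+x. ?K * (\<integral>\<^sup>+t. w t * epowr (ennreal (t powr \<theta>) * heat_nn (c * t) f x) q \<partial>lborel) \<partial>lborel)"
    unfolding HBw using A q1 by (intro nn_integral_mono epowr_nn_integral_le) (auto simp: w_def)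
  also have "\<dots> = ?K * (\<integral>\<^sup>+x. (\<integral>\<^sup>+t. w t * epowr (ennreal (t powr \<theta>) * heat_nn (c * t) f x) q \<partial>lborel) \<partial>lborel)"
    by (rule nn_integral_cmult) measurable
  also have "(\<integral>\<^sup>+x. (\<integral>\<^sup>+t. w t * epowr (ennreal (t powr \<theta>) * heat_nn (c * t) f x) q \<partial>lborel) \<partial>lborel) =
    (\<integral>\<^sup>+t. (\<integral>\<^sup>+x. w t * epowr (ennreal (t powr \<theta>) * heat_nn (c * t) f x) q \<partial>lborel) \<partial>lborel)"
    by (rule lborel_pair.Fubini'[symmetric]) measurable
  also have "\<dots> \<le> (\<integral>\<^sup>+t. w t * ennreal C \<partial>lborel)"
  proof (rule nn_integral_mono)
    fix t :: real
    show "(\<integral>\<^sup>+x. w t * epowr (ennreal (t powr \<theta>) * heat_nn (c * t) f x) q \<partial>lborel) \<le> w t * ennreal C"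
    proof (cases "0 < t \<and> t < 1")
      case True
      then have t: "0 < t" "t \<le> c * t" using c by auto
      have "(\<integral>\<^sup>+x. epowr (ennreal (t powr \<theta>) * heat_nn (c * t) f x) q \<partial>lborel) = (\<integral>\<^sup>+x. ennreal (t powr (\<theta> * q)) * epowr (heat_nn (c * t) f x) q \<partial>lborel)"
        using t by (simp add: epowr_cmult powr_powr)
      also have "\<dots> = ennreal (t powr (\<theta> * q)) * (\<integral>\<^sup>+x. epowr (heat_nn (c * t) f x) q \<partial>lborel)"
        by (rule nn_integral_cmult) measurable
      also have "\<dots> \<le> ennreal (t powr (\<theta> * q)) * ennreal (C * t powr (- (\<theta> * q)))"
        unfolding C_def \<theta>q by (intro mult_left_mono nn_integral_heat_nn_powr[OF f t m q \<mu>]) simp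
      also have "\<dots> = ennreal C"
        using t C0 by (simp add: powr_minus flip: ennreal_mult)
      finally show ?thesis by (subst nn_integral_cmult) (auto intro: mult_left_mono)
    qed (simp add: w_def)
  qed
  also have "\<dots> = (\<integral>\<^sup>+t. w t \<partial>lborel) * ennreal C" by (rule nn_integral_multc) measurable
  also have "\<dots> \<le> ennreal A * ennreal C" using A(2) unfolding w_def by (rule mult_right_mono) simp
  finally have "(\<integral>\<^sup>+x. epowr (heat_potential c \<alpha> f x) q \<partial>lborel) \<le> ?K * (ennreal A * ennreal C)"
    by (simp add: mult_left_mono)
  also have "\<dots> < \<infinity>" by (simp add: ennreal_mult_less_top)
  finally show ?thesis .
qed

text \<open>The endpoint q = \<infinity> of \<open>heat_potential_powr_finite\<close>, where the
  pointwise bound replaces the integrated one.\<close>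

lemma heat_potential_bounded:
  fixes f :: "'a::euclidean_space \<Rightarrow> ennreal"
  assumes f [measurable]: "f \<in> borel_measurable borel" and c: "c \<ge> 1" and m: "m \<ge> 1"
    and M: "(\<integral>\<^sup>+y. epowr (f y) m \<partial>lborel) < \<infinity>"
    and cond: "\<alpha> + real DIM('a) / (2 * m) < 1"
  shows "\<exists>K. \<forall>x. heat_potential c \<alpha> f x \<le> ennreal K"
proof -
  obtain \<mu> where \<mu>: "(\<integral>\<^sup>+y. epowr (f y) m \<partial>lborel) = ennreal \<mu>" "\<mu> \<ge> 0"
    using M by (cases "(\<integral>\<^sup>+y. epowr (f y) m \<partial>lborel)") auto
  define \<theta> where "\<theta> = real DIM('a) / (2 * m)"
  obtain A where A: "A > 0" "(\<integral>\<^sup>+t. indicator {0<..<1} t * ennreal (t powr (- (\<alpha> + \<theta>))) \<partial>lborel) \<le> ennreal A"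
    using nn_integral_powr_0_1[of "\<alpha> + \<theta>"] cond by (auto simp: \<theta>_def)
  define C where "C = 2 * \<mu> powr (1 / m)"
  have C0: "C \<ge> 0" by (simp add: C_def)
  have "heat_potential c \<alpha> f x \<le> ennreal (C * A)" for x
  proof -
    have "heat_potential c \<alpha> f x \<le> (\<integral>\<^sup>+t. ennreal C * (indicator {0<..<1} t * ennreal (t powr (- (\<alpha> + \<theta>)))) \<partial>lborel)"
      unfolding heat_potential_def
    proof (rule nn_integral_mono)
      fix t :: real
      show "indicator {0<..<1} t * (ennreal (t powr - \<alpha>) * heat_nn (c * t) f x) \<le> ennreal C * (indicator {0<..<1} t * ennreal (t powr - (\<alpha> + \<theta>)))"
      proof (cases "0 < t \<and> t < 1")
        case True
        then have t: "0 < t" "t \<le> c * t" using c by auto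
        have "ennreal (t powr - \<alpha>) * heat_nn (c * t) f x \<le> ennreal (t powr - \<alpha>) * ennreal (C * t powr (- \<theta>))"
          unfolding C_def \<theta>_def by (intro mult_left_mono heat_nn_pointwise'[OF f t m \<mu>]) simp
        also have "\<dots> = ennreal C * ennreal (t powr (- (\<alpha> + \<theta>)))"
          using C0 t by (simp add: powr_add mult_ac powr_diff powr_minus divide_inverse flip: ennreal_mult)
        finally show ?thesis using True by simp
      qed simp
    qed
    also have "\<dots> = ennreal C * (\<integral>\<^sup>+t. indicator {0<..<1} t * ennreal (t powr (- (\<alpha> + \<theta>))) \<partial>lborel)"
      by (rule nn_integral_cmult) measurable
    also have "\<dots> \<le> ennreal C * ennreal A" by (intro mult_left_mono A) simp
    finally show ?thesis using A C0 by (simp add: ennreal_mult)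
  qed
  then show ?thesis by blast
qed

section \<open>Derivatives of the heat kernel\<close>

definition heat_kernel_dt :: "real \<Rightarrow> 'a::euclidean_space \<Rightarrow> real" where
  "heat_kernel_dt t x = ((norm x)\<^sup>2 / (4 * t\<^sup>2) - real DIM('a) / (2 * t)) * heat_kernel t x"

lemma heat_kernel_dt_measurable2 [measurable (raw)]:
  assumes [measurable]: "f \<in> borel_measurable M" "g \<in> M \<rightarrow>\<^sub>M borel"
  shows "(\<lambda>p. heat_kernel_dt (f p) (g p)) \<in> borel_measurable M"
  unfolding heat_kernel_dt_def by measurable

lemma heat_kernel_has_time_derivative:
  fixes x :: "'a::euclidean_space"
  assumes t: "t > 0"
  shows "((\<lambda>s. heat_kernel s x) has_real_derivative heat_kernel_dt t x) (at t)"
proof -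
  let ?r = "- real DIM('a) / 2"
  have l: "((\<lambda>s. 4 * pi * s) has_real_derivative 4 * pi) (at t)"
    by (auto intro!: derivative_eq_intros)
  have "((\<lambda>s. (4 * pi * s) powr ?r) has_real_derivative ?r * (4 * pi * t) powr (?r - 1) * (4 * pi)) (at t)"
    by (rule DERIV_chain2[OF has_real_derivative_powr l]) (use t in simp)
  moreover have "?r * (4 * pi * t) powr (?r - 1) * (4 * pi) = (- real DIM('a) / (2 * t)) * (4 * pi * t) powr ?r"
    using t by (simp add: powr_diff)
  ultimately have 1: "((\<lambda>s. (4 * pi * s) powr ?r) has_real_derivative (- real DIM('a) / (2 * t)) * (4 * pi * t) powr ?r) (at t)"
    by simp
  have 2: "((\<lambda>s. exp (- (norm x)\<^sup>2 / (4 * s))) has_real_derivative (norm x)\<^sup>2 / (4 * t\<^sup>2) * exp (- (norm x)\<^sup>2 / (4 * t))) (at t)"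
    using t by (auto intro!: derivative_eq_intros simp: field_simps power2_eq_square)
  show ?thesis
    unfolding heat_kernel_def heat_kernel_dt_def by (rule DERIV_cong[OF DERIV_mult[OF 1 2]]) (simp add: algebra_simps)
qed

text \<open>Polynomial factors are paid for with half of the Gaussian decay. With u = |x|^2 / (4 t)
  the remaining half is the exponent of the kernel at time 2t.\<close>

lemma exp_half_bounds:
  fixes u :: real
  assumes "u \<ge> 0"
  shows "u * exp (- u) \<le> 2 * exp (- (u / 2))" "sqrt u * exp (- u) \<le> 2 * exp (- (u / 2))" "exp (- u) \<le> exp (- (u / 2))"
proof -
  have e: "exp (- u) = exp (- (u / 2)) * exp (- (u / 2))" by (simp flip: exp_add)
  have 1: "1 + u / 2 \<le> exp (u / 2)" by (rule exp_ge_add_one_self)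
  have inv: "exp (u / 2) * exp (- (u / 2)) = 1" by (simp flip: exp_add)
  have key: "v * exp (- u) \<le> 2 * exp (- (u / 2))" if v: "v \<le> 2 * (1 + u / 2)" for v
  proof -
    have "2 * (1 + u / 2) \<le> 2 * exp (u / 2)" using 1 by (rule mult_left_mono) simp
    with v have "v \<le> 2 * exp (u / 2)" by (rule order_trans)
    then have "v * exp (- u) \<le> 2 * exp (u / 2) * exp (- u)" by (intro mult_right_mono) auto
    also have "\<dots> = 2 * (exp (u / 2) * exp (- (u / 2))) * exp (- (u / 2))" unfolding e by simp
    finally show ?thesis unfolding inv by simp
  qed
  show "u * exp (- u) \<le> 2 * exp (- (u / 2))" by (rule key) simp
  have "2 * sqrt u * 1 \<le> (sqrt u)\<^sup>2 + 1\<^sup>2" by (rule sum_squares_bound)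
  then have "sqrt u \<le> 2 * (1 + u / 2)" using assms real_sqrt_ge_zero[OF assms] by simp
  then show "sqrt u * exp (- u) \<le> 2 * exp (- (u / 2))" by (rule key)
  show "exp (- u) \<le> exp (- (u / 2))" using assms by simp
qed

text \<open>One constant for the time derivative and for the gradient: 2^(d/2) comes from passing to
  time 2t, and 2 + d from the polynomial prefactors.\<close>

definition Kd :: "nat \<Rightarrow> real" where
  "Kd d = 2 powr (real d / 2) * (2 + real d)"

lemma heat_kernel_double:
  fixes x :: "'a::euclidean_space"
  assumes t: "t > 0"
  shows "(4 * pi * t) powr (- real DIM('a) / 2) * exp (- ((norm x)\<^sup>2 / (4 * t) / 2)) = 2 powr (real DIM('a) / 2) * heat_kernel (2 * t) x"
  unfolding powr_double_half[OF t, of "DIM('a)"] heat_kernel_def using t by (simp add: field_simps)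

lemma heat_kernel_dt_bound:
  fixes x :: "'a::euclidean_space"
  assumes t: "t > 0"
  shows "\<bar>heat_kernel_dt t x\<bar> \<le> Kd DIM('a) / t * heat_kernel (2 * t) x"
proof -
  define u where "u = (norm x)\<^sup>2 / (4 * t)"
  let ?c = "(4 * pi * t) powr (- real DIM('a) / 2)"
  have u: "u \<ge> 0" using t by (simp add: u_def)
  have "heat_kernel_dt t x = (1 / t) * ((u - real DIM('a) / 2) * (?c * exp (- u)))"
    unfolding heat_kernel_dt_def heat_kernel_def u_def using t by (simp add: field_simps power2_eq_square)
  also have "\<bar>\<dots>\<bar> = (1 / t) * ?c * (\<bar>u - real DIM('a) / 2\<bar> * exp (- u))"
    using t by (simp add: abs_mult)
  also have "\<dots> \<le> (1 / t) * ?c * (2 * exp (- (u / 2)) + real DIM('a) * exp (- (u / 2)))"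
  proof (rule mult_left_mono)
    have "\<bar>u - real DIM('a) / 2\<bar> \<le> u + real DIM('a)" using u by linarith
    then have "\<bar>u - real DIM('a) / 2\<bar> * exp (- u) \<le> u * exp (- u) + real DIM('a) * exp (- u)"
      by (simp add: mult_right_mono flip: distrib_right)
    also have "\<dots> \<le> 2 * exp (- (u / 2)) + real DIM('a) * exp (- (u / 2))"
      by (intro add_mono mult_left_mono exp_half_bounds u) auto
    finally show "\<bar>u - real DIM('a) / 2\<bar> * exp (- u) \<le> 2 * exp (- (u / 2)) + real DIM('a) * exp (- (u / 2))" .
  qed (use t in simp)
  also have "\<dots> = (2 + real DIM('a)) / t * (?c * exp (- (u / 2)))"
    by (simp add: field_simps)
  also have "\<dots> = Kd DIM('a) / t * heat_kernel (2 * t) x"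
    unfolding u_def heat_kernel_double[OF t] Kd_def by simp
  finally show ?thesis .
qed

lemma heat_kernel_gradient_bound:
  fixes x b :: "'a::euclidean_space"
  assumes t: "t > 0" and b: "norm b = 1"
  shows "\<bar>(x \<bullet> b) / (2 * t) * heat_kernel t x\<bar> \<le> Kd DIM('a) * t powr (- (1/2)) * heat_kernel (2 * t) x"
proof -
  define u where "u = (norm x)\<^sup>2 / (4 * t)"
  let ?c = "(4 * pi * t) powr (- real DIM('a) / 2)"
  have u: "u \<ge> 0" using t by (simp add: u_def)
  have su: "norm x / (2 * t) = t powr (- (1/2)) * sqrt u"
    using t by (simp add: u_def real_sqrt_divide powr_minus powr_half_sqrt real_sqrt_mult field_simps)
  have "\<bar>(x \<bullet> b) / (2 * t) * heat_kernel t x\<bar> \<le> norm x / (2 * t) * heat_kernel t x"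
    unfolding abs_mult using t b Cauchy_Schwarz_ineq2[of x b] by (intro mult_mono) (auto simp: divide_right_mono)
  also have "\<dots> = t powr (- (1/2)) * ?c * (sqrt u * exp (- u))"
    unfolding su heat_kernel_def u_def by simp
  also have "\<dots> \<le> t powr (- (1/2)) * ?c * (2 * exp (- (u / 2)))"
    by (intro mult_left_mono exp_half_bounds u) auto
  also have "\<dots> = t powr (- (1/2)) * 2 * (?c * exp (- (u / 2)))" by simp
  also have "\<dots> = 2 * 2 powr (real DIM('a) / 2) * t powr (- (1/2)) * heat_kernel (2 * t) x"
    unfolding u_def heat_kernel_double[OF t] by simp
  also have "\<dots> \<le> Kd DIM('a) * t powr (- (1/2)) * heat_kernel (2 * t) x"
    unfolding Kd_def by (intro mult_right_mono) (auto simp: algebra_simps)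
  finally show ?thesis .
qed

text \<open>In this class the symmetry can be read off the product rule by induction on the
  construction. It serves to exchange a partial derivative with the Laplacian of the kernel in the
  bound for the gradient.\<close>

lemma partial_deriv_commute:
  assumes "poly_gauss z f"
  shows "partial_deriv b (partial_deriv c f) = partial_deriv c (partial_deriv b f)"
  using assms
proof (induction rule: poly_gauss.induct)
  case (poly_gauss_gauss a)
  let ?G = "\<lambda>x::'a. complex_of_real (exp (- a * (norm (x - z))\<^sup>2))"
  have "partial_deriv b (\<lambda>x. of_real (- 2 * a) * (of_real ((x - z) \<bullet> c) * ?G x)) =
    (\<lambda>x. of_real (- 2 * a) * (of_real ((x - z) \<bullet> c) * (of_real (- 2 * a) * (of_real ((x - z) \<bullet> b) * ?G x)) + of_real (b \<bullet> c) * ?G x))" for b c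
    by (simp only: partial_deriv_cmult[OF smooth_gen_mult[OF smooth_gen_lin' smooth_gen_gauss]] partial_deriv_mult[OF smooth_gen_lin' smooth_gen_gauss]
        partial_deriv_lin partial_deriv_gauss)
  note eq = this
  show ?case unfolding partial_deriv_gauss eq by (simp add: fun_eq_iff inner_commute[of b c] algebra_simps)
next
  case (poly_gauss_lin f d)
  note s = poly_gauss_smooth_gen[OF poly_gauss_lin.hyps] and s' = poly_gauss_smooth_gen[OF poly_gauss_partial[OF poly_gauss_lin.hyps]]
  have "partial_deriv b (partial_deriv c (\<lambda>x. of_real ((x - z) \<bullet> d) * f x)) =
    (\<lambda>x. (of_real ((x - z) \<bullet> d) * partial_deriv b (partial_deriv c f) x + of_real (b \<bullet> d) * partial_deriv c f x) +
      of_real (c \<bullet> d) * partial_deriv b f x)" for b c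
    unfolding partial_deriv_mult[OF smooth_gen_lin' s] partial_deriv_lin
      partial_deriv_add[OF smooth_gen_mult[OF smooth_gen_lin' s'] smooth_gen_mult[OF smooth_gen_const s]]
      partial_deriv_mult[OF smooth_gen_lin' s'] partial_deriv_cmult[OF s] by simp
  then show ?case using poly_gauss_lin.IH by (simp add: fun_eq_iff)
next
  case (poly_gauss_cmult f k)
  then show ?case
    by (simp add: partial_deriv_cmult[OF poly_gauss_smooth_gen] partial_deriv_cmult[OF poly_gauss_smooth_gen[OF poly_gauss_partial]])
next
  case (poly_gauss_add f g)
  then show ?case
    by (simp add: partial_deriv_add[OF poly_gauss_smooth_gen poly_gauss_smooth_gen] partial_deriv_add[OF poly_gauss_smooth_gen[OF poly_gauss_partial] poly_gauss_smooth_gen[OF poly_gauss_partial]])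
qed

lemma poly_gauss_sum:
  assumes "finite I" "I \<noteq> {}" "\<And>i. i \<in> I \<Longrightarrow> poly_gauss z (f i)"
  shows "poly_gauss z (\<lambda>x. \<Sum>i\<in>I. f i x)"
  using assms by (induct I rule: finite_ne_induct) (auto intro: poly_gauss_add)

lemma partial_deriv_sum:
  assumes "finite I" "\<And>i. i \<in> I \<Longrightarrow> smooth_gen (f i)"
  shows "partial_deriv b (\<lambda>x. \<Sum>i\<in>I. f i x) = (\<lambda>x. \<Sum>i\<in>I. partial_deriv b (f i) x)"
  using assms by (induct I rule: finite_induct) (auto simp: partial_deriv_const partial_deriv_add smooth_gen_sum)

lemma laplacian_partial:
  assumes "poly_gauss z f"
  shows "laplacian (partial_deriv b f) = partial_deriv b (laplacian f)"
proof -
  have "partial_deriv b (laplacian f) = (\<lambda>x. \<Sum>c\<in>Basis. partial_deriv b (partial_deriv c (partial_deriv c f)) x)"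
    unfolding laplacian_def[abs_def] by (rule partial_deriv_sum) (auto intro: poly_gauss_smooth_gen poly_gauss_partial assms)
  then show ?thesis
    unfolding laplacian_def[abs_def] partial_deriv_commute[OF poly_gauss_partial[OF assms], of b]
    by (simp add: partial_deriv_commute[OF assms, of b])
qed

lemma poly_gauss_laplacian: "poly_gauss z f \<Longrightarrow> poly_gauss z (laplacian f)"
  unfolding laplacian_def[abs_def] by (intro poly_gauss_sum poly_gauss_partial) auto

lemma partial_deriv_heat_kernel:
  fixes x :: "'a::euclidean_space"
  assumes t: "t > 0"
  shows "partial_deriv b (\<lambda>y. complex_of_real (heat_kernel t (x - y))) = (\<lambda>y. complex_of_real (((x - y) \<bullet> b) / (2 * t) * heat_kernel t (x - y)))"
proof -
  let ?c = "complex_of_real ((4 * pi * t) powr (- real DIM('a) / 2))"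
  have eq: "(\<lambda>y. complex_of_real (heat_kernel t (x - y))) = (\<lambda>y. ?c * of_real (exp (- (1 / (4 * t)) * (norm (y - x))\<^sup>2)))"
    by (simp add: heat_kernel_def norm_minus_commute)
  have e2: "((x - y) \<bullet> b) / (2 * t) = - 2 * (1 / (4 * t)) * ((y - x) \<bullet> b)" for y
    using t by (simp add: inner_diff_left field_simps)
  show ?thesis
    unfolding eq partial_deriv_cmult[OF smooth_gen_gauss] partial_deriv_gauss e2
    unfolding fun_cong[OF eq] of_real_mult by (simp add: fun_eq_iff heat_kernel_def norm_minus_commute)
qed

lemma laplacian_heat_kernel:
  fixes x :: "'a::euclidean_space"
  assumes t: "t > 0"
  shows "laplacian (\<lambda>y. complex_of_real (heat_kernel t (x - y))) = (\<lambda>y. complex_of_real (heat_kernel_dt t (x - y)))"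
proof
  fix y :: 'a
  define a where "a = 1 / (4 * t)"
  let ?c = "complex_of_real ((4 * pi * t) powr (- real DIM('a) / 2))"
  let ?G = "\<lambda>y. complex_of_real (exp (- a * (norm (y - x))\<^sup>2))"
  have eq: "(\<lambda>y. complex_of_real (heat_kernel t (x - y))) = (\<lambda>y. ?c * ?G y)"
    by (simp add: heat_kernel_def a_def norm_minus_commute)
  have d2: "partial_deriv b (partial_deriv b (\<lambda>y. ?c * ?G y)) y =
    ?c * ?G y * of_real (4 * a\<^sup>2 * ((y - x) \<bullet> b)\<^sup>2 - 2 * a)" if b: "b \<in> Basis" for b
  proof -
    have "partial_deriv b (partial_deriv b (\<lambda>y. ?c * ?G y)) =
      (\<lambda>y. ?c * (of_real (- 2 * a) * (of_real ((y - x) \<bullet> b) * (of_real (- 2 * a) * (of_real ((y - x) \<bullet> b) * ?G y)) + of_real (b \<bullet> b) * ?G y)))"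
      by (simp only: partial_deriv_cmult[OF smooth_gen_gauss] partial_deriv_gauss
          partial_deriv_cmult[OF smooth_gen_mult[OF smooth_gen_const smooth_gen_mult[OF smooth_gen_lin' smooth_gen_gauss]]]
          partial_deriv_cmult[OF smooth_gen_mult[OF smooth_gen_lin' smooth_gen_gauss]] partial_deriv_mult[OF smooth_gen_lin' smooth_gen_gauss] partial_deriv_lin)
    then show ?thesis using b by (simp add: algebra_simps power2_eq_square)
  qed
  have n: "(\<Sum>b\<in>Basis. ((y - x) \<bullet> b)\<^sup>2) = (norm (y - x))\<^sup>2"
    unfolding power2_norm_eq_inner by (subst euclidean_inner[of "y - x" "y - x"]) (simp add: power2_eq_square)
  have "laplacian (\<lambda>y. complex_of_real (heat_kernel t (x - y))) y =
    (\<Sum>b\<in>Basis. ?c * ?G y * of_real (4 * a\<^sup>2 * ((y - x) \<bullet> b)\<^sup>2 - 2 * a))"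
    unfolding laplacian_def eq by (intro sum.cong refl d2)
  also have "\<dots> = ?c * ?G y * of_real (\<Sum>b\<in>Basis. 4 * a\<^sup>2 * ((y - x) \<bullet> b)\<^sup>2 - 2 * a)"
    by (simp only: sum_distrib_left[symmetric] of_real_sum)
  also have "(\<Sum>b\<in>Basis. 4 * a\<^sup>2 * ((y - x) \<bullet> b)\<^sup>2 - 2 * a) = 4 * a\<^sup>2 * (norm (y - x))\<^sup>2 - 2 * a * real DIM('a)"
    by (simp add: sum_subtractf sum_distrib_left[symmetric] n)
  also have "4 * a\<^sup>2 * (norm (y - x))\<^sup>2 - 2 * a * real DIM('a) = (norm (x - y))\<^sup>2 / (4 * t\<^sup>2) - real DIM('a) / (2 * t)"
    using t by (simp add: a_def norm_minus_commute field_simps power2_eq_square)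
  finally show "laplacian (\<lambda>y. complex_of_real (heat_kernel t (x - y))) y = complex_of_real (heat_kernel_dt t (x - y))"
    unfolding fun_cong[OF eq, symmetric] heat_kernel_dt_def by simp
qed

section \<open>Regularity from a heat flow representation\<close>

lemma heat_nn_norm_L2:
  fixes u :: "'a::euclidean_space \<Rightarrow> complex"
  assumes u: "u \<in> L2"
  shows "(\<integral>\<^sup>+y. epowr (ennreal (norm (u y))) 2 \<partial>lborel) = ennreal (sq u)"
  using nn_integral_sq[OF u] by (simp add: epowr_ennreal powr_numeral)

text \<open>Times below e are excluded because the bound for the time derivative contains 1 / t;
  absolute integrability is needed to exchange the time and space integrals.\<close>

lemma heat_kernel_dt_integrable:
  fixes u :: "'a::euclidean_space \<Rightarrow> complex"
  assumes u: "u \<in> L2" and e: "e > 0"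
  shows "integrable (lborel \<Otimes>\<^sub>M lborel) (\<lambda>(t, y). indicator {e..1} t *\<^sub>R (complex_of_real (heat_kernel_dt t (x - y)) * u y))"
proof -
  have [measurable]: "u \<in> borel_measurable borel" using u by auto
  let ?d = "real DIM('a)"
  have heat_nn: "heat_nn (2 * t) (\<lambda>y. ennreal (norm (u y))) x \<le> ennreal (2 * sq u powr (1 / 2) * e powr (- (?d / 4)))" if "e \<le> t" for t
    using heat_nn_pointwise'[OF _ e _ _ heat_nn_norm_L2[OF u] sq_nonneg, of "2 * t" x] that e by simp
  have "(\<integral>\<^sup>+p. ennreal (norm (case p of (t, y) \<Rightarrow> indicator {e..1} t *\<^sub>R (complex_of_real (heat_kernel_dt t (x - y)) * u y))) \<partial>(lborel \<Otimes>\<^sub>M lborel)) =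
    (\<integral>\<^sup>+t. (\<integral>\<^sup>+y. ennreal (norm (indicator {e..1} t *\<^sub>R (complex_of_real (heat_kernel_dt t (x - y)) * u y))) \<partial>lborel) \<partial>lborel)"
    by (subst lborel.nn_integral_fst[symmetric]) auto
  also have "\<dots> \<le> (\<integral>\<^sup>+t. indicator {e..1} t * ennreal (Kd DIM('a) / e * (2 * sq u powr (1 / 2) * e powr (- (?d / 4)))) \<partial>lborel)"
  proof (rule nn_integral_mono)
    fix t :: real
    show "(\<integral>\<^sup>+y. ennreal (norm (indicator {e..1} t *\<^sub>R (complex_of_real (heat_kernel_dt t (x - y)) * u y))) \<partial>lborel) \<le>
      indicator {e..1} t * ennreal (Kd DIM('a) / e * (2 * sq u powr (1 / 2) * e powr (- (?d / 4))))"
    proof (cases "t \<in> {e..1}")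
      case True
      then have t: "t > 0" "e \<le> t" using e by auto
      have K: "0 \<le> Kd DIM('a) / e" using e by (simp add: Kd_def)
      have "(\<integral>\<^sup>+y. ennreal (norm (indicator {e..1} t *\<^sub>R (complex_of_real (heat_kernel_dt t (x - y)) * u y))) \<partial>lborel) \<le>
        (\<integral>\<^sup>+y. ennreal (Kd DIM('a) / e) * (ennreal (heat_kernel (2 * t) (x - y)) * ennreal (norm (u y))) \<partial>lborel)"
      proof (rule nn_integral_mono)
        fix y
        have "\<bar>heat_kernel_dt t (x - y)\<bar> \<le> Kd DIM('a) / t * heat_kernel (2 * t) (x - y)" by (rule heat_kernel_dt_bound[OF t(1)])
        also have "\<dots> \<le> Kd DIM('a) / e * heat_kernel (2 * t) (x - y)"
          using t e by (intro mult_right_mono divide_left_mono) (auto simp: Kd_def)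
        finally have "\<bar>heat_kernel_dt t (x - y)\<bar> * norm (u y) \<le> Kd DIM('a) / e * heat_kernel (2 * t) (x - y) * norm (u y)"
          by (rule mult_right_mono) simp
        then show "ennreal (norm (indicator {e..1} t *\<^sub>R (complex_of_real (heat_kernel_dt t (x - y)) * u y))) \<le>
          ennreal (Kd DIM('a) / e) * (ennreal (heat_kernel (2 * t) (x - y)) * ennreal (norm (u y)))"
          using True K by (simp add: norm_mult ennreal_leI mult.assoc flip: ennreal_mult)
      qed
      also have "\<dots> = ennreal (Kd DIM('a) / e) * heat_nn (2 * t) (\<lambda>y. ennreal (norm (u y))) x"
        unfolding heat_nn_def by (rule nn_integral_cmult) measurable
      also have "\<dots> \<le> ennreal (Kd DIM('a) / e) * ennreal (2 * sq u powr (1 / 2) * e powr (- (?d / 4)))"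
        by (intro mult_left_mono heat_nn t) simp
      also have "\<dots> = ennreal (Kd DIM('a) / e * (2 * sq u powr (1 / 2) * e powr (- (?d / 4))))"
        using K by (intro ennreal_mult[symmetric]) auto
      finally show ?thesis using True by simp
    qed simp
  qed
  also have "\<dots> < \<infinity>"
    by (subst nn_integral_multc) (auto simp: ennreal_mult_less_top emeasure_lborel_Icc_eq)
  finally show ?thesis
    unfolding integrable_iff_bounded by (auto intro!: measurable_If simp: split_beta)
qed

lemma heat_kernel_dt_FTC:
  fixes z :: "'a::euclidean_space"
  assumes e: "0 < e" "e \<le> 1"
  shows "(\<integral>t. indicator {e..1} t * heat_kernel_dt t z \<partial>lborel) = heat_kernel 1 z - heat_kernel e z"
proof -
  have "(\<integral>t. heat_kernel_dt t z * indicator {e..1} t \<partial>lborel) = heat_kernel 1 z - heat_kernel e z"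
  proof (rule integral_FTC_Icc_real[OF e(2)])
    show "DERIV (\<lambda>t. heat_kernel t z) t :> heat_kernel_dt t z" if "e \<le> t" "t \<le> 1" for t
      using that e by (intro heat_kernel_has_time_derivative) simp
    show "isCont (\<lambda>t. heat_kernel_dt t z) t" if "e \<le> t" "t \<le> 1" for t
      unfolding heat_kernel_dt_def heat_kernel_def using that e by (intro continuous_intros) auto
  qed
  then show ?thesis by (simp add: mult.commute)
qed

lemma heat_conv_diff_eq:
  fixes u :: "'a::euclidean_space \<Rightarrow> complex"
  assumes u: "u \<in> L2" and e: "0 < e" "e \<le> 1"
  shows "heat_conv 1 u x - heat_conv e u x = (\<integral>t. indicator {e..1} t *\<^sub>R (\<integral>y. complex_of_real (heat_kernel_dt t (x - y)) * u y \<partial>lborel) \<partial>lborel)"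
proof -
  have "heat_conv 1 u x - heat_conv e u x = (\<integral>y. complex_of_real (heat_kernel 1 (x - y) - heat_kernel e (x - y)) * u y \<partial>lborel)"
    unfolding heat_conv_def using heat_conv_integrable_L2[OF u, of 1 x] heat_conv_integrable_L2[OF u e(1), of x]
    by (simp add: left_diff_distrib)
  also have "\<dots> = (\<integral>y. (\<integral>t. indicator {e..1} t *\<^sub>R (complex_of_real (heat_kernel_dt t (x - y)) * u y) \<partial>lborel) \<partial>lborel)"
  proof (intro Bochner_Integration.integral_cong refl)
    fix y
    have "(\<integral>t. indicator {e..1} t *\<^sub>R (complex_of_real (heat_kernel_dt t (x - y)) * u y) \<partial>lborel) =
      (\<integral>t. complex_of_real (indicator {e..1} t * heat_kernel_dt t (x - y)) * u y \<partial>lborel)"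
      by (intro Bochner_Integration.integral_cong refl) (simp add: scaleR_conv_of_real)
    also have "\<dots> = complex_of_real (heat_kernel 1 (x - y) - heat_kernel e (x - y)) * u y"
      unfolding heat_kernel_dt_FTC[OF e, symmetric] by (simp only: integral_mult_left_zero integral_complex_of_real)
    finally show "complex_of_real (heat_kernel 1 (x - y) - heat_kernel e (x - y)) * u y =
      (\<integral>t. indicator {e..1} t *\<^sub>R (complex_of_real (heat_kernel_dt t (x - y)) * u y) \<partial>lborel)" by simp
  qed
  also have "\<dots> = (\<integral>t. (\<integral>y. indicator {e..1} t *\<^sub>R (complex_of_real (heat_kernel_dt t (x - y)) * u y) \<partial>lborel) \<partial>lborel)"
    by (rule lborel_pair.Fubini_integral[OF heat_kernel_dt_integrable[OF u e(1)]])
  finally show ?thesis by simp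
qed

lemma heat_conv_representation:
  fixes u :: "'a::euclidean_space \<Rightarrow> complex"
  assumes u: "u \<in> L2" and e: "0 < e" "e \<le> 1"
  shows "ennreal (norm (heat_conv e u x)) \<le> ennreal (norm (heat_conv 1 u x)) +
    (\<integral>\<^sup>+t. indicator {0<..<1} t * ennreal (norm (\<integral>y. complex_of_real (heat_kernel_dt t (x - y)) * u y \<partial>lborel)) \<partial>lborel)"
proof -
  have [measurable]: "u \<in> borel_measurable borel" using u by auto
  define V where "V t = (\<integral>y. complex_of_real (heat_kernel_dt t (x - y)) * u y \<partial>lborel)" for t
  have [measurable]: "V \<in> borel_measurable borel" unfolding V_def by measurable
  have eq: "heat_conv 1 u x - heat_conv e u x = (\<integral>t. indicator {e..1} t *\<^sub>R V t \<partial>lborel)"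
    unfolding V_def by (rule heat_conv_diff_eq[OF u e])
  have "ennreal (norm (heat_conv 1 u x - heat_conv e u x)) \<le> (\<integral>\<^sup>+t. ennreal (norm (indicator {e..1} t *\<^sub>R V t)) \<partial>lborel)"
    unfolding eq by (rule norm_integral_le_nn_integral)
  also have "\<dots> \<le> (\<integral>\<^sup>+t. indicator {0<..<1} t * ennreal (norm (V t)) \<partial>lborel)"
  proof (rule nn_integral_mono_AE)
    \<comment> \<open>The endpoint t = 1 belongs to the closed interval but not to the open one, so
      one point has to be discarded.\<close>
    show "AE t in lborel. ennreal (norm (indicator {e..1} t *\<^sub>R V t)) \<le> indicator {0<..<1} t * ennreal (norm (V t))"
      using AE_lborel_singleton[of "1::real"] by eventually_elim (use e in \<open>auto simp: indicator_def\<close>)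
  qed
  finally have le: "ennreal (norm (heat_conv 1 u x - heat_conv e u x)) \<le> (\<integral>\<^sup>+t. indicator {0<..<1} t * ennreal (norm (V t)) \<partial>lborel)" .
  have "norm (heat_conv e u x) \<le> norm (heat_conv 1 u x) + norm (heat_conv 1 u x - heat_conv e u x)"
    using norm_triangle_ineq4[of "heat_conv 1 u x" "heat_conv 1 u x - heat_conv e u x"] by simp
  then have "ennreal (norm (heat_conv e u x)) \<le> ennreal (norm (heat_conv 1 u x)) + ennreal (norm (heat_conv 1 u x - heat_conv e u x))"
    by (simp add: ennreal_leI flip: ennreal_plus)
  also have "\<dots> \<le> ennreal (norm (heat_conv 1 u x)) + (\<integral>\<^sup>+t. indicator {0<..<1} t * ennreal (norm (V t)) \<partial>lborel)"
    by (intro add_left_mono le)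
  finally show ?thesis by (simp add: V_def)
qed

lemma inv_Suc_le_1: "inv_Suc k \<le> 1" by (simp add: inv_Suc_def)

text \<open>The bound of \<open>heat_conv_representation\<close> does not depend on e, so it passes
  to the limit e = 0. L2 convergence gives convergence almost everywhere only along a subsequence,
  and this is enough.\<close>

lemma L2_representation:
  fixes u :: "'a::euclidean_space \<Rightarrow> complex"
  assumes u: "u \<in> L2"
  shows "AE x in lborel. ennreal (norm (u x)) \<le> ennreal (norm (heat_conv 1 u x)) +
    (\<integral>\<^sup>+t. indicator {0<..<1} t * ennreal (norm (\<integral>y. complex_of_real (heat_kernel_dt t (x - y)) * u y \<partial>lborel)) \<partial>lborel)"
proof -
  obtain r :: "nat \<Rightarrow> nat" where "AE x in lborel. (\<lambda>n. heat_conv (inv_Suc (r n)) u x - u x) \<longlonglongrightarrow> 0"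
    using sq_tendsto_0_AE_subseq[OF _ heat_conv_L2_tendsto[OF u]] L2_diff[OF heat_conv_L2(1)[OF u inv_Suc_pos] u] by blast
  then show ?thesis
  proof eventually_elim
    fix x assume "(\<lambda>n. heat_conv (inv_Suc (r n)) u x - u x) \<longlonglongrightarrow> 0"
    then have "(\<lambda>n. heat_conv (inv_Suc (r n)) u x) \<longlonglongrightarrow> u x" by (simp add: LIM_zero_iff)
    then have "(\<lambda>n. ennreal (norm (heat_conv (inv_Suc (r n)) u x))) \<longlonglongrightarrow> ennreal (norm (u x))"
      by (intro tendsto_ennrealI tendsto_norm)
    then show "ennreal (norm (u x)) \<le> ennreal (norm (heat_conv 1 u x)) +
      (\<integral>\<^sup>+t. indicator {0<..<1} t * ennreal (norm (\<integral>y. complex_of_real (heat_kernel_dt t (x - y)) * u y \<partial>lborel)) \<partial>lborel)"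
      by (rule LIMSEQ_le_const2) (use heat_conv_representation[OF u inv_Suc_pos inv_Suc_le_1] in blast)
  qed
qed

text \<open>The finite index set lets several sources enter, each later estimated in a Lebesgue
  space of its own: the components of the gradient, or the two parts of the right-hand side.\<close>

lemma L2_representation_heat_potential:
  fixes u :: "'a::euclidean_space \<Rightarrow> complex" and f :: "'i \<Rightarrow> 'a \<Rightarrow> ennreal"
  assumes u: "u \<in> L2" and I: "finite I" and f [measurable]: "\<And>i. i \<in> I \<Longrightarrow> f i \<in> borel_measurable borel"
    and V: "\<And>t x. 0 < t \<Longrightarrow> t < 1 \<Longrightarrow> ennreal (norm (\<integral>y. complex_of_real (heat_kernel_dt t (x - y)) * u y \<partial>lborel)) \<le>
      ennreal K * (\<Sum>i\<in>I. ennreal (t powr (- \<alpha>)) * heat_nn (c * t) (f i) x)"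
  shows "AE x in lborel. ennreal (norm (u x)) \<le> heat_nn 1 (\<lambda>y. ennreal (norm (u y))) x + ennreal K * (\<Sum>i\<in>I. heat_potential c \<alpha> (f i) x)"
  using L2_representation[OF u]
proof eventually_elim
  fix x
  assume le: "ennreal (norm (u x)) \<le> ennreal (norm (heat_conv 1 u x)) +
    (\<integral>\<^sup>+t. indicator {0<..<1} t * ennreal (norm (\<integral>y. complex_of_real (heat_kernel_dt t (x - y)) * u y \<partial>lborel)) \<partial>lborel)"
  have "(\<integral>\<^sup>+t. indicator {0<..<1} t * ennreal (norm (\<integral>y. complex_of_real (heat_kernel_dt t (x - y)) * u y \<partial>lborel)) \<partial>lborel) \<le>
    (\<integral>\<^sup>+t. ennreal K * (\<Sum>i\<in>I. indicator {0<..<1} t * (ennreal (t powr (- \<alpha>)) * heat_nn (c * t) (f i) x)) \<partial>lborel)"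
  proof (rule nn_integral_mono)
    fix t :: real
    show "indicator {0<..<1} t * ennreal (norm (\<integral>y. complex_of_real (heat_kernel_dt t (x - y)) * u y \<partial>lborel)) \<le>
      ennreal K * (\<Sum>i\<in>I. indicator {0<..<1} t * (ennreal (t powr (- \<alpha>)) * heat_nn (c * t) (f i) x))"
      using V[of t x] by (cases "0 < t \<and> t < 1") auto
  qed
  also have "\<dots> = ennreal K * (\<Sum>i\<in>I. heat_potential c \<alpha> (f i) x)"
    unfolding heat_potential_def by (subst nn_integral_cmult, measurable, subst nn_integral_sum) (auto intro!: borel_measurable_times_ennreal)
  finally have "ennreal (norm (u x)) \<le> ennreal (norm (heat_conv 1 u x)) + ennreal K * (\<Sum>i\<in>I. heat_potential c \<alpha> (f i) x)"
    using le by (meson add_left_mono order_trans)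
  also have "\<dots> \<le> heat_nn 1 (\<lambda>y. ennreal (norm (u y))) x + ennreal K * (\<Sum>i\<in>I. heat_potential c \<alpha> (f i) x)"
    by (intro add_right_mono norm_heat_conv_le)
  finally show "ennreal (norm (u x)) \<le> heat_nn 1 (\<lambda>y. ennreal (norm (u y))) x + ennreal K * (\<Sum>i\<in>I. heat_potential c \<alpha> (f i) x)" .
qed

text \<open>Membership in L^q without the q-th root, in the form that \<open>epowr\<close> and the
  smoothing estimates handle.\<close>

definition fin_pow :: "real \<Rightarrow> ('a::euclidean_space \<Rightarrow> ennreal) \<Rightarrow> bool" where
  "fin_pow q f \<longleftrightarrow> (\<integral>\<^sup>+x. epowr (f x) q \<partial>lborel) < \<infinity>"

section \<open>Finite power integrals and the regularity criteria\<close>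

lemma fin_pow_add:
  assumes [measurable]: "f \<in> borel_measurable borel" "g \<in> borel_measurable borel" and q: "q > 0" and "fin_pow q f" "fin_pow q g"
  shows "fin_pow q (\<lambda>x. f x + g x)"
proof -
  have "(\<integral>\<^sup>+x. epowr (f x + g x) q \<partial>lborel) \<le> (\<integral>\<^sup>+x. ennreal (2 powr q) * (epowr (f x) q + epowr (g x) q) \<partial>lborel)"
    by (intro nn_integral_mono epowr_add_le q)
  also have "\<dots> = ennreal (2 powr q) * ((\<integral>\<^sup>+x. epowr (f x) q \<partial>lborel) + (\<integral>\<^sup>+x. epowr (g x) q \<partial>lborel))"
    by (subst nn_integral_cmult, measurable, subst nn_integral_add) auto
  also have "\<dots> < \<infinity>" using assms by (simp add: fin_pow_def ennreal_mult_less_top)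
  finally show ?thesis by (simp add: fin_pow_def)
qed

lemma fin_pow_zero [simp]: "fin_pow q (\<lambda>x. 0)"
  by (simp add: fin_pow_def)

lemma fin_pow_sum:
  assumes "finite I" "\<And>i. i \<in> I \<Longrightarrow> f i \<in> borel_measurable borel" and q: "q > 0" and "\<And>i. i \<in> I \<Longrightarrow> fin_pow q (f i)"
  shows "fin_pow q (\<lambda>x. \<Sum>i\<in>I. f i x)"
  using assms(1,2,4) by (induct I rule: finite_induct) (auto intro!: fin_pow_add q borel_measurable_sum)

lemma fin_pow_cmult:
  assumes [measurable]: "f \<in> borel_measurable borel" and "fin_pow q f"
  shows "fin_pow q (\<lambda>x. ennreal K * f x)"
proof (cases "K > 0")
  case True
  then show ?thesis
    using assms by (simp add: fin_pow_def epowr_cmult nn_integral_cmult ennreal_mult_less_top)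
next
  case False
  then show ?thesis by (simp add: ennreal_neg)
qed

lemma fin_pow_mono_AE:
  assumes "AE x in lborel. f x \<le> g x" "q > 0" "fin_pow q g"
  shows "fin_pow q f"
proof -
  have "(\<integral>\<^sup>+x. epowr (f x) q \<partial>lborel) \<le> (\<integral>\<^sup>+x. epowr (g x) q \<partial>lborel)"
  proof (rule nn_integral_mono_AE)
    show "AE x in lborel. epowr (f x) q \<le> epowr (g x) q"
      using assms(1) by eventually_elim (use assms(2) in \<open>auto intro: epowr_mono\<close>)
  qed
  then show ?thesis using assms(3) by (auto simp: fin_pow_def)
qed

lemma fin_pow_L2: "u \<in> L2 \<Longrightarrow> fin_pow 2 (\<lambda>x. ennreal (norm (u x)))"
  by (simp add: fin_pow_def heat_nn_norm_L2)

text \<open>The criterion behind both the Sobolev embedding and the bootstrap. The flow at time 1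
  improves L2 to L^q at once; the condition on \<alpha>, \<open>m i\<close> and q is the one for
  potentials.\<close>

lemma regularity_fin_pow:
  fixes u :: "'a::euclidean_space \<Rightarrow> complex" and f :: "'i \<Rightarrow> 'a \<Rightarrow> ennreal"
  assumes u: "u \<in> L2" and I: "finite I" and f: "\<And>i. i \<in> I \<Longrightarrow> f i \<in> borel_measurable borel"
    and V: "\<And>t x. 0 < t \<Longrightarrow> t < 1 \<Longrightarrow> ennreal (norm (\<integral>y. complex_of_real (heat_kernel_dt t (x - y)) * u y \<partial>lborel)) \<le>
      ennreal K * (\<Sum>i\<in>I. ennreal (t powr (- \<alpha>)) * heat_nn (c * t) (f i) x)"
    and c: "c \<ge> 1" and q: "q \<ge> 2" and m: "\<And>i. i \<in> I \<Longrightarrow> 1 \<le> m i \<and> m i \<le> q \<and> fin_pow (m i) (f i) \<and>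
       \<alpha> + real DIM('a) / 2 * (1 / m i - 1 / q) < 1"
  shows "fin_pow q (\<lambda>x. ennreal (norm (u x)))"
proof (rule fin_pow_mono_AE)
  show "AE x in lborel. ennreal (norm (u x)) \<le> heat_nn 1 (\<lambda>y. ennreal (norm (u y))) x + ennreal K * (\<Sum>i\<in>I. heat_potential c \<alpha> (f i) x)"
    by (rule L2_representation_heat_potential[OF u I f V]) assumption+
  have um: "(\<lambda>y. ennreal (norm (u y))) \<in> borel_measurable borel" using u by measurable
  show "fin_pow q (\<lambda>x. heat_nn 1 (\<lambda>y. ennreal (norm (u y))) x + ennreal K * (\<Sum>i\<in>I. heat_potential c \<alpha> (f i) x))"
  proof (intro fin_pow_add fin_pow_cmult fin_pow_sum I heat_nn_measurable um borel_measurable_times_ennreal borel_measurable_sum borel_measurable_const heat_potential_measurable f)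
    have "(\<integral>\<^sup>+x. epowr (heat_nn 1 (\<lambda>y. ennreal (norm (u y))) x) q \<partial>lborel) \<le>
      ennreal (2 powr q * sq u powr (q / 2 - 1) * sq u * 1 powr (- (real DIM('a) / 2 * (q / 2 - 1))))"
      by (rule nn_integral_heat_nn_powr[OF um _ _ _ q heat_nn_norm_L2[OF u]]) auto
    then show "fin_pow q (heat_nn 1 (\<lambda>y. ennreal (norm (u y))))"
      unfolding fin_pow_def by (rule le_less_trans) simp
    show "fin_pow q (heat_potential c \<alpha> (f i))" if "i \<in> I" for i
      unfolding fin_pow_def using m[OF that] by (intro heat_potential_powr_finite[OF f[OF that] c, of "m i"]) (auto simp: fin_pow_def)
  qed (use q in auto)
qed (use q in auto)

lemma regularity_bounded:
  fixes u :: "'a::euclidean_space \<Rightarrow> complex" and f :: "'i \<Rightarrow> 'a \<Rightarrow> ennreal"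
  assumes u: "u \<in> L2" and I: "finite I" and f: "\<And>i. i \<in> I \<Longrightarrow> f i \<in> borel_measurable borel"
    and V: "\<And>t x. 0 < t \<Longrightarrow> t < 1 \<Longrightarrow> ennreal (norm (\<integral>y. complex_of_real (heat_kernel_dt t (x - y)) * u y \<partial>lborel)) \<le>
      ennreal K * (\<Sum>i\<in>I. ennreal (t powr (- \<alpha>)) * heat_nn (c * t) (f i) x)"
    and c: "c \<ge> 1" and m: "\<And>i. i \<in> I \<Longrightarrow> 1 \<le> m i \<and> fin_pow (m i) (f i) \<and> \<alpha> + real DIM('a) / (2 * m i) < 1"
  shows "\<exists>K. AE x in lborel. norm (u x) \<le> K"
proof -
  have um: "(\<lambda>y. ennreal (norm (u y))) \<in> borel_measurable borel" using u by measurable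
  have "\<exists>K. \<forall>x. heat_potential c \<alpha> (f i) x \<le> ennreal K" if "i \<in> I" for i
    using m[OF that] by (intro heat_potential_bounded[OF f[OF that] c, of "m i"]) (auto simp: fin_pow_def)
  then obtain B where B: "\<And>i x. i \<in> I \<Longrightarrow> heat_potential c \<alpha> (f i) x \<le> ennreal (B i)" by metis
  define A where "A = 2 * sq u powr (1 / 2) * 1 powr (- (real DIM('a) / (2 * 2)))"
  have A: "heat_nn 1 (\<lambda>y. ennreal (norm (u y))) x \<le> ennreal A" for x
    unfolding A_def by (rule heat_nn_pointwise'[OF um _ _ _ heat_nn_norm_L2[OF u]]) auto
  define T where "T = ennreal A + ennreal K * (\<Sum>i\<in>I. ennreal (B i))"
  have "T < \<infinity>" using I by (simp add: T_def ennreal_mult_less_top)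
  then obtain \<tau> where \<tau>: "T = ennreal \<tau>" "\<tau> \<ge> 0" by (cases T) auto
  have "AE x in lborel. norm (u x) \<le> \<tau>"
  proof -
    have rep: "AE x in lborel. ennreal (norm (u x)) \<le> heat_nn 1 (\<lambda>y. ennreal (norm (u y))) x + ennreal K * (\<Sum>i\<in>I. heat_potential c \<alpha> (f i) x)"
      by (rule L2_representation_heat_potential[OF u I f V]) assumption+
    show ?thesis
      using rep
    proof eventually_elim
    fix x
    assume "ennreal (norm (u x)) \<le> heat_nn 1 (\<lambda>y. ennreal (norm (u y))) x + ennreal K * (\<Sum>i\<in>I. heat_potential c \<alpha> (f i) x)"
    also have "\<dots> \<le> T" unfolding T_def by (intro add_mono A mult_left_mono sum_mono B) auto
    finally show "norm (u x) \<le> \<tau>" using \<tau> by (simp add: ennreal_le_iff)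
    qed
  qed
  then show ?thesis by blast
qed

section \<open>The nonlinearity\<close>

lemma has_derivative_frechet:
  "f differentiable (at x) \<Longrightarrow> (f has_derivative frechet_derivative f (at x)) (at x)"
  using frechet_derivative_works by blast

lemma partial_deriv_lin_comb:
  assumes "f differentiable (at x)"
  shows "frechet_derivative f (at x) (a *\<^sub>R u + b *\<^sub>R v) = a *\<^sub>R partial_deriv u f x + b *\<^sub>R partial_deriv v f x"
proof -
  interpret linear "frechet_derivative f (at x)"
    using has_derivative_linear[OF has_derivative_frechet[OF assms]] .
  show ?thesis by (simp add: add scale partial_deriv_def)
qed

lemma Ck2_diff: "Ck 2 g \<Longrightarrow> g differentiable (at x)"
  by (simp add: numeral_2_eq_2)

lemma axis_Basis: "axis j (1::complex) \<in> Basis" "axis j \<i> \<in> Basis"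
  by (auto simp: axis_in_Basis_iff Basis_complex_def)

lemma nonlinearity_continuous:
  fixes g :: "complex^'n \<Rightarrow> real"
  assumes "Ck 2 g"
  shows "continuous_on UNIV (nonlinearity p g j)"
proof -
  have "continuous_on UNIV (partial_deriv b g)" if "b \<in> Basis" for b
  proof -
    have "partial_deriv b g differentiable (at x)" for x
      using assms that by (simp add: numeral_2_eq_2)
    then show ?thesis by (simp add: continuous_at_imp_continuous_on differentiable_imp_continuous_within)
  qed
  note c = this[OF axis_Basis(1)[of j]] this[OF axis_Basis(2)[of j]]
  show ?thesis unfolding nonlinearity_def dbar_def by (intro continuous_intros c)
qed

lemma axis_complex: "axis j (Complex a b) = a *\<^sub>R axis j 1 + b *\<^sub>R axis j \<i>"
  by (simp add: vec_eq_iff axis_def complex_eq_iff)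

text \<open>The identity g(R z) = g(z) is differentiated, where R is the diagonal rotation. The
  chain rule moves R onto the direction of differentiation, and R multiplies the j-th axis by a
  unimodular c.\<close>

lemma nonlinearity_gauge:
  fixes g :: "complex^'n \<Rightarrow> real" and n :: "'n \<Rightarrow> nat"
  assumes C: "Ck 2 g"
    and inv: "\<And>\<theta> z. g (\<chi> j. exp (\<i> * complex_of_real (real (n j) * \<theta>)) * z $ j) = g z"
  shows "nonlinearity p g j (\<chi> k. exp (\<i> * complex_of_real (real (n k) * \<theta>)) * z $ k) =
    exp (\<i> * complex_of_real (real (n j) * \<theta>)) * nonlinearity p g j z"
proof -
  define R :: "complex^'n \<Rightarrow> complex^'n" where "R v = (\<chi> k. exp (\<i> * complex_of_real (real (n k) * \<theta>)) * v $ k)" for v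
  have lR: "linear R"
    by (rule linearI) (simp_all add: R_def vec_eq_iff algebra_simps)
  define c where "c = exp (\<i> * complex_of_real (real (n j) * \<theta>))"
  define D where "D = frechet_derivative g (at (R z))"
  have Rd: "(R has_derivative R) (at z)"
    by (rule linear_imp_has_derivative[OF lR])
  have gd: "(g has_derivative D) (at (R z))"
    unfolding D_def by (rule has_derivative_frechet[OF Ck2_diff[OF C]])
  have "((\<lambda>v. g (R v)) has_derivative (\<lambda>v. D (R v))) (at z)"
    by (rule has_derivative_compose[OF Rd gd])
  moreover have "(\<lambda>v. g (R v)) = g" using inv by (simp add: R_def fun_eq_iff)
  ultimately have gz: "(g has_derivative (\<lambda>v. D (R v))) (at z)" by simp
  have pd: "partial_deriv b g z = D (R b)" for b by (rule has_derivative_partial[OF gz])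
  have nc: "c * cnj c = 1" unfolding c_def by (simp add: complex_norm_square[symmetric])
  have Ra: "R (axis j w) = axis j (c * w)" for w
    by (simp add: R_def vec_eq_iff axis_def c_def)
  have Dax: "D (axis j w) = Re w * D (axis j 1) + Im w * D (axis j \<i>)" for w
  proof -
    have "axis j w = Re w *\<^sub>R axis j 1 + Im w *\<^sub>R axis j \<i>" using axis_complex[of j "Re w" "Im w"] by simp
    then have "D (axis j w) = D (Re w *\<^sub>R axis j 1 + Im w *\<^sub>R axis j \<i>)" by simp
    also have "\<dots> = Re w *\<^sub>R partial_deriv (axis j 1) g (R z) + Im w *\<^sub>R partial_deriv (axis j \<i>) g (R z)"
      unfolding D_def by (rule partial_deriv_lin_comb[OF Ck2_diff[OF C]])
    finally show ?thesis by (simp add: D_def partial_deriv_def)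
  qed
  have "dbar j g z = (1 / 2) * (complex_of_real (D (axis j c)) + \<i> * complex_of_real (D (axis j (c * \<i>))))"
    unfolding dbar_def pd Ra by simp
  \<comment> \<open>D is real linear. In the combination D(c) + i D(i c) its complex linear part
    cancels, so c is pulled out as its conjugate.\<close>
  also have "\<dots> = cnj c * ((1 / 2) * (complex_of_real (D (axis j 1)) + \<i> * complex_of_real (D (axis j \<i>))))"
    unfolding Dax[of c] Dax[of "c * \<i>"] by (simp add: complex_eq_iff algebra_simps)
  also have "\<dots> = cnj c * dbar j g (R z)" by (simp add: dbar_def D_def partial_deriv_def)
  finally have "c * dbar j g z = c * cnj c * dbar j g (R z)" by simp
  then have "dbar j g (R z) = c * dbar j g z" by (simp add: nc)
  then show ?thesis by (simp add: nonlinearity_def R_def c_def)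
qed

lemma partial_deriv_homogeneous:
  fixes g :: "complex^'n \<Rightarrow> real"
  assumes C: "Ck 2 g" and hom: "\<And>r z. r \<ge> 0 \<Longrightarrow> g (r *\<^sub>R z) = r powr p * g z" and r: "r > 0"
  shows "partial_deriv b g (r *\<^sub>R z) = r powr (p - 1) * partial_deriv b g z"
proof -
  let ?D = "frechet_derivative g (at (r *\<^sub>R z))"
  have "((\<lambda>v. r *\<^sub>R v) has_derivative (\<lambda>v. r *\<^sub>R v)) (at z)"
    by (auto intro!: derivative_eq_intros)
  from has_derivative_compose[OF this has_derivative_frechet[OF Ck2_diff[OF C]]]
  have "((\<lambda>v. g (r *\<^sub>R v)) has_derivative (\<lambda>v. ?D (r *\<^sub>R v))) (at z)" .
  from has_derivative_partial[OF this]
  have "partial_deriv b (\<lambda>v. g (r *\<^sub>R v)) z = ?D (r *\<^sub>R b)" .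
  also have "?D (r *\<^sub>R b) = r * partial_deriv b g (r *\<^sub>R z)"
    using linear_scale[OF has_derivative_linear[OF has_derivative_frechet[OF Ck2_diff[OF C]]]]
    by (simp add: partial_deriv_def)
  finally have 1: "partial_deriv b (\<lambda>v. g (r *\<^sub>R v)) z = r * partial_deriv b g (r *\<^sub>R z)" .
  have "((\<lambda>v. r powr p * g v) has_derivative (\<lambda>v. r powr p * frechet_derivative g (at z) v)) (at z)"
    by (intro has_derivative_mult_right has_derivative_frechet[OF Ck2_diff[OF C]])
  from has_derivative_partial[OF this]
  have "partial_deriv b (\<lambda>v. r powr p * g v) z = r powr p * partial_deriv b g z" by (simp add: partial_deriv_def)
  moreover have "(\<lambda>v. g (r *\<^sub>R v)) = (\<lambda>v. r powr p * g v)" using hom r by auto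
  ultimately have "r * partial_deriv b g (r *\<^sub>R z) = r powr p * partial_deriv b g z" using 1 by simp
  then show ?thesis using r by (simp add: powr_diff field_simps)
qed

lemma nonlinearity_homogeneous:
  fixes g :: "complex^'n \<Rightarrow> real"
  assumes "Ck 2 g" "\<And>r z. r \<ge> 0 \<Longrightarrow> g (r *\<^sub>R z) = r powr p * g z" "r > 0"
  shows "nonlinearity p g j (r *\<^sub>R z) = complex_of_real (r powr (p - 1)) * nonlinearity p g j z"
proof -
  have "partial_deriv b g (r *\<^sub>R z) = r powr (p - 1) * partial_deriv b g z" for b
    by (rule partial_deriv_homogeneous) (use assms in auto)
  then show ?thesis unfolding nonlinearity_def dbar_def by (simp add: field_simps)
qed

text \<open>F_j is homogeneous of degree p - 1, so its maximum on the compact unit sphere is the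
  constant.\<close>

lemma nonlinearity_bound:
  fixes g :: "complex^'n \<Rightarrow> real"
  assumes C: "Ck 2 g" and hom: "\<And>r z. r \<ge> 0 \<Longrightarrow> g (r *\<^sub>R z) = r powr p * g z" and p: "p > 2"
  shows "\<exists>C\<ge>0. \<forall>z. norm (nonlinearity p g j z) \<le> C * norm z powr (p - 1)"
proof -
  let ?F = "nonlinearity p g j"
  have "compact (?F ` sphere 0 1)"
    by (intro compact_continuous_image compact_sphere continuous_on_subset[OF nonlinearity_continuous[OF C]]) auto
  then obtain K where K: "K > 0" "\<And>z. norm z = 1 \<Longrightarrow> norm (?F z) \<le> K"
    by (auto dest!: compact_imp_bounded simp: bounded_pos)
  have "norm (?F z) \<le> K * norm z powr (p - 1)" for z
  proof (cases "z = 0")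
    case True
    \<comment> \<open>Homogeneity with r = 2 reads F(0) = 2^(p-1) F(0) with a factor different from
      1, which forces F(0) = 0.\<close>
    have "?F 0 = complex_of_real (2 powr (p - 1)) * ?F 0"
      using nonlinearity_homogeneous[OF C hom, of 2 j 0] by simp
    moreover have "(2::real) powr (p - 1) > 2 powr 0" using p by (intro powr_less_mono) auto
    then have "complex_of_real (2 powr (p - 1)) \<noteq> 1" by (metis less_irrefl of_real_1 of_real_eq_iff powr_zero_eq_one zero_neq_numeral)
    ultimately have "?F 0 = 0" by (metis mult_cancel_right1)
    then show ?thesis using True by simp
  next
    case False
    have "?F z = complex_of_real (norm z powr (p - 1)) * ?F (z /\<^sub>R norm z)"
      using nonlinearity_homogeneous[OF C hom, of "norm z" j "z /\<^sub>R norm z"] False by simp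
    then have "norm (?F z) = norm z powr (p - 1) * norm (?F (z /\<^sub>R norm z))"
      by (simp add: norm_mult)
    also have "\<dots> \<le> norm z powr (p - 1) * K"
      using False by (intro mult_left_mono K) auto
    finally show ?thesis by (simp add: mult.commute)
  qed
  then show ?thesis using K(1) by (intro exI[of _ K]) auto
qed

section \<open>Regularity of standing waves\<close>

text \<open>Against a Gaussian, the constant part is absorbed by the integrability of the Gaussian
  and h by the bound 1 of the Gaussian.\<close>

lemma tempered_dominated:
  fixes f :: "'a::euclidean_space \<Rightarrow> complex"
  assumes [measurable]: "f \<in> borel_measurable borel" "h \<in> borel_measurable borel"
    and le: "\<And>x. ennreal (norm (f x)) \<le> ennreal K * (1 + h x)" and h: "(\<integral>\<^sup>+x. h x \<partial>lborel) < \<infinity>"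
  shows "tempered f"
  unfolding tempered_def
proof (intro conjI allI impI)
  fix a :: real and z :: 'a assume a: "a > 0"
  have gi: "(\<integral>\<^sup>+x. ennreal (exp (- a * (norm (x - z))\<^sup>2)) \<partial>lborel) < \<infinity>"
  proof -
    have "(\<integral>\<^sup>+x. ennreal (exp (- a * (norm (x - z))\<^sup>2)) \<partial>lborel) = (\<integral>\<^sup>+x. ennreal (exp (- a * (norm (x :: 'a))\<^sup>2)) \<partial>lborel)"
      by (rule nn_integral_lborel_translate) measurable
    also have "\<dots> < \<infinity>"
      using gauss_mult_integrable(1)[OF a, where 'a='a] unfolding integrable_iff_bounded by simp
    finally show ?thesis .
  qed
  have "(\<integral>\<^sup>+x. ennreal (norm (norm (f x) * exp (- a * (norm (x - z))\<^sup>2))) \<partial>lborel) \<le>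
    (\<integral>\<^sup>+x. ennreal K * (ennreal (exp (- a * (norm (x - z))\<^sup>2)) + h x) \<partial>lborel)"
  proof (rule nn_integral_mono)
    fix x
    have e1: "exp (- a * (norm (x - z))\<^sup>2) \<le> 1" using a by simp
    have "ennreal (norm (norm (f x) * exp (- a * (norm (x - z))\<^sup>2))) = ennreal (norm (f x)) * ennreal (exp (- a * (norm (x - z))\<^sup>2))"
      by (simp add: ennreal_mult)
    also have "\<dots> \<le> (ennreal K * (1 + h x)) * ennreal (exp (- a * (norm (x - z))\<^sup>2))"
      by (intro mult_right_mono le) simp
    also have "\<dots> = ennreal K * (ennreal (exp (- a * (norm (x - z))\<^sup>2)) + h x * ennreal (exp (- a * (norm (x - z))\<^sup>2)))"
      by (simp add: algebra_simps)
    also have "\<dots> \<le> ennreal K * (ennreal (exp (- a * (norm (x - z))\<^sup>2)) + h x * 1)"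
      using e1 by (intro mult_left_mono add_left_mono) (auto simp flip: ennreal_1 intro: ennreal_leI)
    finally show "ennreal (norm (norm (f x) * exp (- a * (norm (x - z))\<^sup>2))) \<le> ennreal K * (ennreal (exp (- a * (norm (x - z))\<^sup>2)) + h x)"
      by simp
  qed
  also have "\<dots> = ennreal K * ((\<integral>\<^sup>+x. ennreal (exp (- a * (norm (x - z))\<^sup>2)) \<partial>lborel) + (\<integral>\<^sup>+x. h x \<partial>lborel))"
    by (subst nn_integral_cmult, measurable, subst nn_integral_add) auto
  also have "\<dots> < \<infinity>" using gi h by (simp add: ennreal_mult_less_top)
  finally show "integrable lborel (\<lambda>x. norm (f x) * exp (- a * (norm (x - z))\<^sup>2))"
    by (intro integrableI_bounded) auto
qed measurable

lemma tempered_L2: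
  assumes "f \<in> L2" shows "tempered f"
proof (rule tempered_dominated[where K=1 and h="\<lambda>x. ennreal ((norm (f x))\<^sup>2)"])
  have "norm (f x) \<le> 1 + (norm (f x))\<^sup>2" for x
    using sum_squares_bound[of "norm (f x)" 1] norm_ge_zero[of "f x"] by (simp del: norm_ge_zero)
  then have "ennreal (norm (f x)) \<le> ennreal (1 + (norm (f x))\<^sup>2)" for x
    by (rule ennreal_leI)
  then show "ennreal (norm (f x)) \<le> ennreal 1 * (1 + ennreal ((norm (f x))\<^sup>2))" for x
    by (simp add: ennreal_plus)
  show "(\<integral>\<^sup>+x. ennreal ((norm (f x))\<^sup>2) \<partial>lborel) < \<infinity>" using nn_integral_sq[OF assms] by simp
qed (use assms in measurable)

lemma tempered_test_integrable:
  fixes f :: "'a::euclidean_space \<Rightarrow> complex"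
  assumes f: "tempered f" and t: "test_function \<psi>"
  shows "integrable lborel (\<lambda>x. f x * \<psi> x)"
proof -
  obtain C K where C: "\<And>x. norm (\<psi> x) \<le> C" and K: "compact K" "\<And>x. x \<notin> K \<Longrightarrow> \<psi> x = 0"
    using test_function_bounded[OF t] by metis
  have [measurable]: "f \<in> borel_measurable borel" "\<psi> \<in> borel_measurable borel"
    using f test_function_bounded(1)[OF t] by (auto simp: tempered_def)
  obtain R where R: "\<And>x. x \<in> K \<Longrightarrow> norm x \<le> R"
    using compact_imp_bounded[OF K(1)] by (auto simp: bounded_iff)
  \<comment> \<open>On the support of the test function the Gaussian is at least exp(-R^2), so this
    factor turns it into a majorant.\<close>
  have "integrable lborel (\<lambda>x. (C * exp (R\<^sup>2)) * (norm (f x) * exp (- 1 * (norm (x - 0))\<^sup>2)))"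
    using f unfolding tempered_def by (intro integrable_mult_right) (metis zero_less_one)
  then show ?thesis
  proof (rule Bochner_Integration.integrable_bound)
    show "AE x in lborel. norm (f x * \<psi> x) \<le> norm ((C * exp (R\<^sup>2)) * (norm (f x) * exp (- 1 * (norm (x - 0))\<^sup>2)))"
    proof (rule AE_I2)
      fix x
      show "norm (f x * \<psi> x) \<le> norm ((C * exp (R\<^sup>2)) * (norm (f x) * exp (- 1 * (norm (x - 0))\<^sup>2)))"
      proof (cases "x \<in> K")
        case True
        have C0: "0 \<le> C" using C[of x] norm_ge_zero[of "\<psi> x"] by linarith
        have "1 \<le> exp (R\<^sup>2) * exp (- (norm x)\<^sup>2)"
          using R[OF True] by (simp add: power_mono flip: exp_add)
        then have "norm (f x) * C * 1 \<le> norm (f x) * C * (exp (R\<^sup>2) * exp (- (norm x)\<^sup>2))"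
          using C0 by (intro mult_left_mono) auto
        then have "norm (f x) * C \<le> norm (f x) * C * (exp (R\<^sup>2) * exp (- (norm x)\<^sup>2))" by simp
        moreover have "norm (f x * \<psi> x) \<le> norm (f x) * C"
          unfolding norm_mult by (intro mult_left_mono C) simp
        ultimately show ?thesis using C0 by (simp add: abs_mult mult_ac)
      qed (simp add: K(2))
    qed
  qed measurable
qed

lemma test_function_partial:
  fixes \<psi> :: "'a::euclidean_space \<Rightarrow> complex"
  assumes t: "test_function \<psi>" and b: "b \<in> Basis"
  shows "test_function (partial_deriv b \<psi>)"
proof -
  have "Ck k (partial_deriv b \<psi>)" for k
    using t b unfolding test_function_def by (metis Ck.simps(2))
  moreover have "{x. partial_deriv b \<psi> x \<noteq> 0} \<subseteq> closure {x. \<psi> x \<noteq> 0}"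
  proof
    fix x assume "x \<in> {x. partial_deriv b \<psi> x \<noteq> 0}"
    moreover have "\<psi> x = 0" if "x \<notin> closure {x. \<psi> x \<noteq> 0}" for x
      using that closure_subset[of "{x. \<psi> x \<noteq> 0}"] by auto
    ultimately show "x \<in> closure {x. \<psi> x \<noteq> 0}"
      using support_closed_partial[OF closed_closure, of _ \<psi> x b] by blast
  qed
  then have "closure {x. partial_deriv b \<psi> x \<noteq> 0} \<subseteq> closure {x. \<psi> x \<noteq> 0}"
    by (rule closure_minimal) simp
  then have "compact (closure {x. partial_deriv b \<psi> x \<noteq> 0})"
    using t unfolding test_function_def by (metis closed_closure compact_Int_closed inf.absorb_iff2 inf_commute)
  ultimately show ?thesis by (simp add: test_function_def)
qed

lemma tempered_laplacian_integrable:
  assumes "tempered f" "test_function \<psi>"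
  shows "integrable lborel (\<lambda>x. f x * laplacian \<psi> x)"
  unfolding laplacian_def sum_distrib_left
  by (intro Bochner_Integration.integrable_sum tempered_test_integrable assms test_function_partial)

lemma norm_vec_le_sum: "norm (z :: complex^'n) \<le> (\<Sum>k\<in>UNIV. norm (z $ k))"
  unfolding norm_vec_def by (rule L2_set_le_sum) simp

lemma heat_nn_sum_const:
  assumes "finite I" "\<And>i. i \<in> I \<Longrightarrow> f i \<in> borel_measurable borel"
  shows "heat_nn t (\<lambda>y. ennreal K * (\<Sum>i\<in>I. f i y)) x = ennreal K * (\<Sum>i\<in>I. heat_nn t (f i) x)"
proof -
  have "heat_nn t (\<lambda>y. ennreal K * (\<Sum>i\<in>I. f i y)) x = (\<integral>\<^sup>+y. ennreal K * (\<Sum>i\<in>I. ennreal (heat_kernel t (x - y)) * f i y) \<partial>lborel)"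
    unfolding heat_nn_def by (intro nn_integral_cong) (simp add: sum_distrib_left mult_ac)
  also have "\<dots> = ennreal K * (\<Sum>i\<in>I. heat_nn t (f i) x)"
    unfolding heat_nn_def using assms by (subst nn_integral_cmult, measurable, subst nn_integral_sum) auto
  finally show ?thesis .
qed

text \<open>The only place where a single derivative on the kernel is estimated; it costs t^(-1/2)
  and a doubling of the time.\<close>

lemma gradient_kernel_le:
  fixes x :: "'a::euclidean_space"
  assumes [measurable]: "E \<in> borel_measurable borel" and t: "t > 0" and b: "b \<in> Basis"
  shows "ennreal (norm (\<integral>y. E y * partial_deriv b (\<lambda>y. complex_of_real (heat_kernel t (x - y))) y \<partial>lborel)) \<le>
    ennreal (Kd DIM('a)) * (ennreal (t powr (- (1 / 2))) * heat_nn (2 * t) (\<lambda>y. ennreal (norm (E y))) x)"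
proof -
  have K: "0 \<le> Kd DIM('a)" by (simp add: Kd_def)
  have "ennreal (norm (\<integral>y. E y * partial_deriv b (\<lambda>y. complex_of_real (heat_kernel t (x - y))) y \<partial>lborel)) \<le>
    (\<integral>\<^sup>+y. ennreal (norm (E y * partial_deriv b (\<lambda>y. complex_of_real (heat_kernel t (x - y))) y)) \<partial>lborel)"
    by (rule norm_integral_le_nn_integral)
  also have "\<dots> \<le> (\<integral>\<^sup>+y. ennreal (Kd DIM('a) * t powr (- (1 / 2))) * (ennreal (heat_kernel (2 * t) (x - y)) * ennreal (norm (E y))) \<partial>lborel)"
  proof (rule nn_integral_mono)
    fix y
    have "norm (E y * partial_deriv b (\<lambda>y. complex_of_real (heat_kernel t (x - y))) y) =
      norm (E y) * \<bar>((x - y) \<bullet> b) / (2 * t) * heat_kernel t (x - y)\<bar>"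
      unfolding partial_deriv_heat_kernel[OF t] norm_mult norm_of_real ..
    also have "\<dots> \<le> norm (E y) * (Kd DIM('a) * t powr (- (1 / 2)) * heat_kernel (2 * t) (x - y))"
      using b by (intro mult_left_mono heat_kernel_gradient_bound t) auto
    finally show "ennreal (norm (E y * partial_deriv b (\<lambda>y. complex_of_real (heat_kernel t (x - y))) y)) \<le>
      ennreal (Kd DIM('a) * t powr (- (1 / 2))) * (ennreal (heat_kernel (2 * t) (x - y)) * ennreal (norm (E y)))"
      using K by (simp add: ennreal_leI mult_ac flip: ennreal_mult)
  qed
  also have "\<dots> = ennreal (Kd DIM('a) * t powr (- (1 / 2))) * heat_nn (2 * t) (\<lambda>y. ennreal (norm (E y))) x"
    unfolding heat_nn_def by (rule nn_integral_cmult) measurable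
  finally show ?thesis using K by (simp add: ennreal_mult mult.assoc)
qed

text \<open>This is where \<open>p < 2\<^sup>*\<close> enters: \<open>1 / x\<close> is an exponent within reach of the Sobolev embedding from which
  the bootstrap gains.\<close>

lemma exists_exponent:
  assumes p: "2 < p" "ereal p < two_star d" and d: "d \<ge> 1"
  shows "\<exists>x>0. x \<le> 1 / p \<and> x > 1 / 2 - 1 / real d \<and> (p - 2) * x < 2 / real d"
proof -
  \<comment> \<open>The lower bound is the threshold of the Sobolev embedding. The upper bound
    combines 1 / x \<ge> p, which keeps F_j(Phi) in a Lebesgue space of exponent at least 1, with
    the gain condition of the bootstrap.\<close>
  define lo where "lo = max 0 (1 / 2 - 1 / real d)"
  define hi where "hi = min (1 / p) (2 / (real d * (p - 2)))"
  have "lo < hi"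
  proof (cases "d \<le> 2")
    case True
    then have "1 / 2 \<le> 1 / real d" using d by (simp add: divide_simps)
    then show ?thesis using p d by (simp add: lo_def hi_def)
  next
    case False
    then have d3: "real d > 2" by simp
    have "p < 2 * real d / (real d - 2)" using p False by (simp add: two_star_def)
    then have h: "p * (real d - 2) < 2 * real d" using d3 by (simp add: field_simps)
    have "(real d - 2) / (2 * real d) < 1 / p"
      using h p d3 by (simp add: pos_divide_less_eq pos_less_divide_eq mult.commute)
    then have "1 / 2 - 1 / real d < 1 / p" using d3 by (simp add: diff_divide_distrib)
    moreover have "1 / 2 - 1 / real d < 2 / (real d * (p - 2))"
    proof -
      have "(real d - 2) * (p - 2) < 4" using h by (simp add: algebra_simps)
      then have "real d - 2 < 4 / (p - 2)" using p by (simp add: pos_less_divide_eq)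
      then have "(real d - 2) / (2 * real d) < (4 / (p - 2)) / (2 * real d)"
        using d3 by (intro divide_strict_right_mono) auto
      then have "(real d - 2) / (2 * real d) < 2 / (real d * (p - 2))" by (simp add: mult.commute)
      moreover have "1 / 2 - 1 / real d = (real d - 2) / (2 * real d)" using d3 by (simp add: field_simps)
      ultimately show ?thesis by simp
    qed
    ultimately show ?thesis using p d3 by (simp add: lo_def hi_def)
  qed
  then obtain x where x: "lo < x" "x < hi" using dense by blast
  have "x < 2 / (real d * (p - 2))" using x by (simp add: hi_def)
  then have "(p - 2) * x < 2 / real d" using p d by (simp add: field_simps)
  then show ?thesis using x by (intro exI[of _ x]) (auto simp: lo_def hi_def)
qed

text \<open>Borel representatives \<open>\<phi>\<close> of the components and \<open>G\<close> of
  their weak gradients, with all identities written over \<open>lborel\<close>. The nonlinearity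
  enters through its continuity and its growth of order p - 1.\<close>

locale standing_wave =
  fixes \<phi> :: "'n::finite \<Rightarrow> 'a::euclidean_space \<Rightarrow> complex" and G :: "'n \<Rightarrow> 'a \<Rightarrow> 'a \<Rightarrow> complex"
    and F :: "'n \<Rightarrow> complex^'n \<Rightarrow> complex" and p \<omega> C :: real
  assumes \<phi>: "\<And>j. \<phi> j \<in> L2" and G: "\<And>j b. b \<in> Basis \<Longrightarrow> G j b \<in> L2"
    and weak: "\<And>j b \<psi>. b \<in> Basis \<Longrightarrow> test_function \<psi> \<Longrightarrow>
      (\<integral>x. \<phi> j x * partial_deriv b \<psi> x \<partial>lborel) = - (\<integral>x. G j b x * \<psi> x \<partial>lborel)"
    and equation: "\<And>j \<psi>. test_function \<psi> \<Longrightarrow>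
      (\<integral>x. \<phi> j x * (- laplacian \<psi> x + complex_of_real \<omega> * \<psi> x) \<partial>lborel) = - (\<integral>x. F j (\<chi> k. \<phi> k x) * \<psi> x \<partial>lborel)"
    and cont: "\<And>j. continuous_on UNIV (F j)"
    and growth: "\<And>j z. norm (F j z) \<le> C * norm z powr (p - 1)" and C: "C \<ge> 0"
    and p: "2 < p" "ereal p < two_star DIM('a)" and \<omega>: "\<omega> > 0"
begin

text \<open>A sum of moduli instead of the norm of the vector, so that power integrals reduce
  directly to the components.\<close>

definition f0 :: "'a \<Rightarrow> ennreal" where "f0 x = (\<Sum>k\<in>UNIV. ennreal (norm (\<phi> k x)))"

definition Fx :: "'n \<Rightarrow> 'a \<Rightarrow> complex" where "Fx j x = F j (\<chi> k. \<phi> k x)"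

text \<open>The distributional Laplacian of \<open>\<phi> j\<close>, since the equation reads
  \<Delta> \<phi>_j = \<omega> \<phi>_j + F_j(\<phi>).\<close>

definition E :: "'n \<Rightarrow> 'a \<Rightarrow> complex" where "E j x = complex_of_real \<omega> * \<phi> j x + Fx j x"

text \<open>The two terms of \<open>E\<close> are estimated in different Lebesgue spaces, hence the index.\<close>

definition src :: "bool \<Rightarrow> 'a \<Rightarrow> ennreal" where "src i x = (if i then epowr (f0 x) (p - 1) else f0 x)"

lemma \<phi>_measurable [measurable]: "\<phi> j \<in> borel_measurable borel"
  using \<phi> by auto

lemma f0_measurable [measurable]: "f0 \<in> borel_measurable borel"
  unfolding f0_def by measurable

lemma src_measurable [measurable]: "src i \<in> borel_measurable borel"
  unfolding src_def by measurable

lemma Fx_measurable [measurable]: "Fx j \<in> borel_measurable borel"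
proof -
  have "(\<lambda>x. \<chi> k. \<phi> k x) \<in> borel_measurable borel"
    by (subst borel_measurable_euclidean_space)
      (auto simp: Basis_vec_def inner_axis intro!: borel_measurable_inner)
  from measurable_compose[OF this borel_measurable_continuous_onI[OF cont]]
  show ?thesis unfolding Fx_def .
qed

lemma E_measurable [measurable]: "E j \<in> borel_measurable borel"
  unfolding E_def by measurable

lemma norm_Fx_le: "ennreal (norm (Fx j x)) \<le> ennreal C * epowr (f0 x) (p - 1)"
proof -
  have s: "f0 x = ennreal (\<Sum>k\<in>UNIV. norm (\<phi> k x))" by (simp add: f0_def sum_ennreal)
  have "norm (Fx j x) \<le> C * norm (\<chi> k. \<phi> k x) powr (p - 1)" unfolding Fx_def by (rule growth)
  also have "\<dots> \<le> C * (\<Sum>k\<in>UNIV. norm (\<phi> k x)) powr (p - 1)"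
    using norm_vec_le_sum[of "\<chi> k. \<phi> k x"] p C by (intro mult_left_mono powr_mono2) auto
  finally show ?thesis
    unfolding s using C by (simp add: epowr_ennreal sum_nonneg ennreal_leI flip: ennreal_mult)
qed

definition KE :: real where "KE = max \<omega> C"

lemma norm_E_le: "ennreal (norm (E j x)) \<le> ennreal KE * (\<Sum>i\<in>UNIV. src i x)"
proof -
  have "ennreal (norm (E j x)) \<le> ennreal (norm (complex_of_real \<omega> * \<phi> j x) + norm (Fx j x))"
    unfolding E_def by (intro ennreal_leI norm_triangle_ineq)
  also have "\<dots> = ennreal \<omega> * ennreal (norm (\<phi> j x)) + ennreal (norm (Fx j x))"
    using \<omega> by (simp add: norm_mult ennreal_mult)
  also have "\<dots> \<le> ennreal KE * f0 x + ennreal KE * epowr (f0 x) (p - 1)"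
  proof (rule add_mono)
    have "ennreal (norm (\<phi> j x)) \<le> f0 x" unfolding f0_def by (rule member_le_sum) auto
    then show "ennreal \<omega> * ennreal (norm (\<phi> j x)) \<le> ennreal KE * f0 x"
      by (intro mult_mono ennreal_leI) (auto simp: KE_def)
    have "ennreal C * epowr (f0 x) (p - 1) \<le> ennreal KE * epowr (f0 x) (p - 1)"
      by (intro mult_right_mono ennreal_leI) (auto simp: KE_def)
    with norm_Fx_le[of j x] show "ennreal (norm (Fx j x)) \<le> ennreal KE * epowr (f0 x) (p - 1)" by (rule order_trans)
  qed
  also have "\<dots> = ennreal KE * (\<Sum>i\<in>UNIV. src i x)" by (simp add: UNIV_bool src_def distrib_left add.commute)
  finally show ?thesis .
qed

section \<open>Sobolev embedding of the standing wave\<close>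

lemma weak_poly_gauss:
  assumes b: "b \<in> Basis" and poly_gauss: "poly_gauss z \<psi>"
  shows "(\<integral>x. \<phi> j x * partial_deriv b \<psi> x \<partial>lborel) = - (\<integral>x. G j b x * \<psi> x \<partial>lborel)"
  by (rule weak_deriv_poly_gauss[OF tempered_L2[OF \<phi>] tempered_L2[OF G[OF b]] weak[OF b] poly_gauss])

lemma heat_kernel_dt_integral: "t > 0 \<Longrightarrow> (\<integral>y. complex_of_real (heat_kernel_dt t (x - y)) * u y \<partial>lborel) =
    (\<integral>y. u y * laplacian (\<lambda>y. complex_of_real (heat_kernel t (x - y))) y \<partial>lborel)"
  by (simp add: laplacian_heat_kernel mult.commute)

lemma fin_pow_f0: "q > 0 \<Longrightarrow> (\<And>j. fin_pow q (\<lambda>x. ennreal (norm (\<phi> j x)))) \<Longrightarrow> fin_pow q f0"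
  unfolding f0_def[abs_def] by (intro fin_pow_sum) auto

text \<open>The Laplacian of the kernel is a sum of two-fold derivatives. One of the two goes to
  \<phi>_j and becomes a component of the gradient in L2; the other stays, so \<alpha> = 1/2, and
  the condition on q is the integrability condition at t = 0, without the critical exponent.\<close>

lemma Sobolev_fin_pow:
  assumes q: "q \<ge> 2" and cond: "real DIM('a) * (1 / 2 - 1 / q) < 1"
  shows "fin_pow q f0"
proof (rule fin_pow_f0)
  fix j
  show "fin_pow q (\<lambda>x. ennreal (norm (\<phi> j x)))"
  proof (rule regularity_fin_pow[OF \<phi> finite_Basis, where \<alpha>="1/2" and c=2 and m="\<lambda>_. 2" and f="\<lambda>b y. ennreal (norm (G j b y))" and K="Kd DIM('a)"])
    show "(\<lambda>y. ennreal (norm (G j b y))) \<in> borel_measurable borel" if "b \<in> Basis" for b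
      using G[OF that, of j] by measurable
    fix t :: real and x :: 'a assume t: "0 < t" "t < 1"
    let ?\<psi> = "\<lambda>y. complex_of_real (heat_kernel t (x - y))"
    have poly_gauss: "poly_gauss x ?\<psi>" by (rule poly_gauss_heat_kernel[OF t(1)])
    have "(\<integral>y. complex_of_real (heat_kernel_dt t (x - y)) * \<phi> j y \<partial>lborel) =
      (\<integral>y. (\<Sum>b\<in>Basis. \<phi> j y * partial_deriv b (partial_deriv b ?\<psi>) y) \<partial>lborel)"
      unfolding heat_kernel_dt_integral[OF t(1)] by (simp add: laplacian_def sum_distrib_left)
    also have "\<dots> = (\<Sum>b\<in>Basis. \<integral>y. \<phi> j y * partial_deriv b (partial_deriv b ?\<psi>) y \<partial>lborel)"
      by (rule Bochner_Integration.integral_sum) (rule tempered_mult_integrable[OF tempered_L2[OF \<phi>] poly_gauss_partial[OF poly_gauss_partial[OF poly_gauss]]])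
    also have "\<dots> = (\<Sum>b\<in>Basis. - (\<integral>y. G j b y * partial_deriv b ?\<psi> y \<partial>lborel))"
      by (intro sum.cong refl) (rule weak_poly_gauss[OF _ poly_gauss_partial[OF poly_gauss]])
    finally have eq: "(\<integral>y. complex_of_real (heat_kernel_dt t (x - y)) * \<phi> j y \<partial>lborel) =
      (\<Sum>b\<in>Basis. - (\<integral>y. G j b y * partial_deriv b ?\<psi> y \<partial>lborel))" .
    have "ennreal (norm (\<integral>y. complex_of_real (heat_kernel_dt t (x - y)) * \<phi> j y \<partial>lborel)) \<le>
      ennreal (\<Sum>b\<in>Basis. norm (\<integral>y. G j b y * partial_deriv b ?\<psi> y \<partial>lborel))"
      unfolding eq by (intro ennreal_leI order_trans[OF norm_sum]) simp
    also have "\<dots> = (\<Sum>b\<in>Basis. ennreal (norm (\<integral>y. G j b y * partial_deriv b ?\<psi> y \<partial>lborel)))"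
      by (simp add: sum_ennreal)
    also have "\<dots> \<le> (\<Sum>b\<in>Basis. ennreal (Kd DIM('a)) * (ennreal (t powr (- (1 / 2))) * heat_nn (2 * t) (\<lambda>y. ennreal (norm (G j b y))) x))"
      using G by (intro sum_mono gradient_kernel_le t) auto
    finally show "ennreal (norm (\<integral>y. complex_of_real (heat_kernel_dt t (x - y)) * \<phi> j y \<partial>lborel)) \<le>
      ennreal (Kd DIM('a)) * (\<Sum>b\<in>Basis. ennreal (t powr (- (1 / 2))) * heat_nn (2 * t) (\<lambda>y. ennreal (norm (G j b y))) x)"
      by (simp only: sum_distrib_left)
  next
    show "(1::real) \<le> 2 \<and> 2 \<le> q \<and> fin_pow 2 (\<lambda>y. ennreal (norm (G j b y))) \<and> 1 / 2 + real DIM('a) / 2 * (1 / 2 - 1 / q) < 1"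
      if "b \<in> Basis" for b using q cond fin_pow_L2[OF G[OF that]] by (simp add: field_simps)
  qed (use q in auto)
qed (use q in simp)

text \<open>Exponents are recorded by their reciprocals, for which the smoothing conditions are
  affine. The interval from x0 to 1/2 is supplied by the Sobolev embedding, and x0 already satisfies
  the gain condition.\<close>

lemma f0_exponent:
  obtains x0 where "x0 > 0" "x0 \<le> 1 / p" "(p - 2) * x0 < 2 / real DIM('a)"
    "\<And>y. x0 \<le> y \<Longrightarrow> y \<le> 1 / 2 \<Longrightarrow> fin_pow (1 / y) f0"
proof -
  obtain x0 where x: "x0 > 0" "x0 \<le> 1 / p" "x0 > 1 / 2 - 1 / real DIM('a)" "(p - 2) * x0 < 2 / real DIM('a)"
    using exists_exponent[OF p] DIM_positive[where 'a='a] by (metis Suc_leI One_nat_def)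
  have "fin_pow (1 / y) f0" if y: "x0 \<le> y" "y \<le> 1 / 2" for y
  proof (rule Sobolev_fin_pow)
    show "2 \<le> 1 / y" using x y by (simp add: field_simps)
    have "1 / 2 - y < 1 / real DIM('a)" using x y by linarith
    then show "real DIM('a) * (1 / 2 - 1 / (1 / y)) < 1" by (simp add: field_simps)
  qed
  then show thesis using that x by blast
qed

text \<open>The Sobolev embedding provides an exponent 1 / x0 \<ge> p > p - 1, so the power p - 1 is
  at most 1 plus an integrable power. This permits testing the equation with Gaussians before
  F_j(Phi) is known to lie in L2.\<close>

lemma Fx_tempered: "tempered (Fx j)"
proof -
  obtain x0 where x: "x0 > 0" "x0 \<le> 1 / p" "\<And>y. x0 \<le> y \<Longrightarrow> y \<le> 1 / 2 \<Longrightarrow> fin_pow (1 / y) f0"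
    using f0_exponent by metis
  have "1 / p \<le> 1 / 2" using p by (simp add: field_simps)
  then have "fin_pow (1 / x0) f0" using x by (intro x(3)) auto
  moreover have "epowr r (p - 1) \<le> 1 + epowr r (1 / x0)" for r
  proof (cases r)
    case (real a)
    have le: "p - 1 \<le> 1 / x0" using x p by (simp add: field_simps)
    have "a powr (p - 1) \<le> 1 + a powr (1 / x0)"
    proof (cases "a \<le> 1")
      case True
      then have "a powr (p - 1) \<le> 1 powr (p - 1)" using real p by (intro powr_mono2) auto
      then show ?thesis using powr_ge_zero[of a "1 / x0"] by (simp del: powr_ge_zero)
    next
      case False
      then have "a powr (p - 1) \<le> a powr (1 / x0)" using le by (intro powr_mono) auto
      then show ?thesis by simp
    qed
    then show ?thesis using real by (simp add: epowr_ennreal ennreal_leI flip: ennreal_1 ennreal_plus)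
  qed simp
  then have "ennreal (norm (Fx j y)) \<le> ennreal C * (1 + epowr (f0 y) (1 / x0))" for y
    using norm_Fx_le[of j y] by (meson mult_left_mono order_trans zero_le)
  ultimately show ?thesis
    by (intro tempered_dominated[where h="\<lambda>y. epowr (f0 y) (1 / x0)" and K=C]) (auto simp: fin_pow_def)
qed

lemma E_tempered: "tempered (E j)"
proof -
  have t: "tempered (\<lambda>x. complex_of_real \<omega> * \<phi> j x)" by (rule tempered_L2[OF L2_cmult[OF \<phi>]])
  show ?thesis
    unfolding tempered_def
  proof (intro conjI allI impI)
    fix a :: real and z :: 'a assume a: "a > 0"
    have "integrable lborel (\<lambda>x. norm (complex_of_real \<omega> * \<phi> j x) * exp (- a * (norm (x - z))\<^sup>2) + norm (Fx j x) * exp (- a * (norm (x - z))\<^sup>2))"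
      using t Fx_tempered[of j] a unfolding tempered_def by (intro Bochner_Integration.integrable_add) auto
    then show "integrable lborel (\<lambda>x. norm (E j x) * exp (- a * (norm (x - z))\<^sup>2))"
    proof (rule Bochner_Integration.integrable_bound)
      show "AE x in lborel. norm (norm (E j x) * exp (- a * (norm (x - z))\<^sup>2)) \<le>
        norm (norm (complex_of_real \<omega> * \<phi> j x) * exp (- a * (norm (x - z))\<^sup>2) + norm (Fx j x) * exp (- a * (norm (x - z))\<^sup>2))"
      proof (rule AE_I2)
        fix x
        have "norm (E j x) * exp (- a * (norm (x - z))\<^sup>2) \<le> (norm (complex_of_real \<omega> * \<phi> j x) + norm (Fx j x)) * exp (- a * (norm (x - z))\<^sup>2)"
          unfolding E_def by (intro mult_right_mono norm_triangle_ineq) simp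
        also have "\<dots> = norm (complex_of_real \<omega> * \<phi> j x) * exp (- a * (norm (x - z))\<^sup>2) + norm (Fx j x) * exp (- a * (norm (x - z))\<^sup>2)"
          by (rule distrib_right)
        finally show "norm (norm (E j x) * exp (- a * (norm (x - z))\<^sup>2)) \<le>
          norm (norm (complex_of_real \<omega> * \<phi> j x) * exp (- a * (norm (x - z))\<^sup>2) + norm (Fx j x) * exp (- a * (norm (x - z))\<^sup>2))"
          by (auto intro: order_trans[OF _ abs_ge_self])
      qed
    qed measurable
  qed measurable
qed

section \<open>The equation tested with the heat kernel, and the bootstrap\<close>

lemma equation_test:
  assumes t: "test_function \<psi>"
  shows "(\<integral>x. \<phi> j x * laplacian \<psi> x \<partial>lborel) = (\<integral>x. E j x * \<psi> x \<partial>lborel)"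
proof -
  note i1 = tempered_laplacian_integrable[OF tempered_L2[OF \<phi>] t, of j]
  note i2 = tempered_test_integrable[OF tempered_L2[OF L2_cmult[OF \<phi>]] t, of "complex_of_real \<omega>" j]
  note i3 = tempered_test_integrable[OF Fx_tempered t, of j]
  have "(\<integral>x. \<phi> j x * (- laplacian \<psi> x + complex_of_real \<omega> * \<psi> x) \<partial>lborel) =
    (\<integral>x. complex_of_real \<omega> * \<phi> j x * \<psi> x - \<phi> j x * laplacian \<psi> x \<partial>lborel)"
    by (intro Bochner_Integration.integral_cong refl) (simp add: algebra_simps)
  also have "\<dots> = (\<integral>x. complex_of_real \<omega> * \<phi> j x * \<psi> x \<partial>lborel) - (\<integral>x. \<phi> j x * laplacian \<psi> x \<partial>lborel)"
    by (rule Bochner_Integration.integral_diff[OF i2 i1])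
  finally have e: "(\<integral>x. complex_of_real \<omega> * \<phi> j x * \<psi> x \<partial>lborel) - (\<integral>x. \<phi> j x * laplacian \<psi> x \<partial>lborel) = - (\<integral>x. Fx j x * \<psi> x \<partial>lborel)"
    using equation[OF t, of j] unfolding Fx_def by (rule trans[OF sym])
  have "(\<integral>x. \<phi> j x * laplacian \<psi> x \<partial>lborel) = (\<integral>x. complex_of_real \<omega> * \<phi> j x * \<psi> x \<partial>lborel) -
    ((\<integral>x. complex_of_real \<omega> * \<phi> j x * \<psi> x \<partial>lborel) - (\<integral>x. \<phi> j x * laplacian \<psi> x \<partial>lborel))" by simp
  also have "\<dots> = (\<integral>x. complex_of_real \<omega> * \<phi> j x * \<psi> x \<partial>lborel) + (\<integral>x. Fx j x * \<psi> x \<partial>lborel)"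
    unfolding e by simp
  also have "\<dots> = (\<integral>x. complex_of_real \<omega> * \<phi> j x * \<psi> x + Fx j x * \<psi> x \<partial>lborel)"
    by (rule Bochner_Integration.integral_add[OF i2 i3, symmetric])
  finally show ?thesis by (simp add: E_def distrib_right)
qed

lemma equation_poly_gauss: "poly_gauss z \<psi> \<Longrightarrow> (\<integral>x. \<phi> j x * laplacian \<psi> x \<partial>lborel) = (\<integral>x. E j x * \<psi> x \<partial>lborel)"
  by (rule laplacian_poly_gauss[OF tempered_L2[OF \<phi>] E_tempered equation_test])

lemma heat_kernel_dt_\<phi>: "t > 0 \<Longrightarrow> (\<integral>y. complex_of_real (heat_kernel_dt t (x - y)) * \<phi> j y \<partial>lborel) = heat_conv t (E j) x"
  unfolding heat_kernel_dt_integral equation_poly_gauss[OF poly_gauss_heat_kernel] heat_conv_def by (simp add: mult.commute)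

lemma heat_nn_E_le: "heat_nn t (\<lambda>y. ennreal (norm (E j y))) x \<le> ennreal KE * (\<Sum>i\<in>UNIV. heat_nn t (src i) x)"
proof -
  have "heat_nn t (\<lambda>y. ennreal (norm (E j y))) x \<le> heat_nn t (\<lambda>y. ennreal KE * (\<Sum>i\<in>UNIV. src i y)) x"
    by (rule heat_nn_mono) (rule norm_E_le)
  also have "\<dots> = ennreal KE * (\<Sum>i\<in>UNIV. heat_nn t (src i) x)" by (rule heat_nn_sum_const) auto
  finally show ?thesis .
qed

lemma fin_pow_src:
  assumes "0 < y" "fin_pow (1 / y) f0"
  shows "fin_pow (1 / y) (src False)" "fin_pow (1 / (y * (p - 1))) (src True)"
proof -
  show "fin_pow (1 / y) (src False)" using assms by (simp add: src_def[abs_def])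
  have "(p - 1) * (1 / (y * (p - 1))) = 1 / y" using p by simp
  then show "fin_pow (1 / (y * (p - 1))) (src True)"
    using assms(2) by (simp add: fin_pow_def src_def epowr_epowr)
qed

text \<open>For reciprocals of exponents, the equation maps \<open>x\<close> to any \<open>y > (p - 1) x - 2 / d\<close>.\<close>

lemma bootstrap_step:
  assumes x: "0 < x" "x \<le> 1 / p" "fin_pow (1 / x) f0" and y: "0 < y" "y \<le> x" "(p - 1) * x - 2 / real DIM('a) < y"
  shows "fin_pow (1 / y) f0"
proof (rule fin_pow_f0)
  fix j
  have y2: "y \<le> 1 / 2"
  proof -
    have "1 / p \<le> 1 / 2" using p by (simp add: field_simps)
    then show ?thesis using x y by linarith
  qed
  have xp: "x * (p - 1) \<le> 1"
  proof -
    have "x * (p - 1) \<le> 1 / p * (p - 1)" using x p by (intro mult_right_mono) auto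
    also have "\<dots> \<le> 1" using p by (simp add: field_simps)
    finally show ?thesis .
  qed
  have xx: "x \<le> x * (p - 1)" using x p by (simp add: mult_le_cancel_left1)
  \<comment> \<open>The two sources have reciprocal exponents x (p - 1) and x. The nonlinear one
    decides, as x \<le> x (p - 1), and x \<le> 1 / p keeps its exponent at least 1. No derivative
    stays on the kernel, hence \<alpha> = 0 and c = 1.\<close>
  show "fin_pow (1 / y) (\<lambda>x. ennreal (norm (\<phi> j x)))"
  proof (rule regularity_fin_pow[OF \<phi> finite[of "UNIV :: bool set"], where \<alpha>=0 and c=1 and f=src and K=KE
        and m="\<lambda>i. if i then 1 / (x * (p - 1)) else 1 / x"])
    fix t :: real and z :: 'a assume t: "0 < t" "t < 1"
    have "ennreal (norm (\<integral>y. complex_of_real (heat_kernel_dt t (z - y)) * \<phi> j y \<partial>lborel)) \<le> heat_nn t (\<lambda>y. ennreal (norm (E j y))) z"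
      unfolding heat_kernel_dt_\<phi>[OF t(1)] by (rule norm_heat_conv_le)
    also have "\<dots> \<le> ennreal KE * (\<Sum>i\<in>UNIV. heat_nn t (src i) z)" by (rule heat_nn_E_le)
    finally show "ennreal (norm (\<integral>y. complex_of_real (heat_kernel_dt t (z - y)) * \<phi> j y \<partial>lborel)) \<le>
      ennreal KE * (\<Sum>i\<in>UNIV. ennreal (t powr - 0) * heat_nn (1 * t) (src i) z)" using t by simp
  next
    fix i :: bool
    have d: "real DIM('a) > 0" by simp
    have key: "real DIM('a) / 2 * (x * (p - 1) - y) < 1"
    proof -
      have "x * (p - 1) - y < 2 / real DIM('a)" using y by (simp add: mult.commute)
      then show ?thesis using d by (simp add: field_simps)
    qed
    have key2: "real DIM('a) / 2 * (x - y) < 1"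
    proof -
      have "real DIM('a) / 2 * (x - y) \<le> real DIM('a) / 2 * (x * (p - 1) - y)"
        using xx d by (intro mult_left_mono) auto
      then show ?thesis using key by linarith
    qed
    have x1: "x \<le> 1" using xx xp by linarith
    show "1 \<le> (if i then 1 / (x * (p - 1)) else 1 / x) \<and> (if i then 1 / (x * (p - 1)) else 1 / x) \<le> 1 / y \<and>
      fin_pow (if i then 1 / (x * (p - 1)) else 1 / x) (src i) \<and>
      0 + real DIM('a) / 2 * (1 / (if i then 1 / (x * (p - 1)) else 1 / x) - 1 / (1 / y)) < 1"
    proof (cases i)
      case True
      have "0 < x * (p - 1)" using x p by simp
      moreover have "y \<le> x * (p - 1)" using y xx by linarith
      ultimately show ?thesis using True fin_pow_src[OF x(1,3)] y xp key by (simp add: frac_le le_divide_eq)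
    next
      case False
      then show ?thesis using fin_pow_src[OF x(1,3)] x y x1 key2 by (auto simp: frac_le)
    qed
  qed (use y y2 in \<open>auto simp: field_simps\<close>)
qed (use y in simp)

text \<open>One step may lower the reciprocal exponent a to anything above a - (2/d - (p - 2) a).
  The gain in brackets is at least its value \<delta> > 0 at x0 as long as a \<le> x0, so steps of
  fixed length \<delta>/2 reach y after finitely many rounds.\<close>

lemma f0_all_powers:
  assumes y: "0 < y" "y \<le> 1 / 2"
  shows "fin_pow (1 / y) f0"
proof -
  obtain x0 where x0: "x0 > 0" "x0 \<le> 1 / p" "(p - 2) * x0 < 2 / real DIM('a)"
    and st: "\<And>y. x0 \<le> y \<Longrightarrow> y \<le> 1 / 2 \<Longrightarrow> fin_pow (1 / y) f0"
    using f0_exponent by metis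
  show ?thesis
  proof (cases "x0 \<le> y")
    case True
    then show ?thesis using st y by blast
  next
    case False
    define \<delta> where "\<delta> = 2 / real DIM('a) - (p - 2) * x0"
    have \<delta>: "\<delta> > 0" using x0 by (simp add: \<delta>_def)
    have p2: "1 / p \<le> 1 / 2" using p by (simp add: field_simps)
    \<comment> \<open>The maximum stops the descent at the target, so reciprocals remain positive;
      half of \<delta> leaves room for the strict inequality of
      \<open>bootstrap_step\<close>.\<close>
    have "fin_pow (1 / max (x0 - real k * (\<delta> / 2)) y) f0" for k :: nat
    proof (induction k)
      case 0
      have "max (x0 - real 0 * (\<delta> / 2)) y = x0" using False by simp
      then show ?case using st[of x0] x0 p2 by simp
    next
      case (Suc k)
      define a where "a = max (x0 - real k * (\<delta> / 2)) y"
      define b where "b = max (x0 - real (Suc k) * (\<delta> / 2)) y"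
      have ab: "b \<le> a" "a - \<delta> / 2 \<le> b" "0 < a" "0 < b" "a \<le> x0"
        using y \<delta> False by (auto simp: a_def b_def algebra_simps max_def add_divide_distrib)
      have "(p - 1) * a - 2 / real DIM('a) < b"
      proof -
        have "(p - 2) * a \<le> (p - 2) * x0" using ab p by (intro mult_left_mono) auto
        then have "(p - 1) * a - 2 / real DIM('a) \<le> a - \<delta>" by (simp add: \<delta>_def algebra_simps)
        then show ?thesis using ab \<delta> by linarith
      qed
      then have "fin_pow (1 / b) f0"
        using ab x0 Suc unfolding a_def[symmetric] by (intro bootstrap_step[of a b]) auto
      then show ?case by (simp add: b_def)
    qed
    moreover obtain k :: nat where "x0 / (\<delta> / 2) \<le> real k" using real_arch_simple by blast
    then have "x0 - real k * (\<delta> / 2) \<le> y" using \<delta> y by (simp add: field_simps)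
    then have "max (x0 - real k * (\<delta> / 2)) y = y" by simp
    ultimately show ?thesis by metis
  qed
qed

section \<open>Square integrability of the nonlinearity, boundedness of the wave and its
  gradient\<close>

lemma f0_fin_pow: "q \<ge> 2 \<Longrightarrow> fin_pow q f0"
  using f0_all_powers[of "1 / q"] by (simp add: field_simps)

lemma src_fin_pow:
  assumes "q \<ge> 2" shows "fin_pow q (src i)"
proof (cases i)
  case True
  have "2 \<le> (p - 1) * q" using p assms mult_mono[of 1 "p - 1" 2 q] by simp
  then have "fin_pow ((p - 1) * q) f0" by (rule f0_fin_pow)
  then show ?thesis using True by (simp add: fin_pow_def src_def epowr_epowr)
next
  case False
  then show ?thesis using f0_fin_pow[OF assms] by (simp add: src_def[abs_def])
qed

lemma Fx_L2: "Fx j \<in> L2"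
proof -
  have "fin_pow 2 (\<lambda>x. ennreal C * src True x)" by (intro fin_pow_cmult src_fin_pow) auto
  then have "fin_pow 2 (\<lambda>x. ennreal (norm (Fx j x)))"
    by (rule fin_pow_mono_AE[rotated 2]) (auto simp: src_def norm_Fx_le)
  then show ?thesis
    unfolding L2_iff_nn_integral fin_pow_def by (simp add: epowr_ennreal powr_numeral)
qed

text \<open>For the exponent m = d + 2 one has d / (2 m) < 1/2. This is more than \<alpha> = 0
  requires and is just what \<open>G_bounded\<close> needs with \<alpha> = 1/2.\<close>

lemma \<phi>_bounded: "\<exists>K. AE x in lborel. norm (\<phi> j x) \<le> K"
proof (rule regularity_bounded[OF \<phi> finite[of "UNIV :: bool set"], where \<alpha>=0 and c=1 and f=src and K=KE and m="\<lambda>_. real DIM('a) + 2"])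
  fix t :: real and z :: 'a assume t: "0 < t" "t < 1"
  have "ennreal (norm (\<integral>y. complex_of_real (heat_kernel_dt t (z - y)) * \<phi> j y \<partial>lborel)) \<le> heat_nn t (\<lambda>y. ennreal (norm (E j y))) z"
    unfolding heat_kernel_dt_\<phi>[OF t(1)] by (rule norm_heat_conv_le)
  also have "\<dots> \<le> ennreal KE * (\<Sum>i\<in>UNIV. heat_nn t (src i) z)" by (rule heat_nn_E_le)
  finally show "ennreal (norm (\<integral>y. complex_of_real (heat_kernel_dt t (z - y)) * \<phi> j y \<partial>lborel)) \<le>
    ennreal KE * (\<Sum>i\<in>UNIV. ennreal (t powr - 0) * heat_nn (1 * t) (src i) z)" using t by simp
next
  show "1 \<le> real DIM('a) + 2 \<and> fin_pow (real DIM('a) + 2) (src i) \<and> 0 + real DIM('a) / (2 * (real DIM('a) + 2)) < 1" for i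
    by (simp add: src_fin_pow)
qed auto

text \<open>The weak gradient is tested with the Laplacian of the kernel, the derivative is commuted
  past the Laplacian, and the equation is tested with the derivative of the kernel. Thus G is
  represented by E against a first derivative of the kernel.\<close>

lemma G_bounded:
  assumes b: "b \<in> Basis"
  shows "\<exists>K. AE x in lborel. norm (G j b x) \<le> K"
proof (rule regularity_bounded[OF G[OF b] finite[of "UNIV :: bool set"], where \<alpha>="1/2" and c=2 and f=src and K="Kd DIM('a) * KE" and m="\<lambda>_. real DIM('a) + 2"])
  fix t :: real and z :: 'a assume t: "0 < t" "t < 1"
  let ?\<psi> = "\<lambda>y. complex_of_real (heat_kernel t (z - y))"
  have poly_gauss: "poly_gauss z ?\<psi>" by (rule poly_gauss_heat_kernel[OF t(1)])
  have "(\<integral>y. complex_of_real (heat_kernel_dt t (z - y)) * G j b y \<partial>lborel) = - (\<integral>y. \<phi> j y * partial_deriv b (laplacian ?\<psi>) y \<partial>lborel)"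
    unfolding heat_kernel_dt_integral[OF t(1)] weak_poly_gauss[OF b poly_gauss_laplacian[OF poly_gauss]] by simp
  also have "\<dots> = - (\<integral>y. E j y * partial_deriv b ?\<psi> y \<partial>lborel)"
    unfolding laplacian_partial[OF poly_gauss, symmetric] equation_poly_gauss[OF poly_gauss_partial[OF poly_gauss]] ..
  finally have "ennreal (norm (\<integral>y. complex_of_real (heat_kernel_dt t (z - y)) * G j b y \<partial>lborel)) \<le>
    ennreal (Kd DIM('a)) * (ennreal (t powr (- (1 / 2))) * heat_nn (2 * t) (\<lambda>y. ennreal (norm (E j y))) z)"
    using gradient_kernel_le[OF E_measurable t(1) b, of j z] by simp
  also have "\<dots> \<le> ennreal (Kd DIM('a)) * (ennreal (t powr (- (1 / 2))) * (ennreal KE * (\<Sum>i\<in>UNIV. heat_nn (2 * t) (src i) z)))"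
    by (intro mult_left_mono heat_nn_E_le) auto
  also have "\<dots> = ennreal (Kd DIM('a) * KE) * (\<Sum>i\<in>UNIV. ennreal (t powr - (1 / 2)) * heat_nn (2 * t) (src i) z)"
  proof -
    have "0 \<le> Kd DIM('a)" "0 \<le> KE" using C by (auto simp: Kd_def KE_def)
    then show ?thesis by (simp add: ennreal_mult sum_distrib_left[symmetric] mult_ac)
  qed
  finally show "ennreal (norm (\<integral>y. complex_of_real (heat_kernel_dt t (z - y)) * G j b y \<partial>lborel)) \<le>
    ennreal (Kd DIM('a) * KE) * (\<Sum>i\<in>UNIV. ennreal (t powr - (1 / 2)) * heat_nn (2 * t) (src i) z)" .
next
  show "1 \<le> real DIM('a) + 2 \<and> fin_pow (real DIM('a) + 2) (src i) \<and> 1 / 2 + real DIM('a) / (2 * (real DIM('a) + 2)) < 1" for i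
    by (simp add: src_fin_pow field_simps)
qed auto

end

section \<open>The equation on the Fourier side\<close>

text \<open>Multiplied by r, the formula includes r = 0, that is, the frequency 0.\<close>

lemma integral_exp_Icc:
  fixes r :: real
  shows "r * (\<integral>t. indicator {1/2..1} t * exp (- t * r) \<partial>lborel) = exp (- (1/2) * r) - exp (- 1 * r)"
proof (cases "r = 0")
  case False
  have "(\<integral>t. exp (- t * r) * indicator {1/2..1} t \<partial>lborel) = - exp (- 1 * r) / r - (- exp (- (1/2) * r) / r)"
    by (rule integral_FTC_Icc_real[where F="\<lambda>t. - exp (- t * r) / r"])
      (use False in \<open>auto intro!: derivative_eq_intros continuous_intros\<close>)
  then have "r * (\<integral>t. indicator {1/2..1} t * exp (- t * r) \<partial>lborel) = r * (- exp (- 1 * r) / r - (- exp (- (1/2) * r) / r))"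
    by (simp only: mult.commute[of "indicator _ _"])
  also have "\<dots> = exp (- (1/2) * r) - exp (- 1 * r)" using False by (simp add: field_simps)
  finally show ?thesis .
qed simp

text \<open>The equation \<Delta> \<phi>_j = E_j integrated along the heat flow. On the interval
  from 1/2 to 1 the flow is away from its singular time, so both sides are explicit Fourier
  integrals.\<close>

lemma (in standing_wave) heat_conv_E_integral:
  "heat_conv 1 (\<phi> j) x - heat_conv (1/2) (\<phi> j) x = (\<integral>t. indicator {1/2..1} t *\<^sub>R heat_conv t (E j) x \<partial>lborel)"
proof -
  have "heat_conv 1 (\<phi> j) x - heat_conv (1/2) (\<phi> j) x = (\<integral>t. indicator {1/2..1} t *\<^sub>R (\<integral>y. complex_of_real (heat_kernel_dt t (x - y)) * \<phi> j y \<partial>lborel) \<partial>lborel)"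
    by (rule heat_conv_diff_eq[OF \<phi>]) auto
  also have "\<dots> = (\<integral>t. indicator {1/2..1} t *\<^sub>R heat_conv t (E j) x \<partial>lborel)"
  proof (intro Bochner_Integration.integral_cong refl)
    fix t :: real
    show "indicator {1/2..1} t *\<^sub>R (\<integral>y. complex_of_real (heat_kernel_dt t (x - y)) * \<phi> j y \<partial>lborel) = indicator {1/2..1} t *\<^sub>R heat_conv t (E j) x"
      by (cases "t \<in> {1/2..1}") (auto simp: heat_kernel_dt_\<phi>)
  qed
  finally show ?thesis .
qed

lemma FT_heat_average:
  fixes e :: "'a::euclidean_space \<Rightarrow> complex"
  assumes Ee: "FT E e"
  shows "complex_of_real ((2 * pi) powr (real DIM('a) / 2)) * (\<integral>t. indicator {1/2..1} t *\<^sub>R heat_conv t E x \<partial>lborel) =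
    (\<integral>\<xi>. exp (\<i> * complex_of_real (x \<bullet> \<xi>)) *
       (complex_of_real (\<integral>t. indicator {1/2..1} t * exp (- t * (norm \<xi>)\<^sup>2) \<partial>lborel) * e \<xi>) \<partial>lborel)"
proof -
  have [measurable]: "e \<in> borel_measurable borel" using FT_L2(2)[OF Ee] by auto
  let ?c = "complex_of_real ((2 * pi) powr (real DIM('a) / 2))"
  let ?f = "\<lambda>(t::real, \<xi>). exp (\<i> * complex_of_real (x \<bullet> \<xi>)) * (complex_of_real (indicator {1/2..1} t * exp (- t * (norm \<xi>)\<^sup>2)) * e \<xi>)"
  \<comment> \<open>For t between 1/2 and 1 the Gaussian factor is at most its value at 1/2, and a
    Gaussian times an L2 function is integrable; this gives the majorant for Fubini's
    theorem.\<close>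
  define g where "g \<xi> = exp (- (1/2) * (norm \<xi>)\<^sup>2) * norm (e \<xi>)" for \<xi>
  have [measurable]: "g \<in> borel_measurable borel" unfolding g_def by measurable
  have ig: "integrable lborel g"
  proof -
    have "integrable lborel (\<lambda>\<xi>::'a. (exp (\<i> * complex_of_real (0 \<bullet> \<xi>)) * complex_of_real (exp (- (1/2) * (norm \<xi>)\<^sup>2))) * e \<xi>)"
      by (rule L2_mult_integrable[OF gauss_mult_integrable(2) FT_L2(2)[OF Ee]]) simp
    from integrable_norm[OF this] show ?thesis by (simp add: g_def[abs_def] norm_mult)
  qed
  have int: "integrable (lborel \<Otimes>\<^sub>M lborel) ?f"
    unfolding integrable_iff_bounded
  proof
    show "?f \<in> borel_measurable (lborel \<Otimes>\<^sub>M lborel)" by measurable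
    have "(\<integral>\<^sup>+p. ennreal (norm (?f p)) \<partial>(lborel \<Otimes>\<^sub>M lborel)) \<le>
      (\<integral>\<^sup>+p. (case p of (t, \<xi>) \<Rightarrow> indicator {1/2..1::real} t * ennreal (g \<xi>)) \<partial>(lborel \<Otimes>\<^sub>M lborel))"
    proof (rule nn_integral_mono, clarify)
      fix t :: real and \<xi> :: 'a
      show "ennreal (norm (exp (\<i> * complex_of_real (x \<bullet> \<xi>)) * (complex_of_real (indicator {1/2..1} t * exp (- t * (norm \<xi>)\<^sup>2)) * e \<xi>))) \<le>
        indicator {1/2..1} t * ennreal (g \<xi>)"
      proof (cases "t \<in> {1/2..1}")
        case True
        have "- t * (norm \<xi>)\<^sup>2 \<le> - (1/2) * (norm \<xi>)\<^sup>2" using True by (intro mult_right_mono) auto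
        then have "exp (- t * (norm \<xi>)\<^sup>2) * norm (e \<xi>) \<le> g \<xi>"
          unfolding g_def by (intro mult_right_mono) auto
        then show ?thesis using True by (simp add: norm_mult ennreal_leI)
      qed simp
    qed
    also have "\<dots> = (\<integral>\<^sup>+t. \<integral>\<^sup>+\<xi>. indicator {1/2..1::real} t * ennreal (g \<xi>) \<partial>lborel \<partial>lborel)"
      by (subst lborel.nn_integral_fst[symmetric]) auto
    also have "\<dots> = (\<integral>\<^sup>+t. indicator {1/2..1::real} t \<partial>lborel) * (\<integral>\<^sup>+\<xi>. ennreal (g \<xi>) \<partial>lborel)"
      by (simp add: nn_integral_cmult nn_integral_multc)
    also have "\<dots> < \<infinity>"
    proof -
      have "(\<integral>\<^sup>+\<xi>. ennreal (g \<xi>) \<partial>lborel) < \<infinity>"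
        using ig unfolding integrable_iff_bounded by (simp add: g_def)
      moreover have "(\<integral>\<^sup>+t. indicator {1/2..1::real} t \<partial>lborel) = ennreal (1 - 1/2)" by simp
      ultimately show ?thesis by (simp only: ennreal_mult_less_top ennreal_less_top infinity_ennreal_def simp_thms)
    qed
    finally show "(\<integral>\<^sup>+p. ennreal (norm (?f p)) \<partial>(lborel \<Otimes>\<^sub>M lborel)) < \<infinity>" .
  qed
  have "?c * (\<integral>t. indicator {1/2..1} t *\<^sub>R heat_conv t E x \<partial>lborel) = (\<integral>t. ?c * (indicator {1/2..1} t *\<^sub>R heat_conv t E x) \<partial>lborel)"
    by (rule integral_mult_right_zero[symmetric])
  also have "\<dots> = (\<integral>t. (\<integral>\<xi>. exp (\<i> * complex_of_real (x \<bullet> \<xi>)) * (complex_of_real (indicator {1/2..1} t * exp (- t * (norm \<xi>)\<^sup>2)) * e \<xi>) \<partial>lborel) \<partial>lborel)"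
  proof (intro Bochner_Integration.integral_cong refl)
    fix t :: real
    show "?c * (indicator {1/2..1} t *\<^sub>R heat_conv t E x) = (\<integral>\<xi>. exp (\<i> * complex_of_real (x \<bullet> \<xi>)) * (complex_of_real (indicator {1/2..1} t * exp (- t * (norm \<xi>)\<^sup>2)) * e \<xi>) \<partial>lborel)"
    proof (cases "t \<in> {1/2..1}")
      case True
      then have "t > 0" by simp
      from heat_conv_FT[OF Ee this, of x] show ?thesis using True by simp
    qed simp
  qed
  also have "\<dots> = (\<integral>\<xi>. (\<integral>t. exp (\<i> * complex_of_real (x \<bullet> \<xi>)) * (complex_of_real (indicator {1/2..1} t * exp (- t * (norm \<xi>)\<^sup>2)) * e \<xi>) \<partial>lborel) \<partial>lborel)"
    by (rule lborel_pair.Fubini_integral[symmetric, OF int])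
  also have "\<dots> = (\<integral>\<xi>. exp (\<i> * complex_of_real (x \<bullet> \<xi>)) *
       (complex_of_real (\<integral>t. indicator {1/2..1} t * exp (- t * (norm \<xi>)\<^sup>2) \<partial>lborel) * e \<xi>) \<partial>lborel)"
    by (simp only: integral_mult_right_zero integral_mult_left_zero integral_complex_of_real)
  finally show ?thesis .
qed

text \<open>Both sides of \<open>heat_conv_E_integral\<close> are compared as Fourier integrals.
  With r = |\<xi>|^2 and m the integral of exp(-t r) over the time interval, this gives m e =
  (exp(-r) - exp(-r/2)) h, while r m = exp(-r/2) - exp(-r). Cancelling m leaves e = -r h. The detour
  through the heat flow keeps every integrand integrable although r h is not known beforehand to lie
  in L2.\<close>

lemma (in standing_wave) FT_E_eq:
  assumes h: "FT (\<phi> j) h" and e: "FT (E j) e"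
  shows "AE \<xi> in lborel. e \<xi> = - complex_of_real ((norm \<xi>)\<^sup>2) * h \<xi>"
proof -
  have hL: "h \<in> L2" and eL: "e \<in> L2" using FT_L2[OF h] FT_L2[OF e] by auto
  have [measurable]: "h \<in> borel_measurable borel" "e \<in> borel_measurable borel" using hL eL by auto
  let ?c = "complex_of_real ((2 * pi) powr (real DIM('a) / 2))"
  define m where "m \<xi> = (\<integral>t. indicator {1/2..1} t * exp (- t * (norm \<xi>)\<^sup>2) \<partial>lborel)" for \<xi> :: 'a
  have [measurable]: "m \<in> borel_measurable borel" unfolding m_def by measurable
  have mr: "(norm \<xi>)\<^sup>2 * m \<xi> = exp (- (1/2) * (norm \<xi>)\<^sup>2) - exp (- 1 * (norm \<xi>)\<^sup>2)" for \<xi>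
    unfolding m_def by (rule integral_exp_Icc)
  define g where "g s \<xi> = complex_of_real (exp (- s * (norm \<xi>)\<^sup>2))" for s and \<xi> :: 'a
  have g2: "g s \<in> L2" if "s > 0" for s
    using gauss_mult_integrable(2)[OF that, of 0] by (simp add: g_def[abs_def])
  have gm [measurable]: "g s \<in> borel_measurable borel" for s unfolding g_def by measurable
  have m_ge: "0 \<le> m \<xi>" "m \<xi> \<le> exp (- (1/2) * (norm \<xi>)\<^sup>2)" for \<xi>
  proof -
    show "0 \<le> m \<xi>" unfolding m_def by simp
    have "m \<xi> \<le> (\<integral>t. indicator {1/2..1::real} t * exp (- (1/2) * (norm \<xi>)\<^sup>2) \<partial>lborel)"
      unfolding m_def
    proof (rule integral_mono)
      show "integrable lborel (\<lambda>t. indicator {1/2..1} t * exp (- t * (norm \<xi>)\<^sup>2))"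
        using borel_integrable_atLeastAtMost'[of "1/2" 1 "\<lambda>t. exp (- t * (norm \<xi>)\<^sup>2)"]
        by (simp add: set_integrable_def continuous_intros)
      fix t :: real
      show "indicator {1/2..1} t * exp (- t * (norm \<xi>)\<^sup>2) \<le> indicator {1/2..1} t * exp (- (1/2) * (norm \<xi>)\<^sup>2)"
      proof (cases "t \<in> {1/2..1}")
        case True
        have "- t * (norm \<xi>)\<^sup>2 \<le> - (1/2) * (norm \<xi>)\<^sup>2" using True by (intro mult_right_mono) auto
        then show ?thesis using True by simp
      qed simp
    qed (auto intro!: integrable_mult_left integrable_real_indicator emeasure_bounded_finite simp del: emeasure_lborel_Icc_eq)
    also have "\<dots> \<le> exp (- (1/2) * (norm \<xi>)\<^sup>2)" by simp
    finally show "m \<xi> \<le> exp (- (1/2) * (norm \<xi>)\<^sup>2)" .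
  qed
  have mL: "(\<lambda>\<xi>. complex_of_real (m \<xi>)) \<in> L2"
    by (rule sq_mono(1)[OF _ g2[of "1/2"]]) (use m_ge in \<open>auto simp: g_def\<close>)
  have b1: "norm (g s \<xi>) \<le> 1" if "s > 0" for s \<xi> using that by (simp add: g_def)
  have b2: "norm (complex_of_real (m \<xi>)) \<le> 1" for \<xi>
    using m_ge[of \<xi>] by (simp add: order_trans[of _ "exp (- (1/2) * (norm \<xi>)\<^sup>2)"])
  \<comment> \<open>The difference of the two sides on the frequency side; all its Fourier integrals
    vanish, so injectivity gives w = 0.\<close>
  define w where "w \<xi> = (g 1 \<xi> * h \<xi> - g (1/2) \<xi> * h \<xi>) - complex_of_real (m \<xi>) * e \<xi>" for \<xi>
  have i1: "integrable lborel (\<lambda>\<xi>. exp (\<i> * complex_of_real (x \<bullet> \<xi>)) * (g s \<xi> * h \<xi>))" if "s > 0" for s x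
    using L2_mult_integrable[OF gauss_mult_integrable(2)[OF that, of x] hL] by (simp add: g_def mult.assoc)
  have i2: "integrable lborel (\<lambda>\<xi>. exp (\<i> * complex_of_real (x \<bullet> \<xi>)) * (complex_of_real (m \<xi>) * e \<xi>))" for x
  proof -
    have "(\<lambda>\<xi>. exp (\<i> * complex_of_real (x \<bullet> \<xi>)) * e \<xi>) \<in> L2"
      by (rule L2_mult_bounded[OF eL, where C=1]) auto
    from L2_mult_integrable[OF mL this] show ?thesis by (simp add: mult_ac)
  qed
  have "AE \<xi> in lborel. w \<xi> = 0"
  proof (rule fourier_injective)
    show "integrable lborel w"
      unfolding w_def[abs_def] by (intro Bochner_Integration.integrable_diff L2_mult_integrable g2 hL mL eL) auto
    show "w \<in> L2"
      unfolding w_def[abs_def]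
      by (intro L2_diff L2_mult_bounded[OF hL gm b1] L2_mult_bounded[OF eL _ b2]) auto
    fix x :: 'a
    have "(\<integral>\<xi>. exp (\<i> * complex_of_real (x \<bullet> \<xi>)) * w \<xi> \<partial>lborel) =
      ((\<integral>\<xi>. exp (\<i> * complex_of_real (x \<bullet> \<xi>)) * (g 1 \<xi> * h \<xi>) \<partial>lborel) -
       (\<integral>\<xi>. exp (\<i> * complex_of_real (x \<bullet> \<xi>)) * (g (1/2) \<xi> * h \<xi>) \<partial>lborel)) -
       (\<integral>\<xi>. exp (\<i> * complex_of_real (x \<bullet> \<xi>)) * (complex_of_real (m \<xi>) * e \<xi>) \<partial>lborel)"
      unfolding w_def right_diff_distrib
      by (simp only: Bochner_Integration.integral_diff[OF Bochner_Integration.integrable_diff[OF i1 i1] i2]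
          Bochner_Integration.integral_diff[OF i1 i1] zero_less_one half_gt_zero_iff)
    also have "\<dots> = (?c * heat_conv 1 (\<phi> j) x - ?c * heat_conv (1/2) (\<phi> j) x) - ?c * (heat_conv 1 (\<phi> j) x - heat_conv (1/2) (\<phi> j) x)"
      using heat_conv_FT[OF h, of 1 x] heat_conv_FT[OF h, of "1/2" x] FT_heat_average[OF e, of x]
      unfolding heat_conv_E_integral g_def m_def by simp
    also have "\<dots> = 0" by (simp add: algebra_simps)
    finally show "(\<integral>\<xi>. exp (\<i> * complex_of_real (x \<bullet> \<xi>)) * w \<xi> \<partial>lborel) = 0" .
  qed
  \<comment> \<open>Away from the origin the two exponentials differ strictly, so that m, which is
    to be cancelled, is seen to be nonzero.\<close>
  moreover have "AE \<xi> in lborel. \<xi> \<noteq> (0::'a)" by (rule AE_lborel_singleton)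
  ultimately show ?thesis
  proof eventually_elim
    fix \<xi> :: 'a assume w: "w \<xi> = 0" and \<xi>: "\<xi> \<noteq> 0"
    have "g 1 \<xi> - g (1/2) \<xi> = - complex_of_real ((norm \<xi>)\<^sup>2 * m \<xi>)"
      unfolding mr g_def by simp
    moreover have "complex_of_real (m \<xi>) * e \<xi> = (g 1 \<xi> - g (1/2) \<xi>) * h \<xi>"
      using w by (simp add: w_def left_diff_distrib)
    ultimately have "complex_of_real (m \<xi>) * e \<xi> = complex_of_real (m \<xi>) * (- complex_of_real ((norm \<xi>)\<^sup>2) * h \<xi>)"
      by simp
    moreover have "exp (- 1 * (norm \<xi>)\<^sup>2) < exp (- (1/2) * (norm \<xi>)\<^sup>2)" using \<xi> by simp
    then have "m \<xi> \<noteq> 0" using mr[of \<xi>] by auto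
    ultimately show "e \<xi> = - complex_of_real ((norm \<xi>)\<^sup>2) * h \<xi>" by (simp only: mult_cancel_left of_real_eq_0_iff simp_thms)
  qed
qed

lemma (in standing_wave) FT_Fx:
  assumes h: "FT (\<phi> j) h"
  shows "FT (Fx j) (\<lambda>\<xi>. - complex_of_real ((norm \<xi>)\<^sup>2 + \<omega>) * h \<xi>)"
proof -
  obtain k where k: "FT (Fx j) k" using FT_exists[OF Fx_L2] by blast
  have "FT (E j) (\<lambda>\<xi>. complex_of_real \<omega> * h \<xi> + k \<xi>)"
    unfolding E_def[abs_def] by (intro FT_add FT_cmult h k)
  from FT_E_eq[OF h this]
  have "AE \<xi> in lborel. - complex_of_real ((norm \<xi>)\<^sup>2 + \<omega>) * h \<xi> = k \<xi>"
  proof eventually_elim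
    fix \<xi> assume "complex_of_real \<omega> * h \<xi> + k \<xi> = - complex_of_real ((norm \<xi>)\<^sup>2) * h \<xi>"
    then have "k \<xi> = - complex_of_real ((norm \<xi>)\<^sup>2) * h \<xi> - complex_of_real \<omega> * h \<xi>"
      by (metis add_diff_cancel_left')
    then show "- complex_of_real ((norm \<xi>)\<^sup>2 + \<omega>) * h \<xi> = k \<xi>" by (simp add: distrib_right left_diff_distrib)
  qed
  then show ?thesis
    using FT_L2(2)[OF h] FT_L2(2)[OF k] by (intro FT_cong_AE[OF k]) auto
qed

section \<open>Riemann sums\<close>

text \<open>Left-endpoint Riemann sums in the list format of \<open>simple_pieces\<close>. Half-open
  cells are disjoint, so at each time at most one summand survives.\<close>

definition pieces :: "(nat \<Rightarrow> real) \<Rightarrow> nat \<Rightarrow> (real \<Rightarrow> 'a \<Rightarrow> complex) \<Rightarrow> (real set \<times> ('a \<Rightarrow> complex)) list" where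
  "pieces \<tau> N w = map (\<lambda>i. ({\<tau> i..<\<tau> (Suc i)}, w (\<tau> i))) [0..<N]"

lemma simple_eval_pieces: "simple_eval (pieces \<tau> N w) t x = (\<Sum>i<N. indicator {\<tau> i..<\<tau> (Suc i)} t * w (\<tau> i) x)"
  by (simp add: simple_eval_def pieces_def o_def interv_sum_list_conv_sum_set_nat atLeast0LessThan)

lemma simple_integral_pieces:
  "simple_integral I (pieces \<tau> N w) x = (\<Sum>i<N. complex_of_real (measure lebesgue ({\<tau> i..<\<tau> (Suc i)} \<inter> I)) * w (\<tau> i) x)"
  by (simp add: simple_integral_def pieces_def o_def interv_sum_list_conv_sum_set_nat atLeast0LessThan)

lemma simple_pieces_pieces: "(\<And>t. w t \<in> X) \<Longrightarrow> simple_pieces X (pieces \<tau> N w)"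
  unfolding simple_pieces_def pieces_def
  by (auto intro!: bounded_set_imp_lmeasurable bounded_subset[OF bounded_closed_interval atLeastLessThan_subseteq_atLeastAtMost_iff[THEN iffD2]])

text \<open>The cell is found before the coefficients are given: it may depend on the time only,
  while the coefficients later depend on the point x.\<close>

lemma sum_pieces:
  fixes \<tau> :: "nat \<Rightarrow> real"
  assumes "\<And>i. \<tau> i \<le> \<tau> (Suc i)" "\<tau> 0 \<le> t" "t < \<tau> N"
  shows "\<exists>i<N. \<tau> i \<le> t \<and> t < \<tau> (Suc i) \<and> (\<forall>c::nat \<Rightarrow> complex. (\<Sum>i<N. indicator {\<tau> i..<\<tau> (Suc i)} t * c i) = c i)"
  using assms(3)
proof (induction N)
  case 0
  then show ?case using assms(2) by simp
next
  case (Suc N)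
  have mono: "\<tau> i \<le> \<tau> k" if "i \<le> k" for i k using that assms(1) by (rule lift_Suc_mono_le[rotated])
  show ?case
  proof (cases "t < \<tau> N")
    case True
    from Suc.IH[OF True] obtain i where "i < N" "\<tau> i \<le> t" "t < \<tau> (Suc i)"
      "\<And>c::nat \<Rightarrow> complex. (\<Sum>i<N. indicator {\<tau> i..<\<tau> (Suc i)} t * c i) = c i" by blast
    then show ?thesis using True by (intro exI[of _ i]) simp
  next
    case False
    have "(\<Sum>i<N. indicator {\<tau> i..<\<tau> (Suc i)} t * c i) = 0" for c :: "nat \<Rightarrow> complex"
    proof (rule sum.neutral, safe)
      fix i assume "i < N"
      then have "\<tau> (Suc i) \<le> \<tau> N" by (intro mono) simp
      then show "indicator {\<tau> i..<\<tau> (Suc i)} t * c i = 0" using False by simp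
    qed
    then show ?thesis using False Suc.prems by (intro exI[of _ N]) simp
  qed
qed

definition grid :: "real \<Rightarrow> real \<Rightarrow> nat \<Rightarrow> nat \<Rightarrow> real" where
  "grid a b N i = a + real i * ((b - a) / real N)"

lemma grid_simps:
  assumes "N > 0" "a \<le> b"
  shows "grid a b N 0 = a" "grid a b N N = b" "grid a b N i \<le> grid a b N (Suc i)"
    "grid a b N (Suc i) - grid a b N i = (b - a) / real N"
  using assms by (auto simp: grid_def algebra_simps add_divide_distrib diff_divide_distrib divide_right_mono)

lemma grid_bounds:
  assumes "N > 0" "a \<le> b" "i \<le> N"
  shows "a \<le> grid a b N i" "grid a b N i \<le> b"
proof -
  have "real i * ((b - a) / real N) \<le> real N * ((b - a) / real N)"
    using assms by (intro mult_right_mono) auto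
  then show "grid a b N i \<le> b" using assms by (simp add: grid_def)
  show "a \<le> grid a b N i" using assms by (simp add: grid_def)
qed

lemma simple_eval_grid:
  assumes N: "N > 0" and t: "a \<le> t" "t < b"
  shows "\<exists>s. a \<le> s \<and> s \<le> b \<and> \<bar>t - s\<bar> \<le> (b - a) / real N \<and> simple_eval (pieces (grid a b N) N w) t = w s"
proof -
  have ab: "a \<le> b" using t by simp
  note g = grid_simps[OF N ab]
  obtain i where i: "i < N" "grid a b N i \<le> t" "t < grid a b N (Suc i)"
    "\<And>c::nat \<Rightarrow> complex. (\<Sum>i<N. indicator {grid a b N i..<grid a b N (Suc i)} t * c i) = c i"
    using sum_pieces[of "grid a b N" t N] g t by auto
  have "\<bar>t - grid a b N i\<bar> \<le> (b - a) / real N" using i(2,3) g(4)[of i] by linarith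
  moreover have "simple_eval (pieces (grid a b N) N w) t = w (grid a b N i)"
    unfolding fun_eq_iff simple_eval_pieces i(4) by simp
  ultimately show ?thesis using grid_bounds[OF N ab, of i] i(1) by (intro exI[of _ "grid a b N i"]) simp
qed

text \<open>Everything is transported to the Fourier side, where the integrand is an explicit function.\<close>

lemma bochner_integral_Fourier:
  fixes w :: "real \<Rightarrow> 'a::euclidean_space \<Rightarrow> complex"
  assumes w: "\<And>s. borel_rep (w s) (v s)" "\<And>s. FT (v s) (W s)"
    and Q: "\<And>s \<xi>. ((\<lambda>s. Q s \<xi>) has_vector_derivative W s \<xi>) (at s)"
    and M: "\<And>\<delta>. M \<delta> \<in> L2" "\<And>\<delta> s s' \<xi>. \<bar>s - s'\<bar> \<le> \<delta> \<Longrightarrow> norm (W s \<xi> - W s' \<xi>) \<le> norm (M \<delta> \<xi>)"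
      "\<And>\<delta>. (\<And>k. \<delta> k \<ge> 0) \<Longrightarrow> \<delta> \<longlonglongrightarrow> 0 \<Longrightarrow> (\<lambda>k. sq (M (\<delta> k))) \<longlonglongrightarrow> 0"
    and ab: "a \<le> b" and J: "borel_rep J J'" "FT J' (\<lambda>\<xi>. Q b \<xi> - Q a \<xi>)"
  shows "has_bochner_integral_on {a..b} (Lp 2) (Lp_norm 2) w J"
proof -
  define N where "N k = Suc k" for k
  have N: "N k > 0" for k by (simp add: N_def)
  define S where "S k = pieces (grid a b (N k)) (N k) w" for k
  define \<delta> where "\<delta> k = (b - a) / real (N k)" for k
  have \<delta>0: "\<delta> k \<ge> 0" for k using ab by (simp add: \<delta>_def)
  have "(\<lambda>k. (b - a) * (1 / real (Suc k))) \<longlonglongrightarrow> (b - a) * 0"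
    by (intro tendsto_mult tendsto_const LIMSEQ_inverse_real_of_nat[unfolded inverse_eq_divide])
  then have \<delta>l: "\<delta> \<longlonglongrightarrow> 0" by (simp add: \<delta>_def[abs_def] N_def)
  have Ml: "(\<lambda>k. sq (M (\<delta> k))) \<longlonglongrightarrow> 0" by (rule M(3)[OF \<delta>0 \<delta>l])
  have wX: "w s \<in> Lp 2" for s using Lp2_iff[OF w(1)] FT_L2(1)[OF w(2)] by blast
  have SX: "simple_pieces (Lp 2) (S k)" for k unfolding S_def by (rule simple_pieces_pieces[OF wX])
  have WM: "Wb \<in> borel_measurable borel" if "Wb \<in> L2" for Wb :: "'a \<Rightarrow> complex" using that by auto
  have bound: "Lp_norm 2 (\<lambda>x. w t x - simple_eval (S k) t x) \<le> ennreal (sqrt (sq (M (\<delta> k))))" if t: "a \<le> t" "t < b" for t k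
  proof -
    obtain s where s: "\<bar>t - s\<bar> \<le> \<delta> k" "simple_eval (S k) t = w s"
      using simple_eval_grid[OF N t, of k w] unfolding S_def \<delta>_def by blast
    have F: "FT (\<lambda>x. v t x - v s x) (\<lambda>\<xi>. W t \<xi> - W s \<xi>)" by (intro FT_diff w)
    have "Lp_norm 2 (\<lambda>x. w t x - simple_eval (S k) t x) = ennreal (sqrt (sq (\<lambda>x. v t x - v s x)))"
      unfolding s(2) by (rule Lp_norm_2_L2[OF borel_rep_diff[OF w(1) w(1)] FT_L2(1)[OF F]])
    also have "sq (\<lambda>x. v t x - v s x) = sq (\<lambda>\<xi>. W t \<xi> - W s \<xi>)" using FT_sq[OF F] by simp
    also have "\<dots> \<le> sq (M (\<delta> k))"
      by (rule sq_mono(2)[OF WM[OF FT_L2(2)[OF F]] M(1) M(2)[OF s(1)]])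
    finally show ?thesis by (simp add: ennreal_leI)
  qed
  have bl: "(\<lambda>k. ennreal (sqrt (sq (M (\<delta> k))))) \<longlonglongrightarrow> 0"
    using Ml by (subst tendsto_ennreal_sqrt_iff) auto
  \<comment> \<open>The half-open cells miss the right endpoint b, where the simple functions vanish
    and the comparison fails.\<close>
  have AEb: "AE t in lebesgue. t \<noteq> b"
    unfolding AE_lebesgue_iff_lborel by (rule AE_lborel_singleton)
  have "strongly_measurable_on {a..b} (Lp 2) (Lp_norm 2) w"
    unfolding strongly_measurable_on_def
  proof (intro exI[of _ S] conjI allI SX)
    show "AE t in lebesgue. t \<in> {a..b} \<longrightarrow> w t \<in> Lp 2 \<and> (\<lambda>k. Lp_norm 2 (\<lambda>x. w t x - simple_eval (S k) t x)) \<longlonglongrightarrow> 0"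
      using AEb
    proof eventually_elim
      fix t assume tb: "t \<noteq> b"
      show "t \<in> {a..b} \<longrightarrow> w t \<in> Lp 2 \<and> (\<lambda>k. Lp_norm 2 (\<lambda>x. w t x - simple_eval (S k) t x)) \<longlonglongrightarrow> 0"
      proof (intro impI conjI wX)
        assume "t \<in> {a..b}"
        then have t: "a \<le> t" "t < b" using tb by auto
        show "(\<lambda>k. Lp_norm 2 (\<lambda>x. w t x - simple_eval (S k) t x)) \<longlonglongrightarrow> 0"
          by (rule tendsto_sandwich[OF always_eventually always_eventually tendsto_const bl])
            (simp_all only: bound[OF t] zero_le simp_thms)
      qed
    qed
  qed
  moreover have "(\<lambda>k. \<integral>\<^sup>+t\<in>{a..b}. Lp_norm 2 (\<lambda>x. w t x - simple_eval (S k) t x) \<partial>lebesgue) \<longlonglongrightarrow> 0"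
  proof -
    have le: "(\<integral>\<^sup>+t\<in>{a..b}. Lp_norm 2 (\<lambda>x. w t x - simple_eval (S k) t x) \<partial>lebesgue) \<le> ennreal (sqrt (sq (M (\<delta> k)))) * ennreal (b - a)" for k
    proof -
      have "(\<integral>\<^sup>+t\<in>{a..b}. Lp_norm 2 (\<lambda>x. w t x - simple_eval (S k) t x) \<partial>lebesgue) \<le>
        (\<integral>\<^sup>+t. ennreal (sqrt (sq (M (\<delta> k)))) * indicator {a..b} t \<partial>lebesgue)"
      proof (rule nn_integral_mono_AE)
        show "AE t in lebesgue. Lp_norm 2 (\<lambda>x. w t x - simple_eval (S k) t x) * indicator {a..b} t \<le> ennreal (sqrt (sq (M (\<delta> k)))) * indicator {a..b} t"
          using AEb
        proof eventually_elim
          fix t assume "t \<noteq> b"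
          then show "Lp_norm 2 (\<lambda>x. w t x - simple_eval (S k) t x) * indicator {a..b} t \<le> ennreal (sqrt (sq (M (\<delta> k)))) * indicator {a..b} t"
            using bound[of t k] by (cases "t \<in> {a..b}") auto
        qed
      qed
      also have "\<dots> = ennreal (sqrt (sq (M (\<delta> k)))) * ennreal (b - a)"
        using ab by (subst nn_integral_cmult_indicator) auto
      finally show ?thesis .
    qed
    have "(\<lambda>k. ennreal (sqrt (sq (M (\<delta> k)))) * ennreal (b - a)) \<longlonglongrightarrow> 0 * ennreal (b - a)"
      using ennreal_tendsto_cmult[OF ennreal_less_top bl, of "b - a"] by (simp add: mult.commute)
    then have l: "(\<lambda>k. ennreal (sqrt (sq (M (\<delta> k)))) * ennreal (b - a)) \<longlonglongrightarrow> 0" by simp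
    show ?thesis
      by (rule tendsto_sandwich[OF always_eventually always_eventually tendsto_const l]) (simp_all only: le zero_le simp_thms)
  qed
  moreover have "(\<lambda>k. Lp_norm 2 (\<lambda>x. simple_integral {a..b} (S k) x - J x)) \<longlonglongrightarrow> 0"
  proof -
    have le: "Lp_norm 2 (\<lambda>x. simple_integral {a..b} (S k) x - J x) \<le> ennreal (sqrt (sq (\<lambda>\<xi>. complex_of_real (b - a) * M (\<delta> k) \<xi>)))" for k
    proof -
      let ?g = "grid a b (N k)"
      have si: "simple_integral {a..b} (S k) x = (\<Sum>i<N k. complex_of_real (\<delta> k) * w (?g i) x)" for x
      proof -
        have "measure lebesgue ({?g i..<?g (Suc i)} \<inter> {a..b}) = \<delta> k" if "i < N k" for i
        proof -
          have "{?g i..<?g (Suc i)} \<inter> {a..b} = {?g i..<?g (Suc i)}"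
            using grid_bounds[OF N ab, of i k] grid_bounds[OF N ab, of "Suc i" k] that by auto
          then show ?thesis
            using grid_simps(3,4)[OF N ab, of k i] by (simp add: \<delta>_def)
        qed
        then show ?thesis unfolding S_def simple_integral_pieces by (intro sum.cong) auto
      qed
      have F: "FT (\<lambda>x. (\<Sum>i<N k. complex_of_real (\<delta> k) * v (?g i) x) - J' x)
        (\<lambda>\<xi>. (\<Sum>i<N k. complex_of_real (\<delta> k) * W (?g i) \<xi>) - (Q b \<xi> - Q a \<xi>))"
        by (intro FT_diff FT_sum FT_cmult w J)
      have "Lp_norm 2 (\<lambda>x. simple_integral {a..b} (S k) x - J x) = ennreal (sqrt (sq (\<lambda>x. (\<Sum>i<N k. complex_of_real (\<delta> k) * v (?g i) x) - J' x)))"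
        unfolding si by (rule Lp_norm_2_L2[OF borel_rep_diff[OF borel_rep_sum J(1)] FT_L2(1)[OF F]]) (rule borel_rep_cmult[OF w(1)])
      also have "sq (\<lambda>x. (\<Sum>i<N k. complex_of_real (\<delta> k) * v (?g i) x) - J' x) =
        sq (\<lambda>\<xi>. (\<Sum>i<N k. complex_of_real (\<delta> k) * W (?g i) \<xi>) - (Q b \<xi> - Q a \<xi>))" using FT_sq[OF F] by simp
      also have "\<dots> \<le> sq (\<lambda>\<xi>. complex_of_real (b - a) * M (\<delta> k) \<xi>)"
      proof (rule sq_mono(2)[OF WM[OF FT_L2(2)[OF F]] L2_cmult[OF M(1)]])
        fix \<xi>
        have step: "norm (complex_of_real (\<delta> k) * W (?g i) \<xi> - (Q (?g (Suc i)) \<xi> - Q (?g i) \<xi>)) \<le> \<delta> k * norm (M (\<delta> k) \<xi>)" for i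
        proof (cases "\<delta> k = 0")
          \<comment> \<open>This covers a = b, where all grid points coincide and the mean value
            theorem has no open interval to work on.\<close>
          case True
          then have "?g (Suc i) = ?g i" using grid_simps(4)[OF N ab, of k i] unfolding \<delta>_def by linarith
          then show ?thesis using True by simp
        next
          case False
          have ge: "?g (Suc i) - ?g i = \<delta> k" using grid_simps(4)[OF N ab, of k i] by (simp add: \<delta>_def)
          then have lt: "?g i < ?g (Suc i)" using False \<delta>0[of k] by linarith
          \<comment> \<open>Subtracting the affine function with slope W at the left endpoint makes
            the derivative the oscillation of W over the cell, which M bounds. The mean value
            inequality then gives the error of one cell.\<close>
          define f where "f s = Q s \<xi> - s *\<^sub>R W (?g i) \<xi>" for s
          have fd: "(f has_derivative (\<lambda>h. h *\<^sub>R (W s \<xi> - W (?g i) \<xi>))) (at s)" for s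
            unfolding f_def using Q[of \<xi> s, unfolded has_vector_derivative_def]
            by (auto intro!: derivative_eq_intros simp: scaleR_diff_right)
          have "continuous_on {?g i..?g (Suc i)} f"
            using fd by (meson continuous_at_imp_continuous_on has_derivative_continuous)
          from mvt_general[OF lt this fd]
          obtain s where s: "s \<in> {?g i<..<?g (Suc i)}" "norm (f (?g (Suc i)) - f (?g i)) \<le> norm ((?g (Suc i) - ?g i) *\<^sub>R (W s \<xi> - W (?g i) \<xi>))"
            by blast
          have "f (?g (Suc i)) - f (?g i) = (Q (?g (Suc i)) \<xi> - Q (?g i) \<xi>) - (?g (Suc i) - ?g i) *\<^sub>R W (?g i) \<xi>"
            by (simp add: f_def scaleR_diff_left)
          then have "norm (complex_of_real (\<delta> k) * W (?g i) \<xi> - (Q (?g (Suc i)) \<xi> - Q (?g i) \<xi>)) = norm (f (?g (Suc i)) - f (?g i))"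
            unfolding ge by (simp add: norm_minus_commute scaleR_conv_of_real)
          also have "\<dots> \<le> \<delta> k * norm (W s \<xi> - W (?g i) \<xi>)" using s(2) \<delta>0[of k] unfolding ge by simp
          also have "\<dots> \<le> \<delta> k * norm (M (\<delta> k) \<xi>)"
            using s(1) ge \<delta>0[of k] by (intro mult_left_mono M(2)) auto
          finally show ?thesis .
        qed
        have "(\<Sum>i<N k. Q (?g (Suc i)) \<xi> - Q (?g i) \<xi>) = Q b \<xi> - Q a \<xi>"
          unfolding sum_lessThan_telescope[of "\<lambda>i. Q (?g i) \<xi>"] grid_simps(1,2)[OF N ab] ..
        then have "norm ((\<Sum>i<N k. complex_of_real (\<delta> k) * W (?g i) \<xi>) - (Q b \<xi> - Q a \<xi>)) =
          norm (\<Sum>i<N k. complex_of_real (\<delta> k) * W (?g i) \<xi> - (Q (?g (Suc i)) \<xi> - Q (?g i) \<xi>))"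
          by (simp add: sum_subtractf)
        also have "\<dots> \<le> (\<Sum>i<N k. \<delta> k * norm (M (\<delta> k) \<xi>))"
          by (rule order_trans[OF norm_sum sum_mono]) (rule step)
        also have "\<dots> = (b - a) * norm (M (\<delta> k) \<xi>)" using N[of k] by (simp add: \<delta>_def)
        also have "\<dots> = norm (complex_of_real (b - a) * M (\<delta> k) \<xi>)" using ab by (simp add: norm_mult flip: of_real_diff)
        finally show "norm ((\<Sum>i<N k. complex_of_real (\<delta> k) * W (?g i) \<xi>) - (Q b \<xi> - Q a \<xi>)) \<le> norm (complex_of_real (b - a) * M (\<delta> k) \<xi>)" .
      qed
      finally show ?thesis by (simp add: ennreal_leI)
    qed
    have "(\<lambda>k. (norm (complex_of_real (b - a)))\<^sup>2 * sq (M (\<delta> k))) \<longlonglongrightarrow> (norm (complex_of_real (b - a)))\<^sup>2 * 0"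
      by (intro tendsto_mult tendsto_const Ml)
    then have "(\<lambda>k. sq (\<lambda>\<xi>. complex_of_real (b - a) * M (\<delta> k) \<xi>)) \<longlonglongrightarrow> 0" by (simp only: sq_cmult mult_zero_right)
    then have l: "(\<lambda>k. ennreal (sqrt (sq (\<lambda>\<xi>. complex_of_real (b - a) * M (\<delta> k) \<xi>)))) \<longlonglongrightarrow> 0"
      by (subst tendsto_ennreal_sqrt_iff) auto
    show ?thesis
      by (rule tendsto_sandwich[OF always_eventually always_eventually tendsto_const l]) (simp_all only: le zero_le simp_thms)
  qed
  moreover have "J \<in> Lp 2" using Lp2_iff[OF J(1)] FT_L2(1)[OF J(2)] by blast
  ultimately show ?thesis
    unfolding has_bochner_integral_on_def using SX by blast
qed

section \<open>Duhamel's formula\<close>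

lemma norm_exp_i_diff_le:
  "norm (exp (\<i> * complex_of_real a) - exp (\<i> * complex_of_real b)) \<le> \<bar>a - b\<bar>"
proof -
  have "exp (\<i> * complex_of_real a) - exp (\<i> * complex_of_real b) = exp (\<i> * complex_of_real b) * (exp (\<i> * complex_of_real (a - b)) - 1)"
    by (simp add: right_diff_distrib flip: exp_add)
  then have "norm (exp (\<i> * complex_of_real a) - exp (\<i> * complex_of_real b)) = norm (exp (\<i> * complex_of_real (a - b)) - 1)"
    by (simp only: norm_mult norm_exp_i_times mult_1)
  also have "\<dots> \<le> \<bar>a - b\<bar>" using iexp_approx1[of "a - b" 0] by simp
  finally show ?thesis .
qed

lemma norm_exp_i_diff_le_min:
  "norm (exp (\<i> * complex_of_real a) - exp (\<i> * complex_of_real b)) \<le> min 2 \<bar>a - b\<bar>"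
  using norm_exp_i_diff_le[of a b] norm_triangle_ineq4[of "exp (\<i> * complex_of_real a)" "exp (\<i> * complex_of_real b)"] by simp

text \<open>The value of the integral is obtained by solving u(t) = S(t) f - i J for J, where S is
  the group, giving J = i (u(t) - S(t) f). On the Fourier side the derivative of Q brings down i
  \<nu> (|\<xi>|^2 + \<omega>); with the outer factor i this is -\<nu> (|\<xi>|^2 + \<omega>) h =
  \<nu> k, the transform of \<nu> F_j(Phi).\<close>

lemma (in standing_wave) duhamel:
  assumes f: "borel_rep f (\<phi> j)" and fF: "borel_rep fF (Fx j)" and \<nu>: "\<nu> \<ge> 0"
  shows "has_L2_integral_from_to 0 t
    (\<lambda>s. schroedinger ((t - s) * \<nu>) (\<lambda>x. complex_of_real \<nu> * (exp (\<i> * complex_of_real (\<nu> * \<omega> * s)) * fF x)))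
    (\<lambda>x. \<i> * (exp (\<i> * complex_of_real (\<nu> * \<omega> * t)) * f x - schroedinger (t * \<nu>) f x))"
    (is "has_L2_integral_from_to 0 t ?w ?J")
proof -
  obtain h where h: "FT (\<phi> j) h" using FT_exists[OF \<phi>] by blast
  define k where "k \<xi> = - complex_of_real ((norm \<xi>)\<^sup>2 + \<omega>) * h \<xi>" for \<xi>
  have k: "FT (Fx j) k" unfolding k_def[abs_def] by (rule FT_Fx[OF h])
  have [measurable]: "h \<in> borel_measurable borel" "k \<in> borel_measurable borel" using FT_L2(2)[OF h] FT_L2(2)[OF k] by auto
  define e where "e s = exp (\<i> * complex_of_real (\<nu> * \<omega> * s))" for s
  define ph where "ph s \<xi> = exp (- \<i> * complex_of_real ((t - s) * \<nu> * (norm \<xi>)\<^sup>2))" for s and \<xi> :: 'a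
  define W where "W s \<xi> = ph s \<xi> * (complex_of_real \<nu> * (e s * k \<xi>))" for s \<xi>
  define Q where "Q s \<xi> = \<i> * (ph s \<xi> * (e s * h \<xi>))" for s \<xi>
  have "\<exists>v. borel_rep (?w s) v \<and> FT v (W s)" for s
    unfolding W_def ph_def e_def
    by (rule schroedinger_FT[OF borel_rep_cmult[OF borel_rep_cmult[OF fF]] FT_cmult[OF FT_cmult[OF k]]])
  then obtain v where v: "\<And>s. borel_rep (?w s) (v s)" "\<And>s. FT (v s) (W s)" by metis
  obtain v0 where v0: "borel_rep (schroedinger (t * \<nu>) f) v0"
    "FT v0 (\<lambda>\<xi>. exp (- \<i> * complex_of_real (t * \<nu> * (norm \<xi>)\<^sup>2)) * h \<xi>)"
    using schroedinger_FT[OF f h] by blast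
  define J' where "J' x = \<i> * (e t * \<phi> j x - v0 x)" for x
  have J1: "borel_rep ?J J'"
    unfolding J'_def e_def by (intro borel_rep_cmult borel_rep_diff f v0)
  have "FT J' (\<lambda>\<xi>. \<i> * (e t * h \<xi> - exp (- \<i> * complex_of_real (t * \<nu> * (norm \<xi>)\<^sup>2)) * h \<xi>))"
    unfolding J'_def by (intro FT_cmult FT_diff h v0)
  then have J2: "FT J' (\<lambda>\<xi>. Q t \<xi> - Q 0 \<xi>)"
    by (simp add: Q_def ph_def e_def right_diff_distrib)
  have Qd: "((\<lambda>s. Q s \<xi>) has_vector_derivative W s \<xi>) (at s)" for s \<xi>
  proof -
    let ?l = "complex_of_real (\<nu> * ((norm \<xi>)\<^sup>2 + \<omega>))" and ?c = "complex_of_real (t * \<nu> * (norm \<xi>)\<^sup>2)"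
    have P: "ph s \<xi> * e s = exp (\<i> * (?l * complex_of_real s - ?c))" for s
      unfolding ph_def e_def by (simp add: algebra_simps flip: exp_add)
    have D: "((\<lambda>z. \<i> * exp (\<i> * (l * z - c)) * a) has_field_derivative \<i> * (exp (\<i> * (l * z - c)) * (\<i> * l)) * a) (at z)"
      for l c a z :: complex
      by (auto intro!: derivative_eq_intros)
    from has_vector_derivative_real_field[OF D[of ?l ?c "h \<xi>" "complex_of_real s"]]
    have "((\<lambda>s. \<i> * (ph s \<xi> * e s) * h \<xi>) has_vector_derivative \<i> * ((ph s \<xi> * e s) * (\<i> * ?l)) * h \<xi>) (at s)"
      by (simp only: P)
    moreover have "\<i> * ((ph s \<xi> * e s) * (\<i> * ?l)) * h \<xi> = W s \<xi>"
    proof -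
      have "\<i> * ((ph s \<xi> * e s) * (\<i> * ?l)) * h \<xi> = (\<i> * \<i>) * ((ph s \<xi> * e s) * ?l * h \<xi>)" by (simp only: ac_simps)
      also have "\<dots> = W s \<xi>" by (simp only: W_def k_def of_real_mult i_squared mult_minus_left mult_minus_right mult_1 ac_simps)
      finally show ?thesis .
    qed
    ultimately show ?thesis by (simp add: Q_def mult.assoc)
  qed
  \<comment> \<open>The phase is Lipschitz in s with a constant that grows like |\<xi>|^2, and this
    constant times k is not known to lie in L2. The minimum with the trivial bound 2 is dominated by
    a multiple of |k| and still tends to 0 pointwise with \<delta>.\<close>
  define M where "M \<delta> \<xi> = complex_of_real (min 2 (\<nu> * ((norm \<xi>)\<^sup>2 + \<omega>) * \<bar>\<delta>\<bar>) * \<nu>) * k \<xi>" for \<delta> \<xi>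
  have min_ge: "0 \<le> min 2 (\<nu> * ((norm \<xi>)\<^sup>2 + \<omega>) * \<bar>\<delta>\<bar>)" for \<delta> and \<xi> :: 'a using \<nu> \<omega> by auto
  have Mle: "norm (complex_of_real (min 2 (\<nu> * ((norm \<xi>)\<^sup>2 + \<omega>) * \<bar>\<delta>\<bar>) * \<nu>)) \<le> 2 * \<nu>" for \<delta> and \<xi> :: 'a
    using min_ge[of \<xi> \<delta>] \<nu> by (simp add: norm_mult mult_right_mono del: of_real_mult)
  have M1: "M \<delta> \<in> L2" for \<delta>
    unfolding M_def[abs_def] by (rule L2_mult_bounded[OF FT_L2(2)[OF k] _ Mle]) measurable
  have M2: "norm (W s \<xi> - W s' \<xi>) \<le> norm (M \<delta> \<xi>)" if "\<bar>s - s'\<bar> \<le> \<delta>" for \<delta> s s' \<xi>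
  proof -
    let ?\<theta> = "\<lambda>s. \<nu> * \<omega> * s - (t - s) * \<nu> * (norm \<xi>)\<^sup>2"
    have P: "ph s \<xi> * e s = exp (\<i> * complex_of_real (?\<theta> s))" for s
      unfolding ph_def e_def by (simp add: algebra_simps flip: exp_add)
    have "W s \<xi> - W s' \<xi> = (exp (\<i> * complex_of_real (?\<theta> s)) - exp (\<i> * complex_of_real (?\<theta> s'))) * (complex_of_real \<nu> * k \<xi>)"
      unfolding P[symmetric] W_def by (simp add: algebra_simps)
    then have "norm (W s \<xi> - W s' \<xi>) \<le> min 2 \<bar>?\<theta> s - ?\<theta> s'\<bar> * (\<nu> * norm (k \<xi>))"
      using \<nu> by (simp only: norm_mult norm_of_real abs_of_nonneg) (intro mult_right_mono norm_exp_i_diff_le_min; simp)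
    also have "\<bar>?\<theta> s - ?\<theta> s'\<bar> = \<nu> * ((norm \<xi>)\<^sup>2 + \<omega>) * \<bar>s - s'\<bar>"
    proof -
      have "?\<theta> s - ?\<theta> s' = \<nu> * ((norm \<xi>)\<^sup>2 + \<omega>) * (s - s')" by (simp add: algebra_simps)
      then show ?thesis using \<nu> \<omega> by (simp add: abs_mult)
    qed
    also have "min 2 (\<nu> * ((norm \<xi>)\<^sup>2 + \<omega>) * \<bar>s - s'\<bar>) * (\<nu> * norm (k \<xi>)) \<le> min 2 (\<nu> * ((norm \<xi>)\<^sup>2 + \<omega>) * \<bar>\<delta>\<bar>) * (\<nu> * norm (k \<xi>))"
      using that \<nu> \<omega> by (intro mult_right_mono min.mono mult_left_mono) auto
    also have "\<dots> = norm (M \<delta> \<xi>)"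
      using min_ge[of \<xi> \<delta>] \<nu> by (simp add: M_def norm_mult mult.assoc)
    finally show ?thesis .
  qed
  have M3: "(\<lambda>i. sq (M (\<delta> i))) \<longlonglongrightarrow> 0" if "\<delta> \<longlonglongrightarrow> 0" for \<delta>
  proof (rule sq_dominated_tendsto[where w="\<lambda>\<xi>. complex_of_real (2 * \<nu>) * k \<xi>"])
    show "M (\<delta> i) \<in> borel_measurable borel" for i unfolding M_def[abs_def] by measurable
    show "(\<lambda>\<xi>. complex_of_real (2 * \<nu>) * k \<xi>) \<in> L2" by (rule L2_cmult[OF FT_L2(2)[OF k]])
    show "norm (M (\<delta> i) \<xi>) \<le> norm (complex_of_real (2 * \<nu>) * k \<xi>)" for i \<xi>
    proof -
      have "norm (complex_of_real (2 * \<nu>)) = 2 * \<nu>" using \<nu> by simp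
      then show ?thesis unfolding M_def norm_mult[of _ "k \<xi>"] using Mle[of \<xi> "\<delta> i"] by (simp only: mult_right_mono norm_ge_zero)
    qed
    show "AE \<xi> in lborel. (\<lambda>i. M (\<delta> i) \<xi>) \<longlonglongrightarrow> 0"
    proof (rule AE_I2)
      fix \<xi> :: 'a
      have "(\<lambda>i. M (\<delta> i) \<xi>) \<longlonglongrightarrow> complex_of_real (min 2 (\<nu> * ((norm \<xi>)\<^sup>2 + \<omega>) * \<bar>0\<bar>) * \<nu>) * k \<xi>"
        unfolding M_def by (intro tendsto_intros tendsto_of_real tendsto_min that)
      then show "(\<lambda>i. M (\<delta> i) \<xi>) \<longlonglongrightarrow> 0" by simp
    qed
  qed
  show ?thesis
  proof (cases "0 \<le> t")
    case True
    have "has_bochner_integral_on {0..t} (Lp 2) (Lp_norm 2) ?w ?J"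
      by (rule bochner_integral_Fourier[where W=W and v=v and M=M and Q=Q, OF v Qd M1 M2 M3 True J1 J2])
    then show ?thesis using True by (simp add: has_L2_integral_from_to_def)
  next
    \<comment> \<open>For negative t the orientation reverses: the integral over the interval from t
      to 0 is -J, whose transform is Q 0 - Q t.\<close>
    case False
    have J3: "borel_rep (\<lambda>x. - ?J x) (\<lambda>x. - 1 * J' x)" using borel_rep_cmult[OF J1, of "- 1"] by simp
    have J4: "FT (\<lambda>x. - 1 * J' x) (\<lambda>\<xi>. Q 0 \<xi> - Q t \<xi>)" using FT_cmult[OF J2, of "- 1"] by simp
    have "has_bochner_integral_on {t..0} (Lp 2) (Lp_norm 2) ?w (\<lambda>x. - ?J x)"
      by (rule bochner_integral_Fourier[where W=W and v=v and M=M and Q=Q, OF v Qd M1 M2 M3 _ J3 J4]) (use False in auto)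
    then show ?thesis using False by (simp add: has_L2_integral_from_to_def)
  qed
qed

section \<open>Time regularity of the standing wave\<close>

text \<open>Time enters only through a scalar phase, so continuity and measurability in time reduce
  to a Lipschitz bound for this phase in any Sobolev norm.\<close>

lemma W1_norm_phase_diff:
  assumes f: "f \<in> W1 r" and r: "r = \<infinity> \<or> (\<exists>q>0. r = ereal q)"
  shows "W1_norm r (\<lambda>x. exp (\<i> * complex_of_real (a * t)) * f x - exp (\<i> * complex_of_real (a * s)) * f x) \<le>
    ennreal (\<bar>a\<bar> * \<bar>t - s\<bar>) * W1_norm r f"
proof -
  let ?d = "exp (\<i> * complex_of_real (a * t)) - exp (\<i> * complex_of_real (a * s))"
  have "norm ?d \<le> \<bar>a\<bar> * \<bar>t - s\<bar>"
    using norm_exp_i_diff_le[of "a * t" "a * s"] by (simp only: right_diff_distrib[symmetric] abs_mult)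
  then show ?thesis
    unfolding left_diff_distrib[symmetric]
    by (intro order_trans[OF W1_norm_cmult_le[OF f r]] mult_right_mono ennreal_leI) auto
qed

lemma tendsto_ennreal_mult_zero:
  assumes "(u \<longlongrightarrow> 0) F" "B < \<infinity>"
  shows "((\<lambda>x. ennreal (u x) * B) \<longlongrightarrow> 0) F"
  using ennreal_tendsto_cmult[OF _ tendsto_ennrealI[OF assms(1)], of B] assms(2) by (simp add: mult.commute)

lemma phase_continuous_into_H1:
  assumes f: "f \<in> H1"
  shows "continuous_into_H1 UNIV (\<lambda>t x. exp (\<i> * complex_of_real (a * t)) * f x)"
proof -
  have r: "(2::ereal) = \<infinity> \<or> (\<exists>q>0. (2::ereal) = ereal q)" by (intro disjI2 exI[of _ 2]) simp
  show ?thesis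
    unfolding continuous_into_H1_def
  proof (intro ballI conjI)
    fix t :: real
    show "(\<lambda>x. exp (\<i> * complex_of_real (a * t)) * f x) \<in> H1" by (rule W1_cmult[OF f r])
    have "((\<lambda>s. \<bar>a\<bar> * \<bar>s - t\<bar>) \<longlongrightarrow> \<bar>a\<bar> * \<bar>t - t\<bar>) (at t)" by (intro tendsto_intros)
    then have l: "((\<lambda>s. ennreal (\<bar>a\<bar> * \<bar>s - t\<bar>) * W1_norm 2 f) \<longlongrightarrow> 0) (at t)"
      by (intro tendsto_ennreal_mult_zero W1_norm_finite[OF f]) simp
    show "((\<lambda>s. W1_norm 2 (\<lambda>x. exp (\<i> * complex_of_real (a * s)) * f x - exp (\<i> * complex_of_real (a * t)) * f x)) \<longlongrightarrow> 0) (at t)"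
      by (rule tendsto_sandwich[OF always_eventually always_eventually tendsto_const l])
        (simp_all only: W1_norm_phase_diff[OF f r] zero_le simp_thms)
  qed
qed

lemma phase_Lq_loc:
  assumes f: "f \<in> W1 r" and r: "r = \<infinity> \<or> (\<exists>q>0. r = ereal q)" and q: "q \<ge> 0"
  shows "(\<lambda>t x. exp (\<i> * complex_of_real (a * t)) * f x) \<in> Lq_loc q UNIV (W1 r) (W1_norm r)"
proof -
  let ?w = "\<lambda>t x. exp (\<i> * complex_of_real (a * t)) * f x"
  have wX: "?w t \<in> W1 r" for t by (rule W1_cmult[OF f r])
  \<comment> \<open>The window from -(k + 1) to k + 1 is cut into (k + 1)^2 cells: it exhausts the
    time axis while the mesh 2 / (k + 1) tends to 0.\<close>
  define K where "K k = real (Suc k)" for k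
  define N where "N k = Suc k * Suc k" for k
  have N: "N k > 0" for k by (simp add: N_def)
  define S where "S k = pieces (grid (- K k) (K k) (N k)) (N k) ?w" for k
  have "strongly_measurable_on UNIV (W1 r) (W1_norm r) ?w"
    unfolding strongly_measurable_on_def
  proof (intro exI[of _ S] conjI allI AE_I2 impI wX)
    show "simple_pieces (W1 r) (S k)" for k unfolding S_def by (rule simple_pieces_pieces[OF wX])
    fix t :: real
    have le: "W1_norm r (\<lambda>x. ?w t x - simple_eval (S k) t x) \<le> ennreal (\<bar>a\<bar> * (2 * (1 / real (Suc k)))) * W1_norm r f"
      if "\<bar>t\<bar> < real k" for k
    proof -
      have "- K k \<le> t" "t < K k" using that by (auto simp: K_def)
      from simple_eval_grid[OF N this, of k ?w]
      obtain s where s: "\<bar>t - s\<bar> \<le> (K k - - K k) / real (N k)" "simple_eval (S k) t = ?w s"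
        unfolding S_def by blast
      have "(c - - c) / (c * c) = 2 * (1 / c)" for c :: real by (cases "c = 0") (simp_all add: field_simps)
      then have "(K k - - K k) / real (N k) = 2 * (1 / real (Suc k))"
        unfolding K_def N_def of_nat_mult .
      then have "\<bar>a\<bar> * \<bar>t - s\<bar> \<le> \<bar>a\<bar> * (2 * (1 / real (Suc k)))"
        using s(1) by (intro mult_left_mono) auto
      then show ?thesis unfolding s(2)
        by (intro order_trans[OF W1_norm_phase_diff[OF f r]] mult_right_mono ennreal_leI) auto
    qed
    have "(\<lambda>k. \<bar>a\<bar> * (2 * (1 / real (Suc k)))) \<longlonglongrightarrow> \<bar>a\<bar> * (2 * 0)"
      by (intro tendsto_mult tendsto_const LIMSEQ_inverse_real_of_nat[unfolded inverse_eq_divide])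
    then have l: "(\<lambda>k. ennreal (\<bar>a\<bar> * (2 * (1 / real (Suc k)))) * W1_norm r f) \<longlonglongrightarrow> 0"
      by (intro tendsto_ennreal_mult_zero W1_norm_finite[OF f]) simp
    obtain k0 where k0: "\<bar>t\<bar> < real k0" using reals_Archimedean2 by blast
    have ev: "\<forall>\<^sub>F k in sequentially. W1_norm r (\<lambda>x. ?w t x - simple_eval (S k) t x) \<le> ennreal (\<bar>a\<bar> * (2 * (1 / real (Suc k)))) * W1_norm r f"
      using eventually_ge_at_top[of k0] by eventually_elim (rule le, use k0 in linarith)
    show "(\<lambda>k. W1_norm r (\<lambda>x. ?w t x - simple_eval (S k) t x)) \<longlonglongrightarrow> 0"
      by (rule tendsto_sandwich[OF always_eventually ev tendsto_const l]) simp
  qed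
  moreover have "(\<integral>\<^sup>+t\<in>K. epowr (W1_norm r (?w t)) q \<partial>lebesgue) < \<infinity>" if K: "compact K" for K
  proof -
    have "W1_norm r (?w t) \<le> W1_norm r f" for t
      using W1_norm_cmult_le[OF f r, of "exp (\<i> * complex_of_real (a * t))"] by (simp only: norm_exp_i_times ennreal_1 mult_1)
    then have "(\<integral>\<^sup>+t\<in>K. epowr (W1_norm r (?w t)) q \<partial>lebesgue) \<le> (\<integral>\<^sup>+t. epowr (W1_norm r f) q * indicator K t \<partial>lebesgue)"
      by (intro nn_integral_mono mult_right_mono epowr_mono q) auto
    also have "\<dots> = epowr (W1_norm r f) q * emeasure lebesgue K"
      using lmeasurable_compact[OF K] by (intro nn_integral_cmult_indicator) auto
    also have "\<dots> < \<infinity>"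
    proof -
      have "emeasure lebesgue K < \<infinity>" using lmeasurable_compact[OF K] by (auto simp: fmeasurable_def)
      moreover have "epowr (W1_norm r f) q < \<infinity>"
        using W1_norm_finite[OF f] by (auto simp: epowr_def)
      ultimately show ?thesis by (simp add: ennreal_mult_less_top)
    qed
    finally show ?thesis .
  qed
  ultimately show ?thesis by (simp add: Lq_loc_def)
qed

text \<open>Interpolation between L2 and boundedness: |f|^q \<le> K^(q-2) |f|^2 almost
  everywhere.\<close>

lemma bounded_L2_Lp:
  assumes f: "borel_rep f f'" and L: "f' \<in> L2" and K: "AE x in lborel. norm (f' x) \<le> K"
    and r: "r = \<infinity> \<or> (\<exists>q\<ge>2. r = ereal q)"
  shows "f \<in> Lp r"
proof -
  note fr = borel_repD[OF f]
  have fK: "AE x in lebesgue. norm (f x) \<le> K \<and> f x = f' x"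
    using fr(4) K[folded AE_lebesgue_iff_lborel] by eventually_elim simp
  consider "r = \<infinity>" | q where "q \<ge> 2" "r = ereal q" using r by blast
  then have "Lp_norm r f < \<infinity>"
  proof cases
    case 1
    have "esssup lebesgue (\<lambda>x. ennreal (norm (f x))) \<le> ennreal K"
      using fr(1) fK by (intro esssup_I) (auto elim!: eventually_mono intro: ennreal_leI)
    then show ?thesis using 1 by (auto simp: Lp_norm_def intro: le_less_trans)
  next
    case 2
    have "(\<integral>\<^sup>+x. ennreal (norm (f x) powr q) \<partial>lebesgue) \<le> (\<integral>\<^sup>+x. ennreal (K powr (q - 2)) * ennreal ((norm (f' x))\<^sup>2) \<partial>lebesgue)"
    proof (rule nn_integral_mono_AE, use fK in eventually_elim)
      fix x assume x: "norm (f x) \<le> K \<and> f x = f' x"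
      have "norm (f x) powr q = norm (f x) powr (q - 2) * norm (f x) powr 2"
        by (simp only: powr_add[symmetric] diff_add_cancel)
      also have "\<dots> \<le> K powr (q - 2) * (norm (f' x))\<^sup>2"
        using x 2 by (auto simp: powr_numeral intro!: mult_right_mono powr_mono2)
      finally show "ennreal (norm (f x) powr q) \<le> ennreal (K powr (q - 2)) * ennreal ((norm (f' x))\<^sup>2)"
        by (simp add: ennreal_leI flip: ennreal_mult)
    qed
    also have "\<dots> = ennreal (K powr (q - 2)) * (\<integral>\<^sup>+x. ennreal ((norm (f' x))\<^sup>2) \<partial>lborel)"
      using fr(5) fr(2) by (subst nn_integral_cmult) (auto simp: nn_integral_completion)
    also have "\<dots> < \<infinity>" using nn_integral_sq[OF L] by (simp add: ennreal_mult_less_top)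
    finally show ?thesis using 2 by (auto simp: Lp_norm_def epowr_def)
  qed
  then show ?thesis using fr(1) by (simp add: Lp_def)
qed

section \<open>Transfer to the original functions and conclusion\<close>

lemma vec_lebesgue_measurable:
  fixes \<Phi> :: "'n::finite \<Rightarrow> 'a::euclidean_space \<Rightarrow> complex"
  assumes F: "continuous_on UNIV F" and \<Phi>: "\<And>k. borel_rep (\<Phi> k) (\<phi> k)"
  shows "borel_rep (\<lambda>x. F (\<chi> k. \<Phi> k x) :: complex) (\<lambda>x. F (\<chi> k. \<phi> k x))"
proof -
  have Fm: "F \<in> borel_measurable borel" by (rule borel_measurable_continuous_onI[OF F])
  have m: "(\<lambda>x. \<chi> k. u k x) \<in> borel_measurable N" if "\<And>k. u k \<in> borel_measurable N"
    for u :: "'n \<Rightarrow> 'a \<Rightarrow> complex" and N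
    using that by (subst borel_measurable_euclidean_space)
      (auto simp: Basis_vec_def inner_axis intro!: borel_measurable_inner)
  note r = borel_repD[OF \<Phi>]
  have "AE x in lborel. \<forall>k\<in>UNIV. \<Phi> k x = \<phi> k x"
    by (intro AE_finite_allI r(3)) simp
  then have "AE x in lborel. F (\<chi> k. \<Phi> k x) = F (\<chi> k. \<phi> k x)" by eventually_elim simp
  then show ?thesis
    unfolding borel_rep_def
    by (intro conjI measurable_compose[OF m[OF r(1)] Fm] measurable_compose[OF m[OF r(2)] Fm])
qed

lemma r_exp_cases:
  assumes "2 < p" "d \<ge> 1"
  shows "r_exp p d = \<infinity> \<or> (\<exists>q\<ge>2. r_exp p d = ereal q)"
proof -
  have "2 * real d / (real d - 2) \<ge> 2" if "d > 2" using that by (simp add: field_simps)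
  then show ?thesis using assms by (auto simp: r_exp_def two_star_def)
qed

lemma test_function_laplacian_measurable:
  fixes \<psi> :: "'a::euclidean_space \<Rightarrow> complex"
  assumes "test_function \<psi>" shows "laplacian \<psi> \<in> borel_measurable borel"
  unfolding laplacian_def[abs_def]
  using assms by (intro borel_measurable_sum test_function_bounded(1) test_function_partial)

theorem theorem1p8:
  fixes g :: "complex^'n \<Rightarrow> real" and n :: "'n \<Rightarrow> nat" and p \<omega> :: real
    and \<Phi> :: "'n \<Rightarrow> real^'d \<Rightarrow> complex"
  assumes "CARD('n) \<ge> 2"
    and "2 < p" and "ereal p < two_star CARD('d)"
    and "Ck 2 g"
    and "\<And>r z. r \<ge> 0 \<Longrightarrow> g (r *\<^sub>R z) = r powr p * g z"
    and "\<And>j. n j > 0"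
    and "\<And>\<theta> z. g (\<chi> j. exp (\<i> * complex_of_real (real (n j) * \<theta>)) * z $ j) = g z"
    and "\<omega> > 0"
    and "\<Phi> \<in> standing_waves (nonlinearity p g) \<omega>"
  shows "global_H1_solution p n (nonlinearity p g) \<Phi>
           (\<lambda>j t x. exp (\<i> * complex_of_real (real (n j) * \<omega> * t)) * \<Phi> j x)"
proof -
  let ?F = "nonlinearity p g" and ?r = "r_exp p CARD('d)"
  have \<Phi>: "\<Phi> j \<in> H1" for j using assms(9) by (simp add: standing_waves_def)
  have "\<exists>f'. borel_rep (\<Phi> j) f' \<and> f' \<in> L2" for j using \<Phi>[of j] by (intro Lp2_ex_rep) (simp add: W1_def)
  then obtain \<phi> where rep: "\<And>j. borel_rep (\<Phi> j) (\<phi> j)" "\<And>j. \<phi> j \<in> L2" by metis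
  \<comment> \<open>A weak derivative and its Borel representative are chosen as one pair, so that
    \<open>D\<close> and \<open>G\<close> belong together.\<close>
  define P where "P j b q \<longleftrightarrow> is_weak_deriv b (\<Phi> j) (fst q) \<and> borel_rep (fst q) (snd q) \<and> snd q \<in> L2" for j b q
  have "\<exists>q. P j b q" if "b \<in> Basis" for j b
    using \<Phi>[of j] that Lp2_ex_rep unfolding W1_def P_def by fastforce
  then have P: "P j b (SOME q. P j b q)" if "b \<in> Basis" for j b using that by (simp add: some_eq_ex)
  define D where "D j b = fst (SOME q. P j b q)" for j b
  define G where "G j b = snd (SOME q. P j b q)" for j b
  have D: "is_weak_deriv b (\<Phi> j) (D j b)" "borel_rep (D j b) (G j b)" "G j b \<in> L2" if "b \<in> Basis" for j b
    using P[OF that, of j] by (auto simp: P_def D_def G_def)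
  obtain C where C: "\<And>j. C j \<ge> 0" "\<And>j z. norm (?F j z) \<le> C j * norm z powr (p - 1)"
    using nonlinearity_bound[OF assms(4,5,2)] by metis
  have cont: "continuous_on UNIV (?F j)" for j by (rule nonlinearity_continuous[OF assms(4)])
  have FF: "borel_rep (\<lambda>x. ?F j (\<chi> k. \<Phi> k x)) (\<lambda>x. ?F j (\<chi> k. \<phi> k x))" for j
    by (rule vec_lebesgue_measurable[OF cont rep(1)])
  \<comment> \<open>The locale has a single growth constant; the sum of the nonnegative constants of
    the components serves all of them.\<close>
  interpret standing_wave \<phi> G ?F p \<omega> "\<Sum>j\<in>UNIV. C j"
  proof
    fix j and b :: "real^'d" and \<psi> :: "real^'d \<Rightarrow> complex" assume b: "b \<in> Basis" and t: "test_function \<psi>"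
    have "(\<integral>x. \<Phi> j x * partial_deriv b \<psi> x \<partial>lebesgue) = - (\<integral>x. D j b x * \<psi> x \<partial>lebesgue)"
      using D(1)[OF b] t by (simp add: is_weak_deriv_def)
    moreover have "(\<integral>x. \<Phi> j x * partial_deriv b \<psi> x \<partial>lebesgue) = (\<integral>x. \<phi> j x * partial_deriv b \<psi> x \<partial>lborel)"
      by (rule borel_rep_integral(1)[OF borel_rep_mult[OF rep(1) borel_rep_self[OF test_function_bounded(1)[OF test_function_partial[OF t b]]]]])
    moreover have "(\<integral>x. D j b x * \<psi> x \<partial>lebesgue) = (\<integral>x. G j b x * \<psi> x \<partial>lborel)"
      by (rule borel_rep_integral(1)[OF borel_rep_mult[OF D(2)[OF b] borel_rep_self[OF test_function_bounded(1)[OF t]]]])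
    ultimately show "(\<integral>x. \<phi> j x * partial_deriv b \<psi> x \<partial>lborel) = - (\<integral>x. G j b x * \<psi> x \<partial>lborel)" by simp
  next
    fix j and \<psi> :: "real^'d \<Rightarrow> complex" assume t: "test_function \<psi>"
    have [measurable]: "\<psi> \<in> borel_measurable borel" "laplacian \<psi> \<in> borel_measurable borel"
      using test_function_bounded(1)[OF t] test_function_laplacian_measurable[OF t] by auto
    have "(\<integral>x. \<Phi> j x * (- laplacian \<psi> x + complex_of_real \<omega> * \<psi> x) \<partial>lebesgue) = - (\<integral>x. ?F j (\<chi> k. \<Phi> k x) * \<psi> x \<partial>lebesgue)"
      using assms(9) t by (simp add: standing_waves_def)
    moreover have "(\<integral>x. \<Phi> j x * (- laplacian \<psi> x + complex_of_real \<omega> * \<psi> x) \<partial>lebesgue) =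
      (\<integral>x. \<phi> j x * (- laplacian \<psi> x + complex_of_real \<omega> * \<psi> x) \<partial>lborel)"
      by (rule borel_rep_integral(1)[OF borel_rep_mult[OF rep(1) borel_rep_self]]) measurable
    moreover have "(\<integral>x. ?F j (\<chi> k. \<Phi> k x) * \<psi> x \<partial>lebesgue) = (\<integral>x. ?F j (\<chi> k. \<phi> k x) * \<psi> x \<partial>lborel)"
      by (rule borel_rep_integral(1)[OF borel_rep_mult[OF FF borel_rep_self]]) measurable
    ultimately show "(\<integral>x. \<phi> j x * (- laplacian \<psi> x + complex_of_real \<omega> * \<psi> x) \<partial>lborel) = - (\<integral>x. ?F j (\<chi> k. \<phi> k x) * \<psi> x \<partial>lborel)"
      by simp
  next
    fix j z
    have "C j \<le> (\<Sum>j\<in>UNIV. C j)" using C(1) by (intro member_le_sum) auto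
    then show "norm (?F j z) \<le> (\<Sum>j\<in>UNIV. C j) * norm z powr (p - 1)"
      by (intro order_trans[OF C(2)] mult_right_mono) auto
  qed (use rep D cont C assms(2,3,8) in \<open>auto intro: sum_nonneg\<close>)
  have FF: "borel_rep (\<lambda>x. ?F j (\<chi> k. \<Phi> k x)) (Fx j)" for j
    using FF[of j] by (simp add: Fx_def[abs_def])
  \<comment> \<open>Gauge invariance at the angle \<theta> = \<omega> s turns F_j(u(s)) into a phase
    times F_j(Phi), the integrand treated by \<open>duhamel\<close>.\<close>
  have gauge: "?F j (\<chi> k. exp (\<i> * complex_of_real (real (n k) * \<omega> * s)) * \<Phi> k x) =
    exp (\<i> * complex_of_real (real (n j) * \<omega> * s)) * ?F j (\<chi> k. \<Phi> k x)" for j s x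
    using nonlinearity_gauge[where p=p and j=j and \<theta>="\<omega> * s" and z="\<chi> k. \<Phi> k x" and n=n, OF assms(4,7)]
    by (simp add: mult.assoc)
  have rc: "?r = \<infinity> \<or> (\<exists>q\<ge>2. ?r = ereal q)" by (rule r_exp_cases[OF assms(2)]) simp
  then have rc': "?r = \<infinity> \<or> (\<exists>q>0. ?r = ereal q)" by force
  have "\<Phi> j \<in> W1 ?r" for j
  proof -
    have "\<Phi> j \<in> Lp ?r" using \<phi>_bounded[of j] bounded_L2_Lp[OF rep(1) rep(2) _ rc] by blast
    moreover have "D j b \<in> Lp ?r" if "b \<in> Basis" for b
      using G_bounded[OF that, of j] bounded_L2_Lp[OF D(2)[OF that] D(3)[OF that] _ rc] by blast
    ultimately show ?thesis using D(1) by (auto simp: W1_def)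
  qed
  moreover have "q_exp p CARD('d) \<ge> 0" using assms(2) by (simp add: q_exp_def)
  ultimately have Lq: "(\<lambda>t x. exp (\<i> * complex_of_real (a * t)) * \<Phi> j x) \<in> Lq_loc (q_exp p CARD('d)) UNIV (W1 ?r) (W1_norm ?r)" for a j
    by (intro phase_Lq_loc rc')
  have FL: "(\<lambda>x. ?F j (\<chi> k. \<Phi> k x)) \<in> Lp 2" for j using Lp2_iff[OF FF] Fx_L2 by blast
  have duh: "has_L2_integral_from_to 0 t
      (\<lambda>s. schroedinger ((t - s) * real (n j)) (\<lambda>x. of_nat (n j) * (exp (\<i> * complex_of_real (real (n j) * \<omega> * s)) * ?F j (\<chi> k. \<Phi> k x))))
      (\<lambda>x. \<i> * (exp (\<i> * complex_of_real (real (n j) * \<omega> * t)) * \<Phi> j x - schroedinger (t * real (n j)) (\<Phi> j) x))" for j t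
    using duhamel[OF rep(1) FF, where \<nu>="real (n j)" and t=t] by simp
  have r2: "(2::ereal) = \<infinity> \<or> (\<exists>q>0. (2::ereal) = ereal q)" by (intro disjI2 exI[of _ 2]) simp
  show ?thesis
    unfolding global_H1_solution_def H1_solution_def gauge
  proof (intro conjI allI ballI AE_I2 impI \<Phi> phase_continuous_into_H1 Lp_cmult FL r2)
    show "(\<lambda>t x. exp (\<i> * complex_of_real (real (n j) * \<omega> * t)) * \<Phi> j x) \<in>
      Lq_loc (q_exp p DIM(real^'d)) UNIV (W1 (r_exp p DIM(real^'d))) (W1_norm (r_exp p DIM(real^'d)))" for j
      using Lq[of "real (n j) * \<omega>" j] by simp
    fix j t
    show "\<exists>J. has_L2_integral_from_to 0 t
      (\<lambda>s. schroedinger ((t - s) * real (n j)) (\<lambda>x. of_nat (n j) * (exp (\<i> * complex_of_real (real (n j) * \<omega> * s)) * ?F j (\<chi> k. \<Phi> k x)))) J \<and>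
      (AE x in lebesgue. exp (\<i> * complex_of_real (real (n j) * \<omega> * t)) * \<Phi> j x = schroedinger (t * real (n j)) (\<Phi> j) x - \<i> * J x)"
      by (rule exI, rule conjI, rule duh) (simp flip: mult.assoc)
  qed simp_all
qed

end
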